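(* Assume Jensen's Diamond Principle $\diamondsuit$. Let $R$ be a small semiartinian von Neumann regular ring with primitive factors artinian, and let $M$ be a right $R$-module. Then $M$ is weakly $R$-projective if and only if $M$ is $R$-projective, if and only if $M$ is projective. In particular, the Dual Baer Criterion holds for $R$, i.e., every right $R$-module is projective if and only if it is $R$-projective.
   Context: Rings are associative with unit; modules are right modules unless stated otherwise. $\diamondsuit$ denotes the assertion that $\diamondsuit_\kappa(E)$ holds for each regular uncountable cardinal $\kappa$ and each stationary subset $E\subseteq\kappa$. Here $\diamondsuit_\kappa(E)$ says that there are sets $X_\gamma\subseteq\gamma$ ($\gamma\in E$) such that for each $X\subseteq\kappa$ the set $\{\gamma\in E\mid X\cap\gamma=X_\gamma\}$ is stationary in $\kappa$. Equivalently, $\diamondsuit$ says that Jensen-functions exist: for each regular uncountable $\kappa$, each stationary $E\subseteq\kappa$, all sets $A,B$ of cardinality $\le\kappa$, and each $\kappa$-filtration $\{A_\gamma\mid\gamma<\kappa\}$ of $A$ (an increasing continuous chain of subsets of cardinality $<\kappa$ with union $A$), there are maps $c_\gamma:A_\gamma\to B$ ($\gamma<\kappa$) such that for each map $c:A\to B$ the set $\{\gamma\in E\mid c\restriction A_\gamma=c_\gamma\}$ is stationary in $\kappa$. A ring $R$ is von Neumann regular if for each $r\in R$ there is $s\in R$ with $rsr=r$. $R$ is (right) semiartinian if $\mathrm{Soc}(M)\neq 0$ for each non-zero module $M$; then there is a strictly increasing chain of ideals $(S_\alpha\mid\alpha\le\sigma+1)$ (the socle sequence of $R$) with $S_0=0$,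 $S_{\alpha+1}/S_\alpha=\mathrm{Soc}(R/S_\alpha)$ for each $\alpha\le\sigma$, $S_\alpha=\bigcup_{\beta<\alpha}S_\beta$ for limit $\alpha$, and $S_{\sigma+1}=R$; the ordinal $\sigma+1$ is the Loewy length of $R$. (For von Neumann regular rings, right and left semiartinian are equivalent and the right and left socle sequences coincide.) A von Neumann regular ring has primitive factors artinian if $R/P$ is artinian for each primitive ideal $P$. Standing assumption: $R$ is not completely reducible, i.e., $\sigma\ge 1$. Such a ring $R$ is small if $\mathrm{card}(R)\le 2^{\omega}$, $R$ has finite Loewy length, and for each $0<\alpha<\sigma$ the module $S_{\alpha+1}/S_\alpha$ is countably generated. A module $M$ is $R$-projective if for each right ideal $I$ of $R$, each homomorphism $M\to R/I$ factorises through the canonical projection $R\to R/I$. A module $M$ is weakly $R$-projective if for each $0<\alpha\le\sigma$ and each $\varphi\in\mathrm{Hom}_R(M,S_{\alpha+1}/S_\alpha)$ with finitely generated image, there exists $\psi\in\mathrm{Hom}_R(M,S_{\alpha+1})$ with $\varphi=\pi_\alpha\psi$, where $\pi_\alpha:S_{\alpha+1}\to S_{\alpha+1}/S_\alpha$ is the canonical projection. *)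

theory Defs
  imports "HOL-Algebra.Module" "HOL-Algebra.QuotRing" "HOL-Library.Countable_Set"
begin

unbundle cardinal_syntax

section \<open>Right modules\<close>

text \<open>
  The module record and the submodule predicate of HOL-Algebra are reused, but the locale
  for modules found there requires a commutative ring.  Throughout, \<open>r \<odot>\<^bsub>M\<^esub> x\<close> stands for
  the product \<open>x r\<close> of an element \<open>x\<close> of a \<^emph>\<open>right\<close> module with a scalar \<open>r\<close>; hence the
  order of the factors in the associativity law.
\<close>

locale right_module = R?: ring R + M?: abelian_group M
  for R :: "('r, 'a) ring_scheme" (structure) and M :: "('r, 'm, 'b) module_scheme" (structure) +
  assumes smult_closed [simp, intro]:
      "\<lbrakk>a \<in> carrier R; x \<in> carrier M\<rbrakk> \<Longrightarrow> a \<odot>\<^bsub>M\<^esub> x \<in> carrier M"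
    and smult_l_distr:
      "\<lbrakk>a \<in> carrier R; b \<in> carrier R; x \<in> carrier M\<rbrakk> \<Longrightarrow>
      (a \<oplus> b) \<odot>\<^bsub>M\<^esub> x = a \<odot>\<^bsub>M\<^esub> x \<oplus>\<^bsub>M\<^esub> b \<odot>\<^bsub>M\<^esub> x"
    and smult_r_distr:
      "\<lbrakk>a \<in> carrier R; x \<in> carrier M; y \<in> carrier M\<rbrakk> \<Longrightarrow>
      a \<odot>\<^bsub>M\<^esub> (x \<oplus>\<^bsub>M\<^esub> y) = a \<odot>\<^bsub>M\<^esub> x \<oplus>\<^bsub>M\<^esub> a \<odot>\<^bsub>M\<^esub> y"
    and smult_assoc:
      "\<lbrakk>a \<in> carrier R; b \<in> carrier R; x \<in> carrier M\<rbrakk> \<Longrightarrow>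
      (a \<otimes> b) \<odot>\<^bsub>M\<^esub> x = b \<odot>\<^bsub>M\<^esub> (a \<odot>\<^bsub>M\<^esub> x)"
    and smult_one [simp]:
      "x \<in> carrier M \<Longrightarrow> \<one> \<odot>\<^bsub>M\<^esub> x = x"

definition rmod_hom ::
  "('r, 'a) ring_scheme \<Rightarrow> ('r, 'm, 'b) module_scheme \<Rightarrow> ('r, 'n, 'c) module_scheme \<Rightarrow> ('m \<Rightarrow> 'n) set"
  where "rmod_hom R M N = {f. f \<in> carrier M \<rightarrow> carrier N \<and>
    (\<forall>x\<in>carrier M. \<forall>y\<in>carrier M. f (x \<oplus>\<^bsub>M\<^esub> y) = f x \<oplus>\<^bsub>N\<^esub> f y) \<and>
    (\<forall>r\<in>carrier R. \<forall>x\<in>carrier M. f (r \<odot>\<^bsub>M\<^esub> x) = r \<odot>\<^bsub>N\<^esub> f x)}"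

definition right_regular :: "('r, 'a) ring_scheme \<Rightarrow> ('r, 'r) module"
  where "right_regular R = \<lparr>carrier = carrier R, mult = mult R, one = one R,
    zero = zero R, add = add R, smult = (\<lambda>r x. x \<otimes>\<^bsub>R\<^esub> r)\<rparr>"

definition right_ideal :: "'r set \<Rightarrow> ('r, 'a) ring_scheme \<Rightarrow> bool"
  where "right_ideal I R \<longleftrightarrow> submodule I R (right_regular R)"

text \<open>
  The ring multiplication and unit contained in the module record play no role.
\<close>

definition quotient_module :: "('r, 'm, 'b) module_scheme \<Rightarrow> 'm set \<Rightarrow> ('r, 'm set) module"
  where "quotient_module M N = \<lparr>carrier = a_rcosets\<^bsub>M\<^esub> N, mult = undefined, one = undefined,
    zero = N, add = set_add M, smult = (\<lambda>r X. \<Union>x\<in>X. N +>\<^bsub>M\<^esub> (r \<odot>\<^bsub>M\<^esub> x))\<rparr>"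

definition rspan :: "('r, 'a) ring_scheme \<Rightarrow> ('r, 'm, 'b) module_scheme \<Rightarrow> 'm set \<Rightarrow> 'm set"
  where "rspan R M A = \<Inter>{N. submodule N R M \<and> A \<subseteq> N}"

definition countably_generated :: "('r, 'a) ring_scheme \<Rightarrow> ('r, 'm, 'b) module_scheme \<Rightarrow> bool"
  where "countably_generated R M \<longleftrightarrow>
    (\<exists>A. countable A \<and> A \<subseteq> carrier M \<and> rspan R M A = carrier M)"

definition simple_module :: "('r, 'a) ring_scheme \<Rightarrow> ('r, 'm, 'b) module_scheme \<Rightarrow> bool"
  where "simple_module R M \<longleftrightarrow> right_module R M \<and> carrier M \<noteq> {\<zero>\<^bsub>M\<^esub>} \<and>
    (\<forall>N. submodule N R M \<longrightarrow> N = {\<zero>\<^bsub>M\<^esub>} \<or> N = carrier M)"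

definition socle :: "('r, 'a) ring_scheme \<Rightarrow> ('r, 'm, 'b) module_scheme \<Rightarrow> 'm set"
  where "socle R M =
    rspan R M (\<Union>{N. submodule N R M \<and> simple_module R (M\<lparr>carrier := N\<rparr>)})"

definition annihilator :: "('r, 'a) ring_scheme \<Rightarrow> ('r, 'm, 'b) module_scheme \<Rightarrow> 'r set"
  where "annihilator R M = {r \<in> carrier R. \<forall>x\<in>carrier M. r \<odot>\<^bsub>M\<^esub> x = \<zero>\<^bsub>M\<^esub>}"


section \<open>Classes of rings\<close>

definition von_neumann_regular :: "('r, 'a) ring_scheme \<Rightarrow> bool"
  where "von_neumann_regular R \<longleftrightarrow>
    (\<forall>r\<in>carrier R. \<exists>s\<in>carrier R. r \<otimes>\<^bsub>R\<^esub> s \<otimes>\<^bsub>R\<^esub> r = r)"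

definition completely_reducible :: "('r, 'a) ring_scheme \<Rightarrow> bool"
  where "completely_reducible R \<longleftrightarrow> socle R (right_regular R) = carrier R"

text \<open>
  HOL cannot quantify over modules of all types within a formula.  The carrier type
  \<^typ>\<open>'r set\<close> below accommodates all cyclic modules \<open>R / I\<close>, which is enough to cover
  modules over every type: see \<open>semiartinian_socle\<close> and \<open>primitive_ideal_annihilator\<close>.
\<close>

definition semiartinian :: "('r, 'a) ring_scheme \<Rightarrow> bool"
  where "semiartinian R \<longleftrightarrow>
    (\<forall>M :: ('r, 'r set) module. right_module R M \<and> carrier M \<noteq> {\<zero>\<^bsub>M\<^esub>} \<longrightarrow>
       socle R M \<noteq> {\<zero>\<^bsub>M\<^esub>})"

definition primitive_ideal :: "'r set \<Rightarrow> ('r, 'a) ring_scheme \<Rightarrow> bool"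
  where "primitive_ideal P R \<longleftrightarrow>
    (\<exists>M :: ('r, 'r set) module. simple_module R M \<and> P = annihilator R M)"

text \<open>
  Primitive means right primitive and artinian means right artinian; for von Neumann regular
  factor rings right artinian, left artinian and completely reducible are all equivalent.
\<close>

definition right_artinian :: "('r, 'a) ring_scheme \<Rightarrow> bool"
  where "right_artinian R \<longleftrightarrow>
    (\<forall>I :: nat \<Rightarrow> 'r set. (\<forall>n. right_ideal (I n) R) \<and> (\<forall>n. I (Suc n) \<subseteq> I n) \<longrightarrow>
       (\<exists>n. \<forall>m\<ge>n. I m = I n))"

definition primitive_factors_artinian :: "('r, 'a) ring_scheme \<Rightarrow> bool"
  where "primitive_factors_artinian R \<longleftrightarrow>
    (\<forall>P. primitive_ideal P R \<longrightarrow> right_artinian (R Quot P))"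


subsection \<open>Independence of the carrier types\<close>

lemma right_moduleI:
  assumes "ring R" "abelian_group M"
    and "\<And>a x. \<lbrakk>a \<in> carrier R; x \<in> carrier M\<rbrakk> \<Longrightarrow> a \<odot>\<^bsub>M\<^esub> x \<in> carrier M"
    and "\<And>a b x. \<lbrakk>a \<in> carrier R; b \<in> carrier R; x \<in> carrier M\<rbrakk> \<Longrightarrow>
      (a \<oplus>\<^bsub>R\<^esub> b) \<odot>\<^bsub>M\<^esub> x = a \<odot>\<^bsub>M\<^esub> x \<oplus>\<^bsub>M\<^esub> b \<odot>\<^bsub>M\<^esub> x"
    and "\<And>a x y. \<lbrakk>a \<in> carrier R; x \<in> carrier M; y \<in> carrier M\<rbrakk> \<Longrightarrow>
      a \<odot>\<^bsub>M\<^esub> (x \<oplus>\<^bsub>M\<^esub> y) = a \<odot>\<^bsub>M\<^esub> x \<oplus>\<^bsub>M\<^esub> a \<odot>\<^bsub>M\<^esub> y"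
    and "\<And>a b x. \<lbrakk>a \<in> carrier R; b \<in> carrier R; x \<in> carrier M\<rbrakk> \<Longrightarrow>
      (a \<otimes>\<^bsub>R\<^esub> b) \<odot>\<^bsub>M\<^esub> x = b \<odot>\<^bsub>M\<^esub> (a \<odot>\<^bsub>M\<^esub> x)"
    and "\<And>x. x \<in> carrier M \<Longrightarrow> \<one>\<^bsub>R\<^esub> \<odot>\<^bsub>M\<^esub> x = x"
  shows "right_module R M"
  by (intro right_module.intro right_module_axioms.intro assms)

lemma (in right_module) smult_zero_right [simp]:
  assumes "a \<in> carrier R" shows "a \<odot>\<^bsub>M\<^esub> \<zero>\<^bsub>M\<^esub> = \<zero>\<^bsub>M\<^esub>"
proof -
  have "a \<odot>\<^bsub>M\<^esub> \<zero>\<^bsub>M\<^esub> = a \<odot>\<^bsub>M\<^esub> \<zero>\<^bsub>M\<^esub> \<oplus>\<^bsub>M\<^esub> a \<odot>\<^bsub>M\<^esub> \<zero>\<^bsub>M\<^esub>"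
    using smult_r_distr[OF assms, of "\<zero>\<^bsub>M\<^esub>" "\<zero>\<^bsub>M\<^esub>"] by simp
  then show ?thesis
    using assms by (metis M.add.r_cancel_one' M.zero_closed smult_closed)
qed

lemma (in right_module) smult_zero_left [simp]:
  assumes "x \<in> carrier M" shows "\<zero> \<odot>\<^bsub>M\<^esub> x = \<zero>\<^bsub>M\<^esub>"
proof -
  have "\<zero> \<odot>\<^bsub>M\<^esub> x = \<zero> \<odot>\<^bsub>M\<^esub> x \<oplus>\<^bsub>M\<^esub> \<zero> \<odot>\<^bsub>M\<^esub> x"
    using smult_l_distr[of \<zero> \<zero> x] assms by simp
  then show ?thesis
    using assms by (metis M.add.r_cancel_one' R.zero_closed smult_closed)
qed

lemma (in right_module) smult_minus_one:
  assumes "x \<in> carrier M" shows "(\<ominus> \<one>) \<odot>\<^bsub>M\<^esub> x = \<ominus>\<^bsub>M\<^esub> x"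
proof -
  have "(\<ominus> \<one>) \<odot>\<^bsub>M\<^esub> x \<oplus>\<^bsub>M\<^esub> x = (\<ominus> \<one> \<oplus> \<one>) \<odot>\<^bsub>M\<^esub> x"
    using smult_l_distr[of "\<ominus> \<one>" \<one> x] assms by simp
  also have "\<dots> = \<zero>\<^bsub>M\<^esub>" using assms by (simp add: R.l_neg)
  finally show ?thesis using assms by (simp add: M.minus_equality)
qed

lemma (in right_module) submodule_iff:
  "submodule N R M \<longleftrightarrow> N \<subseteq> carrier M \<and> \<zero>\<^bsub>M\<^esub> \<in> N \<and> (\<forall>x\<in>N. \<forall>y\<in>N. x \<oplus>\<^bsub>M\<^esub> y \<in> N) \<and>
     (\<forall>r\<in>carrier R. \<forall>x\<in>N. r \<odot>\<^bsub>M\<^esub> x \<in> N)" (is "_ \<longleftrightarrow> ?rhs")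
proof
  assume "submodule N R M"
  then interpret N: submodule N R M .
  show ?rhs
    using N.subset N.one_closed N.m_closed by auto
next
  assume rhs: ?rhs
  have "inv\<^bsub>add_monoid M\<^esub> x \<in> N" if "x \<in> N" for x
  proof -
    have "(\<ominus> \<one>) \<odot>\<^bsub>M\<^esub> x \<in> N" using rhs that by auto
    then show ?thesis
      using smult_minus_one[of x] subsetD[of N "carrier M" x] rhs that
      by (simp add: a_inv_def[of M])
  qed
  then show "submodule N R M"
    using rhs by (intro submodule.intro subgroup.intro submodule_axioms.intro) auto
qed

lemma (in right_module) right_module_submodule:
  assumes "submodule N R M" shows "right_module R (M\<lparr>carrier := N\<rparr>)"
proof (rule right_moduleI)
  have N: "N \<subseteq> carrier M" "\<zero>\<^bsub>M\<^esub> \<in> N" "\<And>x y. x \<in> N \<Longrightarrow> y \<in> N \<Longrightarrow> x \<oplus>\<^bsub>M\<^esub> y \<in> N"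
    "\<And>r x. r \<in> carrier R \<Longrightarrow> x \<in> N \<Longrightarrow> r \<odot>\<^bsub>M\<^esub> x \<in> N"
    using assms unfolding submodule_iff by auto
  note sub = subsetD[OF N(1)]
  show "ring R" ..
  show "abelian_group (M\<lparr>carrier := N\<rparr>)"
  proof (rule abelian_groupI)
    fix x assume "x \<in> carrier (M\<lparr>carrier := N\<rparr>)"
    then have x: "x \<in> N" by simp
    then have "\<ominus>\<^bsub>M\<^esub> x \<in> N"
      using N(4)[of "\<ominus> \<one>" x] smult_minus_one[of x] sub by simp
    then show "\<exists>y\<in>carrier (M\<lparr>carrier := N\<rparr>). y \<oplus>\<^bsub>M\<lparr>carrier := N\<rparr>\<^esub> x = \<zero>\<^bsub>M\<lparr>carrier := N\<rparr>\<^esub>"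
      using x sub by (auto intro!: bexI[of _ "\<ominus>\<^bsub>M\<^esub> x"] simp: M.l_neg)
  qed (use N sub in \<open>auto simp: M.a_ac\<close>)
qed (use assms in \<open>auto simp: submodule_iff smult_l_distr smult_r_distr smult_assoc subset_iff\<close>)

lemma rmod_homD:
  assumes "f \<in> rmod_hom R M N"
  shows "x \<in> carrier M \<Longrightarrow> f x \<in> carrier N"
    and "x \<in> carrier M \<Longrightarrow> y \<in> carrier M \<Longrightarrow> f (x \<oplus>\<^bsub>M\<^esub> y) = f x \<oplus>\<^bsub>N\<^esub> f y"
    and "r \<in> carrier R \<Longrightarrow> x \<in> carrier M \<Longrightarrow> f (r \<odot>\<^bsub>M\<^esub> x) = r \<odot>\<^bsub>N\<^esub> f x"
  using assms by (auto simp: rmod_hom_def)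

lemma rmod_hom_zero:
  assumes "right_module R M" "right_module R N" "f \<in> rmod_hom R M N"
  shows "f \<zero>\<^bsub>M\<^esub> = \<zero>\<^bsub>N\<^esub>"
proof -
  interpret M: right_module R M by fact
  interpret N: right_module R N by fact
  show ?thesis
    using rmod_homD(3)[OF assms(3), of "\<zero>\<^bsub>R\<^esub>" "\<zero>\<^bsub>M\<^esub>"] rmod_homD(1)[OF assms(3), of "\<zero>\<^bsub>M\<^esub>"] by simp
qed

lemma simple_module_iso:
  assumes f: "f \<in> rmod_hom R M N" and bij: "bij_betw f (carrier M) (carrier N)"
    and M: "simple_module R M" and N: "right_module R N"
  shows "simple_module R N"
proof -
  interpret M: right_module R M using M by (simp add: simple_module_def)
  interpret N: right_module R N by fact
  have f0: "f \<zero>\<^bsub>M\<^esub> = \<zero>\<^bsub>N\<^esub>" by (rule rmod_hom_zero) (fact M.right_module_axioms N f)+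
  have "carrier N \<noteq> {\<zero>\<^bsub>N\<^esub>}"
  proof
    assume "carrier N = {\<zero>\<^bsub>N\<^esub>}"
    then have "x = \<zero>\<^bsub>M\<^esub>" if "x \<in> carrier M" for x
      using bij f0 that by (metis M.zero_closed bij_betw_def inj_onD rmod_homD(1)[OF f] singletonD)
    then have "carrier M = {\<zero>\<^bsub>M\<^esub>}" using M.zero_closed by blast
    then show False using M by (simp add: simple_module_def)
  qed
  moreover have "P = {\<zero>\<^bsub>N\<^esub>} \<or> P = carrier N" if P: "submodule P R N" for P
  proof -
    let ?Q = "{x \<in> carrier M. f x \<in> P}"
    have "submodule ?Q R M"
      using P f0 unfolding M.submodule_iff N.submodule_iff by (auto simp: rmod_homD[OF f])
    then have Q: "?Q = {\<zero>\<^bsub>M\<^esub>} \<or> ?Q = carrier M"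
      using M unfolding simple_module_def by blast
    have surj: "f ` carrier M = carrier N" using bij by (simp add: bij_betw_def)
    then have fQ: "P = f ` ?Q"
      using P unfolding N.submodule_iff by auto
    from Q show ?thesis
    proof
      assume "?Q = {\<zero>\<^bsub>M\<^esub>}"
      then have "P = f ` {\<zero>\<^bsub>M\<^esub>}" by (subst fQ) (rule arg_cong)
      then show ?thesis using f0 by simp
    next
      assume "?Q = carrier M"
      then have "P = f ` carrier M" by (subst fQ) (rule arg_cong)
      then show ?thesis using surj by simp
    qed
  qed
  ultimately show ?thesis using N by (simp add: simple_module_def)
qed

lemma simple_submodule_image:
  assumes M: "right_module R M" and N: "right_module R N"
    and f: "f \<in> rmod_hom R M N" and inj: "inj_on f (carrier M)"
    and P: "submodule P R M" "simple_module R (M\<lparr>carrier := P\<rparr>)"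
  shows "submodule (f ` P) R N \<and> simple_module R (N\<lparr>carrier := f ` P\<rparr>)"
proof
  interpret M: right_module R M by fact
  interpret N: right_module R N by fact
  have P': "P \<subseteq> carrier M" "\<zero>\<^bsub>M\<^esub> \<in> P" "\<And>x y. x \<in> P \<Longrightarrow> y \<in> P \<Longrightarrow> x \<oplus>\<^bsub>M\<^esub> y \<in> P"
    "\<And>r x. r \<in> carrier R \<Longrightarrow> x \<in> P \<Longrightarrow> r \<odot>\<^bsub>M\<^esub> x \<in> P"
    using P(1) unfolding M.submodule_iff by auto
  have f': "f x \<in> carrier N" "f (x \<oplus>\<^bsub>M\<^esub> y) = f x \<oplus>\<^bsub>N\<^esub> f y"
    "r \<in> carrier R \<Longrightarrow> f (r \<odot>\<^bsub>M\<^esub> x) = r \<odot>\<^bsub>N\<^esub> f x" if "x \<in> P" "y \<in> P" for x y r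
    using rmod_homD[OF f] subsetD[OF P'(1) that(1)] subsetD[OF P'(1) that(2)] by simp_all
  have "\<zero>\<^bsub>N\<^esub> \<in> f ` P"
    using P'(2) rmod_hom_zero[OF M N f] by (intro image_eqI[of _ _ "\<zero>\<^bsub>M\<^esub>"]) auto
  moreover have "f x \<oplus>\<^bsub>N\<^esub> f y \<in> f ` P" if "x \<in> P" "y \<in> P" for x y
    using f'(2)[OF that] P'(3)[OF that] by (intro image_eqI[of _ _ "x \<oplus>\<^bsub>M\<^esub> y"]) auto
  moreover have "r \<odot>\<^bsub>N\<^esub> f x \<in> f ` P" if "r \<in> carrier R" "x \<in> P" for r x
    using f'(3)[OF that(2,2,1)] P'(4)[OF that] by (intro image_eqI[of _ _ "r \<odot>\<^bsub>M\<^esub> x"]) auto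
  ultimately show sub: "submodule (f ` P) R N"
    unfolding N.submodule_iff using f'(1) by auto
  show "simple_module R (N\<lparr>carrier := f ` P\<rparr>)"
  proof (rule simple_module_iso)
    show "f \<in> rmod_hom R (M\<lparr>carrier := P\<rparr>) (N\<lparr>carrier := f ` P\<rparr>)"
      using f' by (auto simp: rmod_hom_def)
    show "bij_betw f (carrier (M\<lparr>carrier := P\<rparr>)) (carrier (N\<lparr>carrier := f ` P\<rparr>))"
      using inj_on_subset[OF inj P'(1)] by (simp add: bij_betw_def)
    show "right_module R (N\<lparr>carrier := f ` P\<rparr>)" using N.right_module_submodule sub .
  qed (fact P(2))
qed

lemma socle_nonzero_iff:
  assumes "right_module R M"
  shows "socle R M \<noteq> {\<zero>\<^bsub>M\<^esub>} \<longleftrightarrow> (\<exists>N. submodule N R M \<and> simple_module R (M\<lparr>carrier := N\<rparr>))"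
proof -
  interpret M: right_module R M by fact
  show ?thesis
  proof
    assume "socle R M \<noteq> {\<zero>\<^bsub>M\<^esub>}"
    moreover have "submodule {\<zero>\<^bsub>M\<^esub>} R M" by (simp add: M.submodule_iff)
    moreover have "\<zero>\<^bsub>M\<^esub> \<in> socle R M" by (auto simp: socle_def rspan_def M.submodule_iff)
    ultimately show "\<exists>N. submodule N R M \<and> simple_module R (M\<lparr>carrier := N\<rparr>)"
      unfolding socle_def rspan_def by blast
  next
    assume "\<exists>N. submodule N R M \<and> simple_module R (M\<lparr>carrier := N\<rparr>)"
    then obtain N where N: "submodule N R M" "simple_module R (M\<lparr>carrier := N\<rparr>)" by blast
    then have "N \<subseteq> socle R M" by (auto simp: socle_def rspan_def)
    moreover have "\<zero>\<^bsub>M\<^esub> \<in> N" "N \<noteq> {\<zero>\<^bsub>M\<^esub>}"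
      using N by (auto simp: M.submodule_iff simple_module_def)
    ultimately show "socle R M \<noteq> {\<zero>\<^bsub>M\<^esub>}" by blast
  qed
qed

definition transport_module :: "('m \<Rightarrow> 'n) \<Rightarrow> ('r, 'm, 'b) module_scheme \<Rightarrow> ('r, 'n) module"
  where "transport_module e M = (let d = inv_into (carrier M) e in
    \<lparr>carrier = e ` carrier M, mult = undefined, one = undefined, zero = e \<zero>\<^bsub>M\<^esub>,
     add = (\<lambda>x y. e (d x \<oplus>\<^bsub>M\<^esub> d y)), smult = (\<lambda>r x. e (r \<odot>\<^bsub>M\<^esub> d x))\<rparr>)"

lemma transport_module:
  assumes "right_module R M" and inj: "inj_on e (carrier M)"
  shows "right_module R (transport_module e M)"
    and "e \<in> rmod_hom R M (transport_module e M)"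
    and "bij_betw e (carrier M) (carrier (transport_module e M))"
    and "inv_into (carrier M) e \<in> rmod_hom R (transport_module e M) M"
    and "\<zero>\<^bsub>transport_module e M\<^esub> = e \<zero>\<^bsub>M\<^esub>"
proof -
  interpret M: right_module R M by fact
  note inv = inv_into_f_f[OF inj]
  show "right_module R (transport_module e M)"
  proof (rule right_moduleI)
    show "ring R" ..
    show "abelian_group (transport_module e M)"
    proof (rule abelian_groupI)
      fix x assume "x \<in> carrier (transport_module e M)"
      then obtain y where y: "x = e y" "y \<in> carrier M" by (auto simp: transport_module_def Let_def)
      then show "\<exists>y\<in>carrier (transport_module e M).
          y \<oplus>\<^bsub>transport_module e M\<^esub> x = \<zero>\<^bsub>transport_module e M\<^esub>"
        by (auto intro!: bexI[of _ "\<ominus>\<^bsub>M\<^esub> y"] simp: transport_module_def Let_def inv M.l_neg)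
    qed (auto simp: transport_module_def Let_def inv M.a_ac)
  qed (auto simp: transport_module_def Let_def inv M.smult_l_distr M.smult_r_distr M.smult_assoc)
qed (use inj assms(1) in \<open>auto simp: transport_module_def Let_def rmod_hom_def bij_betw_def
  right_module_def abelian_group_def abelian_monoid.a_closed right_module.smult_closed\<close>)

lemma cyclic_embedding:
  assumes "right_module R M" "x \<in> carrier M"
  shows "submodule ((\<lambda>r. r \<odot>\<^bsub>M\<^esub> x) ` carrier R) R M"
    and "x \<in> (\<lambda>r. r \<odot>\<^bsub>M\<^esub> x) ` carrier R"
    and "inj_on (\<lambda>y. {r \<in> carrier R. r \<odot>\<^bsub>M\<^esub> x = y}) ((\<lambda>r. r \<odot>\<^bsub>M\<^esub> x) ` carrier R)"
proof -
  interpret M: right_module R M by fact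
  have "\<zero>\<^bsub>M\<^esub> = \<zero>\<^bsub>R\<^esub> \<odot>\<^bsub>M\<^esub> x" "x = \<one>\<^bsub>R\<^esub> \<odot>\<^bsub>M\<^esub> x" using assms(2) by simp_all
  then show "submodule ((\<lambda>r. r \<odot>\<^bsub>M\<^esub> x) ` carrier R) R M"
    and "x \<in> (\<lambda>r. r \<odot>\<^bsub>M\<^esub> x) ` carrier R"
    using assms(2) unfolding M.submodule_iff
    by (auto simp: M.smult_l_distr[symmetric] M.smult_assoc[symmetric]
        intro: image_eqI[of _ _ "\<zero>\<^bsub>R\<^esub>"] image_eqI[of _ _ "\<one>\<^bsub>R\<^esub>"] simp del: M.smult_one M.smult_zero_left)
  show "inj_on (\<lambda>y. {r \<in> carrier R. r \<odot>\<^bsub>M\<^esub> x = y}) ((\<lambda>r. r \<odot>\<^bsub>M\<^esub> x) ` carrier R)"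
    by (rule inj_onI) blast
qed

theorem semiartinian_socle:
  fixes M :: "('r, 'm, 'b) module_scheme"
  assumes "semiartinian R" and M: "right_module R M" and nz: "carrier M \<noteq> {\<zero>\<^bsub>M\<^esub>}"
  shows "socle R M \<noteq> {\<zero>\<^bsub>M\<^esub>}"
proof -
  interpret M: right_module R M by fact
  obtain x where x: "x \<in> carrier M" "x \<noteq> \<zero>\<^bsub>M\<^esub>" using nz M.zero_closed by blast
  let ?C = "(\<lambda>r. r \<odot>\<^bsub>M\<^esub> x) ` carrier R"
  let ?C' = "M\<lparr>carrier := ?C\<rparr>"
  let ?e = "\<lambda>y. {r \<in> carrier R. r \<odot>\<^bsub>M\<^esub> x = y}"
  let ?T = "transport_module ?e ?C'"
  let ?d = "inv_into (carrier ?C') ?e"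
  note C = cyclic_embedding[OF M x(1)]
  have mod: "right_module R ?C'" using M.right_module_submodule C(1) .
  interpret C: right_module R ?C' by fact
  have "inj_on ?e (carrier ?C')" using C(3) by simp
  note T = transport_module[OF mod this]
  interpret T: right_module R ?T by (fact T(1))
  have "carrier ?T \<noteq> {\<zero>\<^bsub>?T\<^esub>}"
  proof
    assume "carrier ?T = {\<zero>\<^bsub>?T\<^esub>}"
    moreover have "?e x \<in> carrier ?T"
      using C(2) by (simp add: transport_module_def Let_def)
    ultimately have "?e x = ?e \<zero>\<^bsub>M\<^esub>" using T(5) by simp
    moreover have "\<zero>\<^bsub>M\<^esub> \<in> ?C" using C(1) by (simp add: M.submodule_iff)
    ultimately show False using C(2,3) x(2) by (meson inj_onD)
  qed
  then have "socle R ?T \<noteq> {\<zero>\<^bsub>?T\<^esub>}"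
    using assms(1) T(1) by (simp add: semiartinian_def)
  then obtain N where N: "submodule N R ?T" "simple_module R (?T\<lparr>carrier := N\<rparr>)"
    unfolding socle_nonzero_iff[OF T(1)] by blast
  have "?d \<in> rmod_hom R ?T M"
    using T(4) C(1) unfolding M.submodule_iff by (auto simp: rmod_hom_def)
  moreover have "inj_on ?d (carrier ?T)"
    using T(3) by (simp add: bij_betw_def inj_on_inv_into)
  ultimately show ?thesis
    using simple_submodule_image[OF T(1) M _ _ N] unfolding socle_nonzero_iff[OF M] by blast
qed

theorem primitive_ideal_annihilator:
  fixes M :: "('r, 'm, 'b) module_scheme"
  assumes "simple_module R M"
  shows "primitive_ideal (annihilator R M) R"
proof -
  interpret M: right_module R M using assms by (simp add: simple_module_def)
  obtain x where x: "x \<in> carrier M" "x \<noteq> \<zero>\<^bsub>M\<^esub>"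
    using assms M.zero_closed by (auto simp: simple_module_def)
  note C = cyclic_embedding[OF M.right_module_axioms x(1)]
  let ?e = "\<lambda>y. {r \<in> carrier R. r \<odot>\<^bsub>M\<^esub> x = y}"
  let ?T = "transport_module ?e M"
  have "(\<lambda>r. r \<odot>\<^bsub>M\<^esub> x) ` carrier R = carrier M"
    using assms C(1,2) x(2) unfolding simple_module_def by blast
  then have inj: "inj_on ?e (carrier M)" using C(3) by simp
  note T = transport_module[OF M.right_module_axioms inj]
  have "simple_module R ?T" by (rule simple_module_iso) (fact T assms)+
  moreover have "annihilator R M = annihilator R ?T"
  proof -
    have car: "carrier ?T = ?e ` carrier M" by (simp add: transport_module_def Let_def)
    have "r \<odot>\<^bsub>?T\<^esub> ?e y = \<zero>\<^bsub>?T\<^esub> \<longleftrightarrow> r \<odot>\<^bsub>M\<^esub> y = \<zero>\<^bsub>M\<^esub>"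
      if "r \<in> carrier R" "y \<in> carrier M" for r y
      using rmod_homD(3)[OF T(2) that] inj_on_eq_iff[OF inj, of "r \<odot>\<^bsub>M\<^esub> y" "\<zero>\<^bsub>M\<^esub>"] T(5) that
      by (metis (no_types, lifting) M.smult_closed M.zero_closed)
    then show ?thesis unfolding annihilator_def car by blast
  qed
  ultimately show ?thesis unfolding primitive_ideal_def by blast
qed


section \<open>The socle sequence and small rings\<close>

text \<open>
  Only the finite part \<open>S\<^sub>0 \<subseteq> S\<^sub>1 \<subseteq> \<dots>\<close> of the socle sequence is defined.  For rings of
  finite Loewy length, in particular for small rings, this is the whole sequence.  The
  Loewy length is \<open>\<sigma> + 1\<close>, so \<open>\<alpha> \<le> \<sigma>\<close> reads \<open>\<alpha> < loewy_length R\<close> and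
  \<open>\<alpha> < \<sigma>\<close> reads \<open>Suc \<alpha> < loewy_length R\<close>.
\<close>

primrec socle_seq :: "('r, 'a) ring_scheme \<Rightarrow> nat \<Rightarrow> 'r set"
  where
    "socle_seq R 0 = {\<zero>\<^bsub>R\<^esub>}"
  | "socle_seq R (Suc n) = {x \<in> carrier R. socle_seq R n +>\<^bsub>R\<^esub> x \<in>
        socle R (quotient_module (right_regular R) (socle_seq R n))}"

definition finite_loewy_length :: "('r, 'a) ring_scheme \<Rightarrow> bool"
  where "finite_loewy_length R \<longleftrightarrow> (\<exists>n. socle_seq R n = carrier R)"

definition loewy_length :: "('r, 'a) ring_scheme \<Rightarrow> nat"
  where "loewy_length R = (LEAST n. socle_seq R n = carrier R)"

definition socle_layer :: "('r, 'a) ring_scheme \<Rightarrow> nat \<Rightarrow> ('r, 'r set) module"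
  where "socle_layer R n =
    quotient_module (right_regular R\<lparr>carrier := socle_seq R (Suc n)\<rparr>) (socle_seq R n)"

definition small_ring :: "('r, 'a) ring_scheme \<Rightarrow> bool"
  where "small_ring R \<longleftrightarrow> |carrier R| \<le>o ctwo ^c natLeq \<and> finite_loewy_length R \<and>
    (\<forall>\<alpha>. 0 < \<alpha> \<and> Suc \<alpha> < loewy_length R \<longrightarrow> countably_generated R (socle_layer R \<alpha>))"


section \<open>Projectivity\<close>

text \<open>
  Projectivity is the lifting property with respect to epimorphisms \<open>N \<rightarrow> L\<close>.  The type
  \<^typ>\<open>'m \<Rightarrow> 'r\<close> accommodates a free module that maps onto the given module, so that the
  lifting property for these types implies it for all types: see \<open>projective_module_lift\<close>.
\<close>

definition projective_module :: "('r, 'a) ring_scheme \<Rightarrow> ('r, 'm, 'b) module_scheme \<Rightarrow> bool"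
  where "projective_module R M \<longleftrightarrow>
    (\<forall>(N :: ('r, 'm \<Rightarrow> 'r) module) (L :: ('r, 'm) module) g f.
       right_module R N \<and> right_module R L \<and>
       g \<in> rmod_hom R N L \<and> g ` carrier N = carrier L \<and> f \<in> rmod_hom R M L \<longrightarrow>
       (\<exists>h\<in>rmod_hom R M N. \<forall>x\<in>carrier M. g (h x) = f x))"

text \<open>
  The following module is the free module on the carrier of \<open>M\<close>, and \<open>free_map\<close> is the
  homomorphism from it determined by its values on the basis.
\<close>

definition free_module :: "('r, 'a) ring_scheme \<Rightarrow> ('r, 'm, 'b) module_scheme \<Rightarrow> ('r, 'm \<Rightarrow> 'r) module"
  where "free_module R M =
    \<lparr>carrier = {u. finite {x. u x \<noteq> \<zero>\<^bsub>R\<^esub>} \<and> (\<forall>x. u x \<in> carrier R) \<and>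
       (\<forall>x. x \<notin> carrier M \<longrightarrow> u x = \<zero>\<^bsub>R\<^esub>)},
     mult = undefined, one = undefined, zero = (\<lambda>x. \<zero>\<^bsub>R\<^esub>),
     add = (\<lambda>u v x. u x \<oplus>\<^bsub>R\<^esub> v x), smult = (\<lambda>r u x. u x \<otimes>\<^bsub>R\<^esub> r)\<rparr>"

definition free_map ::
  "('r, 'a) ring_scheme \<Rightarrow> ('r, 'n, 'c) module_scheme \<Rightarrow> ('m \<Rightarrow> 'n) \<Rightarrow> ('m \<Rightarrow> 'r) \<Rightarrow> 'n"
  where "free_map R N t u = (\<Oplus>\<^bsub>N\<^esub>x\<in>{x. u x \<noteq> \<zero>\<^bsub>R\<^esub>}. u x \<odot>\<^bsub>N\<^esub> t x)"

lemma free_module_right_module: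
  assumes "ring R" shows "right_module R (free_module R M)"
proof -
  interpret ring R by fact
  have fin: "finite {x. u x \<oplus>\<^bsub>R\<^esub> v x \<noteq> \<zero>\<^bsub>R\<^esub>}"
    if "finite {x. u x \<noteq> \<zero>\<^bsub>R\<^esub>}" "finite {x. v x \<noteq> \<zero>\<^bsub>R\<^esub>}" for u v :: "'c \<Rightarrow> 'a"
    by (rule finite_subset[OF _ finite_UnI[OF that]]) auto
  have fin': "finite {x. u x \<otimes>\<^bsub>R\<^esub> r \<noteq> \<zero>\<^bsub>R\<^esub>}"
    if "finite {x. u x \<noteq> \<zero>\<^bsub>R\<^esub>}" "r \<in> carrier R" for u :: "'c \<Rightarrow> 'a" and r
    by (rule finite_subset[OF _ that(1)]) (use that(2) in auto)
  show ?thesis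
  proof (rule right_moduleI)
    show "abelian_group (free_module R M)"
    proof (rule abelian_groupI)
      fix u assume "u \<in> carrier (free_module R M)"
      moreover from this have "{x. \<ominus>\<^bsub>R\<^esub> u x \<noteq> \<zero>\<^bsub>R\<^esub>} \<subseteq> {x. u x \<noteq> \<zero>\<^bsub>R\<^esub>}"
        by auto
      ultimately show "\<exists>v\<in>carrier (free_module R M).
          v \<oplus>\<^bsub>free_module R M\<^esub> u = \<zero>\<^bsub>free_module R M\<^esub>"
        by (intro bexI[of _ "\<lambda>x. \<ominus>\<^bsub>R\<^esub> u x"])
          (auto simp: free_module_def l_neg intro: finite_subset)
    qed (auto simp: free_module_def fin a_ac)
  qed (auto simp: free_module_def fin' l_distr r_distr m_assoc assms)
qed

lemma free_map_eq:
  assumes "right_module R N" "t ` carrier M \<subseteq> carrier N" "u \<in> carrier (free_module R M)"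
    and "finite A" "{x. u x \<noteq> \<zero>\<^bsub>R\<^esub>} \<subseteq> A" "A \<subseteq> carrier M"
  shows "free_map R N t u = (\<Oplus>\<^bsub>N\<^esub>x\<in>A. u x \<odot>\<^bsub>N\<^esub> t x)"
proof -
  interpret N: right_module R N by fact
  show ?thesis
    unfolding free_map_def
    by (rule N.M.add.finprod_mono_neutral_cong_left)
      (use assms in \<open>auto simp: free_module_def image_subset_iff subset_iff\<close>)
qed

lemma free_map_hom:
  assumes N: "right_module R N" and t: "t ` carrier M \<subseteq> carrier N"
  shows "free_map R N t \<in> rmod_hom R (free_module R M) N"
proof -
  interpret N: right_module R N by fact
  interpret F: right_module R "free_module R M"
    by (rule free_module_right_module) (rule N.R.ring_axioms)
  have coeff: "u x \<in> carrier R" if "u \<in> carrier (free_module R M)" for u x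
    using that by (auto simp: free_module_def)
  have supp: "finite {x. u x \<noteq> \<zero>\<^bsub>R\<^esub>}" "{x. u x \<noteq> \<zero>\<^bsub>R\<^esub>} \<subseteq> carrier M"
    if "u \<in> carrier (free_module R M)" for u
    using that by (auto simp: free_module_def)
  have tN: "t x \<in> carrier N" if "x \<in> carrier M" for x using t that by auto
  show ?thesis
    unfolding rmod_hom_def
  proof (intro CollectI conjI ballI funcsetI)
    fix u assume u: "u \<in> carrier (free_module R M)"
    then show "free_map R N t u \<in> carrier N"
      unfolding free_map_def by (intro N.M.finsum_closed) (use supp[OF u] coeff[OF u] tN in auto)
  next
    fix u v assume uv: "u \<in> carrier (free_module R M)" "v \<in> carrier (free_module R M)"
    let ?A = "{x. u x \<noteq> \<zero>\<^bsub>R\<^esub>} \<union> {x. v x \<noteq> \<zero>\<^bsub>R\<^esub>}"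
    have A: "finite ?A" "?A \<subseteq> carrier M" using supp uv by auto
    let ?w = "u \<oplus>\<^bsub>free_module R M\<^esub> v"
    have w: "?w x = u x \<oplus>\<^bsub>R\<^esub> v x" for x by (simp add: free_module_def)
    have eq: "free_map R N t z = (\<Oplus>\<^bsub>N\<^esub>x\<in>?A. z x \<odot>\<^bsub>N\<^esub> t x)"
      if "z \<in> carrier (free_module R M)" "{x. z x \<noteq> \<zero>\<^bsub>R\<^esub>} \<subseteq> ?A" for z
      by (rule free_map_eq[OF N t that(1) A(1) that(2) A(2)])
    have "free_map R N t ?w = (\<Oplus>\<^bsub>N\<^esub>x\<in>?A. ?w x \<odot>\<^bsub>N\<^esub> t x)"
      by (rule eq) (use uv in \<open>auto simp: w\<close>)
    also have "\<dots> = (\<Oplus>\<^bsub>N\<^esub>x\<in>?A. u x \<odot>\<^bsub>N\<^esub> t x \<oplus>\<^bsub>N\<^esub> v x \<odot>\<^bsub>N\<^esub> t x)"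
      by (rule N.M.finsum_cong') (use A uv coeff tN in \<open>auto simp: w N.smult_l_distr\<close>)
    also have "\<dots> = (\<Oplus>\<^bsub>N\<^esub>x\<in>?A. u x \<odot>\<^bsub>N\<^esub> t x) \<oplus>\<^bsub>N\<^esub> (\<Oplus>\<^bsub>N\<^esub>x\<in>?A. v x \<odot>\<^bsub>N\<^esub> t x)"
      by (rule N.M.finsum_addf) (use A uv coeff tN in auto)
    also have "\<dots> = free_map R N t u \<oplus>\<^bsub>N\<^esub> free_map R N t v"
      by (simp add: eq uv)
    finally show "free_map R N t ?w = free_map R N t u \<oplus>\<^bsub>N\<^esub> free_map R N t v" .
  next
    fix r u assume r: "r \<in> carrier R" and u: "u \<in> carrier (free_module R M)"
    let ?A = "{x. u x \<noteq> \<zero>\<^bsub>R\<^esub>}"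
    let ?w = "r \<odot>\<^bsub>free_module R M\<^esub> u"
    have w: "?w x = u x \<otimes>\<^bsub>R\<^esub> r" for x by (simp add: free_module_def)
    have wF: "?w \<in> carrier (free_module R M)" using r u by simp
    have "free_map R N t ?w = (\<Oplus>\<^bsub>N\<^esub>x\<in>?A. ?w x \<odot>\<^bsub>N\<^esub> t x)"
      by (rule free_map_eq[OF N t wF supp(1)[OF u] _ supp(2)[OF u]]) (use r in \<open>auto simp: w\<close>)
    also have "\<dots> = (\<Oplus>\<^bsub>N\<^esub>x\<in>?A. r \<odot>\<^bsub>N\<^esub> (u x \<odot>\<^bsub>N\<^esub> t x))"
      by (rule N.M.finsum_cong')
        (use supp[OF u] r coeff[OF u] tN in \<open>auto simp: w N.smult_assoc\<close>)
    also have "\<dots> = r \<odot>\<^bsub>N\<^esub> (\<Oplus>\<^bsub>N\<^esub>x\<in>?A. u x \<odot>\<^bsub>N\<^esub> t x)"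
    proof -
      have "B \<subseteq> carrier M \<Longrightarrow> (\<Oplus>\<^bsub>N\<^esub>x\<in>B. r \<odot>\<^bsub>N\<^esub> (u x \<odot>\<^bsub>N\<^esub> t x)) = r \<odot>\<^bsub>N\<^esub> (\<Oplus>\<^bsub>N\<^esub>x\<in>B. u x \<odot>\<^bsub>N\<^esub> t x)"
        if "finite B" for B
        using that
      proof (induction B)
        case (insert b B)
        then have "(\<Oplus>\<^bsub>N\<^esub>x\<in>B. u x \<odot>\<^bsub>N\<^esub> t x) \<in> carrier N" "u b \<odot>\<^bsub>N\<^esub> t b \<in> carrier N"
          using coeff[OF u] tN by (auto intro!: N.M.finsum_closed)
        with insert show ?case
          using r coeff[OF u] tN by (simp add: N.smult_r_distr Pi_def subset_iff)
      qed (use r in auto)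
      then show ?thesis using supp[OF u] by blast
    qed
    finally show "free_map R N t ?w = r \<odot>\<^bsub>N\<^esub> free_map R N t u" by (simp add: free_map_def)
  qed
qed

lemma hom_free_map:
  assumes N: "right_module R N" and L: "right_module R L" and g: "g \<in> rmod_hom R N L"
    and t: "t ` carrier M \<subseteq> carrier N" and u: "u \<in> carrier (free_module R M)"
  shows "g (free_map R N t u) = free_map R L (\<lambda>x. g (t x)) u"
proof -
  interpret N: right_module R N by fact
  interpret L: right_module R L by fact
  have coeff: "u x \<in> carrier R" for x using u by (auto simp: free_module_def)
  have supp: "finite {x. u x \<noteq> \<zero>\<^bsub>R\<^esub>}" "{x. u x \<noteq> \<zero>\<^bsub>R\<^esub>} \<subseteq> carrier M"
    using u by (auto simp: free_module_def)
  have tN: "t x \<in> carrier N" if "x \<in> carrier M" for x using t that by auto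
  have "B \<subseteq> carrier M \<Longrightarrow> g (\<Oplus>\<^bsub>N\<^esub>x\<in>B. u x \<odot>\<^bsub>N\<^esub> t x) = (\<Oplus>\<^bsub>L\<^esub>x\<in>B. u x \<odot>\<^bsub>L\<^esub> g (t x))"
    if "finite B" for B
    using that
  proof (induction B)
    case (insert b B)
    then have "(\<Oplus>\<^bsub>N\<^esub>x\<in>B. u x \<odot>\<^bsub>N\<^esub> t x) \<in> carrier N" "u b \<odot>\<^bsub>N\<^esub> t b \<in> carrier N"
      using coeff tN by (auto intro!: N.M.finsum_closed)
    with insert show ?case
      using coeff tN by (simp add: rmod_homD[OF g] Pi_def subset_iff)
  qed (simp add: rmod_hom_zero[OF N L g])
  then show ?thesis using supp by (simp add: free_map_def)
qed

theorem projective_module_lift: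
  fixes M :: "('r, 'm, 'b) module_scheme" and N :: "('r, 'n, 'c) module_scheme"
    and L :: "('r, 'l, 'd) module_scheme"
  assumes proj: "projective_module R M" and M: "right_module R M"
    and N: "right_module R N" and L: "right_module R L"
    and g: "g \<in> rmod_hom R N L" "g ` carrier N = carrier L" and f: "f \<in> rmod_hom R M L"
  obtains h where "h \<in> rmod_hom R M N" "\<forall>x\<in>carrier M. g (h x) = f x"
proof -
  interpret M: right_module R M by fact
  let ?F = "free_module R M"
  let ?M = "module.truncate M"
  have F: "right_module R ?F" using free_module_right_module M.R.ring_axioms .
  have trunc: "carrier ?M = carrier M" "\<And>x y. x \<oplus>\<^bsub>?M\<^esub> y = x \<oplus>\<^bsub>M\<^esub> y" "\<zero>\<^bsub>?M\<^esub> = \<zero>\<^bsub>M\<^esub>"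
      "\<And>r x. r \<odot>\<^bsub>?M\<^esub> x = r \<odot>\<^bsub>M\<^esub> x"
    by (simp_all add: module.truncate_def)
  have M': "right_module R ?M"
  proof (rule right_moduleI)
    show "abelian_group ?M"
      by (rule abelian_groupI) (auto simp: trunc M.a_ac intro: M.l_neg bexI[of _ "\<ominus>\<^bsub>M\<^esub> _"])
  qed (auto simp: trunc M.smult_l_distr M.smult_r_distr M.smult_assoc M.R.ring_axioms)
  let ?p = "free_map R M (\<lambda>x. x)"
  have p: "?p \<in> rmod_hom R ?F M" by (rule free_map_hom[OF M]) simp
  have "x \<in> ?p ` carrier ?F" if x: "x \<in> carrier M" for x
  proof (cases "\<one>\<^bsub>R\<^esub> = \<zero>\<^bsub>R\<^esub>")
    case True
    then have "x = \<zero>\<^bsub>M\<^esub>" using M.smult_one[OF x] M.smult_zero_left[OF x] by simp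
    moreover have "?p \<zero>\<^bsub>?F\<^esub> = \<zero>\<^bsub>M\<^esub>" by (rule rmod_hom_zero[OF F M p])
    moreover have "\<zero>\<^bsub>?F\<^esub> \<in> carrier ?F" by (simp add: free_module_def)
    ultimately show ?thesis by (metis image_eqI)
  next
    case False
    let ?u = "\<lambda>y. if y = x then \<one>\<^bsub>R\<^esub> else \<zero>\<^bsub>R\<^esub>"
    have supp: "{y. ?u y \<noteq> \<zero>\<^bsub>R\<^esub>} = {x}" using False by auto
    then have "?u \<in> carrier ?F" using x by (auto simp: free_module_def)
    moreover have "?p ?u = x" using x unfolding free_map_def supp by simp
    ultimately show ?thesis by (metis image_eqI)
  qed
  then have surj: "?p ` carrier ?F = carrier ?M"
    using rmod_homD(1)[OF p] by (auto simp: trunc)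
  have "?p \<in> rmod_hom R ?F ?M" "(\<lambda>x. x) \<in> rmod_hom R M ?M"
    using p by (auto simp: rmod_hom_def trunc)
  with proj F M' surj obtain s where s: "s \<in> rmod_hom R M ?F" "\<forall>x\<in>carrier M. ?p (s x) = x"
    unfolding projective_module_def by blast
  define t where "t x = (SOME y. y \<in> carrier N \<and> g y = f x)" for x
  have t: "t x \<in> carrier N \<and> g (t x) = f x" if "x \<in> carrier M" for x
  proof -
    have "f x \<in> g ` carrier N" unfolding g(2) by (rule rmod_homD(1)[OF f that])
    then have "\<exists>y. y \<in> carrier N \<and> g y = f x" by (elim imageE) auto
    then show ?thesis unfolding t_def by (rule someI_ex)
  qed
  then have tN: "t ` carrier M \<subseteq> carrier N" by auto
  let ?q = "free_map R N t"
  have q: "?q \<in> rmod_hom R ?F N" by (rule free_map_hom[OF N tN])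
  have "(\<lambda>x. ?q (s x)) \<in> rmod_hom R M N"
    using rmod_homD[OF s(1)] rmod_homD[OF q] by (simp add: rmod_hom_def)
  moreover have "g (?q (s x)) = f x" if x: "x \<in> carrier M" for x
  proof -
    interpret L: right_module R L by fact
    have sx: "s x \<in> carrier ?F" using rmod_homD(1)[OF s(1) x] .
    have supp: "y \<in> carrier M" if "s x y \<noteq> \<zero>\<^bsub>R\<^esub>" for y
      using sx that by (auto simp: free_module_def)
    have coeff: "s x y \<in> carrier R" for y using sx by (simp add: free_module_def)
    have "g (?q (s x)) = free_map R L (\<lambda>x. g (t x)) (s x)"
      by (rule hom_free_map[OF N L g(1) tN sx])
    also have "\<dots> = free_map R L f (s x)"
      unfolding free_map_def
      by (rule L.M.finsum_cong')
        (use supp coeff t rmod_homD(1)[OF f] in auto)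
    also have "\<dots> = f (?p (s x))"
      using hom_free_map[OF M L f _ sx, of "\<lambda>x. x"] by simp
    finally show ?thesis using s(2) x by simp
  qed
  ultimately show ?thesis using that by blast
qed

definition R_projective :: "('r, 'a) ring_scheme \<Rightarrow> ('r, 'm, 'b) module_scheme \<Rightarrow> bool"
  where "R_projective R M \<longleftrightarrow>
    (\<forall>I. right_ideal I R \<longrightarrow>
      (\<forall>\<phi>\<in>rmod_hom R M (quotient_module (right_regular R) I).
        \<exists>\<psi>\<in>rmod_hom R M (right_regular R). \<forall>x\<in>carrier M. \<phi> x = I +>\<^bsub>R\<^esub> \<psi> x))"

definition weakly_R_projective :: "('r, 'a) ring_scheme \<Rightarrow> ('r, 'm, 'b) module_scheme \<Rightarrow> bool"
  where "weakly_R_projective R M \<longleftrightarrow>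
    (\<forall>\<alpha>. 0 < \<alpha> \<and> \<alpha> < loewy_length R \<longrightarrow>
      (\<forall>\<phi>\<in>rmod_hom R M (socle_layer R \<alpha>).
        (\<exists>A. finite A \<and> A \<subseteq> \<phi> ` carrier M \<and> rspan R (socle_layer R \<alpha>) A = \<phi> ` carrier M) \<longrightarrow>
        (\<exists>\<psi>\<in>rmod_hom R M (right_regular R\<lparr>carrier := socle_seq R (Suc \<alpha>)\<rparr>).
           \<forall>x\<in>carrier M. \<phi> x = socle_seq R \<alpha> +>\<^bsub>R\<^esub> \<psi> x)))"


section \<open>Jensen's Diamond Principle\<close>

text \<open>
  A cardinal \<open>\<kappa>\<close> is a well-order relation satisfying \<^const>\<open>Card_order\<close>.  The elements of
  \<^term>\<open>Field \<kappa>\<close> represent the ordinals \<open>\<gamma> < \<kappa>\<close>, and \<^term>\<open>underS \<kappa> \<gamma>\<close> is \<open>\<gamma>\<close> as a set of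
  ordinals.
\<close>

definition club :: "'k rel \<Rightarrow> 'k set \<Rightarrow> bool"
  where "club \<kappa> C \<longleftrightarrow> C \<subseteq> Field \<kappa> \<and> cofinal C \<kappa> \<and>
    (\<forall>\<delta>\<in>Field \<kappa>. underS \<kappa> \<delta> \<noteq> {} \<and>
       (\<forall>\<beta>\<in>underS \<kappa> \<delta>. \<exists>\<gamma>\<in>C \<inter> underS \<kappa> \<delta>. \<beta> \<in> underS \<kappa> \<gamma>) \<longrightarrow> \<delta> \<in> C)"

definition stationary :: "'k rel \<Rightarrow> 'k set \<Rightarrow> bool"
  where "stationary \<kappa> S \<longleftrightarrow> S \<subseteq> Field \<kappa> \<and> (\<forall>C. club \<kappa> C \<longrightarrow> S \<inter> C \<noteq> {})"

definition diamond_at :: "'k rel \<Rightarrow> 'k set \<Rightarrow> bool"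
  where "diamond_at \<kappa> E \<longleftrightarrow>
    (\<exists>X. (\<forall>\<gamma>\<in>E. X \<gamma> \<subseteq> underS \<kappa> \<gamma>) \<and>
       (\<forall>Y\<subseteq>Field \<kappa>. stationary \<kappa> {\<gamma>\<in>E. Y \<inter> underS \<kappa> \<gamma> = X \<gamma>}))"

text \<open>
  The principle for all regular uncountable cardinals that are realised on the type \<open>'k\<close>,
  i.e., for those of size at most the cardinality of \<open>'k\<close>.  The principle for all cardinals
  implies the one for each type.  For rings over \<open>'r\<close> and modules over \<open>'m\<close>, the type
  \<^typ>\<open>('r + 'm) set\<close> covers all cardinals up to the power set of the ring and the module.
\<close>

definition diamond :: "'k itself \<Rightarrow> bool"
  where "diamond (_ :: 'k itself) \<longleftrightarrow>
    (\<forall>\<kappa> :: 'k rel. Card_order \<kappa> \<and> natLeq <o \<kappa> \<and> regularCard \<kappa> \<longrightarrow>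
       (\<forall>E. stationary \<kappa> E \<longrightarrow> diamond_at \<kappa> E))"

end

(*
  Call a two-sided ideal P split if every right ideal is generated modulo P by one of its
  elements e with r - e r in P. Primitive ideals are split, modules annihilated by a split ideal
  are injective, and every element of a socle layer is annihilated by one. Hence weak
  R-projectivity passes to submodules and to quotients by finitely generated submodules, and
  countably generated weakly R-projective modules are projective.

  For larger modules M argue by induction on the least size kappa of a generating set. If kappa
  is regular and the filtration of M by submodules with fewer generators has non-projective
  factors on a stationary set, then the bad homomorphisms into socle layers witnessing this can
  be taken to have values in one finitely generated submodule of one layer, because R is small;
  Jensen functions then yield a homomorphism on M that refutes every guess of a lift. If kappa is
  singular, a version of Shelah's singular compactness applies.
*)
theory Submission
  imports Defs
begin

section \<open>Submodules and homomorphisms\<close>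

text \<open>Test homomorphisms take values in finitely generated submodules of single socle layers.
  These are injective, so a test homomorphism given on a submodule of \<open>M\<close> is the
  restriction of one on \<open>M\<close>. This makes weak R-projectivity hereditary, and it lets
  witnesses of failure on small factors be combined into one homomorphism on \<open>M\<close>.

  Smallness of the ring enters twice. In each positive layer countably many finitely generated
  submodules absorb all others, so there are only countably many labels (layer, submodule) for the
  points of a stationary set, and one label occurs stationarily often. Moreover, a diamond sequence
  on \<open>\<kappa>\<close> lists all sets of natural numbers, so the continuum and with it the
  ring have size at most \<open>\<kappa>\<close>; lifts, whose values lie in the ring, can therefore
  be guessed.

  The induction concerns generating sets and not the cardinality of \<open>M\<close>, because a
  single generator may already account for continuum many elements.\<close>

context right_module
begin

lemma submoduleD:
  assumes "submodule N R M"
  shows "N \<subseteq> carrier M" "\<zero>\<^bsub>M\<^esub> \<in> N" "\<lbrakk>x \<in> N; y \<in> N\<rbrakk> \<Longrightarrow> x \<oplus>\<^bsub>M\<^esub> y \<in> N"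
    "\<lbrakk>r \<in> carrier R; x \<in> N\<rbrakk> \<Longrightarrow> r \<odot>\<^bsub>M\<^esub> x \<in> N" "x \<in> N \<Longrightarrow> x \<in> carrier M"
  using assms unfolding submodule_iff by auto

lemma submodule_minus:
  assumes "submodule N R M" "x \<in> N" "y \<in> N"
  shows "x \<ominus>\<^bsub>M\<^esub> y \<in> N" "\<ominus>\<^bsub>M\<^esub> y \<in> N"
proof -
  show "\<ominus>\<^bsub>M\<^esub> y \<in> N"
    using submoduleD[OF assms(1)] assms(3) smult_minus_one[of y] by (metis R.add.inv_closed R.one_closed)
  then show "x \<ominus>\<^bsub>M\<^esub> y \<in> N"
    using submoduleD[OF assms(1)] assms by (simp add: a_minus_def)
qed

lemma smult_minus_right:
  assumes "r \<in> carrier R" "x \<in> carrier M"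
  shows "r \<odot>\<^bsub>M\<^esub> (\<ominus>\<^bsub>M\<^esub> x) = \<ominus>\<^bsub>M\<^esub> (r \<odot>\<^bsub>M\<^esub> x)"
proof -
  have "r \<odot>\<^bsub>M\<^esub> (\<ominus>\<^bsub>M\<^esub> x) \<oplus>\<^bsub>M\<^esub> r \<odot>\<^bsub>M\<^esub> x = \<zero>\<^bsub>M\<^esub>"
    using assms by (simp add: smult_r_distr[symmetric] M.l_neg)
  then show ?thesis using assms by (simp add: M.minus_equality)
qed

lemma smult_minus_left:
  assumes "r \<in> carrier R" "x \<in> carrier M"
  shows "(\<ominus> r) \<odot>\<^bsub>M\<^esub> x = \<ominus>\<^bsub>M\<^esub> (r \<odot>\<^bsub>M\<^esub> x)"
proof -
  have "(\<ominus> r) \<odot>\<^bsub>M\<^esub> x \<oplus>\<^bsub>M\<^esub> r \<odot>\<^bsub>M\<^esub> x = \<zero>\<^bsub>M\<^esub>"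
    using assms by (simp add: smult_l_distr[symmetric] R.l_neg)
  then show ?thesis using assms by (simp add: M.minus_equality)
qed

lemma minus_eq_zero_iff:
  assumes "x \<in> carrier M" "y \<in> carrier M"
  shows "x \<ominus>\<^bsub>M\<^esub> y = \<zero>\<^bsub>M\<^esub> \<longleftrightarrow> x = y"
  using assms by (metis M.r_neg M.minus_equality M.minus_minus M.a_inv_closed a_minus_def)

lemma minus_add_cancel:
  assumes "x \<in> carrier M" "y \<in> carrier M"
  shows "(x \<ominus>\<^bsub>M\<^esub> y) \<oplus>\<^bsub>M\<^esub> y = x" "(x \<oplus>\<^bsub>M\<^esub> y) \<ominus>\<^bsub>M\<^esub> y = x" "(x \<oplus>\<^bsub>M\<^esub> y) \<ominus>\<^bsub>M\<^esub> x = y"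
proof -
  have *: "(x \<oplus>\<^bsub>M\<^esub> y) \<ominus>\<^bsub>M\<^esub> y = x" if "x \<in> carrier M" "y \<in> carrier M" for x y
    using that by (simp add: a_minus_def M.a_assoc M.r_neg)
  show "(x \<ominus>\<^bsub>M\<^esub> y) \<oplus>\<^bsub>M\<^esub> y = x"
    using assms by (simp add: a_minus_def M.a_assoc M.l_neg)
  show "(x \<oplus>\<^bsub>M\<^esub> y) \<ominus>\<^bsub>M\<^esub> y = x" using * assms .
  show "(x \<oplus>\<^bsub>M\<^esub> y) \<ominus>\<^bsub>M\<^esub> x = y"
    using *[OF assms(2,1)] assms by (simp add: M.a_comm)
qed

lemma submodule_add_cancel:
  assumes "submodule N R M" "x \<in> N" "y \<in> carrier M" "x \<oplus>\<^bsub>M\<^esub> y \<in> N"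
  shows "y \<in> N"
  using submodule_minus(1)[OF assms(1,4,2)] submoduleD(5)[OF assms(1,2)] assms(3)
  by (simp add: minus_add_cancel)

lemma carrier_submodule: "submodule (carrier M) R M"
  by (simp add: submodule_iff)

lemma zero_submodule: "submodule {\<zero>\<^bsub>M\<^esub>} R M"
  by (simp add: submodule_iff)

lemma submodule_Inter:
  assumes "\<N> \<noteq> {}" "\<And>N. N \<in> \<N> \<Longrightarrow> submodule N R M" shows "submodule (\<Inter>\<N>) R M"
  unfolding submodule_iff
proof (intro conjI ballI InterI)
  show "\<Inter>\<N> \<subseteq> carrier M" using assms submoduleD(1) by blast
qed (use assms(2) submoduleD(2,3,4) in auto)

lemma submodule_Union_chain:
  assumes "\<N> \<noteq> {}" "\<And>N. N \<in> \<N> \<Longrightarrow> submodule N R M"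
    and chain: "\<And>N P. N \<in> \<N> \<Longrightarrow> P \<in> \<N> \<Longrightarrow> N \<subseteq> P \<or> P \<subseteq> N"
  shows "submodule (\<Union>\<N>) R M"
  unfolding submodule_iff
proof (intro conjI ballI)
  note sub = submoduleD[OF assms(2)]
  show "\<Union>\<N> \<subseteq> carrier M" using sub(1) by blast
  show "\<zero>\<^bsub>M\<^esub> \<in> \<Union>\<N>" using assms(1) sub(2) by blast
  show "x \<oplus>\<^bsub>M\<^esub> y \<in> \<Union>\<N>" if xy: "x \<in> \<Union>\<N>" "y \<in> \<Union>\<N>" for x y
  proof -
    obtain N P where NP: "N \<in> \<N>" "x \<in> N" "P \<in> \<N>" "y \<in> P" using xy by blast
    from chain[OF NP(1,3)] show ?thesis
      using NP sub(3)[OF NP(1), of x y] sub(3)[OF NP(3), of x y] by blast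
  qed
  show "r \<odot>\<^bsub>M\<^esub> x \<in> \<Union>\<N>" if "r \<in> carrier R" "x \<in> \<Union>\<N>" for r x
    using that(2) sub(4)[OF _ that(1)] by blast
qed

lemma submodule_of_submodule_iff:
  assumes "submodule B R M"
  shows "submodule N R (M\<lparr>carrier := B\<rparr>) \<longleftrightarrow> submodule N R M \<and> N \<subseteq> B"
proof -
  interpret B: right_module R "M\<lparr>carrier := B\<rparr>" using right_module_submodule[OF assms] .
  show ?thesis using submoduleD[OF assms] by (auto simp: submodule_iff B.submodule_iff)
qed

lemma rspan_submodule: "A \<subseteq> carrier M \<Longrightarrow> submodule (rspan R M A) R M"
  unfolding rspan_def by (rule submodule_Inter) (use carrier_submodule in auto)

lemma rspan_subset: "A \<subseteq> carrier M \<Longrightarrow> rspan R M A \<subseteq> carrier M"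
  using rspan_submodule submoduleD(1) by blast

lemma rspan_submodule_eq: "submodule N R M \<Longrightarrow> rspan R M N = N"
  unfolding rspan_def by blast

lemma rspan_of_submodule:
  assumes "submodule B R M" "A \<subseteq> B"
  shows "rspan R (M\<lparr>carrier := B\<rparr>) A = rspan R M A"
proof
  show "rspan R (M\<lparr>carrier := B\<rparr>) A \<subseteq> rspan R M A"
  proof
    fix x assume x: "x \<in> rspan R (M\<lparr>carrier := B\<rparr>) A"
    show "x \<in> rspan R M A"
      unfolding rspan_def
    proof (safe)
      fix N assume N: "submodule N R M" "A \<subseteq> N"
      have "submodule (N \<inter> B) R M" using submodule_Inter[of "{N, B}"] N assms by auto
      then have "submodule (N \<inter> B) R (M\<lparr>carrier := B\<rparr>)" using submodule_of_submodule_iff[OF assms(1)] by blast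
      then show "x \<in> N" using x N assms(2) unfolding rspan_def by blast
    qed
  qed
  show "rspan R M A \<subseteq> rspan R (M\<lparr>carrier := B\<rparr>) A"
    unfolding rspan_def using submodule_of_submodule_iff[OF assms(1)] by blast
qed

lemma rspan_empty: "rspan R M {} = {\<zero>\<^bsub>M\<^esub>}"
  using zero_submodule submoduleD(2) unfolding rspan_def by blast

end

lemma rspan_incl: "A \<subseteq> rspan R M A"
  unfolding rspan_def by blast

lemma rspan_minimal: "submodule N R M \<Longrightarrow> A \<subseteq> N \<Longrightarrow> rspan R M A \<subseteq> N"
  unfolding rspan_def by blast

lemma rspan_mono: "A \<subseteq> B \<Longrightarrow> rspan R M A \<subseteq> rspan R M B"
  unfolding rspan_def by blast

context right_module
begin

text \<open>The spans form a chain of submodules, so their union is a submodule. Limit stages of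
  filtrations rest on this continuity.\<close>

lemma rspan_Union_chain:
  assumes "\<X> \<noteq> {}" "\<And>X. X \<in> \<X> \<Longrightarrow> X \<subseteq> carrier M"
    and "\<And>X Y. X \<in> \<X> \<Longrightarrow> Y \<in> \<X> \<Longrightarrow> X \<subseteq> Y \<or> Y \<subseteq> X"
  shows "rspan R M (\<Union>\<X>) = (\<Union>X\<in>\<X>. rspan R M X)"
proof
  have "submodule (\<Union>(rspan R M ` \<X>)) R M"
  proof (rule submodule_Union_chain)
    fix N P assume "N \<in> rspan R M ` \<X>" "P \<in> rspan R M ` \<X>"
    then obtain X Y where XY: "X \<in> \<X>" "Y \<in> \<X>" "N = rspan R M X" "P = rspan R M Y" by blast
    show "N \<subseteq> P \<or> P \<subseteq> N" using assms(3)[OF XY(1,2)] rspan_mono unfolding XY(3,4) by blast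
  next
    fix N assume "N \<in> rspan R M ` \<X>"
    then show "submodule N R M" using rspan_submodule[OF assms(2)] by blast
  qed (use assms(1) in simp)
  moreover have "\<Union>\<X> \<subseteq> \<Union>(rspan R M ` \<X>)"
  proof (rule Union_least)
    fix X assume "X \<in> \<X>"
    then have "rspan R M X \<subseteq> \<Union>(rspan R M ` \<X>)" by blast
    then show "X \<subseteq> \<Union>(rspan R M ` \<X>)" using rspan_incl[of X R M] by simp
  qed
  ultimately show "rspan R M (\<Union>\<X>) \<subseteq> (\<Union>X\<in>\<X>. rspan R M X)" by (rule rspan_minimal)
  show "(\<Union>X\<in>\<X>. rspan R M X) \<subseteq> rspan R M (\<Union>\<X>)" using rspan_mono[OF Union_upper] by (rule UN_least)
qed

text \<open>The finite subsets of \<open>A\<close> are directed, so the union of their spans is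
  already a submodule containing \<open>A\<close>.\<close>

lemma rspan_finite:
  assumes "A \<subseteq> carrier M" "x \<in> rspan R M A"
  obtains B where "finite B" "B \<subseteq> A" "x \<in> rspan R M B"
proof -
  let ?N = "\<Union>(rspan R M ` {B. finite B \<and> B \<subseteq> A})"
  have "submodule ?N R M"
    unfolding submodule_iff
  proof (intro conjI ballI)
    show "?N \<subseteq> carrier M" using assms(1) rspan_subset by blast
    have "\<zero>\<^bsub>M\<^esub> \<in> rspan R M {}" by (simp add: rspan_empty)
    then show "\<zero>\<^bsub>M\<^esub> \<in> ?N" by blast
    show "x \<oplus>\<^bsub>M\<^esub> y \<in> ?N" if xy: "x \<in> ?N" "y \<in> ?N" for x y
    proof -
      obtain B C where BC: "finite B" "B \<subseteq> A" "x \<in> rspan R M B" "finite C" "C \<subseteq> A" "y \<in> rspan R M C"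
        using xy by blast
      then have "x \<in> rspan R M (B \<union> C)" "y \<in> rspan R M (B \<union> C)"
        using rspan_mono[of B "B \<union> C" R M] rspan_mono[of C "B \<union> C" R M] by auto
      moreover have "submodule (rspan R M (B \<union> C)) R M" using BC assms by (intro rspan_submodule) auto
      ultimately have "x \<oplus>\<^bsub>M\<^esub> y \<in> rspan R M (B \<union> C)" using submoduleD(3) by blast
      then show ?thesis using BC by blast
    qed
    show "r \<odot>\<^bsub>M\<^esub> x \<in> ?N" if r: "r \<in> carrier R" and x: "x \<in> ?N" for r x
    proof -
      obtain B where B: "finite B" "B \<subseteq> A" "x \<in> rspan R M B" using x by blast
      then have "r \<odot>\<^bsub>M\<^esub> x \<in> rspan R M B"
        using submoduleD(4)[OF rspan_submodule r] assms by blast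
      then show ?thesis using B by blast
    qed
  qed
  moreover have "A \<subseteq> ?N"
  proof
    fix a assume "a \<in> A" then show "a \<in> ?N" using rspan_incl[of "{a}" R M] by blast
  qed
  ultimately have "rspan R M A \<subseteq> ?N" by (rule rspan_minimal)
  then show ?thesis using assms(2) that by blast
qed

lemma rspan_finite_subset:
  assumes "A \<subseteq> carrier M" "finite Y" "Y \<subseteq> rspan R M A"
  obtains B where "finite B" "B \<subseteq> A" "Y \<subseteq> rspan R M B"
proof -
  have "\<forall>y\<in>Y. \<exists>B. finite B \<and> B \<subseteq> A \<and> y \<in> rspan R M B"
    using assms rspan_finite by (metis subsetD)
  then obtain B where B: "\<forall>y\<in>Y. finite (B y) \<and> B y \<subseteq> A \<and> y \<in> rspan R M (B y)" by metis
  have "Y \<subseteq> rspan R M (\<Union>(B ` Y))"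
  proof
    fix y assume y: "y \<in> Y"
    have "rspan R M (B y) \<subseteq> rspan R M (\<Union>(B ` Y))" by (rule rspan_mono) (use y in auto)
    then show "y \<in> rspan R M (\<Union>(B ` Y))" using B y by blast
  qed
  then show ?thesis using that[of "\<Union>(B ` Y)"] B assms(2) by auto
qed

lemma rspan_singleton:
  assumes "x \<in> carrier M"
  shows "rspan R M {x} = (\<lambda>r. r \<odot>\<^bsub>M\<^esub> x) ` carrier R"
proof
  show "rspan R M {x} \<subseteq> (\<lambda>r. r \<odot>\<^bsub>M\<^esub> x) ` carrier R"
    using cyclic_embedding(1,2)[OF right_module_axioms assms] by (intro rspan_minimal) auto
  show "(\<lambda>r. r \<odot>\<^bsub>M\<^esub> x) ` carrier R \<subseteq> rspan R M {x}"
    using submoduleD(4)[OF rspan_submodule[of "{x}"]] rspan_incl[of "{x}" R M] assms by auto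
qed

text \<open>The explicit form of the elements serves as the domain of one-step extensions of
  homomorphisms.\<close>

lemma rspan_insert:
  assumes A: "submodule A R M" and x: "x \<in> carrier M"
  shows "submodule {a \<oplus>\<^bsub>M\<^esub> r \<odot>\<^bsub>M\<^esub> x | a r. a \<in> A \<and> r \<in> carrier R} R M" (is "submodule ?S R M")
    and "A \<subseteq> {a \<oplus>\<^bsub>M\<^esub> r \<odot>\<^bsub>M\<^esub> x | a r. a \<in> A \<and> r \<in> carrier R}"
    and "x \<in> {a \<oplus>\<^bsub>M\<^esub> r \<odot>\<^bsub>M\<^esub> x | a r. a \<in> A \<and> r \<in> carrier R}"
    and "rspan R M (A \<union> {x}) = {a \<oplus>\<^bsub>M\<^esub> r \<odot>\<^bsub>M\<^esub> x | a r. a \<in> A \<and> r \<in> carrier R}"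
proof -
  note A' = submoduleD[OF A]
  show sub: "submodule ?S R M"
    unfolding submodule_iff
  proof (intro conjI ballI)
    show "?S \<subseteq> carrier M" using A' x by auto
    have "\<zero>\<^bsub>M\<^esub> = \<zero>\<^bsub>M\<^esub> \<oplus>\<^bsub>M\<^esub> \<zero> \<odot>\<^bsub>M\<^esub> x" using x by simp
    then show "\<zero>\<^bsub>M\<^esub> \<in> ?S" using A'(2) by blast
    show "y \<oplus>\<^bsub>M\<^esub> z \<in> ?S" if yz: "y \<in> ?S" "z \<in> ?S" for y z
    proof -
      obtain a r b s where e: "y = a \<oplus>\<^bsub>M\<^esub> r \<odot>\<^bsub>M\<^esub> x" "z = b \<oplus>\<^bsub>M\<^esub> s \<odot>\<^bsub>M\<^esub> x"
        "a \<in> A" "b \<in> A" "r \<in> carrier R" "s \<in> carrier R" using yz by blast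
      have "y \<oplus>\<^bsub>M\<^esub> z = (a \<oplus>\<^bsub>M\<^esub> b) \<oplus>\<^bsub>M\<^esub> (r \<oplus> s) \<odot>\<^bsub>M\<^esub> x"
        using e x A'(5) by (simp add: smult_l_distr M.a_ac)
      then show ?thesis using e A'(3) by blast
    qed
    show "s \<odot>\<^bsub>M\<^esub> y \<in> ?S" if s: "s \<in> carrier R" and y: "y \<in> ?S" for s y
    proof -
      obtain a r where e: "y = a \<oplus>\<^bsub>M\<^esub> r \<odot>\<^bsub>M\<^esub> x" "a \<in> A" "r \<in> carrier R" using y by blast
      have "s \<odot>\<^bsub>M\<^esub> y = (s \<odot>\<^bsub>M\<^esub> a) \<oplus>\<^bsub>M\<^esub> (r \<otimes> s) \<odot>\<^bsub>M\<^esub> x"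
        using e x A'(5) s by (simp add: smult_r_distr smult_assoc)
      then show ?thesis using e A'(4) s by blast
    qed
  qed
  show AS: "A \<subseteq> ?S"
  proof
    fix a assume a: "a \<in> A"
    then have "a = a \<oplus>\<^bsub>M\<^esub> \<zero> \<odot>\<^bsub>M\<^esub> x" using x A'(5) by simp
    then show "a \<in> ?S" using a by blast
  qed
  have "x = \<zero>\<^bsub>M\<^esub> \<oplus>\<^bsub>M\<^esub> \<one> \<odot>\<^bsub>M\<^esub> x" using x by simp
  then show xS: "x \<in> ?S" using A'(2) by blast
  show "rspan R M (A \<union> {x}) = ?S"
  proof
    show "rspan R M (A \<union> {x}) \<subseteq> ?S" using sub AS xS by (intro rspan_minimal) auto
    show "?S \<subseteq> rspan R M (A \<union> {x})"
      using submoduleD(3,4)[OF rspan_submodule[of "A \<union> {x}"]] rspan_incl[of "A \<union> {x}" R M] A'(1) x by auto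
  qed
qed

end

section \<open>Homomorphisms, images and preimages\<close>

lemma rmod_homI:
  assumes "\<And>x. x \<in> carrier M \<Longrightarrow> f x \<in> carrier N"
    and "\<And>x y. \<lbrakk>x \<in> carrier M; y \<in> carrier M\<rbrakk> \<Longrightarrow> f (x \<oplus>\<^bsub>M\<^esub> y) = f x \<oplus>\<^bsub>N\<^esub> f y"
    and "\<And>r x. \<lbrakk>r \<in> carrier R; x \<in> carrier M\<rbrakk> \<Longrightarrow> f (r \<odot>\<^bsub>M\<^esub> x) = r \<odot>\<^bsub>N\<^esub> f x"
  shows "f \<in> rmod_hom R M N"
  using assms by (auto simp: rmod_hom_def)

lemma rmod_hom_cong:
  assumes "right_module R M" "f \<in> rmod_hom R M N" "\<And>x. x \<in> carrier M \<Longrightarrow> f x = g x"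
  shows "g \<in> rmod_hom R M N"
proof -
  interpret right_module R M by fact
  show ?thesis using rmod_homD[OF assms(2)] assms(3) by (intro rmod_homI) (metis M.a_closed smult_closed)+
qed

lemma rmod_hom_comp:
  "f \<in> rmod_hom R M N \<Longrightarrow> g \<in> rmod_hom R N L \<Longrightarrow> (\<lambda>x. g (f x)) \<in> rmod_hom R M L"
  by (simp add: rmod_hom_def Pi_iff)

lemma rmod_hom_restrict:
  "f \<in> rmod_hom R M N \<Longrightarrow> A \<subseteq> carrier M \<Longrightarrow> f \<in> rmod_hom R (M\<lparr>carrier := A\<rparr>) N"
  by (auto simp: rmod_hom_def Pi_iff subset_iff)

lemma rmod_hom_restrict2:
  "f \<in> rmod_hom R (M\<lparr>carrier := B\<rparr>) N \<Longrightarrow> A \<subseteq> B \<Longrightarrow> f \<in> rmod_hom R (M\<lparr>carrier := A\<rparr>) N"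
  by (auto simp: rmod_hom_def Pi_iff subset_iff)

lemma rmod_hom_codomain:
  "f \<in> rmod_hom R M (N\<lparr>carrier := B\<rparr>) \<Longrightarrow> B \<subseteq> C \<Longrightarrow> f \<in> rmod_hom R M (N\<lparr>carrier := C\<rparr>)"
  by (auto simp: rmod_hom_def Pi_iff subset_iff)

lemma rmod_hom_codomain_carrier:
  "f \<in> rmod_hom R M (N\<lparr>carrier := B\<rparr>) \<Longrightarrow> B \<subseteq> carrier N \<Longrightarrow> f \<in> rmod_hom R M N"
  by (auto simp: rmod_hom_def Pi_iff subset_iff)

lemma rmod_hom_codomain_restrict:
  "f \<in> rmod_hom R M N \<Longrightarrow> f ` carrier M \<subseteq> B \<Longrightarrow> f \<in> rmod_hom R M (N\<lparr>carrier := B\<rparr>)"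
  by (auto simp: rmod_hom_def Pi_iff subset_iff)

lemma rmod_hom_add:
  assumes "right_module R M" "right_module R N" "f \<in> rmod_hom R M N" "g \<in> rmod_hom R M N"
  shows "(\<lambda>x. f x \<oplus>\<^bsub>N\<^esub> g x) \<in> rmod_hom R M N"
proof -
  interpret M: right_module R M by fact
  interpret N: right_module R N by fact
  note f = rmod_homD[OF assms(3)] and g = rmod_homD[OF assms(4)]
  show ?thesis by (rule rmod_homI) (simp_all add: f g N.M.a_ac N.smult_r_distr)
qed

lemma rmod_hom_minus:
  assumes "right_module R M" "right_module R N" "f \<in> rmod_hom R M N" "g \<in> rmod_hom R M N"
  shows "(\<lambda>x. f x \<ominus>\<^bsub>N\<^esub> g x) \<in> rmod_hom R M N"
proof -
  interpret M: right_module R M by fact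
  interpret N: right_module R N by fact
  note f = rmod_homD[OF assms(3)] and g = rmod_homD[OF assms(4)]
  show ?thesis
    by (rule rmod_homI)
      (simp_all add: f g N.M.a_ac N.smult_r_distr a_minus_def N.M.minus_add N.smult_minus_right)
qed

lemma rmod_hom_diff:
  assumes "right_module R M" "right_module R N" "f \<in> rmod_hom R M N" "x \<in> carrier M" "y \<in> carrier M"
  shows "f (x \<ominus>\<^bsub>M\<^esub> y) = f x \<ominus>\<^bsub>N\<^esub> f y" "f (\<ominus>\<^bsub>M\<^esub> y) = \<ominus>\<^bsub>N\<^esub> f y"
proof -
  interpret M: right_module R M by fact
  interpret N: right_module R N by fact
  note f = rmod_homD[OF assms(3)]
  show *: "f (\<ominus>\<^bsub>M\<^esub> y) = \<ominus>\<^bsub>N\<^esub> f y"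
    using f(3)[of "\<ominus>\<^bsub>R\<^esub> \<one>\<^bsub>R\<^esub>" y] assms f(1)[of y] by (simp add: M.smult_minus_one N.smult_minus_one)
  show "f (x \<ominus>\<^bsub>M\<^esub> y) = f x \<ominus>\<^bsub>N\<^esub> f y" using assms(4,5) by (simp add: a_minus_def f(2) *)
qed

lemma rmod_hom_id: "(\<lambda>x. x) \<in> rmod_hom R (M\<lparr>carrier := A\<rparr>) (M\<lparr>carrier := A\<rparr>)"
  by (simp add: rmod_hom_def)

lemma submodule_image:
  assumes "right_module R M" "right_module R N" "f \<in> rmod_hom R M N" "submodule A R M"
  shows "submodule (f ` A) R N"
proof -
  interpret M: right_module R M by fact
  interpret N: right_module R N by fact
  note f = rmod_homD[OF assms(3)] and A = M.submoduleD[OF assms(4)]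
  show ?thesis
    unfolding N.submodule_iff
  proof (intro conjI ballI)
    show "f ` A \<subseteq> carrier N" using f(1) A(5) by auto
    show "\<zero>\<^bsub>N\<^esub> \<in> f ` A" using imageI[OF A(2), of f] rmod_hom_zero[OF assms(1-3)] by simp
    show "x \<oplus>\<^bsub>N\<^esub> y \<in> f ` A" if xy: "x \<in> f ` A" "y \<in> f ` A" for x y
    proof -
      obtain a b where ab: "x = f a" "a \<in> A" "y = f b" "b \<in> A" using xy by blast
      then show ?thesis using f(2)[of a b] A(3)[of a b] A(5)[of a] A(5)[of b]
        by (auto intro!: image_eqI[of _ _ "a \<oplus>\<^bsub>M\<^esub> b"])
    qed
    show "r \<odot>\<^bsub>N\<^esub> x \<in> f ` A" if rx: "r \<in> carrier R" "x \<in> f ` A" for r x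
    proof -
      obtain a where a: "x = f a" "a \<in> A" using rx by blast
      then show ?thesis using f(3)[of r a] A(4)[of r a] A(5)[of a] rx
        by (auto intro!: image_eqI[of _ _ "r \<odot>\<^bsub>M\<^esub> a"])
    qed
  qed
qed

lemma submodule_preimage:
  assumes "right_module R M" "right_module R N" "f \<in> rmod_hom R M N" "submodule B R N"
  shows "submodule {x \<in> carrier M. f x \<in> B} R M"
proof -
  interpret M: right_module R M by fact
  interpret N: right_module R N by fact
  note f = rmod_homD[OF assms(3)] and B = N.submoduleD[OF assms(4)]
  show ?thesis
    unfolding M.submodule_iff using f B rmod_hom_zero[OF assms(1-3)] by auto
qed

lemma rspan_image:
  assumes "right_module R M" "right_module R N" "f \<in> rmod_hom R M N" "A \<subseteq> carrier M"
  shows "f ` rspan R M A = rspan R N (f ` A)"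
proof -
  interpret M: right_module R M by fact
  interpret N: right_module R N by fact
  have fA: "f ` A \<subseteq> carrier N" using assms(4) rmod_homD(1)[OF assms(3)] by auto
  show ?thesis
  proof
    have "rspan R M A \<subseteq> {x \<in> carrier M. f x \<in> rspan R N (f ` A)}"
      by (rule rspan_minimal[OF submodule_preimage[OF assms(1-3) N.rspan_submodule[OF fA]]])
        (use assms(4) rspan_incl[of "f ` A" R N] in auto)
    then show "f ` rspan R M A \<subseteq> rspan R N (f ` A)" by blast
    show "rspan R N (f ` A) \<subseteq> f ` rspan R M A"
      by (rule rspan_minimal[OF submodule_image[OF assms(1-3) M.rspan_submodule[OF assms(4)]]])
        (use rspan_incl[of A R M] in auto)
  qed
qed

text \<open>The equaliser is the preimage of zero under the difference of the two maps, hence a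
  submodule.\<close>

lemma rmod_hom_eq_on_rspan:
  assumes "right_module R M" "right_module R N" "f \<in> rmod_hom R M N" "g \<in> rmod_hom R M N"
    and "A \<subseteq> carrier M" "\<And>x. x \<in> A \<Longrightarrow> f x = g x" "x \<in> rspan R M A"
  shows "f x = g x"
proof -
  interpret M: right_module R M by fact
  interpret N: right_module R N by fact
  note f = rmod_homD[OF assms(3)] and g = rmod_homD[OF assms(4)]
  let ?E = "{x \<in> carrier M. (\<lambda>x. f x \<ominus>\<^bsub>N\<^esub> g x) x \<in> {\<zero>\<^bsub>N\<^esub>}}"
  have E: "?E = {x \<in> carrier M. f x = g x}"
    using f(1) g(1) N.minus_eq_zero_iff by auto
  have "submodule ?E R M"
    by (rule submodule_preimage[OF assms(1,2) rmod_hom_minus[OF assms(1-4)] N.zero_submodule])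
  then have "rspan R M A \<subseteq> ?E"
    unfolding E by (rule rspan_minimal) (use assms in auto)
  then show ?thesis using assms(7) unfolding E by blast
qed

section \<open>Quotients\<close>

lemma (in right_module) submodule_abelian_subgroup:
  assumes "submodule N R M" shows "abelian_subgroup N M"
  using assms M.abelian_group_axioms
  by (intro abelian_subgroupI3 additive_subgroup.intro) (simp_all add: submodule.axioms(1))

lemma (in right_module) coset_eq_iff:
  assumes "submodule N R M" "x \<in> carrier M" "y \<in> carrier M"
  shows "N +>\<^bsub>M\<^esub> x = N +>\<^bsub>M\<^esub> y \<longleftrightarrow> x \<ominus>\<^bsub>M\<^esub> y \<in> N"
proof -
  interpret N: abelian_subgroup N M using submodule_abelian_subgroup[OF assms(1)] .
  have "N +>\<^bsub>M\<^esub> x = N +>\<^bsub>M\<^esub> y \<longleftrightarrow> x \<in> N +>\<^bsub>M\<^esub> y"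
  proof
    show "N +>\<^bsub>M\<^esub> x = N +>\<^bsub>M\<^esub> y \<Longrightarrow> x \<in> N +>\<^bsub>M\<^esub> y" using N.a_rcos_self[OF assms(2)] by simp
    show "x \<in> N +>\<^bsub>M\<^esub> y \<Longrightarrow> N +>\<^bsub>M\<^esub> x = N +>\<^bsub>M\<^esub> y" using N.a_repr_independence'[of x y] assms(3) by simp
  qed
  then show ?thesis using N.a_rcos_module[OF assms(3,2)] by (simp add: a_minus_def)
qed

lemma (in right_module) coset_zero_iff:
  assumes "submodule N R M" "x \<in> carrier M"
  shows "N +>\<^bsub>M\<^esub> x = N \<longleftrightarrow> x \<in> N"
proof -
  interpret N: abelian_subgroup N M using submodule_abelian_subgroup[OF assms(1)] .
  have "N +>\<^bsub>M\<^esub> \<zero>\<^bsub>M\<^esub> = N" using N.a_rcos_const[OF submoduleD(2)[OF assms(1)]] .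
  then show ?thesis using coset_eq_iff[OF assms M.zero_closed] minus_add_cancel(2)[OF assms(2) M.zero_closed] assms(2)
    by simp
qed

lemma (in right_module) quotient_smult:
  assumes N: "submodule N R M" and r: "r \<in> carrier R" and x: "x \<in> carrier M"
  shows "r \<odot>\<^bsub>quotient_module M N\<^esub> (N +>\<^bsub>M\<^esub> x) = N +>\<^bsub>M\<^esub> (r \<odot>\<^bsub>M\<^esub> x)"
proof -
  interpret N: abelian_subgroup N M using submodule_abelian_subgroup[OF N] .
  have const: "N +>\<^bsub>M\<^esub> (r \<odot>\<^bsub>M\<^esub> y) = N +>\<^bsub>M\<^esub> (r \<odot>\<^bsub>M\<^esub> x)" if y: "y \<in> N +>\<^bsub>M\<^esub> x" for y
  proof -
    have yM: "y \<in> carrier M" using N.a_elemrcos_carrier[OF x y] .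
    have "y \<ominus>\<^bsub>M\<^esub> x \<in> N" using N.a_rcos_module[OF x yM] y by (simp add: a_minus_def)
    then have "r \<odot>\<^bsub>M\<^esub> (y \<ominus>\<^bsub>M\<^esub> x) \<in> N" using submoduleD(4)[OF N r] by blast
    then have "r \<odot>\<^bsub>M\<^esub> y \<ominus>\<^bsub>M\<^esub> r \<odot>\<^bsub>M\<^esub> x \<in> N"
      using yM x r by (simp add: a_minus_def smult_r_distr smult_minus_right)
    then show ?thesis using coset_eq_iff[OF N] yM x r by simp
  qed
  have "(\<Union>y\<in>N +>\<^bsub>M\<^esub> x. N +>\<^bsub>M\<^esub> (r \<odot>\<^bsub>M\<^esub> y)) = N +>\<^bsub>M\<^esub> (r \<odot>\<^bsub>M\<^esub> x)"
    by (rule UN_constant_eq[OF N.a_rcos_self[OF x]]) (intro ballI const)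
  then show ?thesis by (simp add: quotient_module_def)
qed

lemma (in right_module) quotient_module:
  assumes N: "submodule N R M"
  shows "right_module R (quotient_module M N)"
    and "(\<lambda>x. N +>\<^bsub>M\<^esub> x) \<in> rmod_hom R M (quotient_module M N)"
    and "(\<lambda>x. N +>\<^bsub>M\<^esub> x) ` carrier M = carrier (quotient_module M N)"
    and "\<zero>\<^bsub>quotient_module M N\<^esub> = N"
proof -
  interpret N: abelian_subgroup N M using submodule_abelian_subgroup[OF N] .
  let ?Q = "quotient_module M N"
  have car: "carrier ?Q = (\<lambda>x. N +>\<^bsub>M\<^esub> x) ` carrier M"
    by (auto simp: quotient_module_def A_RCOSETS_def RCOSETS_def a_r_coset_def)
  have add: "(N +>\<^bsub>M\<^esub> x) \<oplus>\<^bsub>?Q\<^esub> (N +>\<^bsub>M\<^esub> y) = N +>\<^bsub>M\<^esub> (x \<oplus>\<^bsub>M\<^esub> y)"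
    if "x \<in> carrier M" "y \<in> carrier M" for x y
    using N.a_rcos_sum[OF that] by (simp add: quotient_module_def)
  have zero: "\<zero>\<^bsub>?Q\<^esub> = N +>\<^bsub>M\<^esub> \<zero>\<^bsub>M\<^esub>"
    using N.a_rcos_const[OF submoduleD(2)[OF N]] by (simp add: quotient_module_def)
  note sm = quotient_smult[OF N]
  show "(\<lambda>x. N +>\<^bsub>M\<^esub> x) ` carrier M = carrier ?Q" using car by simp
  show "(\<lambda>x. N +>\<^bsub>M\<^esub> x) \<in> rmod_hom R M ?Q"
    by (rule rmod_homI) (simp_all add: car add sm)
  show "right_module R ?Q"
  proof (rule right_moduleI)
    show "ring R" ..
    show "abelian_group ?Q"
    proof (rule abelian_groupI)
      fix X assume "X \<in> carrier ?Q"
      then obtain x where x: "X = N +>\<^bsub>M\<^esub> x" "x \<in> carrier M" unfolding car by blast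
      show "\<exists>Y\<in>carrier ?Q. Y \<oplus>\<^bsub>?Q\<^esub> X = \<zero>\<^bsub>?Q\<^esub>"
        by (rule bexI[of _ "N +>\<^bsub>M\<^esub> (\<ominus>\<^bsub>M\<^esub> x)"]) (use x in \<open>auto simp: add zero car M.l_neg\<close>)
    qed (auto simp: car add zero M.a_ac)
  qed (auto simp: car add sm smult_l_distr smult_r_distr smult_assoc)
  show "\<zero>\<^bsub>?Q\<^esub> = N" by (simp add: quotient_module_def)
qed

text \<open>Choosing coset representatives keeps quotients within the carrier type of the module.\<close>

lemma (in right_module) quotient_exists:
  assumes N: "submodule N R M"
  obtains Q :: "('r, 'm) module" and q where "right_module R Q" "q \<in> rmod_hom R M Q"
    "q ` carrier M = carrier Q" "\<And>x. x \<in> carrier M \<Longrightarrow> q x = \<zero>\<^bsub>Q\<^esub> \<longleftrightarrow> x \<in> N"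
proof -
  interpret N: abelian_subgroup N M using submodule_abelian_subgroup[OF N] .
  let ?Q = "quotient_module M N"
  note Q = quotient_module[OF N]
  let ?e = "\<lambda>X. SOME x. x \<in> X"
  have inj: "inj_on ?e (carrier ?Q)"
  proof (rule inj_onI)
    fix X Y assume XY: "X \<in> carrier ?Q" "Y \<in> carrier ?Q" "?e X = ?e Y"
    then obtain x y where xy: "X = N +>\<^bsub>M\<^esub> x" "x \<in> carrier M" "Y = N +>\<^bsub>M\<^esub> y" "y \<in> carrier M"
      unfolding Q(3)[symmetric] by blast
    have "x \<in> X" "y \<in> Y" using xy N.a_rcos_self by auto
    then have "?e X \<in> X" "?e Y \<in> Y" using someI[of "\<lambda>z. z \<in> X" x] someI[of "\<lambda>z. z \<in> Y" y] by auto
    then have "?e X \<in> X" "?e X \<in> Y" using XY(3) by auto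
    have "X = N +>\<^bsub>M\<^esub> ?e X" "Y = N +>\<^bsub>M\<^esub> ?e X"
      using xy N.a_repr_independence'[of "?e X" x] N.a_repr_independence'[of "?e X" y]
        \<open>?e X \<in> X\<close> \<open>?e X \<in> Y\<close> by auto
    then show "X = Y" by simp
  qed
  note T = transport_module[OF Q(1) inj]
  let ?q = "\<lambda>x. ?e (N +>\<^bsub>M\<^esub> x)"
  have NQ: "N \<in> carrier ?Q" using Q(4) right_module.carrier_submodule[OF Q(1)]
      right_module.submoduleD(2)[OF Q(1)] by metis
  show ?thesis
  proof (rule that[of "transport_module ?e ?Q" ?q])
    show "?q \<in> rmod_hom R M (transport_module ?e ?Q)" using rmod_hom_comp[OF Q(2) T(2)] .
    show "?q ` carrier M = carrier (transport_module ?e ?Q)"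
      using T(3) unfolding bij_betw_def Q(3)[symmetric] by (simp add: image_image)
    fix x assume x: "x \<in> carrier M"
    have "N +>\<^bsub>M\<^esub> x \<in> carrier ?Q" using Q(3) x by blast
    then show "?q x = \<zero>\<^bsub>transport_module ?e ?Q\<^esub> \<longleftrightarrow> x \<in> N"
      using inj_on_eq_iff[OF inj _ NQ] coset_zero_iff[OF N x] by (simp add: T(5) Q(4))
  qed (rule T(1))
qed

text \<open>Any epimorphism serves as the quotient map, not only the canonical one. This admits
  quotients that are represented on the carrier type of the module itself.\<close>

lemma rmod_hom_factor:
  assumes M: "right_module R M" and Q: "right_module R Q" and N: "right_module R N"
    and q: "q \<in> rmod_hom R M Q" "q ` carrier M = carrier Q"
    and f: "f \<in> rmod_hom R M N" "\<And>x. x \<in> carrier M \<Longrightarrow> q x = \<zero>\<^bsub>Q\<^esub> \<Longrightarrow> f x = \<zero>\<^bsub>N\<^esub>"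
  obtains g where "g \<in> rmod_hom R Q N" "\<And>x. x \<in> carrier M \<Longrightarrow> g (q x) = f x"
proof -
  interpret M: right_module R M by fact
  interpret Q: right_module R Q by fact
  interpret N: right_module R N by fact
  note q' = rmod_homD[OF q(1)] and f' = rmod_homD[OF f(1)]
  define g where "g y = f (SOME x. x \<in> carrier M \<and> q x = y)" for y
  have eq: "f x = f x'" if "x \<in> carrier M" "x' \<in> carrier M" "q x = q x'" for x x'
  proof -
    have "q (x \<ominus>\<^bsub>M\<^esub> x') = \<zero>\<^bsub>Q\<^esub>"
      using that rmod_hom_diff(1)[OF M Q q(1)] Q.minus_eq_zero_iff q'(1) by simp
    then have "f x \<ominus>\<^bsub>N\<^esub> f x' = \<zero>\<^bsub>N\<^esub>"
      using that rmod_hom_diff(1)[OF M N f(1)] f(2) M.submodule_minus(1)[OF M.carrier_submodule] by metis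
    then show ?thesis using N.minus_eq_zero_iff f'(1) that by simp
  qed
  have gq: "g (q x) = f x" if "x \<in> carrier M" for x
  proof -
    have "(SOME x'. x' \<in> carrier M \<and> q x' = q x) \<in> carrier M \<and> q (SOME x'. x' \<in> carrier M \<and> q x' = q x) = q x"
      by (rule someI[of _ x]) (use that in simp)
    then show ?thesis unfolding g_def using eq that by blast
  qed
  have pre: "\<exists>x\<in>carrier M. y = q x" if "y \<in> carrier Q" for y using that q(2) by blast
  have "g \<in> rmod_hom R Q N"
  proof (rule rmod_homI)
    show "g y \<in> carrier N" if "y \<in> carrier Q" for y using pre[OF that] gq f'(1) by auto
    show "g (y \<oplus>\<^bsub>Q\<^esub> z) = g y \<oplus>\<^bsub>N\<^esub> g z" if yz: "y \<in> carrier Q" "z \<in> carrier Q" for y z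
    proof -
      obtain a b where ab: "a \<in> carrier M" "y = q a" "b \<in> carrier M" "z = q b" using pre yz by blast
      then show ?thesis using gq[of "a \<oplus>\<^bsub>M\<^esub> b"] q'(2)[of a b] by (simp add: gq f'(2))
    qed
    show "g (r \<odot>\<^bsub>Q\<^esub> y) = r \<odot>\<^bsub>N\<^esub> g y" if ry: "r \<in> carrier R" "y \<in> carrier Q" for r y
    proof -
      obtain a where ab: "a \<in> carrier M" "y = q a" using pre ry by blast
      then show ?thesis using gq[of "r \<odot>\<^bsub>M\<^esub> a"] q'(3)[of r a] ry by (simp add: gq f'(3))
    qed
  qed
  then show ?thesis using gq that by blast
qed

text \<open>The kernel of a bijection is zero, so the identity factors through it; the factor is the
  inverse.\<close>

lemma rmod_hom_inverse:
  assumes M: "right_module R M" and N: "right_module R N"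
    and f: "f \<in> rmod_hom R M N" "bij_betw f (carrier M) (carrier N)"
  shows "inv_into (carrier M) f \<in> rmod_hom R N M"
proof -
  interpret M: right_module R M by fact
  have inj: "inj_on f (carrier M)" and im: "f ` carrier M = carrier N"
    using f(2) by (auto simp: bij_betw_def)
  have "f x = \<zero>\<^bsub>N\<^esub> \<Longrightarrow> x = \<zero>\<^bsub>M\<^esub>" if "x \<in> carrier M" for x
    using that rmod_hom_zero[OF M N f(1)] inj by (metis M.M.zero_closed inj_onD)
  moreover have idh: "(\<lambda>x. x) \<in> rmod_hom R M M" by (simp add: rmod_hom_def)
  ultimately obtain g where g: "g \<in> rmod_hom R N M" "\<And>x. x \<in> carrier M \<Longrightarrow> g (f x) = x"
    using rmod_hom_factor[OF M N M f(1) im idh] by auto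
  have "g y = inv_into (carrier M) f y" if "y \<in> carrier N" for y
    using that im g(2) inv_into_f_f[OF inj] by (metis imageE)
  then show ?thesis using rmod_hom_cong[OF N g(1)] by blast
qed

section \<open>Extension by Zorn's lemma\<close>

text \<open>Partial maps are indexed by sets \<^term>\<open>D\<close>, which may carry more information than their
  domains \<^term>\<open>dom D\<close>.\<close>

lemma transfinite_extension:
  fixes dom :: "'d set \<Rightarrow> 'm set" and P :: "'d set \<Rightarrow> ('m \<Rightarrow> 'n) \<Rightarrow> bool"
  assumes start: "P D0 f0"
    and cong: "\<And>D f g. P D f \<Longrightarrow> (\<And>x. x \<in> dom D \<Longrightarrow> f x = g x) \<Longrightarrow> P D g"
    and mono: "\<And>D D'. D \<subseteq> D' \<Longrightarrow> dom D \<subseteq> dom D'"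
    and union: "\<And>\<D> f. \<lbrakk>\<D> \<noteq> {}; \<And>D D'. D \<in> \<D> \<Longrightarrow> D' \<in> \<D> \<Longrightarrow> D \<subseteq> D' \<or> D' \<subseteq> D; \<And>D. D \<in> \<D> \<Longrightarrow> P D f\<rbrakk>
      \<Longrightarrow> P (\<Union>\<D>) f"
    and ext: "\<And>D f. P D f \<Longrightarrow> D \<noteq> T \<Longrightarrow> \<exists>D' f'. P D' f' \<and> D \<subset> D' \<and> (\<forall>x\<in>dom D. f' x = f x)"
  obtains f where "P T f" "\<And>x. x \<in> dom D0 \<Longrightarrow> f x = f0 x"
proof -
  \<comment> \<open>A pair is coded by \<open>D\<close> together with the graph of \<open>f\<close>
    on \<open>dom D\<close>, tagged apart. Inclusion of codes is then extension of partial maps, and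
    Zorn's lemma for inclusion applies although \<open>f\<close> is a total function with arbitrary
    values off \<open>dom D\<close>.\<close>
  define enc where "enc = (\<lambda>(D, f). (Inl ` D \<union> Inr ` {(x, f x) | x. x \<in> dom D} :: ('d + 'm \<times> 'n) set))"
  define \<G> where "\<G> = {(D, f). P D f \<and> D0 \<subseteq> D \<and> (\<forall>x\<in>dom D0. f x = f0 x)}"
  have enc_le: "enc (D, f) \<subseteq> enc (D', f') \<longleftrightarrow> D \<subseteq> D' \<and> (\<forall>x\<in>dom D. x \<in> dom D' \<and> f x = f' x)" for D f D' f'
    unfolding enc_def by (auto simp: subset_iff)
  have "\<exists>U\<in>enc ` \<G>. \<forall>X\<in>enc ` \<G>. U \<subseteq> X \<longrightarrow> X = U"
  proof (rule subset_Zorn)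
    fix C assume chain: "subset.chain (enc ` \<G>) C"
    show "\<exists>U\<in>enc ` \<G>. \<forall>X\<in>C. X \<subseteq> U"
    proof (cases "C = {}")
      case True
      have "(D0, f0) \<in> \<G>" using start unfolding \<G>_def by simp
      then show ?thesis using True by blast
    next
      case False
      have "\<forall>c\<in>C. \<exists>g. g \<in> \<G> \<and> c = enc g" using chain unfolding subset.chain_def by blast
      then obtain g where g: "\<And>c. c \<in> C \<Longrightarrow> g c \<in> \<G>" "\<And>c. c \<in> C \<Longrightarrow> c = enc (g c)" by metis
      have cmp: "c \<subseteq> c' \<or> c' \<subseteq> c" if "c \<in> C" "c' \<in> C" for c c'
        using chain that unfolding subset.chain_def by blast
      define D where "D c = fst (g c)" for c
      define f where "f c = snd (g c)" for c
      have c: "P (D c) (f c)" "D0 \<subseteq> D c" "\<And>x. x \<in> dom D0 \<Longrightarrow> f c x = f0 x" "c = enc (D c, f c)"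
        if "c \<in> C" for c using g[OF that] unfolding D_def f_def \<G>_def by auto
      have agree: "f c x = f c' x" if "c \<in> C" "c' \<in> C" "x \<in> dom (D c)" "x \<in> dom (D c')" for c c' x
      proof -
        have "enc (D c, f c) \<subseteq> enc (D c', f c') \<or> enc (D c', f c') \<subseteq> enc (D c, f c)"
          using cmp[OF that(1,2)] c(4)[OF that(1)] c(4)[OF that(2)] by simp
        then show ?thesis unfolding enc_le using that(3,4) by auto
      qed
      \<comment> \<open>The maps in the chain are glued; by \<open>agree\<close> it does not matter
        which member of the chain is chosen.\<close>
      define h where "h x = f (SOME c. c \<in> C \<and> x \<in> dom (D c)) x" for x
      have h: "h x = f c x" if "c \<in> C" "x \<in> dom (D c)" for c x
      proof -
        have "(SOME c. c \<in> C \<and> x \<in> dom (D c)) \<in> C \<and> x \<in> dom (D (SOME c. c \<in> C \<and> x \<in> dom (D c)))"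
          by (rule someI[of _ c]) (use that in simp)
        then show ?thesis unfolding h_def using agree that by blast
      qed
      have Ph: "P (D c) h" if "c \<in> C" for c
        using cong[OF c(1)[OF that]] h[OF that] by simp
      have "P (\<Union>(D ` C)) h"
      proof (rule union)
        fix E E' assume "E \<in> D ` C" "E' \<in> D ` C"
        then obtain c c' where cc: "c \<in> C" "c' \<in> C" "E = D c" "E' = D c'" by blast
        show "E \<subseteq> E' \<or> E' \<subseteq> E"
        proof -
          have "enc (D c, f c) \<subseteq> enc (D c', f c') \<or> enc (D c', f c') \<subseteq> enc (D c, f c)"
            using cmp[OF cc(1,2)] c(4)[OF cc(1)] c(4)[OF cc(2)] by simp
          then show ?thesis unfolding enc_le cc(3,4) by blast
        qed
      qed (use False Ph in auto)
      moreover obtain c0 where c0: "c0 \<in> C" using False by blast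
      moreover have "D0 \<subseteq> \<Union>(D ` C)" using c(2)[OF c0] c0 by blast
      moreover have "h x = f0 x" if "x \<in> dom D0" for x
        using h[OF c0] c(3)[OF c0] mono[OF c(2)[OF c0]] that by auto
      ultimately have "(\<Union>(D ` C), h) \<in> \<G>" unfolding \<G>_def by simp
      moreover have "X \<subseteq> enc (\<Union>(D ` C), h)" if "X \<in> C" for X
      proof -
        have "enc (D X, f X) \<subseteq> enc (\<Union>(D ` C), h)"
          unfolding enc_le using h[OF that] mono[of "D X" "\<Union>(D ` C)"] that by auto
        then show ?thesis using c(4)[OF that] by simp
      qed
      ultimately show ?thesis by blast
    qed
  qed
  then obtain U where U: "U \<in> enc ` \<G>" "\<forall>X\<in>enc ` \<G>. U \<subseteq> X \<longrightarrow> X = U" by (rule bexE)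
  obtain D f where Df: "(D, f) \<in> \<G>" and UDf: "U = enc (D, f)" using U(1) by auto
  have max: "X = enc (D, f)" if "X \<in> enc ` \<G>" "enc (D, f) \<subseteq> X" for X
    using bspec[OF U(2) that(1)] that(2) unfolding UDf by simp
  have P: "P D f" "D0 \<subseteq> D" "\<And>x. x \<in> dom D0 \<Longrightarrow> f x = f0 x" using Df unfolding \<G>_def by auto
  have "D = T"
  proof (rule ccontr)
    assume "D \<noteq> T"
    then obtain D' f' where D': "P D' f'" "D \<subset> D'" "\<forall>x\<in>dom D. f' x = f x" using ext[OF P(1)] by blast
    have "(D', f') \<in> \<G>" using D' P mono[OF P(2)] unfolding \<G>_def by auto
    moreover have "enc (D, f) \<subseteq> enc (D', f')"
      unfolding enc_le using D' mono[of D D'] by auto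
    ultimately have "enc (D', f') = enc (D, f)" using max by blast
    then have "D' \<subseteq> D" using enc_le by (metis order_refl)
    then show False using D'(2) by blast
  qed
  then show ?thesis using P(1,3) that by blast
qed

lemma rmod_hom_extend_insert:
  assumes M: "right_module R M" and N: "right_module R N" and A: "submodule A R M"
    and f: "f \<in> rmod_hom R (M\<lparr>carrier := A\<rparr>) N" and x: "x \<in> carrier M" and y: "y \<in> carrier N"
    and compat: "\<And>r. r \<in> carrier R \<Longrightarrow> r \<odot>\<^bsub>M\<^esub> x \<in> A \<Longrightarrow> f (r \<odot>\<^bsub>M\<^esub> x) = r \<odot>\<^bsub>N\<^esub> y"
  obtains g where "g \<in> rmod_hom R (M\<lparr>carrier := {a \<oplus>\<^bsub>M\<^esub> r \<odot>\<^bsub>M\<^esub> x | a r. a \<in> A \<and> r \<in> carrier R}\<rparr>) N"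
    "\<And>a. a \<in> A \<Longrightarrow> g a = f a"
proof -
  interpret M: right_module R M by fact
  interpret N: right_module R N by fact
  note A' = M.submoduleD[OF A]
  have MA: "right_module R (M\<lparr>carrier := A\<rparr>)" using M.right_module_submodule[OF A] .
  have f': "a \<in> A \<Longrightarrow> f a \<in> carrier N" "\<lbrakk>a \<in> A; b \<in> A\<rbrakk> \<Longrightarrow> f (a \<oplus>\<^bsub>M\<^esub> b) = f a \<oplus>\<^bsub>N\<^esub> f b"
    "\<lbrakk>r \<in> carrier R; a \<in> A\<rbrakk> \<Longrightarrow> f (r \<odot>\<^bsub>M\<^esub> a) = r \<odot>\<^bsub>N\<^esub> f a" for a b r
    using rmod_homD[OF f] by simp_all
  \<comment> \<open>The graph of the intended extension. Two representations of \<open>z\<close>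
    differ by a multiple of \<open>x\<close> that lies in \<open>A\<close>, where
    \<open>compat\<close> makes the two values agree; so any choice defines a homomorphism.\<close>
  define W where "W z w \<longleftrightarrow> (\<exists>a r. a \<in> A \<and> r \<in> carrier R \<and> z = a \<oplus>\<^bsub>M\<^esub> r \<odot>\<^bsub>M\<^esub> x \<and> w = f a \<oplus>\<^bsub>N\<^esub> r \<odot>\<^bsub>N\<^esub> y)" for z w
  define g where "g z = (SOME w. W z w)" for z
  have g: "g (a \<oplus>\<^bsub>M\<^esub> r \<odot>\<^bsub>M\<^esub> x) = f a \<oplus>\<^bsub>N\<^esub> r \<odot>\<^bsub>N\<^esub> y" if ar: "a \<in> A" "r \<in> carrier R" for a r
  proof -
    have "W (a \<oplus>\<^bsub>M\<^esub> r \<odot>\<^bsub>M\<^esub> x) (f a \<oplus>\<^bsub>N\<^esub> r \<odot>\<^bsub>N\<^esub> y)" unfolding W_def using ar by blast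
    then have "W (a \<oplus>\<^bsub>M\<^esub> r \<odot>\<^bsub>M\<^esub> x) (g (a \<oplus>\<^bsub>M\<^esub> r \<odot>\<^bsub>M\<^esub> x))" unfolding g_def by (rule someI)
    then obtain b s where bs: "b \<in> A" "s \<in> carrier R" "a \<oplus>\<^bsub>M\<^esub> r \<odot>\<^bsub>M\<^esub> x = b \<oplus>\<^bsub>M\<^esub> s \<odot>\<^bsub>M\<^esub> x"
      "g (a \<oplus>\<^bsub>M\<^esub> r \<odot>\<^bsub>M\<^esub> x) = f b \<oplus>\<^bsub>N\<^esub> s \<odot>\<^bsub>N\<^esub> y" unfolding W_def by blast
    let ?t = "r \<oplus>\<^bsub>R\<^esub> \<ominus>\<^bsub>R\<^esub> s"
    have aM: "a \<in> carrier M" "b \<in> carrier M" using A'(5) ar bs by auto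
    have "a \<oplus>\<^bsub>M\<^esub> ?t \<odot>\<^bsub>M\<^esub> x = (a \<oplus>\<^bsub>M\<^esub> r \<odot>\<^bsub>M\<^esub> x) \<ominus>\<^bsub>M\<^esub> s \<odot>\<^bsub>M\<^esub> x"
      using ar bs(2) x aM by (simp add: M.smult_l_distr M.smult_minus_left a_minus_def M.M.a_assoc)
    also have "\<dots> = b" using bs(2) x aM unfolding bs(3) by (simp add: M.minus_add_cancel)
    finally have ab: "a \<oplus>\<^bsub>M\<^esub> ?t \<odot>\<^bsub>M\<^esub> x = b" .
    have tA: "?t \<odot>\<^bsub>M\<^esub> x \<in> A"
      using M.submodule_add_cancel[OF A ar(1), of "?t \<odot>\<^bsub>M\<^esub> x"] ab bs(1,2) ar x by simp
    have fb: "f b = f a \<oplus>\<^bsub>N\<^esub> ?t \<odot>\<^bsub>N\<^esub> y"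
      using f'(2)[OF ar(1) tA] compat[OF _ tA] ar bs(2) ab by simp
    have "f b \<oplus>\<^bsub>N\<^esub> s \<odot>\<^bsub>N\<^esub> y = f a \<oplus>\<^bsub>N\<^esub> (?t \<odot>\<^bsub>N\<^esub> y \<oplus>\<^bsub>N\<^esub> s \<odot>\<^bsub>N\<^esub> y)"
      unfolding fb using f'(1) ar bs(2) y by (simp add: N.M.a_assoc)
    also have "?t \<odot>\<^bsub>N\<^esub> y \<oplus>\<^bsub>N\<^esub> s \<odot>\<^bsub>N\<^esub> y = (?t \<oplus>\<^bsub>R\<^esub> s) \<odot>\<^bsub>N\<^esub> y"
      using ar bs(2) y by (simp add: N.smult_l_distr)
    also have "?t \<oplus>\<^bsub>R\<^esub> s = r" using ar bs(2) by (simp add: M.R.a_assoc M.R.l_neg)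
    finally show ?thesis using bs(4) by simp
  qed
  let ?S = "{a \<oplus>\<^bsub>M\<^esub> r \<odot>\<^bsub>M\<^esub> x | a r. a \<in> A \<and> r \<in> carrier R}"
  have "g \<in> rmod_hom R (M\<lparr>carrier := ?S\<rparr>) N"
  proof (rule rmod_homI)
    fix u assume "u \<in> carrier (M\<lparr>carrier := ?S\<rparr>)"
    then obtain a r where u: "u = a \<oplus>\<^bsub>M\<^esub> r \<odot>\<^bsub>M\<^esub> x" "a \<in> A" "r \<in> carrier R" by auto
    show "g u \<in> carrier N" using u y f'(1) by (simp add: g)
    { fix s assume s: "s \<in> carrier R"
      have "s \<odot>\<^bsub>M\<^esub> u = s \<odot>\<^bsub>M\<^esub> a \<oplus>\<^bsub>M\<^esub> (r \<otimes>\<^bsub>R\<^esub> s) \<odot>\<^bsub>M\<^esub> x"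
        using u s x A'(5) by (simp add: M.smult_r_distr M.smult_assoc)
      then show "g (s \<odot>\<^bsub>M\<lparr>carrier := ?S\<rparr>\<^esub> u) = s \<odot>\<^bsub>N\<^esub> g u"
        using u s y A'(4) f'(1,3) by (simp add: g N.smult_r_distr N.smult_assoc) }
    fix v assume "v \<in> carrier (M\<lparr>carrier := ?S\<rparr>)"
    then obtain b s where v: "v = b \<oplus>\<^bsub>M\<^esub> s \<odot>\<^bsub>M\<^esub> x" "b \<in> A" "s \<in> carrier R" by auto
    have "u \<oplus>\<^bsub>M\<^esub> v = (a \<oplus>\<^bsub>M\<^esub> b) \<oplus>\<^bsub>M\<^esub> (r \<oplus>\<^bsub>R\<^esub> s) \<odot>\<^bsub>M\<^esub> x"
      using u v x A'(5) by (simp add: M.smult_l_distr M.M.a_ac)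
    then show "g (u \<oplus>\<^bsub>M\<lparr>carrier := ?S\<rparr>\<^esub> v) = g u \<oplus>\<^bsub>N\<^esub> g v"
      using u v y A'(3) f'(1,2) by (simp add: g N.smult_l_distr N.M.a_ac)
  qed
  moreover have "g a = f a" if "a \<in> A" for a
    using g[OF that M.R.zero_closed] A'(5)[OF that] f'(1)[OF that] x y by simp
  ultimately show ?thesis using that by blast
qed

section \<open>Split ideals\<close>

lemma right_regular_simps [simp]:
  "carrier (right_regular R) = carrier R" "x \<oplus>\<^bsub>right_regular R\<^esub> y = x \<oplus>\<^bsub>R\<^esub> y"
  "\<zero>\<^bsub>right_regular R\<^esub> = \<zero>\<^bsub>R\<^esub>" "r \<odot>\<^bsub>right_regular R\<^esub> x = x \<otimes>\<^bsub>R\<^esub> r"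
  "I +>\<^bsub>right_regular R\<^esub> x = I +>\<^bsub>R\<^esub> x"
  by (simp_all add: right_regular_def a_r_coset_def')

lemma (in ring) right_regular_module: "right_module R (right_regular R)"
proof (rule right_moduleI)
  show "ring R" ..
  show "abelian_group (right_regular R)"
    by (rule abelian_groupI) (auto simp: a_ac intro: l_neg bexI[of _ "\<ominus> _"])
qed (auto simp: r_distr l_distr m_assoc)

lemma (in ring) right_regular_minus [simp]:
  assumes "x \<in> carrier R" "y \<in> carrier R"
  shows "\<ominus>\<^bsub>right_regular R\<^esub> y = \<ominus> y" "x \<ominus>\<^bsub>right_regular R\<^esub> y = x \<ominus> y"
proof -
  interpret RR: right_module R "right_regular R" by (rule right_regular_module)
  show *: "\<ominus>\<^bsub>right_regular R\<^esub> y = \<ominus> y"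
    using RR.M.minus_equality[of "\<ominus> y" y] assms by (simp add: l_neg)
  show "x \<ominus>\<^bsub>right_regular R\<^esub> y = x \<ominus> y" by (simp add: a_minus_def *)
qed

lemma (in ring) right_ideal_iff:
  "right_ideal I R \<longleftrightarrow> I \<subseteq> carrier R \<and> \<zero> \<in> I \<and> (\<forall>x\<in>I. \<forall>y\<in>I. x \<oplus> y \<in> I) \<and>
     (\<forall>r\<in>carrier R. \<forall>x\<in>I. x \<otimes> r \<in> I)"
  using right_module.submodule_iff[OF right_regular_module] by (simp add: right_ideal_def)

lemma (in ring) right_idealD:
  assumes "right_ideal I R"
  shows "I \<subseteq> carrier R" "\<zero> \<in> I" "\<lbrakk>x \<in> I; y \<in> I\<rbrakk> \<Longrightarrow> x \<oplus> y \<in> I" "\<lbrakk>r \<in> carrier R; x \<in> I\<rbrakk> \<Longrightarrow> x \<otimes> r \<in> I"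
    "x \<in> I \<Longrightarrow> x \<in> carrier R" "\<lbrakk>x \<in> I; y \<in> I\<rbrakk> \<Longrightarrow> x \<ominus> y \<in> I"
proof -
  show *: "I \<subseteq> carrier R" "\<zero> \<in> I" "\<lbrakk>x \<in> I; y \<in> I\<rbrakk> \<Longrightarrow> x \<oplus> y \<in> I" "\<lbrakk>r \<in> carrier R; x \<in> I\<rbrakk> \<Longrightarrow> x \<otimes> r \<in> I"
    "x \<in> I \<Longrightarrow> x \<in> carrier R" for x y r
    using assms unfolding right_ideal_iff by auto
  assume xy: "x \<in> I" "y \<in> I"
  have "y \<otimes> (\<ominus> \<one>) = \<ominus> y" using *(5)[OF xy(2)] by (simp add: r_minus)
  then have "\<ominus> y \<in> I" using *(4)[OF _ xy(2), of "\<ominus> \<one>"] by simp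
  then show "x \<ominus> y \<in> I" using *(3)[OF xy(1)] by (simp add: a_minus_def)
qed

lemma (in ring) ideal_right_ideal:
  assumes "ideal P R" shows "right_ideal P R"
proof -
  interpret P: ideal P R by fact
  show ?thesis unfolding right_ideal_iff using P.a_subset P.zero_closed P.a_closed P.I_r_closed by auto
qed

lemma (in ring) right_ideal_ideal:
  assumes "right_ideal I R" "\<And>r x. r \<in> carrier R \<Longrightarrow> x \<in> I \<Longrightarrow> r \<otimes> x \<in> I"
  shows "ideal I R"
proof (rule idealI)
  note I = right_idealD[OF assms(1)]
  have "\<ominus> x \<in> I" if "x \<in> I" for x using I(6)[OF I(2) that] I(5)[OF that] by (simp add: a_minus_def)
  then show "subgroup I (add_monoid R)"
    using I by (intro subgroup.intro) (auto simp: a_inv_def[symmetric])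
qed (use assms(2) right_idealD(4)[OF assms(1)] ring_axioms in auto)

text \<open>Equivalently, every right ideal of the factor ring is generated by an idempotent, that
  is, the factor ring is completely reducible. Stated with elements of \<open>R\<close>, the
  condition can be applied to right ideals of \<open>R\<close> without passing to the factor
  ring.\<close>

definition split_ideal :: "'r set \<Rightarrow> ('r, 'a) ring_scheme \<Rightarrow> bool"
  where "split_ideal P R \<longleftrightarrow> ideal P R \<and>
    (\<forall>I. right_ideal I R \<longrightarrow> (\<exists>e\<in>I. \<forall>r\<in>I. r \<ominus>\<^bsub>R\<^esub> e \<otimes>\<^bsub>R\<^esub> r \<in> P))"

text \<open>The starting point of finite intersections: the split ideal that annihilates the zero
  element.\<close>

lemma (in ring) split_ideal_carrier: "split_ideal (carrier R) R"
proof -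
  have "\<exists>e\<in>I. \<forall>r\<in>I. r \<ominus> e \<otimes> r \<in> carrier R" if "right_ideal I R" for I
    using right_idealD[OF that] by (intro bexI[of _ \<zero>]) auto
  then show ?thesis unfolding split_ideal_def using oneideal by blast
qed

lemma (in ring) split_ideal_Int:
  assumes P: "split_ideal P R" and P': "split_ideal P' R"
  shows "split_ideal (P \<inter> P') R"
proof -
  interpret P: ideal P R using P unfolding split_ideal_def by blast
  interpret P': ideal P' R using P' unfolding split_ideal_def by blast
  have "\<exists>e\<in>I. \<forall>r\<in>I. r \<ominus> e \<otimes> r \<in> P \<inter> P'" if I: "right_ideal I R" for I
  proof -
    note I' = right_idealD[OF I]
    obtain e where e: "e \<in> I" "\<And>r. r \<in> I \<Longrightarrow> r \<ominus> e \<otimes> r \<in> P" using P I unfolding split_ideal_def by blast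
    obtain e' where e': "e' \<in> I" "\<And>r. r \<in> I \<Longrightarrow> r \<ominus> e' \<otimes> r \<in> P'" using P' I unfolding split_ideal_def by blast
    \<comment> \<open>Chosen so that \<open>\<one> \<ominus> ?e\<close> is the product of
      \<open>\<one> \<ominus> e'\<close> and \<open>\<one> \<ominus> e\<close>. Applied to
      \<open>r\<close>, the right factor moves it into \<open>P\<close>, which is kept since
      \<open>P\<close> is an ideal, and the left factor moves it into \<open>P'\<close>.\<close>
    let ?e = "(e \<oplus> e') \<ominus> e' \<otimes> e"
    have R: "e \<in> carrier R" "e' \<in> carrier R" using I'(5) e(1) e'(1) by auto
    have "r \<ominus> ?e \<otimes> r \<in> P \<inter> P'" if r: "r \<in> I" for r
    proof -
      have rR: "r \<in> carrier R" using I'(5) r by blast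
      let ?s = "r \<ominus> e \<otimes> r"
      have s: "?s \<in> I" "?s \<in> P" using I'(6)[OF r I'(4)[OF rR e(1)]] e(2)[OF r] by auto
      have sR: "?s \<in> carrier R" using I'(5) s(1) by blast
      have "r \<ominus> ?e \<otimes> r = ?s \<ominus> e' \<otimes> ?s"
        using R rR by (simp add: a_minus_def l_distr r_distr minus_add a_ac r_minus l_minus m_assoc)
      moreover have "?s \<ominus> e' \<otimes> ?s \<in> P'" using e'(2) s(1) .
      moreover have "?s \<ominus> e' \<otimes> ?s \<in> P"
        using right_idealD(6)[OF ideal_right_ideal[OF P.ideal_axioms] s(2) P.I_l_closed[OF s(2) R(2)]] .
      ultimately show ?thesis by simp
    qed
    moreover have "?e \<in> I" using I'(6)[OF I'(3)[OF e(1) e'(1)] I'(4)[OF R(1) e'(1)]] .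
    ultimately show ?thesis by blast
  qed
  moreover have "ideal (P \<inter> P') R" using i_intersect[OF P.ideal_axioms P'.ideal_axioms] .
  ultimately show ?thesis unfolding split_ideal_def by blast
qed

lemma (in right_module) annihilator_ideal: "ideal (annihilator R M) R"
proof (rule R.right_ideal_ideal)
  show "right_ideal (annihilator R M) R"
    unfolding R.right_ideal_iff by (auto simp: annihilator_def smult_l_distr smult_assoc)
qed (auto simp: annihilator_def smult_assoc)

text \<open>Modules annihilated by a split ideal are injective: for \<^term>\<open>r\<close> in the split ideal and
  \<^term>\<open>x \<otimes>\<^bsub>R\<^esub> r\<close> in the domain, regularity gives \<^term>\<open>r = r \<otimes>\<^bsub>R\<^esub> s \<otimes>\<^bsub>R\<^esub> r\<close>, so the
  homomorphism vanishes at \<^term>\<open>x \<otimes>\<^bsub>R\<^esub> r\<close>.\<close>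

lemma split_injective:
  assumes vnr: "von_neumann_regular R" and P: "split_ideal P R"
    and M: "right_module R M" and N: "right_module R N"
    and PN: "\<And>p y. p \<in> P \<Longrightarrow> y \<in> carrier N \<Longrightarrow> p \<odot>\<^bsub>N\<^esub> y = \<zero>\<^bsub>N\<^esub>"
    and A: "submodule A R M" and f: "f \<in> rmod_hom R (M\<lparr>carrier := A\<rparr>) N"
  obtains g where "g \<in> rmod_hom R M N" "\<And>x. x \<in> A \<Longrightarrow> g x = f x"
proof -
  interpret M: right_module R M by fact
  interpret N: right_module R N by fact
  interpret P: ideal P R using P unfolding split_ideal_def by blast
  let ?P = "\<lambda>D f. submodule D R M \<and> f \<in> rmod_hom R (M\<lparr>carrier := D\<rparr>) N"
  obtain g where g: "?P (carrier M) g" "\<And>x. x \<in> A \<Longrightarrow> g x = f x"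
  proof (rule transfinite_extension[of ?P A f "\<lambda>D. D" "carrier M"])
    show "?P A f" using A f by blast
    show "?P D k" if "?P D h" "\<And>x. x \<in> D \<Longrightarrow> h x = k x" for D h k
      using that rmod_hom_cong[OF M.right_module_submodule, of D h N k] by simp
    show "?P (\<Union>\<D>) h" if "\<D> \<noteq> {}" and chain: "\<And>D D'. D \<in> \<D> \<Longrightarrow> D' \<in> \<D> \<Longrightarrow> D \<subseteq> D' \<or> D' \<subseteq> D"
      and D: "\<And>D. D \<in> \<D> \<Longrightarrow> ?P D h" for \<D> h
    proof
      show "submodule (\<Union>\<D>) R M" by (rule M.submodule_Union_chain) (use that in auto)
      show "h \<in> rmod_hom R (M\<lparr>carrier := \<Union>\<D>\<rparr>) N"
      proof (rule rmod_homI)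
        fix x assume "x \<in> carrier (M\<lparr>carrier := \<Union>\<D>\<rparr>)"
        then obtain E where E: "E \<in> \<D>" "x \<in> E" by auto
        have hE: "h \<in> rmod_hom R (M\<lparr>carrier := E\<rparr>) N" using D[OF E(1)] by blast
        show "h x \<in> carrier N" using rmod_homD(1)[OF hE] E by simp
        show "h (r \<odot>\<^bsub>M\<lparr>carrier := \<Union>\<D>\<rparr>\<^esub> x) = r \<odot>\<^bsub>N\<^esub> h x" if "r \<in> carrier R" for r
          using rmod_homD(3)[OF hE] E that by simp
        fix y assume "y \<in> carrier (M\<lparr>carrier := \<Union>\<D>\<rparr>)"
        then obtain E' where E': "E' \<in> \<D>" "y \<in> E'" by auto
        have hE': "h \<in> rmod_hom R (M\<lparr>carrier := E'\<rparr>) N" using D[OF E'(1)] by blast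
        show "h (x \<oplus>\<^bsub>M\<lparr>carrier := \<Union>\<D>\<rparr>\<^esub> y) = h x \<oplus>\<^bsub>N\<^esub> h y"
          using chain[OF E(1) E'(1)] rmod_homD(2)[OF hE, of x y] rmod_homD(2)[OF hE', of x y] E E' by auto
      qed
    qed
    show "\<exists>D' f'. ?P D' f' \<and> D \<subset> D' \<and> (\<forall>x\<in>D. f' x = h x)" if D: "?P D h" "D \<noteq> carrier M" for D h
    proof -
      have sub: "submodule D R M" and h: "h \<in> rmod_hom R (M\<lparr>carrier := D\<rparr>) N" using D by auto
      note D' = M.submoduleD[OF sub]
      have h': "a \<in> D \<Longrightarrow> h a \<in> carrier N" "\<lbrakk>a \<in> D; b \<in> D\<rbrakk> \<Longrightarrow> h (a \<oplus>\<^bsub>M\<^esub> b) = h a \<oplus>\<^bsub>N\<^esub> h b"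
        "\<lbrakk>r \<in> carrier R; a \<in> D\<rbrakk> \<Longrightarrow> h (r \<odot>\<^bsub>M\<^esub> a) = r \<odot>\<^bsub>N\<^esub> h a" for a b r
        using rmod_homD[OF h] by simp_all
      obtain x where x: "x \<in> carrier M" "x \<notin> D" using D'(1) D(2) by blast
      let ?I = "{r \<in> carrier R. r \<odot>\<^bsub>M\<^esub> x \<in> D}"
      have "right_ideal ?I R"
        unfolding M.R.right_ideal_iff using x(1) D' by (auto simp: M.smult_l_distr M.smult_assoc)
      then obtain e where e: "e \<in> ?I" "\<And>r. r \<in> ?I \<Longrightarrow> r \<ominus>\<^bsub>R\<^esub> e \<otimes>\<^bsub>R\<^esub> r \<in> P"
        using P unfolding split_ideal_def by blast
      have eR: "e \<in> carrier R" using e(1) by blast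
      \<comment> \<open>A consistent image for \<open>x\<close>: each scalar \<open>r\<close> in
        \<open>?I\<close> equals \<open>e \<otimes> r\<close> up to an element of \<open>P\<close>,
        and by regularity that element contributes nothing to the value of \<open>h\<close>.\<close>
      let ?y = "h (e \<odot>\<^bsub>M\<^esub> x)"
      have y: "?y \<in> carrier N" using h'(1) e(1) by blast
      have "h (r \<odot>\<^bsub>M\<^esub> x) = r \<odot>\<^bsub>N\<^esub> ?y" if r: "r \<in> carrier R" "r \<odot>\<^bsub>M\<^esub> x \<in> D" for r
      proof -
        let ?q = "r \<ominus>\<^bsub>R\<^esub> e \<otimes>\<^bsub>R\<^esub> r"
        have er: "(e \<otimes>\<^bsub>R\<^esub> r) \<odot>\<^bsub>M\<^esub> x \<in> D" using D'(4)[OF r(1), of "e \<odot>\<^bsub>M\<^esub> x"] e(1) eR r x(1) by (simp add: M.smult_assoc)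
        have q: "?q \<in> P" "?q \<in> carrier R" using e(2)[of r] r eR by auto
        have "?q \<odot>\<^bsub>M\<^esub> x = r \<odot>\<^bsub>M\<^esub> x \<ominus>\<^bsub>M\<^esub> (e \<otimes>\<^bsub>R\<^esub> r) \<odot>\<^bsub>M\<^esub> x"
          using r eR x by (simp add: a_minus_def M.smult_l_distr M.smult_minus_left)
        then have qD: "?q \<odot>\<^bsub>M\<^esub> x \<in> D" using M.submodule_minus(1)[OF sub r(2) er] by simp
        obtain s where s: "s \<in> carrier R" "?q \<otimes>\<^bsub>R\<^esub> s \<otimes>\<^bsub>R\<^esub> ?q = ?q"
          using vnr q(2) unfolding von_neumann_regular_def by blast
        have sq: "s \<otimes>\<^bsub>R\<^esub> ?q \<in> P" using P.I_l_closed[OF q(1) s(1)] .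
        have "?q \<odot>\<^bsub>M\<^esub> x = (s \<otimes>\<^bsub>R\<^esub> ?q) \<odot>\<^bsub>M\<^esub> (?q \<odot>\<^bsub>M\<^esub> x)"
          using s q(2) x(1) M.smult_assoc[of ?q "s \<otimes>\<^bsub>R\<^esub> ?q" x] by (simp add: M.R.m_assoc)
        then have "h (?q \<odot>\<^bsub>M\<^esub> x) = (s \<otimes>\<^bsub>R\<^esub> ?q) \<odot>\<^bsub>N\<^esub> h (?q \<odot>\<^bsub>M\<^esub> x)"
          using h'(3)[OF _ qD, of "s \<otimes>\<^bsub>R\<^esub> ?q"] s(1) q(2) by simp
        then have hq: "h (?q \<odot>\<^bsub>M\<^esub> x) = \<zero>\<^bsub>N\<^esub>" using PN[OF sq h'(1)[OF qD]] by simp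
        have "r = ?q \<oplus>\<^bsub>R\<^esub> e \<otimes>\<^bsub>R\<^esub> r" using r(1) eR by (simp add: a_minus_def M.R.a_assoc M.R.l_neg)
        then have "r \<odot>\<^bsub>M\<^esub> x = ?q \<odot>\<^bsub>M\<^esub> x \<oplus>\<^bsub>M\<^esub> (e \<otimes>\<^bsub>R\<^esub> r) \<odot>\<^bsub>M\<^esub> x"
          using M.smult_l_distr[OF q(2) M.R.m_closed[OF eR r(1)] x(1)] by simp
        then have "h (r \<odot>\<^bsub>M\<^esub> x) = h ((e \<otimes>\<^bsub>R\<^esub> r) \<odot>\<^bsub>M\<^esub> x)"
          using h'(2)[OF qD er] hq h'(1)[OF er] by simp
        also have "\<dots> = r \<odot>\<^bsub>N\<^esub> ?y" using h'(3)[OF r(1), of "e \<odot>\<^bsub>M\<^esub> x"] e(1) eR r(1) x(1) by (simp add: M.smult_assoc)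
        finally show ?thesis .
      qed
      then obtain k where k: "k \<in> rmod_hom R (M\<lparr>carrier := {a \<oplus>\<^bsub>M\<^esub> r \<odot>\<^bsub>M\<^esub> x | a r. a \<in> D \<and> r \<in> carrier R}\<rparr>) N"
          "\<And>a. a \<in> D \<Longrightarrow> k a = h a"
        using rmod_hom_extend_insert[OF M N sub h x(1) y] by blast
      note ins = M.rspan_insert[OF sub x(1)]
      show ?thesis
        by (rule exI[of _ "{a \<oplus>\<^bsub>M\<^esub> r \<odot>\<^bsub>M\<^esub> x | a r. a \<in> D \<and> r \<in> carrier R}"], rule exI[of _ k])
          (use ins(1,2,3) k x(2) in blast)
    qed
  qed auto
  have "carrier (M\<lparr>carrier := carrier M\<rparr>) = carrier M" by simp
  then have "g \<in> rmod_hom R M N" using g(1) by (simp add: rmod_hom_def)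
  then show ?thesis using g(2) that by blast
qed

section \<open>Primitive ideals and the socle sequence\<close>

lemma (in ideal) quotient_right_ideal:
  assumes J: "right_ideal J R"
  shows "right_ideal ((\<lambda>r. I +> r) ` J) (R Quot I)"
proof -
  interpret Q: ring "R Quot I" by (rule quotient_is_ring)
  note hom = rcos_ring_hom
  note J' = right_idealD[OF J]
  have car: "carrier (R Quot I) = (\<lambda>r. I +> r) ` carrier R"
    by (auto simp: FactRing_def A_RCOSETS_def RCOSETS_def a_r_coset_def)
  show ?thesis
    unfolding Q.right_ideal_iff
  proof (intro conjI ballI)
    show "(\<lambda>r. I +> r) ` J \<subseteq> carrier (R Quot I)" unfolding car using J'(1) by blast
    have "\<zero>\<^bsub>R Quot I\<^esub> = I +> \<zero>" using ring_hom_zero[OF hom ring_axioms Q.ring_axioms] by simp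
    then show "\<zero>\<^bsub>R Quot I\<^esub> \<in> (\<lambda>r. I +> r) ` J" using J'(2) by blast
    fix X assume "X \<in> (\<lambda>r. I +> r) ` J"
    then obtain x where x: "X = I +> x" "x \<in> J" by blast
    { fix Y assume "Y \<in> (\<lambda>r. I +> r) ` J"
      then obtain y where y: "Y = I +> y" "y \<in> J" by blast
      have "X \<oplus>\<^bsub>R Quot I\<^esub> Y = I +> (x \<oplus> y)"
        using ring_hom_add[OF hom, of x y] J'(5) x y by simp
      then show "X \<oplus>\<^bsub>R Quot I\<^esub> Y \<in> (\<lambda>r. I +> r) ` J" using J'(3)[OF x(2) y(2)] by blast }
    fix Z assume "Z \<in> carrier (R Quot I)"
    then obtain z where z: "Z = I +> z" "z \<in> carrier R" unfolding car by blast
    have "X \<otimes>\<^bsub>R Quot I\<^esub> Z = I +> (x \<otimes> z)"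
      using ring_hom_mult[OF hom, of x z] J'(5) x z by simp
    then show "X \<otimes>\<^bsub>R Quot I\<^esub> Z \<in> (\<lambda>r. I +> r) ` J" using J'(4)[OF z(2) x(2)] by blast
  qed
qed

text \<open>Carries the strictness of a descending chain from \<open>R\<close> to the factor ring,
  where the artinian condition is available.\<close>

lemma (in ring) right_ideal_quotient_eqD:
  assumes I: "ideal I R" and J: "right_ideal J R" "I \<subseteq> J" and K: "right_ideal K R" "I \<subseteq> K"
    and eq: "(\<lambda>r. I +> r) ` J = (\<lambda>r. I +> r) ` K"
  shows "J \<subseteq> K"
proof
  interpret I: ideal I R by fact
  fix x assume x: "x \<in> J"
  then obtain y where y: "y \<in> K" "I +> x = I +> y" using eq by blast
  have R: "x \<in> carrier R" "y \<in> carrier R" using right_idealD(5)[OF J(1) x] right_idealD(5)[OF K(1) y(1)] by auto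
  have "x \<in> I +> y" using I.a_rcos_self[OF R(1)] y(2) by simp
  then have "x \<oplus> \<ominus> y \<in> I" using I.a_rcos_module[OF R(2,1)] by simp
  then have "(x \<oplus> \<ominus> y) \<oplus> y \<in> K" using K(2) right_idealD(3)[OF K(1) _ y(1)] by blast
  then show "x \<in> K" using R by (simp add: a_assoc l_neg)
qed

text \<open>The product \<open>t \<otimes> s\<close> is an idempotent that fixes \<open>t\<close>
  and is annihilated by \<open>e\<close> from the left. The factor \<open>\<one> \<ominus> e\<close>
  makes it orthogonal to \<open>e\<close> on the other side as well, so that the sum is again
  idempotent.\<close>

lemma (in ring) idempotent_extension:
  assumes e: "e \<in> carrier R" "e \<otimes> e = e" and t: "t \<in> carrier R" "e \<otimes> t = \<zero>"
    and s: "s \<in> carrier R" "t \<otimes> s \<otimes> t = t"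
  defines "g \<equiv> e \<oplus> (t \<otimes> s) \<otimes> (\<one> \<ominus> e)"
  shows "g \<in> carrier R" "g \<otimes> g = g" "e \<otimes> g = e" "g \<otimes> t = t"
proof -
  let ?f = "(t \<otimes> s) \<otimes> (\<one> \<ominus> e)"
  have fR: "?f \<in> carrier R" using e t s by simp
  show gR: "g \<in> carrier R" unfolding g_def using e(1) fR by simp
  have ee: "(\<one> \<ominus> e) \<otimes> e = \<zero>" "(\<one> \<ominus> e) \<otimes> t = t" "(\<one> \<ominus> e) \<in> carrier R"
    using e t by (simp_all add: a_minus_def l_distr l_minus r_neg)
  have ef: "e \<otimes> ?f = \<zero>"
  proof -
    have "e \<otimes> ?f = (e \<otimes> t) \<otimes> (s \<otimes> (\<one> \<ominus> e))" using e t(1) s ee(3) by (simp add: m_assoc)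
    then show ?thesis using t s ee(3) by simp
  qed
  have fe: "?f \<otimes> e = \<zero>" using e t(1) s ee by (simp add: m_assoc)
  have ft: "?f \<otimes> t = t" using e t(1) s ee by (simp add: m_assoc)
  have ff: "?f \<otimes> ?f = ?f"
  proof -
    have "?f \<otimes> ?f = (?f \<otimes> t) \<otimes> (s \<otimes> (\<one> \<ominus> e))" using fR t(1) s ee(3) by (simp add: m_assoc)
    also have "\<dots> = t \<otimes> (s \<otimes> (\<one> \<ominus> e))" by (simp only: ft)
    also have "\<dots> = ?f" using t(1) s ee(3) by (simp add: m_assoc)
    finally show ?thesis .
  qed
  show "e \<otimes> g = e" unfolding g_def using e fR ef by (simp add: r_distr)
  show "g \<otimes> t = t" unfolding g_def using e(1) t fR ft by (simp add: l_distr)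
  show "g \<otimes> g = g" unfolding g_def using e fR ef fe ff by (simp add: r_distr l_distr)
qed

text \<open>A right ideal \<^term>\<open>I\<close> is generated modulo \<^term>\<open>P\<close> by an idempotent \<^term>\<open>e \<in> I\<close> for
  which \<^term>\<open>(\<one>\<^bsub>R\<^esub> \<ominus>\<^bsub>R\<^esub> e) \<otimes>\<^bsub>R\<^esub> r\<close>, \<^term>\<open>r \<in> carrier R\<close>, generates together with \<^term>\<open>P\<close> a
  minimal right ideal.\<close>

lemma (in ring) artinian_quotient_split:
  assumes vnr: "von_neumann_regular R" and P: "ideal P R" and art: "right_artinian (R Quot P)"
  shows "split_ideal P R"
proof -
  interpret P: ideal P R by fact
  note P' = right_idealD[OF ideal_right_ideal[OF P]]
  have "\<exists>e\<in>I. \<forall>r\<in>I. r \<ominus> e \<otimes> r \<in> P" if I: "right_ideal I R" for I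
  proof (rule ccontr)
    assume no: "\<not> (\<exists>e\<in>I. \<forall>r\<in>I. r \<ominus> e \<otimes> r \<in> P)"
    note I' = right_idealD[OF I]
    define J where "J e = {(\<one> \<ominus> e) \<otimes> u \<oplus> p | u p. u \<in> carrier R \<and> p \<in> P}" for e
    have J: "right_ideal (J e) R" "P \<subseteq> J e" if e: "e \<in> carrier R" for e
    proof -
      have eR: "\<one> \<ominus> e \<in> carrier R" using e by simp
      show PJ: "P \<subseteq> J e"
      proof
        fix p assume p: "p \<in> P"
        then have "p = (\<one> \<ominus> e) \<otimes> \<zero> \<oplus> p" using eR P'(5) by simp
        then show "p \<in> J e" unfolding J_def using p by blast
      qed
      show "right_ideal (J e) R"
        unfolding right_ideal_iff
      proof (intro conjI ballI)
        show "J e \<subseteq> carrier R" unfolding J_def using eR P'(5) by auto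
        show "\<zero> \<in> J e" using PJ P'(2) by blast
        fix x assume "x \<in> J e"
        then obtain u p where x: "x = (\<one> \<ominus> e) \<otimes> u \<oplus> p" "u \<in> carrier R" "p \<in> P" unfolding J_def by blast
        { fix y assume "y \<in> J e"
          then obtain v q where y: "y = (\<one> \<ominus> e) \<otimes> v \<oplus> q" "v \<in> carrier R" "q \<in> P" unfolding J_def by blast
          have "x \<oplus> y = (\<one> \<ominus> e) \<otimes> (u \<oplus> v) \<oplus> (p \<oplus> q)"
            using x y P'(5) eR r_distr[of u v "\<one> \<ominus> e"] by (simp add: a_ac)
          then show "x \<oplus> y \<in> J e" unfolding J_def using x y P'(3) by blast }
        fix r assume r: "r \<in> carrier R"
        have "x \<otimes> r = (\<one> \<ominus> e) \<otimes> (u \<otimes> r) \<oplus> p \<otimes> r"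
          using x r P'(5) eR by (simp add: l_distr m_assoc)
        then show "x \<otimes> r \<in> J e" unfolding J_def using x r P'(4) by blast
      qed
    qed
    \<comment> \<open>An idempotent of \<open>I\<close> that does not generate \<open>I\<close>
      modulo \<open>P\<close> misses some \<open>?t\<close>. Enlarging it by a regular inverse of
      \<open>?t\<close> gives an idempotent of \<open>I\<close> with strictly smaller complement
      \<open>J\<close>; iteration contradicts the artinian condition.\<close>
    have step: "\<exists>g. (g \<in> I \<and> g \<otimes> g = g) \<and> J g \<subset> J e" if e: "e \<in> I \<and> e \<otimes> e = e" for e
    proof -
      obtain r where r: "r \<in> I" "r \<ominus> e \<otimes> r \<notin> P" using no e by blast
      let ?t = "r \<ominus> e \<otimes> r"
      have R: "e \<in> carrier R" "r \<in> carrier R" using I'(5) e r by auto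
      have tI: "?t \<in> I" using I'(6)[OF r(1) I'(4)[OF R(2)]] e by blast
      have tR: "?t \<in> carrier R" using I'(5) tI by blast
      have et: "e \<otimes> ?t = \<zero>"
      proof -
        have "e \<otimes> ?t = e \<otimes> r \<ominus> (e \<otimes> e) \<otimes> r"
          using R by (simp add: a_minus_def r_distr r_minus m_assoc)
        then show ?thesis using e R by (simp add: a_minus_def r_neg)
      qed
      obtain s where s: "s \<in> carrier R" "?t \<otimes> s \<otimes> ?t = ?t" using vnr tR unfolding von_neumann_regular_def by blast
      let ?g = "e \<oplus> (?t \<otimes> s) \<otimes> (\<one> \<ominus> e)"
      have ee: "e \<otimes> e = e" using e by blast
      note g = idempotent_extension[OF R(1) ee tR et s]
      have gI: "?g \<in> I" using I'(3)[OF _ I'(4)[OF _ I'(4)[OF s(1) tI]]] e R by simp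
      have e1: "\<one> \<ominus> ?g = (\<one> \<ominus> e) \<otimes> (\<one> \<ominus> ?g)"
      proof -
        have *: "\<one> \<ominus> g = (\<one> \<ominus> e) \<otimes> (\<one> \<ominus> g)" if "g \<in> carrier R" "e \<otimes> g = e" for g
        proof -
          have "e \<otimes> (\<one> \<ominus> g) = \<zero>" using that R by (simp add: a_minus_def r_distr r_minus r_neg)
          moreover have "(\<one> \<ominus> e) \<otimes> (\<one> \<ominus> g) = (\<one> \<ominus> g) \<ominus> e \<otimes> (\<one> \<ominus> g)"
            using R that(1) l_distr[of \<one> "\<ominus> e" "\<one> \<ominus> g"] by (simp add: a_minus_def l_minus)
          ultimately show ?thesis using that(1) by (simp add: a_minus_def)
        qed
        show ?thesis by (rule *[OF g(1,3)])
      qed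
      have "J ?g \<subseteq> J e"
      proof
        fix x assume "x \<in> J ?g"
        then obtain u p where x: "x = (\<one> \<ominus> ?g) \<otimes> u \<oplus> p" "u \<in> carrier R" "p \<in> P" unfolding J_def by blast
        have "x = (\<one> \<ominus> e) \<otimes> ((\<one> \<ominus> ?g) \<otimes> u) \<oplus> p"
          unfolding x(1) by (subst e1) (use x(2) R g(1) in \<open>simp add: m_assoc\<close>)
        then show "x \<in> J e" unfolding J_def using x(2,3) g(1) by blast
      qed
      \<comment> \<open>Multiplication by \<open>?g\<close> fixes \<open>?t\<close> and kills
        \<open>\<one> \<ominus> ?g\<close>, so membership in \<open>J ?g\<close> would put
        \<open>?t\<close> into \<open>P\<close>.\<close>
      moreover have "?t \<notin> J ?g"
      proof
        assume "?t \<in> J ?g"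
        then obtain u p where u: "?t = (\<one> \<ominus> ?g) \<otimes> u \<oplus> p" "u \<in> carrier R" "p \<in> P" unfolding J_def by blast
        have z: "?g \<otimes> (\<one> \<ominus> ?g) = \<zero>" using g(1,2) by (simp add: a_minus_def r_distr r_minus r_neg)
        have "?g \<otimes> ((\<one> \<ominus> ?g) \<otimes> u \<oplus> p) = (?g \<otimes> (\<one> \<ominus> ?g)) \<otimes> u \<oplus> ?g \<otimes> p"
          using g(1) u(2) P'(5)[OF u(3)] m_assoc[of ?g "\<one> \<ominus> ?g" u] by (simp add: r_distr)
        then have "?g \<otimes> ?t = ?g \<otimes> p"
          unfolding u(1)[symmetric] using z g(1) u(2) P'(5)[OF u(3)] by simp
        then have "?t \<in> P" using g(4) P.I_l_closed[OF u(3) g(1)] by simp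
        then show False using r(2) by blast
      qed
      moreover have "?t \<in> J e"
      proof -
        have "?t = (\<one> \<ominus> e) \<otimes> r \<oplus> \<zero>" using R by (simp add: a_minus_def l_distr l_minus)
        then show ?thesis unfolding J_def using R P'(2) by blast
      qed
      ultimately have "J ?g \<subset> J e" by blast
      then show ?thesis using gI g(2) by blast
    qed
    have "\<exists>f. \<forall>n. ((f n) \<in> I \<and> f n \<otimes> f n = f n) \<and> J (f (Suc n)) \<subset> J (f n)"
    proof (rule dependent_nat_choice)
      show "\<exists>e. e \<in> I \<and> e \<otimes> e = e" using I'(2) by (intro exI[of _ \<zero>]) simp
      show "\<exists>g. (g \<in> I \<and> g \<otimes> g = g) \<and> J g \<subset> J e" if "e \<in> I \<and> e \<otimes> e = e" for e and n :: nat
        using step[OF that] .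
    qed
    then obtain f where f: "\<And>n. f n \<in> I" "\<And>n. J (f (Suc n)) \<subset> J (f n)" by blast
    have fR: "f n \<in> carrier R" for n using f(1) I'(5) by blast
    let ?K = "\<lambda>n. (\<lambda>r. P +> r) ` J (f n)"
    have "\<forall>n. right_ideal (?K n) (R Quot P)" using P.quotient_right_ideal J(1)[OF fR] by blast
    moreover have "\<forall>n. ?K (Suc n) \<subseteq> ?K n" using f(2) by (meson image_mono psubset_imp_subset)
    ultimately have "(\<forall>n. right_ideal (?K n) (R Quot P)) \<and> (\<forall>n. ?K (Suc n) \<subseteq> ?K n)" by (rule conjI)
    from mp[OF spec[OF art[unfolded right_artinian_def], of ?K] this]
    obtain n where n: "\<forall>m\<ge>n. ?K m = ?K n" by (rule exE)
    have "?K (Suc n) = ?K n" using spec[OF n, of "Suc n"] by simp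
    then have "J (f n) \<subseteq> J (f (Suc n))"
      using right_ideal_quotient_eqD[OF P J[OF fR] J[OF fR], of n "Suc n"] by simp
    then show False using f(2) by blast
  qed
  then show ?thesis unfolding split_ideal_def using P by blast
qed

section \<open>Socles under homomorphisms, and the ideals that annihilate their elements\<close>

lemma (in right_module) socle_submodule: "submodule (socle R M) R M"
  unfolding socle_def by (rule rspan_submodule) (use submoduleD(1) in blast)

text \<open>By Schur's argument a homomorphism is zero or injective on a simple submodule, so it
  sends simple submodules into the socle.\<close>

lemma socle_image:
  assumes M: "right_module R M" and N: "right_module R N" and h: "h \<in> rmod_hom R M N"
    and x: "x \<in> socle R M"
  shows "h x \<in> socle R N"
proof -
  interpret M: right_module R M by fact
  interpret N: right_module R N by fact
  let ?B = "{x \<in> carrier M. h x \<in> socle R N}"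
  have "socle R M \<subseteq> ?B"
    unfolding socle_def[of R M]
  proof (rule rspan_minimal)
    show "submodule ?B R M" by (rule submodule_preimage[OF M N h N.socle_submodule])
    show "\<Union>{Z. submodule Z R M \<and> simple_module R (M\<lparr>carrier := Z\<rparr>)} \<subseteq> ?B"
    proof (rule Union_least)
      fix Z assume "Z \<in> {Z. submodule Z R M \<and> simple_module R (M\<lparr>carrier := Z\<rparr>)}"
      then have Z: "submodule Z R M" "simple_module R (M\<lparr>carrier := Z\<rparr>)" by auto
      note Z' = M.submoduleD[OF Z(1)]
      have MZ: "right_module R (M\<lparr>carrier := Z\<rparr>)" using M.right_module_submodule[OF Z(1)] .
      interpret MZ: right_module R "M\<lparr>carrier := Z\<rparr>" by fact
      have hZ: "h \<in> rmod_hom R (M\<lparr>carrier := Z\<rparr>) N" using rmod_hom_restrict[OF h Z'(1)] .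
      let ?K = "{x \<in> carrier (M\<lparr>carrier := Z\<rparr>). h x \<in> {\<zero>\<^bsub>N\<^esub>}}"
      have "submodule ?K R (M\<lparr>carrier := Z\<rparr>)" by (rule submodule_preimage[OF MZ N hZ N.zero_submodule])
      then have K: "?K = {\<zero>\<^bsub>M\<^esub>} \<or> ?K = Z" using Z(2) unfolding simple_module_def by simp
      have "h z \<in> socle R N" if z: "z \<in> Z" for z
      proof (cases "?K = Z")
        case True
        then have "h z = \<zero>\<^bsub>N\<^esub>" using z by blast
        then show ?thesis using N.submoduleD(2)[OF N.socle_submodule] by simp
      next
        case False
        then have K0: "?K = {\<zero>\<^bsub>M\<^esub>}" using K by blast
        have "inj_on h (carrier (M\<lparr>carrier := Z\<rparr>))"
        proof (rule inj_onI)
          fix a b assume ab: "a \<in> carrier (M\<lparr>carrier := Z\<rparr>)" "b \<in> carrier (M\<lparr>carrier := Z\<rparr>)" "h a = h b"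
          have abM: "a \<in> carrier M" "b \<in> carrier M" using ab Z'(5) by auto
          have "h (a \<ominus>\<^bsub>M\<^esub> b) = \<zero>\<^bsub>N\<^esub>"
            using rmod_hom_diff(1)[OF M N h abM] N.minus_eq_zero_iff rmod_homD(1)[OF h] abM ab(3) by simp
          then have "a \<ominus>\<^bsub>M\<^esub> b \<in> ?K" using M.submodule_minus(1)[OF Z(1)] ab by simp
          then have "a \<ominus>\<^bsub>M\<^esub> b = \<zero>\<^bsub>M\<^esub>" using K0 by blast
          then show "a = b" using M.minus_eq_zero_iff[OF abM] by simp
        qed
        then have "submodule (h ` Z) R N \<and> simple_module R (N\<lparr>carrier := h ` Z\<rparr>)"
          using simple_submodule_image[OF MZ N hZ, of Z] MZ.carrier_submodule Z(2) by simp
        then have "h ` Z \<subseteq> socle R N" unfolding socle_def rspan_def by blast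
        then show ?thesis using z by blast
      qed
      then show "Z \<subseteq> ?B" using Z'(5) by blast
    qed
  qed
  then show ?thesis using x by blast
qed

locale primitive_artinian_regular = ring +
  assumes regular: "von_neumann_regular R"
    and primitive_artinian: "primitive_factors_artinian R"
begin

lemma primitive_split: "primitive_ideal P R \<Longrightarrow> split_ideal P R"
proof -
  assume P: "primitive_ideal P R"
  then obtain M :: "('a, 'a set) module" where M: "simple_module R M" "P = annihilator R M"
    unfolding primitive_ideal_def by blast
  then have "right_module R M" unfolding simple_module_def by blast
  then have "ideal P R" unfolding M(2) by (rule right_module.annihilator_ideal)
  then show "split_ideal P R"
    using artinian_quotient_split[OF regular] primitive_artinian P unfolding primitive_factors_artinian_def by simp
qed

text \<open>Elements of simple submodules are annihilated by primitive ideals, which are split, and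
  sums of such elements by intersections of these. So the elements with a split annihilating ideal
  form a submodule that contains all simple ones.\<close>

lemma socle_killed:
  assumes M: "right_module R M" and x: "x \<in> socle R M"
  obtains P where "split_ideal P R" "\<And>p. p \<in> P \<Longrightarrow> p \<odot>\<^bsub>M\<^esub> x = \<zero>\<^bsub>M\<^esub>"
proof -
  interpret M: right_module R M by fact
  let ?B = "{x \<in> carrier M. \<exists>P. split_ideal P R \<and> (\<forall>p\<in>P. p \<odot>\<^bsub>M\<^esub> x = \<zero>\<^bsub>M\<^esub>)}"
  have "submodule ?B R M"
    unfolding M.submodule_iff
  proof (intro conjI ballI)
    show "?B \<subseteq> carrier M" by blast
    show "\<zero>\<^bsub>M\<^esub> \<in> ?B" using split_ideal_carrier by auto
    fix y assume "y \<in> ?B"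
    then obtain P where P: "split_ideal P R" "\<forall>p\<in>P. p \<odot>\<^bsub>M\<^esub> y = \<zero>\<^bsub>M\<^esub>" and y: "y \<in> carrier M" by blast
    interpret P: ideal P R using P(1) unfolding split_ideal_def by blast
    { fix z assume "z \<in> ?B"
      then obtain P' where P': "split_ideal P' R" "\<forall>p\<in>P'. p \<odot>\<^bsub>M\<^esub> z = \<zero>\<^bsub>M\<^esub>" and z: "z \<in> carrier M" by blast
      have "\<forall>p\<in>P \<inter> P'. p \<odot>\<^bsub>M\<^esub> (y \<oplus>\<^bsub>M\<^esub> z) = \<zero>\<^bsub>M\<^esub>"
        using P(2) P'(2) y z P.a_subset by (auto simp: M.smult_r_distr)
      then show "y \<oplus>\<^bsub>M\<^esub> z \<in> ?B" using split_ideal_Int[OF P(1) P'(1)] y z by blast }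
    fix r assume r: "r \<in> carrier R"
    have "p \<odot>\<^bsub>M\<^esub> (r \<odot>\<^bsub>M\<^esub> y) = \<zero>\<^bsub>M\<^esub>" if p: "p \<in> P" for p
      using M.smult_assoc[OF r P.Icarr[OF p] y] P(2) P.I_l_closed[OF p r] by simp
    then show "r \<odot>\<^bsub>M\<^esub> y \<in> ?B" using P(1) r y by blast
  qed
  moreover have "\<Union>{Z. submodule Z R M \<and> simple_module R (M\<lparr>carrier := Z\<rparr>)} \<subseteq> ?B"
  proof (rule Union_least)
    fix Z assume "Z \<in> {Z. submodule Z R M \<and> simple_module R (M\<lparr>carrier := Z\<rparr>)}"
    then have Z: "submodule Z R M" "simple_module R (M\<lparr>carrier := Z\<rparr>)" by auto
    have "split_ideal (annihilator R (M\<lparr>carrier := Z\<rparr>)) R"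
      using primitive_split primitive_ideal_annihilator[OF Z(2)] by blast
    moreover have "\<forall>p\<in>annihilator R (M\<lparr>carrier := Z\<rparr>). p \<odot>\<^bsub>M\<^esub> z = \<zero>\<^bsub>M\<^esub>" if "z \<in> Z" for z
      using that by (auto simp: annihilator_def)
    ultimately show "Z \<subseteq> ?B" using M.submoduleD(5)[OF Z(1)] by blast
  qed
  ultimately have "socle R M \<subseteq> ?B" unfolding socle_def by (rule rspan_minimal)
  then show ?thesis using x that by blast
qed

text \<open>Only closure under left multiplication is at stake. Left multiplication by
  \<open>r\<close> preserves the ideal \<open>socle_seq R n\<close> and thus induces an endomorphism
  of the right module modulo it, and endomorphisms preserve the socle.\<close>

lemma socle_seq_ideal: "ideal (socle_seq R n) R"
proof (induction n)
  case 0
  show ?case using zeroideal by simp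
next
  case (Suc n)
  interpret RR: right_module R "right_regular R" by (rule right_regular_module)
  interpret S: ideal "socle_seq R n" R by fact
  let ?S = "socle_seq R n" and ?Q = "quotient_module (right_regular R) (socle_seq R n)"
  have sub: "submodule ?S R (right_regular R)"
    using ideal_right_ideal[OF Suc] unfolding right_ideal_def .
  note Q = RR.quotient_module[OF sub, unfolded right_regular_simps]
  interpret Q: right_module R ?Q by (rule Q(1))
  note Qhom = rmod_homD[OF Q(2), unfolded right_regular_simps]
  note soc = Q.submoduleD[OF Q.socle_submodule]
  show ?case
  proof (rule right_ideal_ideal)
    show "right_ideal (socle_seq R (Suc n)) R"
      unfolding right_ideal_iff
    proof (intro conjI ballI)
      show "socle_seq R (Suc n) \<subseteq> carrier R" by auto
      have "?S +> \<zero> = \<zero>\<^bsub>?Q\<^esub>" using rmod_hom_zero[OF RR.right_module_axioms Q(1,2)] by simp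
      then show "\<zero> \<in> socle_seq R (Suc n)" using soc(2) by simp
      show "x \<oplus> y \<in> socle_seq R (Suc n)" if "x \<in> socle_seq R (Suc n)" "y \<in> socle_seq R (Suc n)" for x y
        using that soc(3) Qhom(2) by simp
      show "x \<otimes> r \<in> socle_seq R (Suc n)" if "r \<in> carrier R" "x \<in> socle_seq R (Suc n)" for x r
        using that soc(4) Qhom(3) by simp
    qed
    fix r x assume r: "r \<in> carrier R" and x: "x \<in> socle_seq R (Suc n)"
    let ?k = "\<lambda>x. ?S +> (r \<otimes> x)"
    have k: "?k \<in> rmod_hom R (right_regular R) ?Q"
      by (rule rmod_homI) (use r Qhom in \<open>simp_all add: r_distr m_assoc[symmetric]\<close>)
    have "?k y = \<zero>\<^bsub>?Q\<^esub>" if "y \<in> carrier R" "?S +> y = \<zero>\<^bsub>?Q\<^esub>" for y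
    proof -
      have "y \<in> ?S" using that RR.coset_zero_iff[OF sub] unfolding Q(4) by simp
      then have "r \<otimes> y \<in> ?S" using S.I_l_closed r by blast
      then show ?thesis using RR.coset_zero_iff[OF sub] that(1) r unfolding Q(4) by simp
    qed
    then obtain l where l: "l \<in> rmod_hom R ?Q ?Q" "\<And>y. y \<in> carrier R \<Longrightarrow> l (?S +> y) = ?k y"
      using rmod_hom_factor[OF RR.right_module_axioms Q(1) Q(1) Q(2) _ k] Q(3) by auto
    have "l (?S +> x) \<in> socle R ?Q" using socle_image[OF Q(1,1) l(1)] x by simp
    then show "r \<otimes> x \<in> socle_seq R (Suc n)" using l(2) x r by simp
  qed
qed

lemma socle_seq_submodule: "submodule (socle_seq R n) R (right_regular R)"
  using ideal_right_ideal[OF socle_seq_ideal] unfolding right_ideal_def .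

lemma socle_seq_mono: "socle_seq R n \<subseteq> socle_seq R (Suc n)"
proof
  interpret RR: right_module R "right_regular R" by (rule right_regular_module)
  note sub = socle_seq_submodule[of n]
  note Q = RR.quotient_module[OF sub, unfolded right_regular_simps]
  interpret Q: right_module R "quotient_module (right_regular R) (socle_seq R n)" by (rule Q(1))
  fix x assume x: "x \<in> socle_seq R n"
  then have xR: "x \<in> carrier R" using RR.submoduleD(5)[OF sub] by simp
  have "socle_seq R n +> x = socle_seq R n" using RR.coset_zero_iff[OF sub] xR x by simp
  then show "x \<in> socle_seq R (Suc n)"
    using Q.submoduleD(2)[OF Q.socle_submodule] xR unfolding Q(4) by simp
qed

lemma socle_seq_killed:
  assumes "x \<in> socle_seq R (Suc n)"
  obtains P where "split_ideal P R" "\<And>p. p \<in> P \<Longrightarrow> x \<otimes> p \<in> socle_seq R n"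
proof -
  interpret RR: right_module R "right_regular R" by (rule right_regular_module)
  note sub = socle_seq_submodule[of n]
  note Q = RR.quotient_module[OF sub, unfolded right_regular_simps]
  have x: "x \<in> carrier R" "socle_seq R n +> x \<in> socle R (quotient_module (right_regular R) (socle_seq R n))"
    using assms by auto
  obtain P where P: "split_ideal P R"
    "\<And>p. p \<in> P \<Longrightarrow> p \<odot>\<^bsub>quotient_module (right_regular R) (socle_seq R n)\<^esub> (socle_seq R n +> x)
      = \<zero>\<^bsub>quotient_module (right_regular R) (socle_seq R n)\<^esub>"
    using socle_killed[OF Q(1) x(2)] by blast
  interpret P: ideal P R using P(1) unfolding split_ideal_def by blast
  have "x \<otimes> p \<in> socle_seq R n" if p: "p \<in> P" for p
  proof -
    have "socle_seq R n +> (x \<otimes> p) = socle_seq R n"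
      using P(2)[OF p] rmod_homD(3)[OF Q(2), of p x] P.Icarr[OF p] x(1) unfolding Q(4) by simp
    then show ?thesis using RR.coset_zero_iff[OF sub, of "x \<otimes> p"] P.Icarr[OF p] x(1) by simp
  qed
  then show ?thesis using P(1) that by blast
qed

end

section \<open>Projective modules and filtrations\<close>

text \<open>Says that the factor of \<open>B\<close> by \<open>A\<close> is projective. It is
  represented by a module \<open>Q\<close> on the carrier type of \<open>M\<close>, so that an
  induction hypothesis about modules of that type applies to factors of submodules too.\<close>

definition rel_projective ::
    "('r, 'a) ring_scheme \<Rightarrow> ('r, 'm, 'b) module_scheme \<Rightarrow> 'm set \<Rightarrow> 'm set \<Rightarrow> bool"
  where "rel_projective R M A B \<longleftrightarrow>
    (\<exists>(Q :: ('r, 'm) module) q. right_module R Q \<and> projective_module R Q \<and>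
       q \<in> rmod_hom R (M\<lparr>carrier := B\<rparr>) Q \<and> q ` B = carrier Q \<and> (\<forall>x\<in>B. q x = \<zero>\<^bsub>Q\<^esub> \<longleftrightarrow> x \<in> A))"

text \<open>Projectivity of the factor gives a section \<open>s\<close> of \<open>q\<close>, and
  subtracting \<open>s (q x)\<close> from \<open>x\<close> retracts \<open>B\<close> onto
  \<open>A\<close>. The lift prescribed on \<open>A\<close> is composed with this retraction and
  added to a free choice of lift on the complement.\<close>

lemma rel_projective_extend:
  assumes M: "right_module R M" and B: "submodule B R M" and A: "submodule A R M" and AB: "A \<subseteq> B"
    and proj: "rel_projective R M A B" and N: "right_module R N" and L: "right_module R L"
    and g: "g \<in> rmod_hom R N L" "g ` carrier N = carrier L"
    and f: "f \<in> rmod_hom R (M\<lparr>carrier := B\<rparr>) L"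
    and h0: "h0 \<in> rmod_hom R (M\<lparr>carrier := A\<rparr>) N" "\<And>x. x \<in> A \<Longrightarrow> g (h0 x) = f x"
  obtains h where "h \<in> rmod_hom R (M\<lparr>carrier := B\<rparr>) N" "\<And>x. x \<in> A \<Longrightarrow> h x = h0 x"
    "\<And>x. x \<in> B \<Longrightarrow> g (h x) = f x"
proof -
  interpret M: right_module R M by fact
  interpret N: right_module R N by fact
  interpret L: right_module R L by fact
  obtain Q :: "('a, 'c) module" and q where Q: "right_module R Q" "projective_module R Q"
    and q: "q \<in> rmod_hom R (M\<lparr>carrier := B\<rparr>) Q" "q ` B = carrier Q" "\<And>x. x \<in> B \<Longrightarrow> q x = \<zero>\<^bsub>Q\<^esub> \<longleftrightarrow> x \<in> A"
    using proj unfolding rel_projective_def by blast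
  interpret Q: right_module R Q by fact
  have MB: "right_module R (M\<lparr>carrier := B\<rparr>)" and MA: "right_module R (M\<lparr>carrier := A\<rparr>)"
    using M.right_module_submodule A B by auto
  note B' = M.submoduleD[OF B] and A' = M.submoduleD[OF A]
  have idQ: "(\<lambda>x. x) \<in> rmod_hom R Q Q" by (simp add: rmod_hom_def)
  have qB: "q ` carrier (M\<lparr>carrier := B\<rparr>) = carrier Q" using q(2) by simp
  obtain s where s: "s \<in> rmod_hom R Q (M\<lparr>carrier := B\<rparr>)" "\<forall>y\<in>carrier Q. q (s y) = y"
    using projective_module_lift[OF Q(2,1) MB Q(1) q(1) qB idQ] by blast
  obtain h' where h': "h' \<in> rmod_hom R Q N" "\<forall>y\<in>carrier Q. g (h' y) = f (s y)"
    using projective_module_lift[OF Q(2,1) N L g rmod_hom_comp[OF s(1) f]] by blast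
  have sB: "s y \<in> B" if "y \<in> carrier Q" for y using rmod_homD(1)[OF s(1) that] by simp
  have qQ: "q x \<in> carrier Q" if "x \<in> B" for x using rmod_homD(1)[OF q(1)] that by simp
  define d where "d x = x \<ominus>\<^bsub>M\<^esub> s (q x)" for x
  have dA: "d x \<in> A" if x: "x \<in> B" for x
  proof -
    have xd: "d x \<oplus>\<^bsub>M\<^esub> s (q x) = x"
      unfolding d_def using M.minus_add_cancel(1) B'(5)[OF x] B'(5)[OF sB[OF qQ[OF x]]] by simp
    have dB: "d x \<in> B" unfolding d_def by (rule M.submodule_minus(1)[OF B x sB[OF qQ[OF x]]])
    have "q (d x) \<oplus>\<^bsub>Q\<^esub> q x = q x"
      using rmod_homD(2)[OF q(1), of "d x" "s (q x)"] dB sB[OF qQ[OF x]] s(2) qQ[OF x] xd by simp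
    then have "q (d x) = \<zero>\<^bsub>Q\<^esub>"
      using Q.minus_add_cancel(2)[OF qQ[OF dB] qQ[OF x]] Q.minus_eq_zero_iff[OF qQ[OF x] qQ[OF x]] by simp
    then show ?thesis using q(3)[OF dB] by blast
  qed
  have "d \<in> rmod_hom R (M\<lparr>carrier := B\<rparr>) M"
    unfolding d_def
  proof (rule rmod_hom_minus[OF MB M])
    show "(\<lambda>x. x) \<in> rmod_hom R (M\<lparr>carrier := B\<rparr>) M"
      using rmod_hom_codomain_carrier[OF rmod_hom_id B'(1)] .
    show "(\<lambda>x. s (q x)) \<in> rmod_hom R (M\<lparr>carrier := B\<rparr>) M"
      using rmod_hom_codomain_carrier[OF rmod_hom_comp[OF q(1) s(1)] B'(1)] .
  qed
  then have d: "d \<in> rmod_hom R (M\<lparr>carrier := B\<rparr>) (M\<lparr>carrier := A\<rparr>)"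
    by (rule rmod_hom_codomain_restrict) (use dA in auto)
  define h where "h x = h0 (d x) \<oplus>\<^bsub>N\<^esub> h' (q x)" for x
  have h: "h \<in> rmod_hom R (M\<lparr>carrier := B\<rparr>) N"
    unfolding h_def by (rule rmod_hom_add[OF MB N rmod_hom_comp[OF d h0(1)] rmod_hom_comp[OF q(1) h'(1)]])
  moreover have "h x = h0 x" if x: "x \<in> A" for x
  proof -
    have "q x = \<zero>\<^bsub>Q\<^esub>" using q(3) AB x by blast
    moreover have "s \<zero>\<^bsub>Q\<^esub> = \<zero>\<^bsub>M\<^esub>" using rmod_hom_zero[OF Q(1) MB s(1)] by simp
    moreover have "h' \<zero>\<^bsub>Q\<^esub> = \<zero>\<^bsub>N\<^esub>" using rmod_hom_zero[OF Q(1) N h'(1)] .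
    moreover have "x \<ominus>\<^bsub>M\<^esub> \<zero>\<^bsub>M\<^esub> = x" using M.minus_add_cancel(2)[OF A'(5)[OF x] M.M.zero_closed] A'(5)[OF x] by simp
    ultimately show ?thesis unfolding h_def d_def using rmod_homD(1)[OF h0(1), of x] x by simp
  qed
  moreover have "g (h x) = f x" if x: "x \<in> B" for x
  proof -
    have mem: "h0 (d x) \<in> carrier N" "h' (q x) \<in> carrier N" "d x \<in> B" "s (q x) \<in> B"
      using rmod_homD(1)[OF h0(1), of "d x"] dA[OF x] rmod_homD(1)[OF h'(1) qQ[OF x]] AB sB[OF qQ[OF x]] by auto
    have "g (h x) = f (d x) \<oplus>\<^bsub>L\<^esub> f (s (q x))"
      unfolding h_def using rmod_homD(2)[OF g(1) mem(1,2)] h0(2)[OF dA[OF x]] h'(2) qQ[OF x] by simp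
    also have "\<dots> = f (d x \<oplus>\<^bsub>M\<^esub> s (q x))" using rmod_homD(2)[OF f, of "d x" "s (q x)"] mem by simp
    also have "d x \<oplus>\<^bsub>M\<^esub> s (q x) = x"
      unfolding d_def using M.minus_add_cancel(1) B'(5)[OF x] B'(5)[OF mem(4)] by simp
    finally show ?thesis .
  qed
  ultimately show ?thesis using that by blast
qed

lemma (in right_module) rspan_UN_chain:
  assumes X: "\<And>i. X i \<subseteq> carrier M" and "\<D> \<noteq> {}"
    and chain: "\<And>D D'. D \<in> \<D> \<Longrightarrow> D' \<in> \<D> \<Longrightarrow> D \<subseteq> D' \<or> D' \<subseteq> D"
  shows "rspan R M (\<Union>i\<in>\<Union>\<D>. X i) = (\<Union>D\<in>\<D>. rspan R M (\<Union>i\<in>D. X i))"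
proof -
  have "(\<Union>i\<in>\<Union>\<D>. X i) = \<Union>((\<lambda>D. \<Union>i\<in>D. X i) ` \<D>)" by blast
  also have "rspan R M \<dots> = (\<Union>Y\<in>(\<lambda>D. \<Union>i\<in>D. X i) ` \<D>. rspan R M Y)"
  proof (rule rspan_Union_chain)
    fix Y Z assume "Y \<in> (\<lambda>D. \<Union>i\<in>D. X i) ` \<D>" "Z \<in> (\<lambda>D. \<Union>i\<in>D. X i) ` \<D>"
    then obtain D D' where D: "D \<in> \<D>" "D' \<in> \<D>" "Y = (\<Union>i\<in>D. X i)" "Z = (\<Union>i\<in>D'. X i)" by blast
    show "Y \<subseteq> Z \<or> Z \<subseteq> Y" using chain[OF D(1,2)] unfolding D(3,4) by blast
  qed (use X assms(2) in auto)
  finally show ?thesis by simp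
qed

lemma rmod_hom_Union_chain:
  assumes "right_module R M" "\<And>A. A \<in> \<A> \<Longrightarrow> f \<in> rmod_hom R (M\<lparr>carrier := A\<rparr>) N"
    and chain: "\<And>A B. A \<in> \<A> \<Longrightarrow> B \<in> \<A> \<Longrightarrow> A \<subseteq> B \<or> B \<subseteq> A"
  shows "f \<in> rmod_hom R (M\<lparr>carrier := \<Union>\<A>\<rparr>) N"
proof (rule rmod_homI)
  fix x assume "x \<in> carrier (M\<lparr>carrier := \<Union>\<A>\<rparr>)"
  then obtain E where E: "E \<in> \<A>" "x \<in> E" by auto
  note fE = rmod_homD[OF assms(2)[OF E(1)]]
  show "f x \<in> carrier N" using fE(1) E by simp
  show "f (r \<odot>\<^bsub>M\<lparr>carrier := \<Union>\<A>\<rparr>\<^esub> x) = r \<odot>\<^bsub>N\<^esub> f x" if "r \<in> carrier R" for r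
    using fE(3) E that by simp
  fix y assume "y \<in> carrier (M\<lparr>carrier := \<Union>\<A>\<rparr>)"
  then obtain E' where E': "E' \<in> \<A>" "y \<in> E'" by auto
  note fE' = rmod_homD[OF assms(2)[OF E'(1)]]
  show "f (x \<oplus>\<^bsub>M\<lparr>carrier := \<Union>\<A>\<rparr>\<^esub> y) = f x \<oplus>\<^bsub>N\<^esub> f y"
    using chain[OF E(1) E'(1)] fE(2)[of x y] fE'(2)[of x y] E E' by auto
qed

text \<open>Lifts are extended through the projective factors and united at limits. Indexing the
  stages by a family of sets closed under unions of chains, in place of ordinals, covers initial
  segments of the natural numbers, stages along a club and initial segments of a cardinal
  alike.\<close>

lemma filtration_projective:
  fixes M :: "('r, 'm, 'b) module_scheme" and X :: "'d \<Rightarrow> 'm set"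
  assumes M: "right_module R M" and X: "\<And>i. X i \<subseteq> carrier M"
    and empty: "{} \<in> \<D>" and total: "rspan R M (\<Union>i\<in>T. X i) = carrier M"
    and union: "\<And>\<C>. \<lbrakk>\<C> \<noteq> {}; \<C> \<subseteq> \<D>; \<And>D D'. D \<in> \<C> \<Longrightarrow> D' \<in> \<C> \<Longrightarrow> D \<subseteq> D' \<or> D' \<subseteq> D\<rbrakk> \<Longrightarrow> \<Union>\<C> \<in> \<D>"
    and step: "\<And>D. D \<in> \<D> \<Longrightarrow> D \<noteq> T \<Longrightarrow>
      \<exists>D'\<in>\<D>. D \<subset> D' \<and> rel_projective R M (rspan R M (\<Union>i\<in>D. X i)) (rspan R M (\<Union>i\<in>D'. X i))"
  shows "projective_module R M"
  unfolding projective_module_def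
proof (intro allI impI, elim conjE)
  interpret M: right_module R M by fact
  fix N :: "('r, 'm \<Rightarrow> 'r) module" and L :: "('r, 'm) module" and g f
  assume N: "right_module R N" and L: "right_module R L"
    and g: "g \<in> rmod_hom R N L" "g ` carrier N = carrier L" and f: "f \<in> rmod_hom R M L"
  interpret N: right_module R N by fact
  interpret L: right_module R L by fact
  let ?dom = "\<lambda>D. rspan R M (\<Union>i\<in>D. X i)"
  have sub: "submodule (?dom D) R M" for D using M.rspan_submodule X by (simp add: UN_least)
  let ?P = "\<lambda>D h. D \<in> \<D> \<and> h \<in> rmod_hom R (M\<lparr>carrier := ?dom D\<rparr>) N \<and> (\<forall>x\<in>?dom D. g (h x) = f x)"
  obtain h where h: "?P T h"
  proof (rule transfinite_extension[of ?P "{}" "\<lambda>_. \<zero>\<^bsub>N\<^esub>" ?dom T])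
    have "g \<zero>\<^bsub>N\<^esub> = \<zero>\<^bsub>L\<^esub>" "f \<zero>\<^bsub>M\<^esub> = \<zero>\<^bsub>L\<^esub>" using rmod_hom_zero N L M g(1) f by blast+
    then show "?P {} (\<lambda>_. \<zero>\<^bsub>N\<^esub>)" using empty by (simp add: M.rspan_empty rmod_hom_def)
    show "?P D h'" if "?P D h" and eq: "\<And>x. x \<in> ?dom D \<Longrightarrow> h x = h' x" for D h h'
      proof (intro conjI)
      show "h' \<in> rmod_hom R (M\<lparr>carrier := ?dom D\<rparr>) N"
        by (rule rmod_hom_cong[OF M.right_module_submodule[OF sub] _, of h]) (use that eq in auto)
    qed (use that in auto)
    show "?dom D \<subseteq> ?dom D'" if "D \<subseteq> D'" for D D' by (rule rspan_mono) (use that in blast)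
    show "?P (\<Union>\<C>) h" if \<C>: "\<C> \<noteq> {}" "\<And>D D'. D \<in> \<C> \<Longrightarrow> D' \<in> \<C> \<Longrightarrow> D \<subseteq> D' \<or> D' \<subseteq> D" "\<And>D. D \<in> \<C> \<Longrightarrow> ?P D h"
      for \<C> h
    proof (intro conjI)
      show "\<Union>\<C> \<in> \<D>" using union[OF \<C>(1)] \<C>(2,3) by blast
      have eq: "?dom (\<Union>\<C>) = \<Union>(?dom ` \<C>)" using M.rspan_UN_chain[of X \<C>] X \<C>(1,2) by simp
      show "h \<in> rmod_hom R (M\<lparr>carrier := ?dom (\<Union>\<C>)\<rparr>) N"
        unfolding eq
      proof (rule rmod_hom_Union_chain[OF M])
        fix A B assume "A \<in> ?dom ` \<C>" "B \<in> ?dom ` \<C>"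
        then obtain D D' where D: "D \<in> \<C>" "D' \<in> \<C>" "A = ?dom D" "B = ?dom D'" by blast
        show "A \<subseteq> B \<or> B \<subseteq> A"
          using \<C>(2)[OF D(1,2)] rspan_mono[of "\<Union>i\<in>D. X i" "\<Union>i\<in>D'. X i" R M]
            rspan_mono[of "\<Union>i\<in>D'. X i" "\<Union>i\<in>D. X i" R M] unfolding D(3,4) by blast
      qed (use \<C>(3) in blast)
      show "\<forall>x\<in>?dom (\<Union>\<C>). g (h x) = f x" unfolding eq using \<C>(3) by blast
    qed
    show "\<exists>D' h'. ?P D' h' \<and> D \<subset> D' \<and> (\<forall>x\<in>?dom D. h' x = h x)" if D: "?P D h" "D \<noteq> T" for D h
    proof -
      obtain D' where D': "D' \<in> \<D>" "D \<subset> D'" "rel_projective R M (?dom D) (?dom D')"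
        using step[OF _ D(2)] D(1) by (elim conjE) blast
      have le: "?dom D \<subseteq> ?dom D'" by (rule rspan_mono) (use D'(2) in blast)
      have "f \<in> rmod_hom R (M\<lparr>carrier := ?dom D'\<rparr>) L"
        using rmod_hom_restrict[OF f M.submoduleD(1)[OF sub]] .
      then obtain h' where "h' \<in> rmod_hom R (M\<lparr>carrier := ?dom D'\<rparr>) N" "\<And>x. x \<in> ?dom D \<Longrightarrow> h' x = h x"
        "\<And>x. x \<in> ?dom D' \<Longrightarrow> g (h' x) = f x"
        using rel_projective_extend[OF M sub sub le D'(3) N L g] D by blast
      then show ?thesis using D' by blast
    qed
  qed auto
  have "carrier (M\<lparr>carrier := carrier M\<rparr>) = carrier M" by simp
  then have "h \<in> rmod_hom R M N" using h unfolding total by (simp add: rmod_hom_def)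
  then show "\<exists>h\<in>rmod_hom R M N. \<forall>x\<in>carrier M. g (h x) = f x" using h unfolding total by blast
qed

text \<open>The pair \<open>x\<close>, \<open>\<theta>\<close> is a dual basis: any preimage
  \<open>n\<close> of \<open>f x\<close> gives the lift that multiplies \<open>n\<close> by
  \<open>\<theta> y\<close>.\<close>

lemma cyclic_projective:
  fixes M :: "('r, 'm, 'b) module_scheme"
  assumes M: "right_module R M" and x: "x \<in> carrier M" "rspan R M {x} = carrier M"
    and \<theta>: "\<theta> \<in> rmod_hom R M (right_regular R)" "\<theta> x \<odot>\<^bsub>M\<^esub> x = x"
  shows "projective_module R M"
  unfolding projective_module_def
proof (intro allI impI, elim conjE)
  interpret M: right_module R M by fact
  fix N :: "('r, 'm \<Rightarrow> 'r) module" and L :: "('r, 'm) module" and g f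
  assume N: "right_module R N" and L: "right_module R L"
    and g: "g \<in> rmod_hom R N L" "g ` carrier N = carrier L" and f: "f \<in> rmod_hom R M L"
  interpret N: right_module R N by fact
  have "f x \<in> g ` carrier N" unfolding g(2) using rmod_homD(1)[OF f x(1)] .
  then obtain n where n: "n \<in> carrier N" "g n = f x" by auto
  have \<theta>': "y \<in> carrier M \<Longrightarrow> \<theta> y \<in> carrier R" for y using rmod_homD(1)[OF \<theta>(1)] by simp
  have \<theta>x: "\<theta> y \<odot>\<^bsub>M\<^esub> x = y" if "y \<in> carrier M" for y
  proof -
    have "y \<in> (\<lambda>r. r \<odot>\<^bsub>M\<^esub> x) ` carrier R" using that M.rspan_singleton[OF x(1)] unfolding x(2) by simp
    then obtain r where r: "r \<in> carrier R" "y = r \<odot>\<^bsub>M\<^esub> x" by blast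
    have "\<theta> y = \<theta> x \<otimes>\<^bsub>R\<^esub> r" using rmod_homD(3)[OF \<theta>(1) r(1) x(1)] r(2) by simp
    then show ?thesis using M.smult_assoc[OF \<theta>'[OF x(1)] r(1) x(1)] \<theta>(2) r(2) by simp
  qed
  have "(\<lambda>y. \<theta> y \<odot>\<^bsub>N\<^esub> n) \<in> rmod_hom R M N"
    by (rule rmod_homI)
      (use \<theta>' n(1) rmod_homD[OF \<theta>(1)] in \<open>simp_all add: N.smult_l_distr N.smult_assoc\<close>)
  moreover have "g (\<theta> y \<odot>\<^bsub>N\<^esub> n) = f y" if y: "y \<in> carrier M" for y
    using rmod_homD(3)[OF g(1) \<theta>'[OF y] n(1)] rmod_homD(3)[OF f \<theta>'[OF y] x(1)] \<theta>x[OF y] n(2) by simp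
  ultimately show "\<exists>h\<in>rmod_hom R M N. \<forall>x\<in>carrier M. g (h x) = f x" by (intro bexI[of _ "\<lambda>y. \<theta> y \<odot>\<^bsub>N\<^esub> n"]) simp_all
qed

lemma projective_R_projective:
  assumes M: "right_module R M" and proj: "projective_module R M"
  shows "R_projective R M"
  unfolding R_projective_def
proof (intro allI impI ballI)
  interpret M: right_module R M by fact
  interpret RR: right_module R "right_regular R" by (rule M.R.right_regular_module)
  fix I \<phi> assume I: "right_ideal I R" and \<phi>: "\<phi> \<in> rmod_hom R M (quotient_module (right_regular R) I)"
  note Q = RR.quotient_module[OF I[unfolded right_ideal_def]]
  obtain \<psi> where "\<psi> \<in> rmod_hom R M (right_regular R)" "\<forall>x\<in>carrier M. I +>\<^bsub>right_regular R\<^esub> \<psi> x = \<phi> x"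
    using projective_module_lift[OF proj M RR.right_module_axioms Q(1,2,3) \<phi>] by blast
  then show "\<exists>\<psi>\<in>rmod_hom R M (right_regular R). \<forall>x\<in>carrier M. \<phi> x = I +>\<^bsub>R\<^esub> \<psi> x"
    by (intro bexI[of _ \<psi>]) simp_all
qed

section \<open>Weakly projective modules\<close>

declare socle_seq.simps(2) [simp del]

lemma coset_carrier_update [simp]: "I +>\<^bsub>M\<lparr>carrier := B\<rparr>\<^esub> x = I +>\<^bsub>M\<^esub> x"
  by (simp add: a_r_coset_def')

definition finitely_spanned :: "('r, 'a) ring_scheme \<Rightarrow> ('r, 'm, 'b) module_scheme \<Rightarrow> 'm set \<Rightarrow> bool"
  where "finitely_spanned R M F \<longleftrightarrow> (\<exists>A. finite A \<and> A \<subseteq> F \<and> rspan R M A = F)"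

lemma finitely_spannedI: "finite A \<Longrightarrow> rspan R M A = F \<Longrightarrow> finitely_spanned R M F"
  unfolding finitely_spanned_def using rspan_incl[of A R M] by (intro exI[of _ A]) simp

lemma finitely_spanned_image:
  assumes "right_module R M" "right_module R N" "f \<in> rmod_hom R M N" "A \<subseteq> carrier M" "finitely_spanned R M A"
  shows "finitely_spanned R N (f ` A)"
proof -
  obtain B where B: "finite B" "B \<subseteq> A" "rspan R M B = A" using assms(5) unfolding finitely_spanned_def by blast
  have "rspan R N (f ` B) = f ` A" using rspan_image[OF assms(1-3), of B] B assms(4) by auto
  then show ?thesis using finitely_spannedI[of "f ` B" R N "f ` A"] B(1) by simp
qed

context primitive_artinian_regular
begin

lemma socle_seq_module: "right_module R (right_regular R\<lparr>carrier := socle_seq R n\<rparr>)"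
  using right_module.right_module_submodule[OF right_regular_module socle_seq_submodule] .

lemma socle_seq_subset: "socle_seq R n \<subseteq> carrier R"
  using right_module.submoduleD(1)[OF right_regular_module socle_seq_submodule] by simp

lemma socle_layer:
  shows "right_module R (socle_layer R n)"
    and "(\<lambda>x. socle_seq R n +> x) \<in> rmod_hom R (right_regular R\<lparr>carrier := socle_seq R (Suc n)\<rparr>) (socle_layer R n)"
    and "(\<lambda>x. socle_seq R n +> x) ` socle_seq R (Suc n) = carrier (socle_layer R n)"
    and "\<zero>\<^bsub>socle_layer R n\<^esub> = socle_seq R n"
proof -
  interpret RR: right_module R "right_regular R" by (rule right_regular_module)
  interpret S: right_module R "right_regular R\<lparr>carrier := socle_seq R (Suc n)\<rparr>" by (rule socle_seq_module)
  have "submodule (socle_seq R n) R (right_regular R\<lparr>carrier := socle_seq R (Suc n)\<rparr>)"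
    using RR.submodule_of_submodule_iff[OF socle_seq_submodule] socle_seq_submodule socle_seq_mono by blast
  note Q = S.quotient_module[OF this, folded socle_layer_def]
  show "right_module R (socle_layer R n)"
    and "(\<lambda>x. socle_seq R n +> x) \<in> rmod_hom R (right_regular R\<lparr>carrier := socle_seq R (Suc n)\<rparr>) (socle_layer R n)"
    and "(\<lambda>x. socle_seq R n +> x) ` socle_seq R (Suc n) = carrier (socle_layer R n)"
    and "\<zero>\<^bsub>socle_layer R n\<^esub> = socle_seq R n"
    using Q by simp_all
qed

lemma socle_coset_eq_iff:
  assumes "x \<in> carrier R" "y \<in> carrier R"
  shows "socle_seq R n +> x = socle_seq R n +> y \<longleftrightarrow> x \<ominus> y \<in> socle_seq R n"
  using right_module.coset_eq_iff[OF right_regular_module socle_seq_submodule, of x y n] assms by simp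

lemma socle_coset_zero_iff:
  assumes "x \<in> carrier R"
  shows "socle_seq R n +> x = \<zero>\<^bsub>socle_layer R n\<^esub> \<longleftrightarrow> x \<in> socle_seq R n"
  using right_module.coset_zero_iff[OF right_regular_module socle_seq_submodule, of x n] assms by (simp add: socle_layer(4))

section \<open>Annihilators and injectivity in the socle layers\<close>

lemma socle_layer_killed:
  assumes y: "y \<in> carrier (socle_layer R n)"
  obtains P where "split_ideal P R" "\<And>p. p \<in> P \<Longrightarrow> p \<odot>\<^bsub>socle_layer R n\<^esub> y = \<zero>\<^bsub>socle_layer R n\<^esub>"
proof -
  obtain x where x: "x \<in> socle_seq R (Suc n)" "y = socle_seq R n +> x"
    using y unfolding socle_layer(3)[symmetric] by blast
  obtain P where P: "split_ideal P R" "\<And>p. p \<in> P \<Longrightarrow> x \<otimes> p \<in> socle_seq R n"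
    using socle_seq_killed[OF x(1)] by blast
  interpret P: ideal P R using P(1) unfolding split_ideal_def by blast
  have "p \<odot>\<^bsub>socle_layer R n\<^esub> y = \<zero>\<^bsub>socle_layer R n\<^esub>" if p: "p \<in> P" for p
    using rmod_homD(3)[OF socle_layer(2), of p x n] socle_coset_zero_iff[of "x \<otimes> p" n] P(2)[OF p]
      P.Icarr[OF p] x subsetD[OF socle_seq_subset x(1)] by simp
  then show ?thesis using P(1) that by blast
qed

text \<open>The split ideals that belong to the finitely many generators are intersected. Since the
  result is a two-sided ideal, the elements it annihilates form a submodule, which then contains all
  of \<open>F\<close>.\<close>

lemma finitely_spanned_killed:
  assumes F: "finitely_spanned R (socle_layer R n) F" "F \<subseteq> carrier (socle_layer R n)"
  obtains P where "split_ideal P R" "\<And>p y. p \<in> P \<Longrightarrow> y \<in> F \<Longrightarrow> p \<odot>\<^bsub>socle_layer R n\<^esub> y = \<zero>\<^bsub>socle_layer R n\<^esub>"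
proof -
  let ?L = "socle_layer R n"
  interpret L: right_module R ?L by (rule socle_layer(1))
  obtain A where A: "finite A" "A \<subseteq> F" "rspan R ?L A = F" using F(1) unfolding finitely_spanned_def by blast
  have "B \<subseteq> carrier ?L \<Longrightarrow> \<exists>P. split_ideal P R \<and> (\<forall>p\<in>P. \<forall>y\<in>B. p \<odot>\<^bsub>?L\<^esub> y = \<zero>\<^bsub>?L\<^esub>)" if "finite B" for B
    using that
  proof (induction B)
    case empty
    show ?case using split_ideal_carrier by blast
  next
    case (insert b B)
    obtain P where P: "split_ideal P R" "\<forall>p\<in>P. \<forall>y\<in>B. p \<odot>\<^bsub>?L\<^esub> y = \<zero>\<^bsub>?L\<^esub>" using insert by auto
    have "b \<in> carrier ?L" using insert by blast
    then obtain P' where P': "split_ideal P' R" "\<And>p. p \<in> P' \<Longrightarrow> p \<odot>\<^bsub>?L\<^esub> b = \<zero>\<^bsub>?L\<^esub>"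
      using socle_layer_killed by blast
    show ?case using split_ideal_Int[OF P(1) P'(1)] P(2) P'(2) by auto
  qed
  from this[OF A(1)] A(2) F(2)
  obtain P where P: "split_ideal P R" "\<forall>p\<in>P. \<forall>y\<in>A. p \<odot>\<^bsub>?L\<^esub> y = \<zero>\<^bsub>?L\<^esub>" by auto
  interpret P: ideal P R using P(1) unfolding split_ideal_def by blast
  let ?K = "{y \<in> carrier ?L. \<forall>p\<in>P. p \<odot>\<^bsub>?L\<^esub> y = \<zero>\<^bsub>?L\<^esub>}"
  have "submodule ?K R ?L"
    unfolding L.submodule_iff
  proof (intro conjI ballI)
    fix r y assume r: "r \<in> carrier R" and y: "y \<in> ?K"
    have "p \<odot>\<^bsub>?L\<^esub> (r \<odot>\<^bsub>?L\<^esub> y) = \<zero>\<^bsub>?L\<^esub>" if "p \<in> P" for p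
      using L.smult_assoc[OF r P.Icarr[OF that], of y] y P.I_l_closed[OF that r] by auto
    then show "r \<odot>\<^bsub>?L\<^esub> y \<in> ?K" using r y by simp
  qed (use P.Icarr in \<open>auto simp: L.smult_r_distr\<close>)
  then have "F \<subseteq> ?K" unfolding A(3)[symmetric] by (rule rspan_minimal) (use A(2) F(2) P(2) in auto)
  then show ?thesis using P(1) that by blast
qed

text \<open>Injectivity of finitely generated submodules of layers: a split ideal annihilates all of
  \<open>F\<close>, so \<open>split_injective\<close> applies. All later passages from a submodule
  to the whole module go through this lemma.\<close>

lemma layer_extend:
  assumes M: "right_module R M" and A: "submodule A R M"
    and F: "submodule F R (socle_layer R n)" "finitely_spanned R (socle_layer R n) F"
    and f: "f \<in> rmod_hom R (M\<lparr>carrier := A\<rparr>) (socle_layer R n\<lparr>carrier := F\<rparr>)"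
  obtains g where "g \<in> rmod_hom R M (socle_layer R n\<lparr>carrier := F\<rparr>)" "\<And>x. x \<in> A \<Longrightarrow> g x = f x"
proof -
  interpret L: right_module R "socle_layer R n" by (rule socle_layer(1))
  obtain P where P: "split_ideal P R" "\<And>p y. p \<in> P \<Longrightarrow> y \<in> F \<Longrightarrow> p \<odot>\<^bsub>socle_layer R n\<^esub> y = \<zero>\<^bsub>socle_layer R n\<^esub>"
    using finitely_spanned_killed[OF F(2) L.submoduleD(1)[OF F(1)]] by blast
  show ?thesis
    by (rule split_injective[OF regular P(1) M L.right_module_submodule[OF F(1)] _ A f])
      (use P(2) that in auto)
qed

text \<open>\<open>H\<close> is annihilated by the same split ideal as \<open>F\<close>, hence
  injective and a retract of \<open>F\<close>; the retraction carries generators of \<open>F\<close>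
  to generators of \<open>H\<close>.\<close>

lemma finitely_spanned_submodule:
  assumes F: "submodule F R (socle_layer R n)" "finitely_spanned R (socle_layer R n) F"
    and H: "submodule H R (socle_layer R n)" "H \<subseteq> F"
  shows "finitely_spanned R (socle_layer R n) H"
proof -
  let ?L = "socle_layer R n"
  interpret L: right_module R ?L by (rule socle_layer(1))
  have LF: "right_module R (?L\<lparr>carrier := F\<rparr>)" using L.right_module_submodule[OF F(1)] .
  obtain P where P: "split_ideal P R" "\<And>p y. p \<in> P \<Longrightarrow> y \<in> F \<Longrightarrow> p \<odot>\<^bsub>socle_layer R n\<^esub> y = \<zero>\<^bsub>socle_layer R n\<^esub>"
    using finitely_spanned_killed[OF F(2) L.submoduleD(1)[OF F(1)]] by blast
  have HF: "submodule H R (?L\<lparr>carrier := F\<rparr>)" using L.submodule_of_submodule_iff[OF F(1)] H by blast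
  have idH: "(\<lambda>x. x) \<in> rmod_hom R (?L\<lparr>carrier := F, carrier := H\<rparr>) (?L\<lparr>carrier := H\<rparr>)"
    using rmod_hom_id[of R H ?L] by simp
  obtain \<rho> where \<rho>: "\<rho> \<in> rmod_hom R (?L\<lparr>carrier := F\<rparr>) (?L\<lparr>carrier := H\<rparr>)" "\<And>x. x \<in> H \<Longrightarrow> \<rho> x = x"
    by (rule split_injective[OF regular P(1) LF L.right_module_submodule[OF H(1)] _ HF idH])
      (use P(2) H(2) in auto)
  have LH: "right_module R (?L\<lparr>carrier := H\<rparr>)" using L.right_module_submodule[OF H(1)] .
  have "\<rho> ` F = H"
  proof
    show "\<rho> ` F \<subseteq> H" using rmod_homD(1)[OF \<rho>(1)] by auto
    show "H \<subseteq> \<rho> ` F" using \<rho>(2) H(2) by (metis image_eqI subsetD subsetI)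
  qed
  moreover obtain A where A: "finite A" "A \<subseteq> F" "rspan R ?L A = F" using F(2) unfolding finitely_spanned_def by blast
  moreover have "\<rho> ` rspan R (?L\<lparr>carrier := F\<rparr>) A = rspan R (?L\<lparr>carrier := H\<rparr>) (\<rho> ` A)"
    using rspan_image[OF LF LH \<rho>(1), of A] A(2) by simp
  moreover have "\<rho> ` A \<subseteq> H" using rmod_homD(1)[OF \<rho>(1)] A(2) by auto
  ultimately have "rspan R ?L (\<rho> ` A) = H"
    using L.rspan_of_submodule[OF F(1) A(2)] L.rspan_of_submodule[OF H(1)] by auto
  then show ?thesis using finitely_spannedI[of "\<rho> ` A" R ?L H] A(1) by simp
qed

text \<open>Weak R-projectivity speaks of positive layers only. At the bottom the socle divided out
  is zero, so the projection is bijective and a lift is obtained by inverting it. Inductions along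
  the socle sequence can thus treat all layers alike.\<close>

lemma weakly_lift:
  assumes M: "right_module R M" and weak: "weakly_R_projective R M" and n: "n < loewy_length R"
    and \<phi>: "\<phi> \<in> rmod_hom R M (socle_layer R n)" and fin: "finitely_spanned R (socle_layer R n) (\<phi> ` carrier M)"
  obtains \<psi> where "\<psi> \<in> rmod_hom R M (right_regular R\<lparr>carrier := socle_seq R (Suc n)\<rparr>)"
    "\<And>x. x \<in> carrier M \<Longrightarrow> \<phi> x = socle_seq R n +> \<psi> x"
proof (cases "n = 0")
  case False
  then have "\<forall>\<phi>\<in>rmod_hom R M (socle_layer R n).
      finitely_spanned R (socle_layer R n) (\<phi> ` carrier M) \<longrightarrow>
      (\<exists>\<psi>\<in>rmod_hom R M (right_regular R\<lparr>carrier := socle_seq R (Suc n)\<rparr>).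
         \<forall>x\<in>carrier M. \<phi> x = socle_seq R n +> \<psi> x)"
    using spec[OF weak[unfolded weakly_R_projective_def], of n] n unfolding finitely_spanned_def by simp
  from mp[OF bspec[OF this \<phi>] fin] show ?thesis using that by (elim bexE) simp
next
  case True
  let ?S = "right_regular R\<lparr>carrier := socle_seq R (Suc n)\<rparr>"
  let ?c = "\<lambda>x. socle_seq R n +> x"
  have car: "carrier ?S = socle_seq R (Suc n)" by simp
  have "inj_on ?c (socle_seq R (Suc n))"
  proof (rule inj_onI)
    fix x y assume xy: "x \<in> socle_seq R (Suc n)" "y \<in> socle_seq R (Suc n)" "?c x = ?c y"
    then have R: "x \<in> carrier R" "y \<in> carrier R" using socle_seq_subset by blast+
    then have "x \<ominus> y \<in> socle_seq R n" using xy(3) socle_coset_eq_iff[OF R, of n] by blast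
    then have "x \<ominus> y = \<zero>" using True by simp
    then show "x = y" using right_module.minus_eq_zero_iff[OF right_regular_module, of x y] R by simp
  qed
  then have bij: "bij_betw ?c (carrier ?S) (carrier (socle_layer R n))"
    unfolding car bij_betw_def using socle_layer(3) by blast
  note inv = rmod_hom_inverse[OF socle_seq_module socle_layer(1,2) bij]
  let ?\<psi> = "\<lambda>x. inv_into (carrier ?S) ?c (\<phi> x)"
  have "\<phi> x = ?c (?\<psi> x)" if "x \<in> carrier M" for x
    using f_inv_into_f[of "\<phi> x" ?c "carrier ?S"] rmod_homD(1)[OF \<phi> that] bij unfolding bij_betw_def by simp
  then show ?thesis using that[OF rmod_hom_comp[OF \<phi> inv]] by blast
qed

text \<open>The image may be smaller than \<open>F\<close>, but submodules of \<open>F\<close> are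
  again finitely generated.\<close>

lemma weakly_lift_into:
  assumes M: "right_module R M" and weak: "weakly_R_projective R M" and n: "n < loewy_length R"
    and F: "submodule F R (socle_layer R n)" "finitely_spanned R (socle_layer R n) F"
    and \<phi>: "\<phi> \<in> rmod_hom R M (socle_layer R n\<lparr>carrier := F\<rparr>)"
  obtains \<psi> where "\<psi> \<in> rmod_hom R M (right_regular R\<lparr>carrier := socle_seq R (Suc n)\<rparr>)"
    "\<And>x. x \<in> carrier M \<Longrightarrow> \<phi> x = socle_seq R n +> \<psi> x"
proof -
  interpret L: right_module R "socle_layer R n" by (rule socle_layer(1))
  interpret M: right_module R M by fact
  have \<phi>': "\<phi> \<in> rmod_hom R M (socle_layer R n)"
    using rmod_hom_codomain_carrier[OF \<phi> L.submoduleD(1)[OF F(1)]] .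
  have "finitely_spanned R (socle_layer R n) (\<phi> ` carrier M)"
    using finitely_spanned_submodule[OF F] submodule_image[OF M socle_layer(1) \<phi>' M.carrier_submodule]
      rmod_homD(1)[OF \<phi>] by auto
  then show ?thesis using weakly_lift[OF M weak n \<phi>'] that by blast
qed

text \<open>The image of the given homomorphism is finitely generated and hence injective. So the
  homomorphism extends to \<open>M\<close> with the same image, is lifted there, and the lift is
  restricted.\<close>

lemma weakly_submodule:
  assumes M: "right_module R M" and weak: "weakly_R_projective R M" and A: "submodule A R M"
  shows "weakly_R_projective R (M\<lparr>carrier := A\<rparr>)"
  unfolding weakly_R_projective_def
proof (intro allI impI ballI)
  fix n \<phi> assume n: "0 < n \<and> n < loewy_length R" and \<phi>: "\<phi> \<in> rmod_hom R (M\<lparr>carrier := A\<rparr>) (socle_layer R n)"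
    and fin: "\<exists>B. finite B \<and> B \<subseteq> \<phi> ` carrier (M\<lparr>carrier := A\<rparr>) \<and> rspan R (socle_layer R n) B = \<phi> ` carrier (M\<lparr>carrier := A\<rparr>)"
  interpret M: right_module R M by fact
  let ?F = "\<phi> ` A"
  have MA: "right_module R (M\<lparr>carrier := A\<rparr>)" using M.right_module_submodule[OF A] .
  have F: "submodule ?F R (socle_layer R n)"
    using submodule_image[OF MA socle_layer(1) \<phi> right_module.carrier_submodule[OF MA]] by simp
  have Ffin: "finitely_spanned R (socle_layer R n) ?F" using fin unfolding finitely_spanned_def by simp
  have \<phi>': "\<phi> \<in> rmod_hom R (M\<lparr>carrier := A\<rparr>) (socle_layer R n\<lparr>carrier := ?F\<rparr>)"
    by (rule rmod_hom_codomain_restrict[OF \<phi>]) simp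
  obtain g where g: "g \<in> rmod_hom R M (socle_layer R n\<lparr>carrier := ?F\<rparr>)" "\<And>x. x \<in> A \<Longrightarrow> g x = \<phi> x"
    using layer_extend[OF M A F Ffin \<phi>'] by blast
  have nl: "n < loewy_length R" using n by simp
  obtain \<psi> where \<psi>: "\<psi> \<in> rmod_hom R M (right_regular R\<lparr>carrier := socle_seq R (Suc n)\<rparr>)"
    "\<And>x. x \<in> carrier M \<Longrightarrow> g x = socle_seq R n +> \<psi> x"
    using weakly_lift_into[OF M weak nl F Ffin g(1)] by blast
  show "\<exists>\<psi>\<in>rmod_hom R (M\<lparr>carrier := A\<rparr>) (right_regular R\<lparr>carrier := socle_seq R (Suc n)\<rparr>).
      \<forall>x\<in>carrier (M\<lparr>carrier := A\<rparr>). \<phi> x = socle_seq R n +> \<psi> x"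
    by (rule bexI[of _ \<psi>])
      (use rmod_hom_restrict[OF \<psi>(1) M.submoduleD(1)[OF A]] \<psi>(2) g(2) M.submoduleD(5)[OF A] in auto)
qed

text \<open>The extension is built layer by layer: extend modulo the previous socle by injectivity of
  finitely generated submodules of the layers, lift, and correct the error.\<close>

lemma weakly_extend:
  assumes M: "right_module R M" and weak: "weakly_R_projective R M"
    and A: "submodule A R M" "finitely_spanned R M A" and n: "n \<le> loewy_length R"
    and f: "f \<in> rmod_hom R (M\<lparr>carrier := A\<rparr>) (right_regular R\<lparr>carrier := socle_seq R n\<rparr>)"
  shows "\<exists>g\<in>rmod_hom R M (right_regular R\<lparr>carrier := socle_seq R n\<rparr>). \<forall>x\<in>A. g x = f x"
  using n f
proof (induction n arbitrary: f)
  case 0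
  have "f x = \<zero>" if "x \<in> A" for x using rmod_homD(1)[OF 0(2), of x] that by simp
  then show ?case by (intro bexI[of _ "\<lambda>_. \<zero>"]) (auto simp: rmod_hom_def)
next
  case (Suc n)
  interpret M: right_module R M by fact
  interpret RR: right_module R "right_regular R" by (rule right_regular_module)
  have MA: "right_module R (M\<lparr>carrier := A\<rparr>)" using M.right_module_submodule[OF A(1)] .
  interpret MA: right_module R "M\<lparr>carrier := A\<rparr>" by fact
  let ?S = "\<lambda>n. right_regular R\<lparr>carrier := socle_seq R n\<rparr>"
  let ?\<phi> = "\<lambda>x. socle_seq R n +> f x"
  let ?F = "?\<phi> ` A"
  note \<phi> = rmod_hom_comp[OF Suc(3) socle_layer(2)]
  have F: "submodule ?F R (socle_layer R n)"
    using submodule_image[OF MA socle_layer(1) \<phi> MA.carrier_submodule] by simp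
  have Afin: "finitely_spanned R (M\<lparr>carrier := A\<rparr>) A"
    using A(2) M.rspan_of_submodule[OF A(1)] unfolding finitely_spanned_def by metis
  have Ffin: "finitely_spanned R (socle_layer R n) ?F"
    using finitely_spanned_image[OF MA socle_layer(1) \<phi> _ Afin] by simp
  have \<phi>': "?\<phi> \<in> rmod_hom R (M\<lparr>carrier := A\<rparr>) (socle_layer R n\<lparr>carrier := ?F\<rparr>)"
    by (rule rmod_hom_codomain_restrict[OF \<phi>]) simp
  obtain g where g: "g \<in> rmod_hom R M (socle_layer R n\<lparr>carrier := ?F\<rparr>)" "\<And>x. x \<in> A \<Longrightarrow> g x = ?\<phi> x"
    using layer_extend[OF M A(1) F Ffin \<phi>'] by blast
  have nl: "n < loewy_length R" using Suc(2) by simp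
  obtain \<psi> where \<psi>: "\<psi> \<in> rmod_hom R M (?S (Suc n))" "\<And>x. x \<in> carrier M \<Longrightarrow> g x = socle_seq R n +> \<psi> x"
    using weakly_lift_into[OF M weak nl F Ffin g(1)] by blast
  have \<psi>R: "\<psi> \<in> rmod_hom R M (right_regular R)" and fR: "f \<in> rmod_hom R (M\<lparr>carrier := A\<rparr>) (right_regular R)"
    using rmod_hom_codomain_carrier[OF \<psi>(1)] rmod_hom_codomain_carrier[OF Suc(3)] socle_seq_subset[of "Suc n"]
    by simp_all
  have R: "f x \<in> carrier R" "\<psi> x \<in> carrier R" if "x \<in> A" for x
    using rmod_homD(1)[OF fR, of x] rmod_homD(1)[OF \<psi>R, of x] that M.submoduleD(5)[OF A(1)] by simp_all
  let ?d = "\<lambda>x. f x \<ominus>\<^bsub>right_regular R\<^esub> \<psi> x"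
  have "?d \<in> rmod_hom R (M\<lparr>carrier := A\<rparr>) (right_regular R)"
    using rmod_hom_minus[OF MA right_regular_module fR rmod_hom_restrict[OF \<psi>R M.submoduleD(1)[OF A(1)]]] .
  moreover have "?d x \<in> socle_seq R n" if x: "x \<in> A" for x
  proof -
    have "socle_seq R n +> f x = socle_seq R n +> \<psi> x"
      using g(2)[OF x] \<psi>(2)[of x] M.submoduleD(5)[OF A(1) x] by simp
    then show ?thesis using socle_coset_eq_iff[OF R[OF x]] R[OF x] by simp
  qed
  ultimately have "?d \<in> rmod_hom R (M\<lparr>carrier := A\<rparr>) (?S n)"
    by (intro rmod_hom_codomain_restrict) auto
  then obtain \<chi> where \<chi>: "\<chi> \<in> rmod_hom R M (?S n)" "\<forall>x\<in>A. \<chi> x = ?d x" using Suc.IH nl by fastforce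
  have "\<chi> \<in> rmod_hom R M (?S (Suc n))" using rmod_hom_codomain[OF \<chi>(1) socle_seq_mono] .
  note sum = rmod_hom_add[OF M socle_seq_module this \<psi>(1)]
  moreover have "\<chi> x \<oplus> \<psi> x = f x" if x: "x \<in> A" for x
    using \<chi>(2) x RR.minus_add_cancel(1)[of "f x" "\<psi> x"] R[OF x] by simp
  ultimately show ?case by (intro bexI[OF _ sum]) simp
qed

text \<open>A lift \<open>\<psi>\<close> of the composite with \<open>q\<close> need not vanish on
  the kernel \<open>A\<close>, but its values there lie in the previous socle. As \<open>A\<close>
  is finitely generated, \<open>weakly_extend\<close> extends this restriction to a map
  \<open>\<chi>\<close> from \<open>M\<close> into the previous socle. Subtracting
  \<open>\<chi>\<close> does not disturb the lift modulo that socle, and the difference vanishes on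
  \<open>A\<close>.\<close>

lemma weakly_quotient:
  assumes M: "right_module R M" and weak: "weakly_R_projective R M"
    and A: "submodule A R M" "finitely_spanned R M A"
    and Q: "right_module R Q" and q: "q \<in> rmod_hom R M Q" "q ` carrier M = carrier Q"
      "\<And>x. x \<in> carrier M \<Longrightarrow> q x = \<zero>\<^bsub>Q\<^esub> \<longleftrightarrow> x \<in> A"
  shows "weakly_R_projective R Q"
  unfolding weakly_R_projective_def
proof (intro allI impI ballI)
  fix n \<phi> assume n: "0 < n \<and> n < loewy_length R" and \<phi>: "\<phi> \<in> rmod_hom R Q (socle_layer R n)"
    and fin: "\<exists>B. finite B \<and> B \<subseteq> \<phi> ` carrier Q \<and> rspan R (socle_layer R n) B = \<phi> ` carrier Q"
  interpret M: right_module R M by fact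
  interpret RR: right_module R "right_regular R" by (rule right_regular_module)
  let ?S = "\<lambda>n. right_regular R\<lparr>carrier := socle_seq R n\<rparr>"
  have "finitely_spanned R (socle_layer R n) ((\<lambda>x. \<phi> (q x)) ` carrier M)"
    using fin unfolding finitely_spanned_def image_image[symmetric] q(2) by simp
  then obtain \<psi> where \<psi>: "\<psi> \<in> rmod_hom R M (?S (Suc n))"
    "\<And>x. x \<in> carrier M \<Longrightarrow> \<phi> (q x) = socle_seq R n +> \<psi> x"
    using weakly_lift[OF M weak _ rmod_hom_comp[OF q(1) \<phi>]] n by blast
  have \<psi>S: "\<psi> x \<in> socle_seq R (Suc n)" if "x \<in> carrier M" for x using rmod_homD(1)[OF \<psi>(1) that] by simp
  have \<psi>R: "\<psi> x \<in> carrier R" if "x \<in> carrier M" for x using \<psi>S[OF that] socle_seq_subset[of "Suc n"] by blast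
  have \<psi>A: "\<psi> x \<in> socle_seq R n" if x: "x \<in> A" for x
  proof -
    have xM: "x \<in> carrier M" using M.submoduleD(5)[OF A(1) x] .
    then have "q x = \<zero>\<^bsub>Q\<^esub>" using q(3)[OF xM] x by blast
    then have "\<phi> (q x) = \<zero>\<^bsub>socle_layer R n\<^esub>" using rmod_hom_zero[OF Q socle_layer(1) \<phi>] by simp
    then show ?thesis using \<psi>(2)[OF xM] socle_coset_zero_iff[OF \<psi>R[OF xM]] by simp
  qed
  have \<psi>': "\<psi> \<in> rmod_hom R M (right_regular R)"
    using rmod_hom_codomain_carrier[OF \<psi>(1)] socle_seq_subset[of "Suc n"] by simp
  have "\<psi> \<in> rmod_hom R (M\<lparr>carrier := A\<rparr>) (right_regular R\<lparr>carrier := socle_seq R n\<rparr>)"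
    by (rule rmod_hom_codomain_restrict[OF rmod_hom_restrict[OF \<psi>' M.submoduleD(1)[OF A(1)]]]) (use \<psi>A in auto)
  then obtain \<chi> where \<chi>: "\<chi> \<in> rmod_hom R M (?S n)" "\<forall>x\<in>A. \<chi> x = \<psi> x"
    using weakly_extend[OF M weak A, of n \<psi>] n by auto
  have \<chi>S: "\<chi> x \<in> socle_seq R n" if "x \<in> carrier M" for x using rmod_homD(1)[OF \<chi>(1) that] by simp
  have \<chi>R: "\<chi> x \<in> carrier R" if "x \<in> carrier M" for x using \<chi>S[OF that] socle_seq_subset[of n] by blast
  have \<chi>': "\<chi> \<in> rmod_hom R M (right_regular R)"
    using rmod_hom_codomain_carrier[OF \<chi>(1)] socle_seq_subset[of n] by simp
  let ?d = "\<lambda>x. \<psi> x \<ominus>\<^bsub>right_regular R\<^esub> \<chi> x"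
  have dS: "?d x \<in> socle_seq R (Suc n)" if x: "x \<in> carrier M" for x
    using RR.submodule_minus(1)[OF socle_seq_submodule \<psi>S[OF x], of "\<chi> x"] \<chi>S[OF x] socle_seq_mono[of n] by blast
  have d: "?d \<in> rmod_hom R M (?S (Suc n))"
    by (rule rmod_hom_codomain_restrict[OF rmod_hom_minus[OF M right_regular_module \<psi>' \<chi>']]) (use dS in auto)
  have "?d x = \<zero>\<^bsub>?S (Suc n)\<^esub>" if x: "x \<in> carrier M" "q x = \<zero>\<^bsub>Q\<^esub>" for x
    using x q(3)[OF x(1)] \<chi>(2) RR.minus_eq_zero_iff[of "\<psi> x" "\<chi> x"] \<psi>R[OF x(1)] \<chi>R[OF x(1)] by simp
  then obtain g where g: "g \<in> rmod_hom R Q (?S (Suc n))" "\<And>x. x \<in> carrier M \<Longrightarrow> g (q x) = ?d x"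
    using rmod_hom_factor[OF M Q socle_seq_module q(1,2) d] by blast
  have "\<phi> y = socle_seq R n +> g y" if y: "y \<in> carrier Q" for y
  proof -
    obtain x where x: "x \<in> carrier M" "y = q x" using y unfolding q(2)[symmetric] by blast
    have "\<psi> x \<ominus>\<^bsub>right_regular R\<^esub> ?d x = \<chi> x"
      using \<psi>R[OF x(1)] \<chi>R[OF x(1)] by (simp add: a_minus_def minus_add r_neg1 a_assoc[symmetric] r_neg)
    then have "\<psi> x \<ominus> ?d x \<in> socle_seq R n" using \<chi>S[OF x(1)] \<psi>R[OF x(1)] \<chi>R[OF x(1)] by simp
    then show ?thesis
      using socle_coset_eq_iff[of "\<psi> x" "?d x" n] \<psi>(2)[OF x(1)] g(2)[OF x(1)] \<psi>R[OF x(1)] \<chi>R[OF x(1)] x(2) by simp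
  qed
  then show "\<exists>\<psi>\<in>rmod_hom R Q (right_regular R\<lparr>carrier := socle_seq R (Suc n)\<rparr>).
      \<forall>x\<in>carrier Q. \<phi> x = socle_seq R n +> \<psi> x" using g(1) by blast
qed

text \<open>The homomorphism \<^term>\<open>\<theta>\<close> is improved step by step: at stage \<^term>\<open>n\<close> it satisfies
  \<^prop>\<open>x = \<theta> x \<odot>\<^bsub>M\<^esub> x \<oplus>\<^bsub>M\<^esub> t \<odot>\<^bsub>M\<^esub> x\<close> for some \<^term>\<open>t\<close> in the \<^term>\<open>n\<close>-th socle.\<close>

lemma weakly_cyclic:
  assumes M: "right_module R M" and weak: "weakly_R_projective R M" and fll: "finite_loewy_length R"
    and x: "x \<in> carrier M" "rspan R M {x} = carrier M"
  obtains \<theta> where "\<theta> \<in> rmod_hom R M (right_regular R)" "\<theta> x \<odot>\<^bsub>M\<^esub> x = x"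
proof -
  interpret M: right_module R M by fact
  interpret RR: right_module R "right_regular R" by (rule right_regular_module)
  let ?S = "\<lambda>n. right_regular R\<lparr>carrier := socle_seq R n\<rparr>"
  let ?W = "\<lambda>n \<theta> t. \<theta> \<in> rmod_hom R M (right_regular R) \<and> t \<in> socle_seq R n \<and>
    x = \<theta> x \<odot>\<^bsub>M\<^esub> x \<oplus>\<^bsub>M\<^esub> t \<odot>\<^bsub>M\<^esub> x"
  have top: "socle_seq R (loewy_length R) = carrier R"
    using fll unfolding finite_loewy_length_def loewy_length_def by (rule LeastI_ex)
  have step: "\<exists>\<theta> t. ?W n \<theta> t" if n: "n < loewy_length R" and W: "?W (Suc n) \<theta> t" for n \<theta> t
  proof -
    interpret I: ideal "socle_seq R n" R by (rule socle_seq_ideal)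
    interpret I': ideal "socle_seq R (Suc n)" R by (rule socle_seq_ideal)
    have \<theta>: "\<theta> \<in> rmod_hom R M (right_regular R)" and t1: "t \<in> socle_seq R (Suc n)"
      and xt: "x = \<theta> x \<odot>\<^bsub>M\<^esub> x \<oplus>\<^bsub>M\<^esub> t \<odot>\<^bsub>M\<^esub> x" using W by blast+
    note t = t1 I'.Icarr[OF t1]
    have \<theta>R: "\<theta> y \<in> carrier R" if "y \<in> carrier M" for y using rmod_homD(1)[OF \<theta> that] by simp
    obtain s where s: "s \<in> carrier R" "t \<otimes> s \<otimes> t = t"
      using bspec[OF regular[unfolded von_neumann_regular_def] t(2)] by blast
    \<comment> \<open>A right unit of \<open>t\<close> inside the same socle. Some split ideal
      \<open>P\<close> multiplies it into the previous socle, which governs the passage from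
      \<open>Suc n\<close> to \<open>n\<close>.\<close>
    let ?e = "s \<otimes> t"
    have e: "?e \<in> socle_seq R (Suc n)" "?e \<in> carrier R" "t \<otimes> ?e = t"
      using I'.I_l_closed[OF t(1) s(1)] s t(2) by (simp_all add: m_assoc)
    obtain P where P: "split_ideal P R" "\<And>p. p \<in> P \<Longrightarrow> ?e \<otimes> p \<in> socle_seq R n"
      using socle_seq_killed[OF e(1)] by blast
    \<comment> \<open>The scalars \<open>r\<close> for which \<open>t \<otimes> r\<close> acts on
      \<open>x\<close> like an element of the smaller socle. The annihilator of \<open>x\<close> is
      contained in it, because the summand with \<open>\<theta> x\<close> contributes nothing
      there.\<close>
    let ?J = "{r \<in> carrier R. \<exists>u\<in>socle_seq R n. (t \<otimes> r) \<odot>\<^bsub>M\<^esub> x = u \<odot>\<^bsub>M\<^esub> x}"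
    have "right_ideal ?J R"
      unfolding right_ideal_iff
    proof (intro conjI ballI)
      show "\<zero> \<in> ?J" using t(2) x(1) I.zero_closed by (auto intro: bexI[of _ \<zero>])
      fix r assume "r \<in> ?J"
      then obtain u where r: "r \<in> carrier R" and u: "u \<in> socle_seq R n" "(t \<otimes> r) \<odot>\<^bsub>M\<^esub> x = u \<odot>\<^bsub>M\<^esub> x" by blast
      { fix r' assume "r' \<in> ?J"
        then obtain u' where r': "r' \<in> carrier R" and u': "u' \<in> socle_seq R n" "(t \<otimes> r') \<odot>\<^bsub>M\<^esub> x = u' \<odot>\<^bsub>M\<^esub> x" by blast
        have "(t \<otimes> (r \<oplus> r')) \<odot>\<^bsub>M\<^esub> x = (u \<oplus> u') \<odot>\<^bsub>M\<^esub> x"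
          using r r' u u' t(2) x(1) I.Icarr by (simp add: r_distr M.smult_l_distr)
        then show "r \<oplus> r' \<in> ?J" using r r' I.a_closed[OF u(1) u'(1)] by blast }
      fix v assume v: "v \<in> carrier R"
      have "(t \<otimes> (r \<otimes> v)) \<odot>\<^bsub>M\<^esub> x = v \<odot>\<^bsub>M\<^esub> ((t \<otimes> r) \<odot>\<^bsub>M\<^esub> x)"
        using t(2) r v x(1) M.smult_assoc[of "t \<otimes> r" v x] by (simp add: m_assoc)
      also have "\<dots> = (u \<otimes> v) \<odot>\<^bsub>M\<^esub> x" using u v x(1) I.Icarr by (simp add: M.smult_assoc)
      finally show "r \<otimes> v \<in> ?J" using r v I.I_r_closed[OF u(1) v] by blast
    qed blast
    then obtain g where g: "g \<in> ?J" "\<And>r. r \<in> ?J \<Longrightarrow> r \<ominus> g \<otimes> r \<in> P"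
      using P(1) unfolding split_ideal_def by blast
    then obtain u where gR: "g \<in> carrier R" and u: "u \<in> socle_seq R n" "(t \<otimes> g) \<odot>\<^bsub>M\<^esub> x = u \<odot>\<^bsub>M\<^esub> x" by blast
    \<comment> \<open>By \<open>br\<close>, multiplication by \<open>?b\<close> sends
      \<open>?J\<close> into the smaller socle, so it induces a map from \<open>M\<close> into the
      layer. The factor \<open>\<one> \<ominus> g\<close> costs only the term
      \<open>t \<otimes> g\<close>, which acts on \<open>x\<close> like \<open>u\<close>.\<close>
    let ?b = "?e \<otimes> (\<one> \<ominus> g)"
    have b: "?b \<in> socle_seq R (Suc n)" "?b \<in> carrier R"
      using I'.I_r_closed[OF e(1), of "\<one> \<ominus> g"] gR e(2) by simp_all
    have br: "?b \<otimes> r = ?e \<otimes> (r \<ominus> g \<otimes> r)" if "r \<in> carrier R" for r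
      using that gR e(2) by (simp add: m_assoc a_minus_def l_distr l_minus)
    let ?q = "\<lambda>r. r \<odot>\<^bsub>M\<^esub> x"
    have q: "?q \<in> rmod_hom R (right_regular R) M"
      by (rule rmod_homI) (use x(1) in \<open>simp_all add: M.smult_l_distr M.smult_assoc\<close>)
    have qR: "?q ` carrier (right_regular R) = carrier M"
      using M.rspan_singleton[OF x(1)] x(2) by simp
    have "(\<lambda>r. ?b \<otimes> r) \<in> rmod_hom R (right_regular R) (?S (Suc n))"
      by (rule rmod_homI) (use b I'.I_r_closed[OF b(1)] in \<open>simp_all add: r_distr m_assoc\<close>)
    note f = rmod_hom_comp[OF this socle_layer(2)]
    have "socle_seq R n +> (?b \<otimes> r) = \<zero>\<^bsub>socle_layer R n\<^esub>"
      if r: "r \<in> carrier (right_regular R)" "r \<odot>\<^bsub>M\<^esub> x = \<zero>\<^bsub>M\<^esub>" for r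
    proof -
      have rR: "r \<in> carrier R" using r(1) by simp
      have "\<theta> x \<otimes> r = \<theta> (r \<odot>\<^bsub>M\<^esub> x)" using rmod_homD(3)[OF \<theta> rR x(1)] by simp
      then have \<theta>r: "\<theta> x \<otimes> r = \<zero>" using r(2) rmod_hom_zero[OF M right_regular_module \<theta>] by simp
      have "r \<odot>\<^bsub>M\<^esub> x = r \<odot>\<^bsub>M\<^esub> (\<theta> x \<odot>\<^bsub>M\<^esub> x \<oplus>\<^bsub>M\<^esub> t \<odot>\<^bsub>M\<^esub> x)" using xt by simp
      also have "\<dots> = (\<theta> x \<otimes> r) \<odot>\<^bsub>M\<^esub> x \<oplus>\<^bsub>M\<^esub> (t \<otimes> r) \<odot>\<^bsub>M\<^esub> x"
        using rR \<theta>R x(1) t(2) by (simp add: M.smult_r_distr M.smult_assoc)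
      finally have "(t \<otimes> r) \<odot>\<^bsub>M\<^esub> x = \<zero> \<odot>\<^bsub>M\<^esub> x" using r(2) \<theta>r x(1) t(2) rR by simp
      then have "r \<in> ?J" using rR I.zero_closed by blast
      then have "?b \<otimes> r \<in> socle_seq R n" using g(2) P(2) br[OF rR] by simp
      then show ?thesis using socle_coset_zero_iff[of "?b \<otimes> r" n] b(2) rR by simp
    qed
    then obtain \<phi> where \<phi>: "\<phi> \<in> rmod_hom R M (socle_layer R n)"
      "\<And>r. r \<in> carrier (right_regular R) \<Longrightarrow> \<phi> (r \<odot>\<^bsub>M\<^esub> x) = socle_seq R n +> (?b \<otimes> r)"
      using rmod_hom_factor[OF right_regular_module M socle_layer(1) q qR f] by blast
    have "finitely_spanned R (socle_layer R n) (\<phi> ` carrier M)"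
      by (rule finitely_spanned_image[OF M socle_layer(1) \<phi>(1)])
        (use x finitely_spannedI[of "{x}" R M "carrier M"] in auto)
    then obtain \<psi> where \<psi>: "\<psi> \<in> rmod_hom R M (?S (Suc n))" "\<And>y. y \<in> carrier M \<Longrightarrow> \<phi> y = socle_seq R n +> \<psi> y"
      using weakly_lift[OF M weak n \<phi>(1)] by blast
    have \<psi>': "\<psi> \<in> rmod_hom R M (right_regular R)"
      using rmod_hom_codomain_carrier[OF \<psi>(1)] socle_seq_subset[of "Suc n"] by simp
    have \<psi>R: "\<psi> y \<in> carrier R" if "y \<in> carrier M" for y using rmod_homD(1)[OF \<psi>' that] by simp
    let ?w = "?b \<ominus> \<psi> x"
    have "socle_seq R n +> ?b = socle_seq R n +> \<psi> x"
      using \<phi>(2)[of \<one>] \<psi>(2)[OF x(1)] x(1) b(2) by simp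
    then have w: "?w \<in> socle_seq R n" "?w \<in> carrier R"
      using socle_coset_eq_iff[OF b(2) \<psi>R[OF x(1)]] b(2) \<psi>R[OF x(1)] by auto
    \<comment> \<open>Adding \<open>t \<otimes> \<psi> y\<close> accounts for all of
      \<open>t\<close> but two terms: \<open>t \<otimes> g\<close>, replaced by \<open>u\<close>,
      and \<open>t\<close> times the lifting error \<open>?w\<close>. Both replacements lie in the
      smaller socle and make up the new \<open>?t\<close>.\<close>
    let ?\<theta> = "\<lambda>y. \<theta> y \<oplus> t \<otimes> \<psi> y" and ?t = "u \<oplus> t \<otimes> ?w"
    have \<theta>': "?\<theta> \<in> rmod_hom R M (right_regular R)"
      by (rule rmod_homI)
        (use \<theta>R \<psi>R t(2) rmod_homD[OF \<theta>] rmod_homD[OF \<psi>'] in \<open>simp_all add: r_distr l_distr m_assoc a_ac\<close>)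
    have t': "?t \<in> socle_seq R n" using I.a_closed[OF u(1) I.I_l_closed[OF w(1) t(2)]] .
    have "t \<otimes> ?b = t \<ominus> t \<otimes> g"
      using t(2) e gR m_assoc[of t ?e "\<one> \<ominus> g"] by (simp add: a_minus_def r_distr r_minus)
    moreover have "?b = \<psi> x \<oplus> ?w"
    proof -
      have "c = y \<oplus> (c \<ominus> y)" if "c \<in> carrier R" "y \<in> carrier R" for c y
        using that a_lcomm[of y c "\<ominus> y"] by (simp add: a_minus_def r_neg)
      then show ?thesis using b(2) \<psi>R[OF x(1)] .
    qed
    ultimately have "t = t \<otimes> (\<psi> x \<oplus> ?w) \<oplus> t \<otimes> g"
      using t(2) gR by (simp add: a_minus_def a_assoc l_neg)
    also have "\<dots> = t \<otimes> \<psi> x \<oplus> (t \<otimes> g \<oplus> t \<otimes> ?w)"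
      using t(2) gR \<psi>R[OF x(1)] w(2) by (simp add: r_distr a_ac)
    finally have tt: "t = t \<otimes> \<psi> x \<oplus> (t \<otimes> g \<oplus> t \<otimes> ?w)" .
    have "t \<odot>\<^bsub>M\<^esub> x = (t \<otimes> \<psi> x \<oplus> (t \<otimes> g \<oplus> t \<otimes> ?w)) \<odot>\<^bsub>M\<^esub> x" using tt by simp
    also have "\<dots> = (t \<otimes> \<psi> x) \<odot>\<^bsub>M\<^esub> x \<oplus>\<^bsub>M\<^esub> ((t \<otimes> g) \<odot>\<^bsub>M\<^esub> x \<oplus>\<^bsub>M\<^esub> (t \<otimes> ?w) \<odot>\<^bsub>M\<^esub> x)"
      using t(2) gR \<psi>R[OF x(1)] w(2) x(1) M.smult_l_distr[of "t \<otimes> \<psi> x" "t \<otimes> g \<oplus> t \<otimes> ?w" x]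
        M.smult_l_distr[of "t \<otimes> g" "t \<otimes> ?w" x] by simp
    also have "\<dots> = (t \<otimes> \<psi> x) \<odot>\<^bsub>M\<^esub> x \<oplus>\<^bsub>M\<^esub> ?t \<odot>\<^bsub>M\<^esub> x"
      unfolding u(2) using M.smult_l_distr[OF I.Icarr[OF u(1)], of "t \<otimes> ?w" x] t(2) w(2) x(1) by simp
    finally have tx: "t \<odot>\<^bsub>M\<^esub> x = (t \<otimes> \<psi> x) \<odot>\<^bsub>M\<^esub> x \<oplus>\<^bsub>M\<^esub> ?t \<odot>\<^bsub>M\<^esub> x" .
    have "x = \<theta> x \<odot>\<^bsub>M\<^esub> x \<oplus>\<^bsub>M\<^esub> ((t \<otimes> \<psi> x) \<odot>\<^bsub>M\<^esub> x \<oplus>\<^bsub>M\<^esub> ?t \<odot>\<^bsub>M\<^esub> x)" using xt tx by simp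
    also have "\<dots> = ?\<theta> x \<odot>\<^bsub>M\<^esub> x \<oplus>\<^bsub>M\<^esub> ?t \<odot>\<^bsub>M\<^esub> x"
      using M.smult_l_distr[OF \<theta>R[OF x(1)], of "t \<otimes> \<psi> x" x] \<theta>R[OF x(1)] \<psi>R[OF x(1)] t(2) x(1) I.Icarr[OF t']
      by (simp add: M.M.a_assoc)
    finally show ?thesis using \<theta>' t' by blast
  qed
  \<comment> \<open>The descent starts at the top with the zero homomorphism and \<open>t\<close>
    equal to \<open>\<one>\<close>; at the bottom the remaining \<open>t\<close> is zero.\<close>
  have "\<exists>\<theta> t. ?W (loewy_length R - k) \<theta> t" if "k \<le> loewy_length R" for k
    using that
  proof (induction k)
    case 0
    have "?W (loewy_length R) (\<lambda>_. \<zero>) \<one>" using x(1) top by (simp add: rmod_hom_def)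
    then show ?case by (metis diff_zero)
  next
    case (Suc k)
    then obtain \<theta> t where W: "?W (loewy_length R - k) \<theta> t" by auto
    have "loewy_length R - k = Suc (loewy_length R - Suc k)" using Suc(2) by simp
    with W have W': "?W (Suc (loewy_length R - Suc k)) \<theta> t" by metis
    have "loewy_length R - Suc k < loewy_length R" using Suc(2) by simp
    from step[OF this W'] show ?case .
  qed
  from this[of "loewy_length R"] obtain \<theta> t where W: "?W 0 \<theta> t" by auto
  have \<theta>: "\<theta> \<in> rmod_hom R M (right_regular R)" and t: "t \<in> socle_seq R 0"
    and xt: "x = \<theta> x \<odot>\<^bsub>M\<^esub> x \<oplus>\<^bsub>M\<^esub> t \<odot>\<^bsub>M\<^esub> x" using W by blast+
  have "\<theta> x \<odot>\<^bsub>M\<^esub> x \<oplus>\<^bsub>M\<^esub> t \<odot>\<^bsub>M\<^esub> x = \<theta> x \<odot>\<^bsub>M\<^esub> x"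
    using t x(1) rmod_homD(1)[OF \<theta> x(1)] by simp
  then show ?thesis using that \<theta> xt by simp
qed

text \<open>Generators are adjoined one at a time. Each factor is cyclic and, being the quotient of
  a submodule of \<open>M\<close> by a finitely generated one, weakly R-projective, hence projective
  by \<open>weakly_cyclic\<close>.\<close>

lemma weakly_countable_projective:
  fixes M :: "('a, 'm) module"
  assumes M: "right_module R M" and weak: "weakly_R_projective R M" and fll: "finite_loewy_length R"
    and A: "countable A" "A \<subseteq> carrier M" "rspan R M A = carrier M"
  shows "projective_module R M"
proof -
  interpret M: right_module R M by fact
  \<comment> \<open>Adjoining zero allows an enumeration by all natural numbers even if
    \<open>A\<close> is empty.\<close>
  define a where "a = from_nat_into (insert \<zero>\<^bsub>M\<^esub> A)"
  have ra: "range a = insert \<zero>\<^bsub>M\<^esub> A" unfolding a_def using A(1) by (intro range_from_nat_into) auto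
  have aM: "a i \<in> carrier M" for i using ra A(2) by (metis M.M.zero_closed insert_iff rangeI subsetD)
  let ?X = "\<lambda>i. {a i}"
  let ?dom = "\<lambda>D. rspan R M (\<Union>i\<in>D. ?X i)"
  have sub: "submodule (?dom D) R M" for D using aM by (intro M.rspan_submodule) auto
  show ?thesis
  proof (rule filtration_projective[where X = ?X and T = UNIV and \<D> = "{D. \<forall>i\<in>D. \<forall>j<i. j \<in> D}"])
    show "right_module R M" by fact
    have "carrier M \<subseteq> ?dom UNIV" using rspan_mono[of A "\<Union>i. ?X i" R M] A(3) ra by auto
    then show "?dom UNIV = carrier M" using M.submoduleD(1)[OF sub] by blast
    show "\<exists>D'\<in>{D. \<forall>i\<in>D. \<forall>j<i. j \<in> D}. D \<subset> D' \<and> rel_projective R M (?dom D) (?dom D')"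
      if D: "D \<in> {D. \<forall>i\<in>D. \<forall>j<i. j \<in> D}" "D \<noteq> UNIV" for D
    proof -
      define n where "n = (LEAST i. i \<notin> D)"
      have n: "n \<notin> D" using LeastI_ex[of "\<lambda>i. i \<notin> D"] D(2) unfolding n_def by blast
      have "i \<in> D" if "i < n" for i using not_less_Least[of i "\<lambda>i. i \<notin> D"] that by (simp add: n_def)
      moreover have "i < n" if "i \<in> D" for i
      proof (rule ccontr)
        assume "\<not> i < n"
        then have "n = i \<or> n < i" by auto
        then show False using that D(1) n by auto
      qed
      ultimately have Dn: "D = {..<n}" by blast
      let ?D' = "{..<Suc n}"
      have MB: "right_module R (M\<lparr>carrier := ?dom ?D'\<rparr>)" using M.right_module_submodule[OF sub] .
      interpret MB: right_module R "M\<lparr>carrier := ?dom ?D'\<rparr>" by (rule MB)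
      have le: "?dom D \<subseteq> ?dom ?D'" unfolding Dn by (intro rspan_mono UN_mono) auto
      have A': "submodule (?dom D) R (M\<lparr>carrier := ?dom ?D'\<rparr>)"
        using M.submodule_of_submodule_iff[OF sub] sub le by blast
      have eq: "rspan R (M\<lparr>carrier := ?dom ?D'\<rparr>) B = rspan R M B" if "B \<subseteq> ?dom ?D'" for B
        using M.rspan_of_submodule[OF sub that] .
      have incD: "(\<Union>i\<in>D. ?X i) \<subseteq> ?dom ?D'" using rspan_incl[of "\<Union>i\<in>D. ?X i" R M] le by blast
      have "finite (\<Union>i\<in>D. ?X i)" by (simp add: Dn)
      then have fin: "finitely_spanned R (M\<lparr>carrier := ?dom ?D'\<rparr>) (?dom D)"
        using finitely_spannedI eq[OF incD] by blast
      obtain Q :: "('a, 'm) module" and q where Q: "right_module R Q"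
        "q \<in> rmod_hom R (M\<lparr>carrier := ?dom ?D'\<rparr>) Q" "q ` carrier (M\<lparr>carrier := ?dom ?D'\<rparr>) = carrier Q"
        "\<And>x. x \<in> carrier (M\<lparr>carrier := ?dom ?D'\<rparr>) \<Longrightarrow> q x = \<zero>\<^bsub>Q\<^esub> \<longleftrightarrow> x \<in> ?dom D"
        using MB.quotient_exists[OF A'] by blast
      interpret Q: right_module R Q by (rule Q(1))
      have weakQ: "weakly_R_projective R Q"
        using weakly_quotient[OF MB weakly_submodule[OF M weak sub] A' fin Q] .
      have UN_singleton: "(\<Union>i\<in>D. ?X i) = a ` D" for D by auto
      have inc: "a ` ?D' \<subseteq> ?dom ?D'" using rspan_incl[of "\<Union>i\<in>?D'. ?X i" R M] by auto
      have qn: "q (a n) \<in> carrier Q" using rmod_homD(1)[OF Q(2), of "a n"] inc by auto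
      have "q ` ?dom ?D' = rspan R Q (q ` a ` ?D')"
        using rspan_image[OF MB Q(1,2), of "a ` ?D'"] inc eq[OF inc] UN_singleton[of ?D'] by simp
      also have "\<dots> \<subseteq> rspan R Q {q (a n)}"
      proof (rule rspan_minimal)
        show "submodule (rspan R Q {q (a n)}) R Q" using qn by (intro Q.rspan_submodule) simp
        then have 0: "\<zero>\<^bsub>Q\<^esub> \<in> rspan R Q {q (a n)}" using Q.submoduleD(2) by blast
        have "q (a i) = \<zero>\<^bsub>Q\<^esub>" if "i < n" for i
        proof -
          have "a i \<in> ?dom D" using that rspan_incl[of "\<Union>i\<in>D. ?X i" R M] by (auto simp: Dn)
          then show ?thesis using Q(4)[of "a i"] le by auto
        qed
        then show "q ` a ` ?D' \<subseteq> rspan R Q {q (a n)}"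
          using 0 rspan_incl[of "{q (a n)}" R Q] by (auto simp: less_Suc_eq)
      qed
      finally have cyc: "rspan R Q {q (a n)} = carrier Q"
        using Q(3) Q.rspan_subset[of "{q (a n)}"] qn by auto
      obtain \<theta> where "\<theta> \<in> rmod_hom R Q (right_regular R)" "\<theta> (q (a n)) \<odot>\<^bsub>Q\<^esub> q (a n) = q (a n)"
        using weakly_cyclic[OF Q(1) weakQ fll qn cyc] by blast
      then have "projective_module R Q" using cyclic_projective[OF Q(1) qn cyc] by blast
      then have "rel_projective R M (?dom D) (?dom ?D')"
        unfolding rel_projective_def using Q by (intro exI[of _ Q] exI[of _ q]) simp
      moreover have "D \<subset> ?D'" unfolding Dn by auto
      moreover have "?D' \<in> {D. \<forall>i\<in>D. \<forall>j<i. j \<in> D}" by auto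
      ultimately show ?thesis by (intro bexI[of _ ?D'] conjI)
    qed
    show "\<Union>\<C> \<in> {D. \<forall>i\<in>D. \<forall>j<i. j \<in> D}" if "\<C> \<subseteq> {D. \<forall>i\<in>D. \<forall>j<i. j \<in> D}" for \<C>
      using that by blast
  qed (use aM in auto)
qed

text \<open>A lift into \<open>R\<close> of a map into a layer automatically stays in the socle that
  lies above: its cosets do, and that socle contains the one divided out.\<close>

lemma R_projective_weakly:
  assumes M: "right_module R M" and proj: "R_projective R M"
  shows "weakly_R_projective R M"
  unfolding weakly_R_projective_def
proof (intro allI impI ballI)
  interpret M: right_module R M by fact
  interpret RR: right_module R "right_regular R" by (rule right_regular_module)
  fix n \<phi> assume \<phi>: "\<phi> \<in> rmod_hom R M (socle_layer R n)"
  have I: "right_ideal (socle_seq R n) R" using ideal_right_ideal[OF socle_seq_ideal] .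
  let ?Q = "quotient_module (right_regular R) (socle_seq R n)"
  note Q = RR.quotient_module[OF socle_seq_submodule[of n], unfolded right_regular_simps]
  \<comment> \<open>The layer and the quotient of all of \<open>R\<close> have the same operations
    on cosets and differ in their carriers only.\<close>
  have ops: "x \<oplus>\<^bsub>socle_layer R n\<^esub> y = x \<oplus>\<^bsub>?Q\<^esub> y" "r \<odot>\<^bsub>socle_layer R n\<^esub> x = r \<odot>\<^bsub>?Q\<^esub> x" for x y r
    by (simp_all add: socle_layer_def quotient_module_def set_add_def set_mult_def)
  have car: "carrier (socle_layer R n) \<subseteq> carrier ?Q"
    unfolding socle_layer(3)[symmetric] Q(3)[symmetric] using socle_seq_subset by blast
  have "\<phi> \<in> rmod_hom R M ?Q"
    by (rule rmod_homI) (use rmod_homD[OF \<phi>] car in \<open>auto simp: ops\<close>)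
  with spec[OF proj[unfolded R_projective_def], of "socle_seq R n"] I
  have "\<exists>\<psi>\<in>rmod_hom R M (right_regular R). \<forall>x\<in>carrier M. \<phi> x = socle_seq R n +> \<psi> x" by simp
  then obtain \<psi> where \<psi>: "\<psi> \<in> rmod_hom R M (right_regular R)" "\<And>x. x \<in> carrier M \<Longrightarrow> \<phi> x = socle_seq R n +> \<psi> x"
    by (elim bexE) simp
  have "\<psi> x \<in> socle_seq R (Suc n)" if x: "x \<in> carrier M" for x
  proof -
    obtain y where y: "y \<in> socle_seq R (Suc n)" "\<phi> x = socle_seq R n +> y"
      using rmod_homD(1)[OF \<phi> x] unfolding socle_layer(3)[symmetric] by blast
    have R: "\<psi> x \<in> carrier R" "y \<in> carrier R"
      using rmod_homD(1)[OF \<psi>(1) x] subsetD[OF socle_seq_subset y(1)] by simp_all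
    have "socle_seq R n +> \<psi> x = socle_seq R n +> y" using \<psi>(2)[OF x] y(2) by simp
    then have "\<psi> x \<ominus> y \<in> socle_seq R (Suc n)" using socle_coset_eq_iff[OF R, of n] subsetD[OF socle_seq_mono] by blast
    then have "(\<psi> x \<ominus> y) \<oplus> y \<in> socle_seq R (Suc n)"
      using right_idealD(3)[OF ideal_right_ideal[OF socle_seq_ideal] _ y(1)] by blast
    then show ?thesis using R by (simp add: a_minus_def a_assoc l_neg)
  qed
  then have "\<psi> \<in> rmod_hom R M (right_regular R\<lparr>carrier := socle_seq R (Suc n)\<rparr>)"
    by (intro rmod_hom_codomain_restrict[OF \<psi>(1)]) auto
  then show "\<exists>\<psi>\<in>rmod_hom R M (right_regular R\<lparr>carrier := socle_seq R (Suc n)\<rparr>).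
      \<forall>x\<in>carrier M. \<phi> x = socle_seq R n +> \<psi> x" using \<psi>(2) by (intro bexI[of _ \<psi>]) simp_all
qed

end

section \<open>Closed unbounded sets and Jensen functions\<close>

locale infinite_cardinal =
  fixes \<kappa> :: "'k rel"
  assumes card: "Card_order \<kappa>" and infinite_Field: "\<not> finite (Field \<kappa>)"
begin

lemma well: "Well_order \<kappa>" "wo_rel \<kappa>"
  using card unfolding wo_rel_def card_order_on_def by auto

lemma underS_FieldD: "\<beta> \<in> underS \<kappa> \<gamma> \<Longrightarrow> \<beta> \<in> Field \<kappa> \<and> \<gamma> \<in> Field \<kappa>"
  unfolding underS_def Field_def by auto

lemma underS_trans: "\<alpha> \<in> underS \<kappa> \<beta> \<Longrightarrow> \<beta> \<in> underS \<kappa> \<gamma> \<Longrightarrow> \<alpha> \<in> underS \<kappa> \<gamma>"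
  using wo_rel.TRANS[OF well(2)] wo_rel.ANTISYM[OF well(2)]
  unfolding underS_def trans_def antisym_def by blast

lemma underS_total:
  "\<beta> \<in> Field \<kappa> \<Longrightarrow> \<gamma> \<in> Field \<kappa> \<Longrightarrow> \<beta> = \<gamma> \<or> \<beta> \<in> underS \<kappa> \<gamma> \<or> \<gamma> \<in> underS \<kappa> \<beta>"
  using wo_rel.TOTAL[OF well(2)] unfolding underS_def total_on_def by blast

lemma underS_irrefl: "\<beta> \<notin> underS \<kappa> \<beta>"
  by (simp add: underS_def)

lemma downset_cases:
  assumes "D \<subseteq> Field \<kappa>" "\<And>\<beta>. \<beta> \<in> D \<Longrightarrow> underS \<kappa> \<beta> \<subseteq> D" "D \<noteq> Field \<kappa>"
  obtains \<gamma> where "\<gamma> \<in> Field \<kappa>" "D = underS \<kappa> \<gamma>"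
proof -
  have "under \<kappa> \<beta> \<subseteq> D" if "\<beta> \<in> D" for \<beta>
    using assms(2)[OF that] that unfolding under_def underS_def by auto
  then have "wo_rel.ofilter \<kappa> D" using assms(1) unfolding wo_rel.ofilter_def[OF well(2)] by auto
  then show ?thesis using wo_rel.ofilter_underS_Field[OF well(2)] assms(3) that by auto
qed

lemma underS_less: "\<gamma> \<in> Field \<kappa> \<Longrightarrow> |underS \<kappa> \<gamma>| <o \<kappa>"
  using card_of_underS[OF card] .

lemma underS_limit: "\<beta> \<in> Field \<kappa> \<Longrightarrow> \<exists>\<gamma>\<in>Field \<kappa>. \<beta> \<in> underS \<kappa> \<gamma>"
  using infinite_Card_order_limit[OF card infinite_Field, of \<beta>] unfolding underS_def Field_def by blast

lemma ordLess_Field: "|B| <o \<kappa> \<Longrightarrow> |Field \<kappa>| \<le>o |B| \<Longrightarrow> False"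
  using card_of_Field_ordIso[OF card] not_ordLess_ordLeq ordIso_ordLeq_trans ordIso_symmetric by blast

lemma insert_underS_less: "\<gamma> \<in> Field \<kappa> \<Longrightarrow> |insert \<gamma> (underS \<kappa> \<gamma>)| <o \<kappa>"
proof -
  assume \<gamma>: "\<gamma> \<in> Field \<kappa>"
  obtain \<delta> where \<delta>: "\<delta> \<in> Field \<kappa>" "\<gamma> \<in> underS \<kappa> \<delta>" using underS_limit[OF \<gamma>] by blast
  then have "insert \<gamma> (underS \<kappa> \<gamma>) \<subseteq> underS \<kappa> \<delta>" using underS_trans by blast
  then show ?thesis using underS_less[OF \<delta>(1)] card_of_mono1 ordLeq_ordLess_trans by blast
qed

end

locale regular_cardinal = infinite_cardinal \<kappa> for \<kappa> :: "'k rel" +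
  assumes uncountable: "natLeq <o \<kappa>" and regular: "regularCard \<kappa>"
begin

lemma UNION_less: "|A| <o \<kappa> \<Longrightarrow> (\<And>a. a \<in> A \<Longrightarrow> |F a| <o \<kappa>) \<Longrightarrow> |\<Union>a\<in>A. F a| <o \<kappa>"
  using stable_UNION[OF regularCard_stable[OF card infinite_Field regular]] .

lemma countable_less: "countable A \<Longrightarrow> |A| <o \<kappa>"
proof -
  assume "countable A"
  then have "|A| \<le>o |UNIV :: nat set|" unfolding countable_def card_of_ordLeq[symmetric] by blast
  then show ?thesis using card_of_nat uncountable ordLeq_ordIso_trans ordLeq_ordLess_trans by blast
qed

text \<open>Countably many rounds of applying \<open>H\<close> and closing downwards, started at a
  given point, produce an initial segment. Regularity and uncountability keep it proper, so it is
  \<open>underS\<close> of a point that is closed under \<open>H\<close> and lies above the given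
  one.\<close>

lemma closure_club:
  assumes H: "\<And>\<beta>. \<beta> \<in> Field \<kappa> \<Longrightarrow> H \<beta> \<subseteq> Field \<kappa>" "\<And>\<beta>. \<beta> \<in> Field \<kappa> \<Longrightarrow> |H \<beta>| <o \<kappa>"
  shows "club \<kappa> {\<gamma> \<in> Field \<kappa>. underS \<kappa> \<gamma> \<noteq> {} \<and> (\<forall>\<beta>\<in>underS \<kappa> \<gamma>. H \<beta> \<subseteq> underS \<kappa> \<gamma>)}" (is "club \<kappa> ?C")
  unfolding club_def
proof (intro conjI ballI impI)
  show "?C \<subseteq> Field \<kappa>" by blast
  show "cofinal ?C \<kappa>"
    unfolding cofinal_def
  proof
    fix \<beta>0 assume \<beta>0: "\<beta>0 \<in> Field \<kappa>"
    define down where "down B = (\<Union>\<beta>\<in>B. insert \<beta> (underS \<kappa> \<beta>))" for B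
    define T where "T = rec_nat {\<beta>0} (\<lambda>_ B. down (B \<union> (\<Union>\<beta>\<in>B. H \<beta>)))"
    have T: "T 0 = {\<beta>0}" "T (Suc n) = down (T n \<union> (\<Union>\<beta>\<in>T n. H \<beta>))" for n unfolding T_def by simp_all
    have TF: "T n \<subseteq> Field \<kappa> \<and> |T n| <o \<kappa>" for n
    proof (induction n)
      case 0
      then show ?case using \<beta>0 countable_less[of "{\<beta>0}"] by (simp add: T)
    next
      case (Suc n)
      let ?B = "\<Union>b\<in>T n. insert b (H b)"
      have ins: "|insert b (H b)| <o \<kappa>" if "b \<in> T n" for b
      proof -
        have "b \<in> Field \<kappa>" using that Suc by blast
        moreover have "|{b}| <o \<kappa>" by (rule countable_less) simp
        ultimately have "|{b} \<union> H b| <o \<kappa>"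
          using card_of_Un_ordLess_infinite_Field[OF infinite_Field card _ H(2)] by blast
        then show ?thesis by simp
      qed
      have "|T n| <o \<kappa>" using Suc by blast
      then have B: "|?B| <o \<kappa>" by (rule UNION_less) (rule ins)
      have BF: "?B \<subseteq> Field \<kappa>" using Suc H(1) by blast
      have eq: "T (Suc n) = (\<Union>\<beta>\<in>?B. insert \<beta> (underS \<kappa> \<beta>))" unfolding T down_def by blast
      have "|T (Suc n)| <o \<kappa>" unfolding eq
      proof (rule UNION_less[OF B])
        fix \<beta> assume "\<beta> \<in> ?B"
        then show "|insert \<beta> (underS \<kappa> \<beta>)| <o \<kappa>" using insert_underS_less[of \<beta>] BF by blast
      qed
      moreover have "T (Suc n) \<subseteq> Field \<kappa>" unfolding eq using BF underS_FieldD by blast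
      ultimately show ?case by blast
    qed
    let ?U = "\<Union>n. T n"
    have U: "|?U| <o \<kappa>" by (rule UNION_less) (use countable_less[of "UNIV :: nat set"] TF in auto)
    have step: "insert \<beta> (underS \<kappa> \<beta>) \<union> H \<beta> \<subseteq> T (Suc n)" if "\<beta> \<in> T n" for \<beta> n
      unfolding T down_def using that by blast
    have step': "insert \<beta> (underS \<kappa> \<beta>) \<union> H \<beta> \<subseteq> ?U" if \<beta>: "\<beta> \<in> ?U" for \<beta>
    proof -
      obtain n where "\<beta> \<in> T n" using \<beta> by blast
      then have "insert \<beta> (underS \<kappa> \<beta>) \<union> H \<beta> \<subseteq> T (Suc n)" by (rule step)
      then show ?thesis by blast
    qed
    have "?U \<noteq> Field \<kappa>"
    proof
      assume "?U = Field \<kappa>"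
      then have "|Field \<kappa>| \<le>o |?U|" by (simp add: card_of_mono1)
      then show False using ordLess_Field[OF U] by blast
    qed
    moreover have "?U \<subseteq> Field \<kappa>" using TF by blast
    moreover have "underS \<kappa> \<beta> \<subseteq> ?U" if "\<beta> \<in> ?U" for \<beta> using step'[OF that] by simp
    ultimately obtain \<gamma> where \<gamma>: "\<gamma> \<in> Field \<kappa>" "?U = underS \<kappa> \<gamma>" using downset_cases[of ?U] by metis
    have "\<beta>0 \<in> T 0" using T(1) by simp
    then have "\<beta>0 \<in> ?U" by blast
    then have \<beta>0\<gamma>: "\<beta>0 \<in> underS \<kappa> \<gamma>" unfolding \<gamma>(2) .
    have "H \<beta> \<subseteq> ?U" if "\<beta> \<in> ?U" for \<beta> using step'[OF that] by simp
    then have "\<gamma> \<in> ?C" using \<gamma>(1) \<beta>0\<gamma> unfolding \<gamma>(2) by blast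
    then show "\<exists>b\<in>?C. \<beta>0 \<noteq> b \<and> (\<beta>0, b) \<in> \<kappa>" using \<beta>0\<gamma> unfolding underS_def by blast
  qed
  fix \<delta> assume \<delta>: "\<delta> \<in> Field \<kappa>"
    "underS \<kappa> \<delta> \<noteq> {} \<and> (\<forall>\<beta>\<in>underS \<kappa> \<delta>. \<exists>\<gamma>\<in>?C \<inter> underS \<kappa> \<delta>. \<beta> \<in> underS \<kappa> \<gamma>)"
  have "H \<beta> \<subseteq> underS \<kappa> \<delta>" if \<beta>: "\<beta> \<in> underS \<kappa> \<delta>" for \<beta>
  proof -
    obtain \<gamma> where "\<gamma> \<in> ?C" "\<gamma> \<in> underS \<kappa> \<delta>" "\<beta> \<in> underS \<kappa> \<gamma>" using \<delta>(2) \<beta> by blast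
    then show ?thesis using underS_trans by blast
  qed
  then show "\<delta> \<in> ?C" using \<delta> by blast
qed

lemma club_next:
  assumes "club \<kappa> C" "\<beta> \<in> Field \<kappa>" obtains \<gamma> where "\<gamma> \<in> C" "\<beta> \<in> underS \<kappa> \<gamma>"
  using assms unfolding club_def cofinal_def underS_def by blast

text \<open>Cofinality is inherited from the smaller club, so only closedness of \<open>D\<close> is
  left to check.\<close>

lemma club_superset:
  assumes C: "club \<kappa> C" "C \<subseteq> D" "D \<subseteq> Field \<kappa>"
    and cl: "\<And>\<delta>. \<delta> \<in> Field \<kappa> \<Longrightarrow> underS \<kappa> \<delta> \<noteq> {} \<Longrightarrow>
      (\<And>\<beta>. \<beta> \<in> underS \<kappa> \<delta> \<Longrightarrow> \<exists>\<gamma>\<in>D \<inter> underS \<kappa> \<delta>. \<beta> \<in> underS \<kappa> \<gamma>) \<Longrightarrow> \<delta> \<in> D"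
  shows "club \<kappa> D"
  unfolding club_def
proof (intro conjI ballI impI)
  show "D \<subseteq> Field \<kappa>" by fact
  have "cofinal C \<kappa>" using C(1) unfolding club_def by blast
  then show "cofinal D \<kappa>" using C(2) unfolding cofinal_def by blast
  show "\<delta> \<in> D" if "\<delta> \<in> Field \<kappa>"
    "underS \<kappa> \<delta> \<noteq> {} \<and> (\<forall>\<beta>\<in>underS \<kappa> \<delta>. \<exists>\<gamma>\<in>D \<inter> underS \<kappa> \<delta>. \<beta> \<in> underS \<kappa> \<gamma>)" for \<delta>
    using cl[OF that(1)] that(2) by blast
qed

text \<open>Points closed under functions that step upwards into each \<open>C n\<close> are limits
  of every \<open>C n\<close>, and such points form a club by \<open>closure_club\<close>.\<close>

lemma club_INT:
  fixes C :: "nat \<Rightarrow> 'k set"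
  assumes C: "\<And>n. club \<kappa> (C n)" shows "club \<kappa> (\<Inter>n. C n)"
proof -
  have "\<forall>n \<beta>. \<exists>\<gamma>. \<beta> \<in> Field \<kappa> \<longrightarrow> \<gamma> \<in> C n \<and> \<beta> \<in> underS \<kappa> \<gamma>"
    using club_next[OF C] by metis
  then obtain h where h: "\<And>n \<beta>. \<beta> \<in> Field \<kappa> \<Longrightarrow> h n \<beta> \<in> C n \<and> \<beta> \<in> underS \<kappa> (h n \<beta>)" by metis
  have hF: "h n \<beta> \<in> Field \<kappa>" if "\<beta> \<in> Field \<kappa>" for n \<beta> using h[OF that] underS_FieldD by blast
  have CF: "C n \<subseteq> Field \<kappa>" for n using C unfolding club_def by blast
  let ?H = "\<lambda>\<beta>. range (\<lambda>n. h n \<beta>)"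
  have cl: "\<delta> \<in> C n" if "\<delta> \<in> Field \<kappa>" "underS \<kappa> \<delta> \<noteq> {}" "\<And>\<beta>. \<beta> \<in> underS \<kappa> \<delta> \<Longrightarrow> \<exists>\<gamma>\<in>C n \<inter> underS \<kappa> \<delta>. \<beta> \<in> underS \<kappa> \<gamma>"
    for \<delta> n using C[of n] that unfolding club_def by blast
  show ?thesis
  proof (rule club_superset[OF closure_club[of ?H]])
    show "|range (\<lambda>n. h n \<beta>)| <o \<kappa>" for \<beta> by (rule countable_less) simp
    show "{\<gamma> \<in> Field \<kappa>. underS \<kappa> \<gamma> \<noteq> {} \<and> (\<forall>\<beta>\<in>underS \<kappa> \<gamma>. ?H \<beta> \<subseteq> underS \<kappa> \<gamma>)} \<subseteq> (\<Inter>n. C n)"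
    proof (intro subsetI INT_I)
      fix \<gamma> n assume \<gamma>: "\<gamma> \<in> {\<gamma> \<in> Field \<kappa>. underS \<kappa> \<gamma> \<noteq> {} \<and> (\<forall>\<beta>\<in>underS \<kappa> \<gamma>. ?H \<beta> \<subseteq> underS \<kappa> \<gamma>)}"
      show "\<gamma> \<in> C n"
      proof (rule cl)
        fix \<beta> assume \<beta>: "\<beta> \<in> underS \<kappa> \<gamma>"
        then have "h n \<beta> \<in> underS \<kappa> \<gamma>" using \<gamma> by blast
        then show "\<exists>\<gamma>'\<in>C n \<inter> underS \<kappa> \<gamma>. \<beta> \<in> underS \<kappa> \<gamma>'"
          using h[of \<beta> n] underS_FieldD[OF \<beta>] by blast
      qed (use \<gamma> in auto)
    qed
    show "\<delta> \<in> (\<Inter>n. C n)" if "\<delta> \<in> Field \<kappa>" "underS \<kappa> \<delta> \<noteq> {}"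
      "\<And>\<beta>. \<beta> \<in> underS \<kappa> \<delta> \<Longrightarrow> \<exists>\<gamma>\<in>(\<Inter>n. C n) \<inter> underS \<kappa> \<delta>. \<beta> \<in> underS \<kappa> \<gamma>" for \<delta>
      using cl[OF that(1,2)] that(3) by (metis INT_I Int_iff INT_E UNIV_I)
    show "(\<Inter>n. C n) \<subseteq> Field \<kappa>" using CF by blast
  qed (use hF in blast)
qed

lemma club_Int: "club \<kappa> C \<Longrightarrow> club \<kappa> D \<Longrightarrow> club \<kappa> (C \<inter> D)"
proof -
  assume "club \<kappa> C" "club \<kappa> D"
  then have "club \<kappa> (\<Inter>n::nat. if n = 0 then C else D)" by (intro club_INT) simp
  moreover have "(\<Inter>n::nat. if n = 0 then C else D) = C \<inter> D" by (auto split: if_splits)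
  ultimately show ?thesis by simp
qed

text \<open>Otherwise each piece is avoided by some club, and the intersection of these countably
  many clubs avoids \<open>E\<close>. This pigeonhole principle fixes one layer and one finitely
  generated submodule for stationarily many witnesses.\<close>

lemma stationary_countable_cover:
  fixes E' :: "nat \<Rightarrow> 'k set"
  assumes E: "stationary \<kappa> E" "E \<subseteq> (\<Union>n. E' n)"
  obtains n where "stationary \<kappa> (E \<inter> E' n)"
proof (rule ccontr)
  assume "\<not> thesis"
  have EF: "E \<subseteq> Field \<kappa>" "\<And>C. club \<kappa> C \<Longrightarrow> E \<inter> C \<noteq> {}" using E(1) unfolding stationary_def by auto
  have "\<exists>C. club \<kappa> C \<and> E \<inter> E' n \<inter> C = {}" for n
  proof -
    have "\<not> stationary \<kappa> (E \<inter> E' n)"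
    proof
      assume "stationary \<kappa> (E \<inter> E' n)"
      then have thesis by (rule that)
      then show False using \<open>\<not> thesis\<close> by contradiction
    qed
    moreover have "E \<inter> E' n \<subseteq> Field \<kappa>" using EF(1) by blast
    ultimately show ?thesis unfolding stationary_def by simp
  qed
  then obtain C where C: "\<And>n. club \<kappa> (C n)" "\<And>n. E \<inter> E' n \<inter> C n = {}" by metis
  have "club \<kappa> (\<Inter>n. C n)" by (rule club_INT) (rule C(1))
  then have "E \<inter> (\<Inter>n. C n) \<noteq> {}" by (rule EF(2))
  then obtain \<gamma> where \<gamma>: "\<gamma> \<in> E" "\<And>n. \<gamma> \<in> C n" by blast
  then obtain n where "\<gamma> \<in> E' n" using E(2) by blast
  then have "\<gamma> \<in> E \<inter> E' n \<inter> C n" using \<gamma> by blast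
  then show False unfolding C(2) by simp
qed

lemma stationary_Field: "stationary \<kappa> (Field \<kappa>)"
proof -
  have "Field \<kappa> \<inter> C \<noteq> {}" if C: "club \<kappa> C" for C
  proof -
    have CF: "C \<subseteq> Field \<kappa>" using C unfolding club_def by blast
    have "Field \<kappa> \<noteq> {}" using infinite_Field by auto
    then obtain \<beta> where "\<beta> \<in> Field \<kappa>" by blast
    then obtain \<gamma> where "\<gamma> \<in> C" using club_next[OF C] by blast
    then show ?thesis using CF by blast
  qed
  then show ?thesis unfolding stationary_def by blast
qed

text \<open>A function into \<open>B\<close> is coded by the image of its graph under an injection
  \<open>p\<close> into the cardinal. At points closed under this coding, the trace of the code is
  the code of the restricted function, and \<open>c\<close> decodes the guessed set. The club in the
  conclusion unfolds stationarity.\<close>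

lemma diamond_Jensen:
  assumes diamond: "diamond_at \<kappa> E" and B: "|B| \<le>o \<kappa>"
  obtains c :: "'k \<Rightarrow> 'k \<Rightarrow> 'b" where
    "\<And>f C. (\<And>\<beta>. \<beta> \<in> Field \<kappa> \<Longrightarrow> f \<beta> \<in> B) \<Longrightarrow> club \<kappa> C \<Longrightarrow> \<exists>\<gamma>\<in>E \<inter> C. \<forall>\<beta>\<in>underS \<kappa> \<gamma>. c \<gamma> \<beta> = f \<beta>"
proof -
  have "|Field \<kappa>| \<le>o \<kappa>" using card_of_Field_ordIso[OF card] ordIso_imp_ordLeq by blast
  then have "|Field \<kappa> \<times> B| \<le>o \<kappa>"
    using card_of_Times_ordLeq_infinite_Field[OF infinite_Field _ B card] by blast
  then have "|Field \<kappa> \<times> B| \<le>o |Field \<kappa>|"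
    using card_of_Field_ordIso[OF card] ordIso_symmetric ordLeq_ordIso_trans by blast
  then obtain p where p: "inj_on p (Field \<kappa> \<times> B)" "p ` (Field \<kappa> \<times> B) \<subseteq> Field \<kappa>"
    unfolding card_of_ordLeq[symmetric] by blast
  obtain X where X: "\<And>Y. Y \<subseteq> Field \<kappa> \<Longrightarrow> stationary \<kappa> {\<gamma> \<in> E. Y \<inter> underS \<kappa> \<gamma> = X \<gamma>}"
    using diamond unfolding diamond_at_def by blast
  define c where "c \<gamma> \<beta> = (SOME b. b \<in> B \<and> p (\<beta>, b) \<in> X \<gamma>)" for \<gamma> \<beta>
  have "\<exists>\<gamma>\<in>E \<inter> C. \<forall>\<beta>\<in>underS \<kappa> \<gamma>. c \<gamma> \<beta> = f \<beta>" if f: "\<And>\<beta>. \<beta> \<in> Field \<kappa> \<Longrightarrow> f \<beta> \<in> B" and C: "club \<kappa> C" for f C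
  proof -
    let ?Y = "(\<lambda>\<beta>. p (\<beta>, f \<beta>)) ` Field \<kappa>"
    let ?C = "{\<gamma> \<in> Field \<kappa>. underS \<kappa> \<gamma> \<noteq> {} \<and> (\<forall>\<beta>\<in>underS \<kappa> \<gamma>. {p (\<beta>, f \<beta>)} \<subseteq> underS \<kappa> \<gamma>)}"
    have pF: "p (\<beta>, f \<beta>) \<in> Field \<kappa>" if "\<beta> \<in> Field \<kappa>" for \<beta> using p(2) f that by blast
    have "club \<kappa> ?C" by (rule closure_club) (use pF countable_less[of "{_}"] in simp_all)
    then have "club \<kappa> (C \<inter> ?C)" using club_Int C by blast
    moreover have "?Y \<subseteq> Field \<kappa>" using pF by blast
    ultimately have "{\<gamma> \<in> E. ?Y \<inter> underS \<kappa> \<gamma> = X \<gamma>} \<inter> (C \<inter> ?C) \<noteq> {}"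
      using X[of ?Y] unfolding stationary_def by blast
    then obtain \<gamma> where \<gamma>: "\<gamma> \<in> E" "?Y \<inter> underS \<kappa> \<gamma> = X \<gamma>" "\<gamma> \<in> C" "\<gamma> \<in> ?C" by blast
    have "c \<gamma> \<beta> = f \<beta>" if \<beta>: "\<beta> \<in> underS \<kappa> \<gamma>" for \<beta>
      unfolding c_def
    proof (rule some_equality)
      have \<beta>F: "\<beta> \<in> Field \<kappa>" using underS_FieldD[OF \<beta>] by blast
      have "p (\<beta>, f \<beta>) \<in> underS \<kappa> \<gamma>" using \<gamma>(4) \<beta> by blast
      then show "f \<beta> \<in> B \<and> p (\<beta>, f \<beta>) \<in> X \<gamma>" unfolding \<gamma>(2)[symmetric] using \<beta>F f[OF \<beta>F] by blast
      fix b assume b: "b \<in> B \<and> p (\<beta>, b) \<in> X \<gamma>"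
      then obtain \<beta>' where \<beta>': "\<beta>' \<in> Field \<kappa>" "p (\<beta>, b) = p (\<beta>', f \<beta>')" unfolding \<gamma>(2)[symmetric] by blast
      then have "(\<beta>, b) = (\<beta>', f \<beta>')" using inj_onD[OF p(1) \<beta>'(2)] \<beta>F b f[OF \<beta>'(1)] by blast
      then show "b = f \<beta>" by simp
    qed
    then show ?thesis using \<gamma>(1,3) by blast
  qed
  then show ?thesis using that by blast
qed

text \<open>The diamond sequence restricted to a copy of \<^term>\<open>UNIV :: nat set\<close> lists all sets of
  natural numbers.\<close>

lemma diamond_continuum:
  assumes diamond: "diamond_at \<kappa> (Field \<kappa>)"
  shows "ctwo ^c natLeq \<le>o \<kappa>"
proof -
  obtain X where X: "\<And>Y. Y \<subseteq> Field \<kappa> \<Longrightarrow> stationary \<kappa> {\<gamma> \<in> Field \<kappa>. Y \<inter> underS \<kappa> \<gamma> = X \<gamma>}"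
    using diamond unfolding diamond_at_def by blast
  obtain w :: "nat \<Rightarrow> 'k" where w: "inj w" "range w \<subseteq> Field \<kappa>"
    using infinite_countable_subset[OF infinite_Field] by blast
  let ?C = "{\<gamma> \<in> Field \<kappa>. underS \<kappa> \<gamma> \<noteq> {} \<and> (\<forall>\<beta>\<in>underS \<kappa> \<gamma>. range w \<subseteq> underS \<kappa> \<gamma>)}"
  have C: "club \<kappa> ?C" by (rule closure_club) (use w(2) countable_less[of "range w"] in auto)
  have "Z \<in> (\<lambda>\<gamma>. w -` X \<gamma>) ` Field \<kappa>" for Z :: "nat set"
  proof -
    have "w ` Z \<subseteq> Field \<kappa>" using w(2) by blast
    then have "{\<gamma> \<in> Field \<kappa>. w ` Z \<inter> underS \<kappa> \<gamma> = X \<gamma>} \<inter> ?C \<noteq> {}"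
      using X[of "w ` Z"] C unfolding stationary_def by blast
    then obtain \<gamma> where \<gamma>: "\<gamma> \<in> Field \<kappa>" "w ` Z \<inter> underS \<kappa> \<gamma> = X \<gamma>" "range w \<subseteq> underS \<kappa> \<gamma>" by blast
    then have "w -` X \<gamma> = Z" using w(1) unfolding \<gamma>(2)[symmetric] by (auto dest: injD)
    then show ?thesis using \<gamma>(1) by blast
  qed
  then have "(UNIV :: nat set set) \<subseteq> (\<lambda>\<gamma>. w -` X \<gamma>) ` Field \<kappa>" by blast
  then have "|UNIV :: nat set set| \<le>o |Field \<kappa>|" using surj_imp_ordLeq by blast
  moreover have "|UNIV :: nat set set| =o ctwo ^c natLeq"
    using card_of_Pow_Func[of "UNIV :: nat set"] by (simp add: cexp_def ctwo_def Field_natLeq Field_card_of)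
  ultimately show ?thesis
    using card_of_Field_ordIso[OF card] ordIso_symmetric ordIso_ordLeq_trans ordLeq_ordIso_trans by blast
qed

end

section \<open>Generating sets of regular cardinality\<close>

locale small_regular_ring = primitive_artinian_regular +
  assumes small: "small_ring R"
begin

lemma finite_loewy: "finite_loewy_length R"
  using small unfolding small_ring_def by blast

lemma socle_seq_top: "socle_seq R (loewy_length R) = carrier R"
  using finite_loewy unfolding finite_loewy_length_def loewy_length_def by (rule LeastI_ex)

text \<open>A layer below the top has a countable generating set, and the spans of the initial parts
  of an enumeration absorb every finitely generated submodule. The top layer is an image of
  \<open>R\<close>, hence cyclic, and one submodule suffices.\<close>

lemma socle_layer_cover:
  assumes n: "0 < n" "n < loewy_length R"
  shows "\<exists>F :: nat \<Rightarrow> 'a set set. (\<forall>k. submodule (F k) R (socle_layer R n) \<and>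
      finitely_spanned R (socle_layer R n) (F k)) \<and>
    (\<forall>H. finitely_spanned R (socle_layer R n) H \<and> H \<subseteq> carrier (socle_layer R n) \<longrightarrow> (\<exists>k. H \<subseteq> F k))"
proof (cases "Suc n < loewy_length R")
  case True
  let ?L = "socle_layer R n"
  interpret L: right_module R ?L by (rule socle_layer(1))
  have "countably_generated R ?L" using small n(1) True unfolding small_ring_def by blast
  then obtain A where A: "countable A" "A \<subseteq> carrier ?L" "rspan R ?L A = carrier ?L"
    unfolding countably_generated_def by blast
  define a where "a = from_nat_into (insert \<zero>\<^bsub>?L\<^esub> A)"
  have ra: "range a = insert \<zero>\<^bsub>?L\<^esub> A" unfolding a_def using A(1) by (intro range_from_nat_into) auto
  have aL: "a ` B \<subseteq> carrier ?L" for B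
  proof -
    have "a ` B \<subseteq> insert \<zero>\<^bsub>?L\<^esub> A" using ra by blast
    then show ?thesis using A(2) by auto
  qed
  let ?F = "\<lambda>k. rspan R ?L (a ` {..<k})"
  have "submodule (?F k) R ?L \<and> finitely_spanned R ?L (?F k)" for k
    using L.rspan_submodule[OF aL] finitely_spannedI[of "a ` {..<k}" R ?L "?F k"] by simp
  moreover have "\<exists>k. H \<subseteq> ?F k" if H: "finitely_spanned R ?L H" "H \<subseteq> carrier ?L" for H
  proof -
    obtain Y where Y: "finite Y" "Y \<subseteq> H" "rspan R ?L Y = H" using H(1) unfolding finitely_spanned_def by blast
    have "Y \<subseteq> rspan R ?L A" using Y(2) H(2) A(3) by simp
    then obtain B where B: "finite B" "B \<subseteq> A" "Y \<subseteq> rspan R ?L B"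
      using L.rspan_finite_subset[OF A(2) Y(1)] by blast
    have "B \<subseteq> range a" using B(2) ra by blast
    from finite_subset_image[OF B(1) this] obtain C where C: "finite C" "B = a ` C" by blast
    obtain k where "C \<subseteq> {..<k}" using C(1) finite_nat_iff_bounded by blast
    then have "rspan R ?L B \<subseteq> ?F k" unfolding C(2) by (intro rspan_mono image_mono)
    then have "Y \<subseteq> ?F k" using B(3) by blast
    then have "rspan R ?L Y \<subseteq> ?F k" by (rule rspan_minimal[OF L.rspan_submodule[OF aL]])
    then show ?thesis unfolding Y(3) by blast
  qed
  ultimately show ?thesis by (intro exI[of _ ?F]) simp
next
  case False
  let ?L = "socle_layer R n" and ?S = "right_regular R\<lparr>carrier := socle_seq R (Suc n)\<rparr>"
  interpret L: right_module R ?L by (rule socle_layer(1))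
  interpret RR: right_module R "right_regular R" by (rule right_regular_module)
  have "Suc n = loewy_length R" using False n(2) by simp
  then have top: "socle_seq R (Suc n) = carrier R" using socle_seq_top by simp
  have "rspan R (right_regular R) {\<one>} = carrier R"
    using RR.rspan_singleton[of \<one>] by simp
  then have "rspan R ?S {\<one>} = socle_seq R (Suc n)"
    using RR.rspan_of_submodule[OF socle_seq_submodule[of "Suc n"], of "{\<one>}"] top by simp
  then have "finitely_spanned R ?S (carrier ?S)" using finitely_spannedI[of "{\<one>}" R ?S "carrier ?S"] by simp
  from finitely_spanned_image[OF socle_seq_module socle_layer(1,2) _ this]
  have "finitely_spanned R ?L (carrier ?L)" using socle_layer(3) by simp
  then show ?thesis using L.carrier_submodule by (intro exI[of _ "\<lambda>_. carrier ?L"]) auto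
qed

section \<open>The induction hypothesis and witnesses of non-projectivity\<close>

lemma projective_weakly:
  fixes M :: "('a, 'm, 'c) module_scheme"
  assumes "right_module R M" "projective_module R M" shows "weakly_R_projective R M"
  using R_projective_weakly projective_R_projective assms by blast

text \<open>The induction hypothesis. It covers all modules on the type \<open>'m\<close>, since it
  is applied to factors as well as to submodules of the given module. The cardinal lives on a type
  of its own and can be exchanged for an isomorphic one.\<close>

definition smaller_projective :: "'m itself \<Rightarrow> 'k rel \<Rightarrow> bool"
  where "smaller_projective _ \<kappa> \<longleftrightarrow> (\<forall>(N :: ('a, 'm) module) (Y :: 'm set).
    right_module R N \<and> Y \<subseteq> carrier N \<and> rspan R N Y = carrier N \<and> |Y| <o \<kappa> \<and> weakly_R_projective R N \<longrightarrow>
    projective_module R N)"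

lemma smaller_projectiveD:
  fixes N :: "('a, 'm) module"
  assumes "smaller_projective TYPE('m) \<kappa>" "right_module R N" "Y \<subseteq> carrier N" "rspan R N Y = carrier N"
    "|Y| <o \<kappa>" "weakly_R_projective R N"
  shows "projective_module R N"
  using assms(1)[unfolded smaller_projective_def] assms(2-) by blast

lemma rel_projectiveI:
  fixes M :: "('a, 'm) module" and Q :: "('a, 'm) module"
  assumes IH: "smaller_projective TYPE('m) \<kappa>" and M: "right_module R M" and Y: "Y \<subseteq> carrier M" "|Y| <o \<kappa>"
    and Q: "right_module R Q" "q \<in> rmod_hom R (M\<lparr>carrier := rspan R M Y\<rparr>) Q"
      "q ` rspan R M Y = carrier Q" "\<And>x. x \<in> rspan R M Y \<Longrightarrow> q x = \<zero>\<^bsub>Q\<^esub> \<longleftrightarrow> x \<in> A"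
    and weak: "weakly_R_projective R Q"
  shows "rel_projective R M A (rspan R M Y)"
proof -
  interpret M: right_module R M by fact
  have sub: "submodule (rspan R M Y) R M" by (rule M.rspan_submodule[OF Y(1)])
  have MB: "right_module R (M\<lparr>carrier := rspan R M Y\<rparr>)" using M.right_module_submodule[OF sub] .
  have "rspan R Q (q ` Y) = carrier Q"
    using rspan_image[OF MB Q(1,2), of Y] M.rspan_of_submodule[OF sub rspan_incl] rspan_incl[of Y R M] Q(3) by simp
  moreover have "q ` Y \<subseteq> carrier Q" using Q(3) rspan_incl[of Y R M] by blast
  moreover have "|q ` Y| <o \<kappa>" using card_of_image Y(2) ordLeq_ordLess_trans by blast
  ultimately have "projective_module R Q" using smaller_projectiveD[OF IH Q(1) _ _ _ weak] by blast
  then show ?thesis unfolding rel_projective_def using Q by (intro exI[of _ Q] exI[of _ q]) simp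
qed

text \<open>Supplies the first step of the filtration: the factor by zero of a submodule with few
  generators is weakly R-projective, so the induction hypothesis makes it projective.\<close>

lemma rel_projective_zero:
  fixes M :: "('a, 'm) module"
  assumes IH: "smaller_projective TYPE('m) \<kappa>" and M: "right_module R M" and weak: "weakly_R_projective R M"
    and Y: "Y \<subseteq> carrier M" "|Y| <o \<kappa>"
  shows "rel_projective R M {\<zero>\<^bsub>M\<^esub>} (rspan R M Y)"
proof -
  interpret M: right_module R M by fact
  have sub: "submodule (rspan R M Y) R M" by (rule M.rspan_submodule[OF Y(1)])
  let ?B = "M\<lparr>carrier := rspan R M Y\<rparr>"
  have MB: "right_module R ?B" using M.right_module_submodule[OF sub] .
  interpret MB: right_module R ?B by (rule MB)
  have Z: "submodule {\<zero>\<^bsub>M\<^esub>} R ?B" using MB.zero_submodule by simp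
  obtain Q :: "('a, 'm) module" and q where Q: "right_module R Q" "q \<in> rmod_hom R ?B Q"
    "q ` carrier ?B = carrier Q" "\<And>x. x \<in> carrier ?B \<Longrightarrow> q x = \<zero>\<^bsub>Q\<^esub> \<longleftrightarrow> x \<in> {\<zero>\<^bsub>M\<^esub>}"
    using MB.quotient_exists[OF Z] by blast
  have "finitely_spanned R ?B {\<zero>\<^bsub>M\<^esub>}" using MB.rspan_empty by (intro finitely_spannedI[of "{}"]) auto
  then have "weakly_R_projective R Q"
    using weakly_quotient[OF MB weakly_submodule[OF M weak sub] Z _ Q] by blast
  then show ?thesis by (intro rel_projectiveI[OF IH M Y Q(1,2)]) (use Q in auto)
qed

text \<open>By the induction hypothesis a factor with few generators that is not projective is not
  even weakly R-projective. A homomorphism without a lift takes its values in some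
  \<open>F n k\<close> of the countable cover, and injectivity of \<open>F n k\<close> extends it
  from the submodule to \<open>M\<close>.\<close>

lemma not_weakly_witness:
  fixes M :: "('a, 'm) module"
  assumes IH: "smaller_projective TYPE('m) \<kappa>" and M: "right_module R M" and weak: "weakly_R_projective R M"
    and Y: "Y \<subseteq> carrier M" "|Y| <o \<kappa>" and A: "submodule A R M" "A \<subseteq> rspan R M Y"
    and nproj: "\<not> rel_projective R M A (rspan R M Y)"
    and cover: "\<And>n. 0 < n \<Longrightarrow> n < loewy_length R \<Longrightarrow> (\<forall>k. submodule (F n k) R (socle_layer R n) \<and>
      finitely_spanned R (socle_layer R n) (F n k)) \<and>
      (\<forall>H. finitely_spanned R (socle_layer R n) H \<and> H \<subseteq> carrier (socle_layer R n) \<longrightarrow> (\<exists>k::nat. H \<subseteq> F n k))"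
  shows "\<exists>n k \<phi>. 0 < n \<and> n < loewy_length R \<and> \<phi> \<in> rmod_hom R M (socle_layer R n\<lparr>carrier := F n k\<rparr>) \<and>
    (\<forall>x\<in>A. \<phi> x = \<zero>\<^bsub>socle_layer R n\<^esub>) \<and>
    \<not> (\<exists>\<psi>\<in>rmod_hom R (M\<lparr>carrier := rspan R M Y\<rparr>) (right_regular R\<lparr>carrier := socle_seq R (Suc n)\<rparr>).
        (\<forall>x\<in>A. \<psi> x = \<zero>) \<and> (\<forall>x\<in>rspan R M Y. \<phi> x = socle_seq R n +> \<psi> x))"
proof -
  interpret M: right_module R M by fact
  let ?B = "M\<lparr>carrier := rspan R M Y\<rparr>"
  have sub: "submodule (rspan R M Y) R M" by (rule M.rspan_submodule[OF Y(1)])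
  have MB: "right_module R ?B" using M.right_module_submodule[OF sub] .
  interpret MB: right_module R ?B by (rule MB)
  have AB: "submodule A R ?B" using M.submodule_of_submodule_iff[OF sub] A by blast
  obtain Q :: "('a, 'm) module" and q where Q: "right_module R Q" "q \<in> rmod_hom R ?B Q"
    "q ` carrier ?B = carrier Q" "\<And>x. x \<in> carrier ?B \<Longrightarrow> q x = \<zero>\<^bsub>Q\<^esub> \<longleftrightarrow> x \<in> A"
    using MB.quotient_exists[OF AB] by blast
  have "\<not> weakly_R_projective R Q"
  proof
    assume "weakly_R_projective R Q"
    then have "rel_projective R M A (rspan R M Y)"
      by (intro rel_projectiveI[OF IH M Y Q(1,2)]) (use Q in auto)
    then show False using nproj by contradiction
  qed
  then obtain n \<phi> where n: "0 < n" "n < loewy_length R" and \<phi>: "\<phi> \<in> rmod_hom R Q (socle_layer R n)"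
    and fin: "finitely_spanned R (socle_layer R n) (\<phi> ` carrier Q)"
    and no: "\<not> (\<exists>\<psi>\<in>rmod_hom R Q (right_regular R\<lparr>carrier := socle_seq R (Suc n)\<rparr>).
      \<forall>x\<in>carrier Q. \<phi> x = socle_seq R n +> \<psi> x)"
    unfolding weakly_R_projective_def finitely_spanned_def[symmetric] by auto
  have "\<phi> ` carrier Q \<subseteq> carrier (socle_layer R n)" using rmod_homD(1)[OF \<phi>] by blast
  then obtain k where k: "\<phi> ` carrier Q \<subseteq> F n k" using cover[OF n] fin by blast
  have F: "submodule (F n k) R (socle_layer R n)" "finitely_spanned R (socle_layer R n) (F n k)"
    using cover[OF n] by auto
  have "(\<lambda>x. \<phi> (q x)) \<in> rmod_hom R ?B (socle_layer R n\<lparr>carrier := F n k\<rparr>)"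
    by (rule rmod_hom_codomain_restrict[OF rmod_hom_comp[OF Q(2) \<phi>]]) (use k Q(3) in auto)
  then obtain \<phi>' where \<phi>': "\<phi>' \<in> rmod_hom R M (socle_layer R n\<lparr>carrier := F n k\<rparr>)"
    "\<And>x. x \<in> rspan R M Y \<Longrightarrow> \<phi>' x = \<phi> (q x)"
    using layer_extend[OF M sub F] by blast
  have "\<phi>' x = \<zero>\<^bsub>socle_layer R n\<^esub>" if x: "x \<in> A" for x
  proof -
    have xB: "x \<in> rspan R M Y" using x A(2) by blast
    then have "q x = \<zero>\<^bsub>Q\<^esub>" using Q(4)[of x] x by simp
    then show ?thesis using \<phi>'(2)[OF xB] rmod_hom_zero[OF Q(1) socle_layer(1) \<phi>] by simp
  qed
  moreover have "\<not> (\<exists>\<psi>\<in>rmod_hom R ?B (right_regular R\<lparr>carrier := socle_seq R (Suc n)\<rparr>).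
        (\<forall>x\<in>A. \<psi> x = \<zero>) \<and> (\<forall>x\<in>rspan R M Y. \<phi>' x = socle_seq R n +> \<psi> x))"
  proof
    assume "\<exists>\<psi>\<in>rmod_hom R ?B (right_regular R\<lparr>carrier := socle_seq R (Suc n)\<rparr>).
        (\<forall>x\<in>A. \<psi> x = \<zero>) \<and> (\<forall>x\<in>rspan R M Y. \<phi>' x = socle_seq R n +> \<psi> x)"
    then obtain \<psi> where \<psi>: "\<psi> \<in> rmod_hom R ?B (right_regular R\<lparr>carrier := socle_seq R (Suc n)\<rparr>)"
      "\<forall>x\<in>A. \<psi> x = \<zero>" "\<forall>x\<in>rspan R M Y. \<phi>' x = socle_seq R n +> \<psi> x" by blast
    have "\<psi> x = \<zero>\<^bsub>right_regular R\<lparr>carrier := socle_seq R (Suc n)\<rparr>\<^esub>"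
      if "x \<in> carrier ?B" "q x = \<zero>\<^bsub>Q\<^esub>" for x using \<psi>(2) Q(4) that by simp
    then obtain \<psi>' where \<psi>': "\<psi>' \<in> rmod_hom R Q (right_regular R\<lparr>carrier := socle_seq R (Suc n)\<rparr>)"
      "\<And>x. x \<in> carrier ?B \<Longrightarrow> \<psi>' (q x) = \<psi> x"
      using rmod_hom_factor[OF MB Q(1) socle_seq_module Q(2,3) \<psi>(1)] by blast
    have "\<phi> y = socle_seq R n +> \<psi>' y" if y: "y \<in> carrier Q" for y
    proof -
      obtain x where x: "x \<in> rspan R M Y" "y = q x" using y Q(3) by auto
      then show ?thesis using \<phi>'(2)[OF x(1)] \<psi>(3) \<psi>'(2)[of x] by simp
    qed
    then show False using no \<psi>'(1) by blast
  qed
  ultimately show ?thesis using n \<phi>'(1) by blast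
qed

end

text \<open>The regular case: a filtration \<^term>\<open>A\<close> of the module by submodules with fewer generators
  has projective factors along a closed unbounded set. Otherwise the Jensen functions \<^term>\<open>c\<close>
  guess every possible lift \<^term>\<open>\<psi>\<close> of a homomorphism \<^term>\<open>\<phi>\<close> into a fixed finitely generated
  submodule of a socle layer, and \<^term>\<open>\<phi>\<close> is built so as to refute each guess.\<close>

lemma (in small_regular_ring) regular_projective:
  fixes M :: "('a, 'm) module" and \<kappa> :: "'k rel" and g :: "'k \<Rightarrow> 'm"
  assumes \<kappa>: "regular_cardinal \<kappa>" and diamond: "\<And>E. stationary \<kappa> E \<Longrightarrow> diamond_at \<kappa> E"
    and IH: "smaller_projective TYPE('m) \<kappa>"
    and M: "right_module R M" and weak: "weakly_R_projective R M"
    and g: "\<And>i. g i \<in> carrier M" and gen: "rspan R M (g ` Field \<kappa>) = carrier M"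
  shows "projective_module R M"
proof -
  interpret \<kappa>: regular_cardinal \<kappa> by fact
  interpret M: right_module R M by fact
  define A where "A D = rspan R M (\<Union>i\<in>D. {g i})" for D
  have A_image: "A D = rspan R M (g ` D)" for D
  proof -
    have "(\<Union>i\<in>D. {g i}) = g ` D" by auto
    then show ?thesis unfolding A_def by simp
  qed
  have gD: "g ` D \<subseteq> carrier M" for D using g by blast
  have sub: "submodule (A D) R M" for D unfolding A_image by (rule M.rspan_submodule[OF gD])
  have Amono: "D \<subseteq> D' \<Longrightarrow> A D \<subseteq> A D'" for D D' unfolding A_image by (intro rspan_mono image_mono)
  have MA: "right_module R (M\<lparr>carrier := A D\<rparr>)" for D using M.right_module_submodule[OF sub] .
  have small_under: "|g ` underS \<kappa> \<gamma>| <o \<kappa>" if "\<gamma> \<in> Field \<kappa>" for \<gamma>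
    using card_of_image \<kappa>.underS_less[OF that] ordLeq_ordLess_trans by blast
  \<comment> \<open>The stages with some non-projective later factor. If they avoid a club, the
    factors between members of that club are projective.\<close>
  define E where "E = {\<gamma> \<in> Field \<kappa>. \<exists>\<delta>\<in>Field \<kappa>. underS \<kappa> \<gamma> \<subseteq> underS \<kappa> \<delta> \<and>
    \<not> rel_projective R M (A (underS \<kappa> \<gamma>)) (A (underS \<kappa> \<delta>))}"
  show ?thesis
  proof (cases "stationary \<kappa> E")
    case False
    then obtain C where C: "club \<kappa> C" "E \<inter> C = {}" unfolding stationary_def E_def by blast
    have CF: "C \<subseteq> Field \<kappa>" using C(1) unfolding club_def by blast
    \<comment> \<open>The empty set makes the filtration start at zero, and
      \<open>Field \<kappa>\<close> accounts for unions of unbounded chains; bounded unions stay in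
      the family because the club is closed.\<close>
    let ?\<D> = "{{}, Field \<kappa>} \<union> underS \<kappa> ` C"
    show ?thesis
    proof (rule filtration_projective[where X = "\<lambda>i. {g i}" and T = "Field \<kappa>" and \<D> = ?\<D>])
      show "rspan R M (\<Union>i\<in>Field \<kappa>. {g i}) = carrier M" using gen A_image unfolding A_def by simp
      fix D assume D: "D \<in> ?\<D>" "D \<noteq> Field \<kappa>"
      show "\<exists>D'\<in>?\<D>. D \<subset> D' \<and> rel_projective R M (rspan R M (\<Union>i\<in>D. {g i})) (rspan R M (\<Union>i\<in>D'. {g i}))"
        unfolding A_def[symmetric]
      proof (cases "D = {}")
        case True
        have "Field \<kappa> \<noteq> {}" using \<kappa>.infinite_Field by auto
        then obtain \<beta> where "\<beta> \<in> Field \<kappa>" by blast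
        then obtain \<gamma> where \<gamma>: "\<gamma> \<in> C" "\<beta> \<in> underS \<kappa> \<gamma>" using \<kappa>.club_next[OF C(1)] by blast
        have "\<gamma> \<in> Field \<kappa>" using \<gamma>(1) CF by blast
        then have "rel_projective R M (A {}) (A (underS \<kappa> \<gamma>))"
          using rel_projective_zero[OF IH M weak gD small_under] M.rspan_empty unfolding A_image by simp
        then show "\<exists>D'\<in>?\<D>. D \<subset> D' \<and> rel_projective R M (A D) (A D')"
          using True \<gamma> by (intro bexI[of _ "underS \<kappa> \<gamma>"]) auto
      next
        case False
        then obtain \<gamma> where \<gamma>: "\<gamma> \<in> C" "D = underS \<kappa> \<gamma>" using D by blast
        have \<gamma>F: "\<gamma> \<in> Field \<kappa>" using \<gamma>(1) CF by blast
        obtain \<gamma>' where \<gamma>': "\<gamma>' \<in> C" "\<gamma> \<in> underS \<kappa> \<gamma>'" using \<kappa>.club_next[OF C(1) \<gamma>F] by blast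
        have le: "underS \<kappa> \<gamma> \<subseteq> underS \<kappa> \<gamma>'" using \<kappa>.underS_trans[OF _ \<gamma>'(2)] by blast
        have "\<gamma> \<notin> E" using C(2) \<gamma>(1) by blast
        then have "rel_projective R M (A (underS \<kappa> \<gamma>)) (A (underS \<kappa> \<gamma>'))"
          using \<gamma>F le \<kappa>.underS_FieldD[OF \<gamma>'(2)] unfolding E_def by blast
        moreover have "underS \<kappa> \<gamma> \<subset> underS \<kappa> \<gamma>'" using le \<gamma>'(2) \<kappa>.underS_irrefl by blast
        ultimately show "\<exists>D'\<in>?\<D>. D \<subset> D' \<and> rel_projective R M (A D) (A D')"
          unfolding \<gamma>(2) using \<gamma>'(1) by (intro bexI[of _ "underS \<kappa> \<gamma>'"]) auto
      qed
    next
      fix \<C> assume \<C>: "\<C> \<noteq> {}" "\<C> \<subseteq> ?\<D>"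
      show "\<Union>\<C> \<in> ?\<D>"
      proof (cases "\<Union>\<C> \<in> \<C> \<or> \<Union>\<C> = {} \<or> \<Union>\<C> = Field \<kappa>")
        case True
        then show ?thesis using \<C>(2) by blast
      next
        case False
        have F: "\<Union>\<C> \<subseteq> Field \<kappa>" using \<C>(2) \<kappa>.underS_FieldD by blast
        have down: "underS \<kappa> \<beta> \<subseteq> \<Union>\<C>" if \<beta>: "\<beta> \<in> \<Union>\<C>" for \<beta>
        proof -
          obtain D where D: "D \<in> \<C>" "\<beta> \<in> D" using \<beta> by blast
          then have "D = Field \<kappa> \<or> (\<exists>\<gamma>\<in>C. D = underS \<kappa> \<gamma>)" using \<C>(2) by blast
          then have "underS \<kappa> \<beta> \<subseteq> D" using D(2) \<kappa>.underS_FieldD \<kappa>.underS_trans by blast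
          then show ?thesis using D(1) by blast
        qed
        obtain \<delta> where \<delta>: "\<delta> \<in> Field \<kappa>" "\<Union>\<C> = underS \<kappa> \<delta>" using \<kappa>.downset_cases[OF F down] False by blast
        have "\<exists>\<gamma>\<in>C \<inter> underS \<kappa> \<delta>. \<beta> \<in> underS \<kappa> \<gamma>" if \<beta>: "\<beta> \<in> underS \<kappa> \<delta>" for \<beta>
        proof -
          obtain D where D: "D \<in> \<C>" "\<beta> \<in> D" using \<beta> \<delta>(2) by blast
          have "D \<noteq> Field \<kappa>" using D(1) False F by blast
          then obtain \<gamma> where \<gamma>: "\<gamma> \<in> C" "D = underS \<kappa> \<gamma>" using D \<C>(2) by blast
          have \<gamma>F: "\<gamma> \<in> Field \<kappa>" using \<gamma>(1) CF by blast
          have sub: "underS \<kappa> \<gamma> \<subseteq> underS \<kappa> \<delta>" using D(1) \<delta>(2) \<gamma>(2) by blast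
          have "\<gamma> \<noteq> \<delta>"
          proof
            assume "\<gamma> = \<delta>"
            then have "\<Union>\<C> \<in> \<C>" using D(1) \<gamma>(2) \<delta>(2) by simp
            then show False using False by simp
          qed
          moreover have "\<delta> \<notin> underS \<kappa> \<gamma>" using sub \<kappa>.underS_irrefl by blast
          ultimately have "\<gamma> \<in> underS \<kappa> \<delta>" using \<kappa>.underS_total[OF \<gamma>F \<delta>(1)] by blast
          then show ?thesis using \<gamma> D(2) by blast
        qed
        moreover have "underS \<kappa> \<delta> \<noteq> {}" using False \<delta>(2) by blast
        ultimately have "\<delta> \<in> C" using C(1) \<delta>(1) unfolding club_def by blast
        then show ?thesis unfolding \<delta>(2) by blast
      qed
    qed (use M g in auto)
  next
    case stat: True
    have "\<exists>F. \<forall>n. 0 < n \<longrightarrow> n < loewy_length R \<longrightarrow> ((\<forall>k. submodule (F n k) R (socle_layer R n) \<and>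
      finitely_spanned R (socle_layer R n) (F n k)) \<and>
      (\<forall>H. finitely_spanned R (socle_layer R n) H \<and> H \<subseteq> carrier (socle_layer R n) \<longrightarrow> (\<exists>k::nat. H \<subseteq> F n k)))"
      by (rule choice) (use socle_layer_cover in blast)
    then obtain F where F: "\<And>n. 0 < n \<Longrightarrow> n < loewy_length R \<Longrightarrow> (\<forall>k. submodule (F n k) R (socle_layer R n) \<and>
      finitely_spanned R (socle_layer R n) (F n k)) \<and>
      (\<forall>H. finitely_spanned R (socle_layer R n) H \<and> H \<subseteq> carrier (socle_layer R n) \<longrightarrow> (\<exists>k::nat. H \<subseteq> F n k))"
      by blast
    \<comment> \<open>The data of one witness: \<open>\<phi>\<close> lives on all of
      \<open>M\<close> and vanishes on stage \<open>\<gamma>\<close>, yet has no lift on stage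
      \<open>\<delta>\<close> that vanishes on stage \<open>\<gamma>\<close>.\<close>
    define bad where "bad \<gamma> \<delta> n k \<phi> \<longleftrightarrow> \<delta> \<in> Field \<kappa> \<and> underS \<kappa> \<gamma> \<subseteq> underS \<kappa> \<delta> \<and> 0 < n \<and> n < loewy_length R \<and>
      \<phi> \<in> rmod_hom R M (socle_layer R n\<lparr>carrier := F n k\<rparr>) \<and>
      (\<forall>x\<in>A (underS \<kappa> \<gamma>). \<phi> x = \<zero>\<^bsub>socle_layer R n\<^esub>) \<and>
      \<not> (\<exists>\<psi>\<in>rmod_hom R (M\<lparr>carrier := A (underS \<kappa> \<delta>)\<rparr>) (right_regular R\<lparr>carrier := socle_seq R (Suc n)\<rparr>).
          (\<forall>x\<in>A (underS \<kappa> \<gamma>). \<psi> x = \<zero>) \<and> (\<forall>x\<in>A (underS \<kappa> \<delta>). \<phi> x = socle_seq R n +> \<psi> x))"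
      for \<gamma> \<delta> n k \<phi>
    have bad_ex: "\<exists>\<delta> n k \<phi>. bad \<gamma> \<delta> n k \<phi>" if \<gamma>: "\<gamma> \<in> E" for \<gamma>
    proof -
      obtain \<delta> where \<delta>: "\<delta> \<in> Field \<kappa>" "underS \<kappa> \<gamma> \<subseteq> underS \<kappa> \<delta>"
        "\<not> rel_projective R M (A (underS \<kappa> \<gamma>)) (A (underS \<kappa> \<delta>))" using \<gamma> unfolding E_def by blast
      have le: "A (underS \<kappa> \<gamma>) \<subseteq> rspan R M (g ` underS \<kappa> \<delta>)"
        using Amono[OF \<delta>(2)] unfolding A_image[of "underS \<kappa> \<delta>"] .
      have "\<exists>n k \<phi>. 0 < n \<and> n < loewy_length R \<and> \<phi> \<in> rmod_hom R M (socle_layer R n\<lparr>carrier := F n k\<rparr>) \<and>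
         (\<forall>x\<in>A (underS \<kappa> \<gamma>). \<phi> x = \<zero>\<^bsub>socle_layer R n\<^esub>) \<and>
         \<not> (\<exists>\<psi>\<in>rmod_hom R (M\<lparr>carrier := A (underS \<kappa> \<delta>)\<rparr>) (right_regular R\<lparr>carrier := socle_seq R (Suc n)\<rparr>).
           (\<forall>x\<in>A (underS \<kappa> \<gamma>). \<psi> x = \<zero>) \<and> (\<forall>x\<in>A (underS \<kappa> \<delta>). \<phi> x = socle_seq R n +> \<psi> x))"
        unfolding A_image[of "underS \<kappa> \<delta>"]
        by (rule not_weakly_witness[OF IH M weak gD small_under[OF \<delta>(1)] sub le
              \<delta>(3)[unfolded A_image[of "underS \<kappa> \<delta>"]]]) (rule F)
      then obtain n k \<phi> where "0 < n \<and> n < loewy_length R \<and> \<phi> \<in> rmod_hom R M (socle_layer R n\<lparr>carrier := F n k\<rparr>) \<and>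
         (\<forall>x\<in>A (underS \<kappa> \<gamma>). \<phi> x = \<zero>\<^bsub>socle_layer R n\<^esub>) \<and>
         \<not> (\<exists>\<psi>\<in>rmod_hom R (M\<lparr>carrier := A (underS \<kappa> \<delta>)\<rparr>) (right_regular R\<lparr>carrier := socle_seq R (Suc n)\<rparr>).
           (\<forall>x\<in>A (underS \<kappa> \<gamma>). \<psi> x = \<zero>) \<and> (\<forall>x\<in>A (underS \<kappa> \<delta>). \<phi> x = socle_seq R n +> \<psi> x))"
        by (elim exE)
      with \<delta> have "bad \<gamma> \<delta> n k \<phi>" unfolding bad_def by (intro conjI) simp_all
      then show ?thesis by (intro exI)
    qed
    have "\<exists>t. bad \<gamma> (fst t) (fst (snd t)) (fst (snd (snd t))) (snd (snd (snd t)))" if \<gamma>: "\<gamma> \<in> E" for \<gamma>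
    proof -
      from bad_ex[OF \<gamma>] obtain \<delta> n k \<phi> where "bad \<gamma> \<delta> n k \<phi>" by (elim exE)
      then show ?thesis by (intro exI[of _ "(\<delta>, n, k, \<phi>)"]) simp
    qed
    then have "\<exists>t. \<forall>\<gamma>\<in>E. bad \<gamma> (fst (t \<gamma>)) (fst (snd (t \<gamma>))) (fst (snd (snd (t \<gamma>)))) (snd (snd (snd (t \<gamma>))))"
      by (intro bchoice ballI)
    then obtain t where t: "\<forall>\<gamma>\<in>E. bad \<gamma> (fst (t \<gamma>)) (fst (snd (t \<gamma>))) (fst (snd (snd (t \<gamma>)))) (snd (snd (snd (t \<gamma>))))"
      by (rule exE)
    define d where "d \<gamma> = fst (t \<gamma>)" for \<gamma>
    define n where "n \<gamma> = fst (snd (t \<gamma>))" for \<gamma>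
    define k where "k \<gamma> = fst (snd (snd (t \<gamma>)))" for \<gamma>
    define \<Phi> where "\<Phi> \<gamma> = snd (snd (snd (t \<gamma>)))" for \<gamma>
    have bad: "bad \<gamma> (d \<gamma>) (n \<gamma>) (k \<gamma>) (\<Phi> \<gamma>)" if "\<gamma> \<in> E" for \<gamma>
      using bspec[OF t that] unfolding d_def n_def k_def \<Phi>_def .
    \<comment> \<open>The label of a witness, its layer and its member of the cover, is a single
      natural number, so one label occurs stationarily often.\<close>
    have "E \<subseteq> (\<Union>m. {\<gamma>. prod_encode (n \<gamma>, k \<gamma>) = m})" by blast
    then obtain m where m: "stationary \<kappa> (E \<inter> {\<gamma>. prod_encode (n \<gamma>, k \<gamma>) = m})"
      by (rule \<kappa>.stationary_countable_cover[OF stat])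
    define E1 where "E1 = E \<inter> {\<gamma>. prod_encode (n \<gamma>, k \<gamma>) = m}"
    obtain N K where NK: "m = prod_encode (N, K)" by (metis prod_decode_inverse surj_pair)
    have bad1: "bad \<gamma> (d \<gamma>) N K (\<Phi> \<gamma>)" if "\<gamma> \<in> E1" for \<gamma>
    proof -
      have "prod_encode (n \<gamma>, k \<gamma>) = prod_encode (N, K)" using that unfolding E1_def NK by blast
      then have "n \<gamma> = N" "k \<gamma> = K" using inj_prod_encode[of UNIV] by (auto dest: injD)
      then show ?thesis using bad[of \<gamma>] that unfolding E1_def by blast
    qed
    have E1F: "E1 \<subseteq> Field \<kappa>" unfolding E1_def E_def by blast
    have stat1: "stationary \<kappa> E1" using m unfolding E1_def .
    \<comment> \<open>The ring has at most continuum many elements, so that Jensen functions with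
      values in the ring become available.\<close>
    have "ctwo ^c natLeq \<le>o \<kappa>" using \<kappa>.diamond_continuum diamond \<kappa>.stationary_Field by blast
    then have "|carrier R| \<le>o \<kappa>" using small ordLeq_transitive unfolding small_ring_def by blast
    then obtain c where c: "\<And>f C. (\<And>\<beta>. \<beta> \<in> Field \<kappa> \<Longrightarrow> f \<beta> \<in> carrier R) \<Longrightarrow> club \<kappa> C \<Longrightarrow>
        \<exists>\<gamma>\<in>E1 \<inter> C. \<forall>\<beta>\<in>underS \<kappa> \<gamma>. c \<gamma> \<beta> = f \<beta>"
      using \<kappa>.diamond_Jensen[OF diamond[OF stat1]] by blast
    \<comment> \<open>Some club, used only to see that \<open>E1\<close> has a member; a member
      yields the bounds on \<open>N\<close>.\<close>
    let ?C0 = "{\<gamma> \<in> Field \<kappa>. underS \<kappa> \<gamma> \<noteq> {} \<and> (\<forall>\<beta>\<in>underS \<kappa> \<gamma>. {} \<subseteq> underS \<kappa> \<gamma>)}"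
    have "club \<kappa> ?C0" by (rule \<kappa>.closure_club) (use \<kappa>.countable_less[of "{}"] in auto)
    then have "E1 \<inter> ?C0 \<noteq> {}" using stat1 unfolding stationary_def by blast
    then obtain \<gamma>0 where "\<gamma>0 \<in> E1" by blast
    then have N: "0 < N" "N < loewy_length R" using bad1[of \<gamma>0] unfolding bad_def by blast+
    let ?L = "socle_layer R N" and ?S = "right_regular R\<lparr>carrier := socle_seq R (Suc N)\<rparr>"
    let ?LF = "socle_layer R N\<lparr>carrier := F N K\<rparr>"
    have FN: "submodule (F N K) R ?L" "finitely_spanned R ?L (F N K)" using F[OF N] by auto
    interpret L: right_module R ?L by (rule socle_layer(1))
    have LF: "right_module R ?LF" using L.right_module_submodule[OF FN(1)] .
    interpret S: right_module R ?S by (rule socle_seq_module)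
    \<comment> \<open>Admissible domains: initial segments that contain, along with
      \<open>\<xi>\<close>, the later stage on which the witness at \<open>\<xi>\<close> has no
      lift. Whether the guess at \<open>\<xi>\<close> is refuted is then settled inside the domain
      and survives every extension.\<close>
    define \<D> where "\<D> = {D. D \<subseteq> Field \<kappa> \<and> (\<forall>\<beta>\<in>D. underS \<kappa> \<beta> \<subseteq> D) \<and> (\<forall>\<xi>\<in>D \<inter> E1. underS \<kappa> (d \<xi>) \<subseteq> D)}"
    have \<D>I: "D \<subseteq> Field \<kappa> \<Longrightarrow> (\<And>\<beta>. \<beta> \<in> D \<Longrightarrow> underS \<kappa> \<beta> \<subseteq> D) \<Longrightarrow> (\<And>\<xi>. \<xi> \<in> D \<Longrightarrow> \<xi> \<in> E1 \<Longrightarrow> underS \<kappa> (d \<xi>) \<subseteq> D) \<Longrightarrow> D \<in> \<D>" for D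
      unfolding \<D>_def by blast
    have \<D>D: "D \<in> \<D> \<Longrightarrow> D \<subseteq> Field \<kappa>" "D \<in> \<D> \<Longrightarrow> \<beta> \<in> D \<Longrightarrow> underS \<kappa> \<beta> \<subseteq> D"
      "D \<in> \<D> \<Longrightarrow> \<xi> \<in> D \<Longrightarrow> \<xi> \<in> E1 \<Longrightarrow> underS \<kappa> (d \<xi>) \<subseteq> D" for D \<beta> \<xi> unfolding \<D>_def by blast+
    have Field\<D>: "Field \<kappa> \<in> \<D>" by (rule \<D>I) (use \<kappa>.underS_FieldD in auto)
    \<comment> \<open>Agreement with the guess is demanded on the generators below
      \<open>\<xi>\<close> only: Jensen functions guess functions of indices, and the values at
      generators determine a homomorphism on their span.\<close>
    define lift where "lift D f \<xi> \<psi> \<longleftrightarrow> \<psi> \<in> rmod_hom R (M\<lparr>carrier := A D\<rparr>) ?S \<and>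
      (\<forall>x\<in>A D. f x = socle_seq R N +> \<psi> x) \<and> (\<forall>\<beta>\<in>underS \<kappa> \<xi>. \<psi> (g \<beta>) = c \<xi> \<beta>)" for D f \<xi> \<psi>
    have lift_mono: "lift D f \<xi> \<psi>" if "lift D' f' \<xi> \<psi>" "D \<subseteq> D'" "\<And>x. x \<in> A D \<Longrightarrow> f' x = f x" for D D' f f' \<xi> \<psi>
      unfolding lift_def
    proof (intro conjI ballI)
      show "\<psi> \<in> rmod_hom R (M\<lparr>carrier := A D\<rparr>) ?S"
        using rmod_hom_restrict2[OF _ Amono[OF that(2)]] that(1) unfolding lift_def by blast
      show "f x = socle_seq R N +> \<psi> x" if x: "x \<in> A D" for x
      proof -
        have "x \<in> A D'" using Amono[OF \<open>D \<subseteq> D'\<close>] x by blast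
        then show ?thesis using \<open>lift D' f' \<xi> \<psi>\<close> \<open>\<And>x. x \<in> A D \<Longrightarrow> f' x = f x\<close>[OF x] unfolding lift_def by simp
      qed
      show "\<psi> (g \<beta>) = c \<xi> \<beta>" if "\<beta> \<in> underS \<kappa> \<xi>" for \<beta>
        using that \<open>lift D' f' \<xi> \<psi>\<close> unfolding lift_def by blast
    qed
    define P where "P D f \<longleftrightarrow> D \<in> \<D> \<and> f \<in> rmod_hom R (M\<lparr>carrier := A D\<rparr>) ?LF \<and>
      (\<forall>\<xi>\<in>D \<inter> E1. underS \<kappa> \<xi> \<in> \<D> \<longrightarrow> \<not> (\<exists>\<psi>. lift D f \<xi> \<psi>))" for D f
    have PI: "D \<in> \<D> \<Longrightarrow> f \<in> rmod_hom R (M\<lparr>carrier := A D\<rparr>) ?LF \<Longrightarrow>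
      (\<And>\<xi> \<psi>. \<xi> \<in> D \<Longrightarrow> \<xi> \<in> E1 \<Longrightarrow> underS \<kappa> \<xi> \<in> \<D> \<Longrightarrow> lift D f \<xi> \<psi> \<Longrightarrow> False) \<Longrightarrow> P D f" for D f
      unfolding P_def by blast
    have PD: "P D f \<Longrightarrow> D \<in> \<D>" "P D f \<Longrightarrow> f \<in> rmod_hom R (M\<lparr>carrier := A D\<rparr>) ?LF"
      "P D f \<Longrightarrow> \<xi> \<in> D \<Longrightarrow> \<xi> \<in> E1 \<Longrightarrow> underS \<kappa> \<xi> \<in> \<D> \<Longrightarrow> \<not> lift D f \<xi> \<psi>" for D f \<xi> \<psi>
      unfolding P_def by blast+
    obtain \<phi> where \<phi>: "P (Field \<kappa>) \<phi>"
    proof (rule transfinite_extension[of P "{}" "\<lambda>_. \<zero>\<^bsub>?L\<^esub>" A "Field \<kappa>"])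
      show "P {} (\<lambda>_. \<zero>\<^bsub>?L\<^esub>)"
      proof (rule PI)
        show "{} \<in> \<D>" by (rule \<D>I) auto
        show "(\<lambda>_. \<zero>\<^bsub>?L\<^esub>) \<in> rmod_hom R (M\<lparr>carrier := A {}\<rparr>) ?LF"
          using L.submoduleD(2)[OF FN(1)] by (intro rmod_homI) auto
      qed auto
      show "P D h" if "P D f" and eq: "\<And>x. x \<in> A D \<Longrightarrow> f x = h x" for D f h
      proof (rule PI)
        show "D \<in> \<D>" using PD(1)[OF that(1)] .
        show "h \<in> rmod_hom R (M\<lparr>carrier := A D\<rparr>) ?LF"
          by (rule rmod_hom_cong[OF MA PD(2)[OF that(1)]]) (use eq in auto)
        show False if "\<xi> \<in> D" "\<xi> \<in> E1" "underS \<kappa> \<xi> \<in> \<D>" "lift D h \<xi> \<psi>" for \<xi> \<psi>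
          using PD(3)[OF \<open>P D f\<close> that(1-3)] lift_mono[OF that(4) order_refl, of f] eq by simp
      qed
      show "D \<subseteq> D' \<Longrightarrow> A D \<subseteq> A D'" for D D' by (rule Amono)
      show "P (\<Union>\<C>) f" if \<C>: "\<C> \<noteq> {}" "\<And>D D'. D \<in> \<C> \<Longrightarrow> D' \<in> \<C> \<Longrightarrow> D \<subseteq> D' \<or> D' \<subseteq> D" "\<And>D. D \<in> \<C> \<Longrightarrow> P D f" for \<C> f
      proof (rule PI)
        show "\<Union>\<C> \<in> \<D>" using PD(1)[OF \<C>(3)] unfolding \<D>_def by blast
        have eq: "A (\<Union>\<C>) = \<Union>(A ` \<C>)"
          unfolding A_def using M.rspan_UN_chain[of "\<lambda>i. {g i}" \<C>] g \<C>(1,2) by simp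
        show "f \<in> rmod_hom R (M\<lparr>carrier := A (\<Union>\<C>)\<rparr>) ?LF"
          unfolding eq
        proof (rule rmod_hom_Union_chain[OF M])
          fix B B' assume "B \<in> A ` \<C>" "B' \<in> A ` \<C>"
          then obtain D D' where D: "D \<in> \<C>" "D' \<in> \<C>" "B = A D" "B' = A D'" by blast
          show "B \<subseteq> B' \<or> B' \<subseteq> B" using \<C>(2)[OF D(1,2)] Amono unfolding D(3,4) by blast
        qed (use PD(2)[OF \<C>(3)] in blast)
        fix \<xi> \<psi> assume \<xi>: "\<xi> \<in> \<Union>\<C>" "\<xi> \<in> E1" "underS \<kappa> \<xi> \<in> \<D>" "lift (\<Union>\<C>) f \<xi> \<psi>"
        then obtain D where D: "D \<in> \<C>" "\<xi> \<in> D" by blast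
        have "lift D f \<xi> \<psi>" by (rule lift_mono[OF \<xi>(4)]) (use D(1) in auto)
        then show False using PD(3)[OF \<C>(3)[OF D(1)] D(2) \<xi>(2,3)] by blast
      qed
      show "\<exists>D' f'. P D' f' \<and> D \<subset> D' \<and> (\<forall>x\<in>A D. f' x = f x)" if Pf: "P D f" and DF: "D \<noteq> Field \<kappa>" for D f
      proof -
        note D\<D> = PD(1)[OF Pf]
        obtain \<gamma> where \<gamma>: "\<gamma> \<in> Field \<kappa>" "D = underS \<kappa> \<gamma>"
          using \<kappa>.downset_cases[OF \<D>D(1)[OF D\<D>] \<D>D(2)[OF D\<D>] DF] by blast
        \<comment> \<open>The least admissible domain that contains the new point
          \<open>\<gamma>\<close>. If \<open>\<gamma>\<close> is in \<open>E1\<close>, it contains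
          the stage \<open>d \<gamma>\<close>, where a guess at \<open>\<gamma>\<close> can be
          refuted.\<close>
        define D' where "D' = \<Inter>{D \<in> \<D>. \<gamma> \<in> D}"
        have D'least: "D' \<subseteq> D''" if "D'' \<in> \<D>" "\<gamma> \<in> D''" for D'' using that unfolding D'_def by blast
        have \<gamma>D': "\<gamma> \<in> D'" unfolding D'_def by blast
        have D'\<D>: "D' \<in> \<D>"
        proof (rule \<D>I)
          show "D' \<subseteq> Field \<kappa>" by (rule D'least[OF Field\<D> \<gamma>(1)])
          show "underS \<kappa> \<beta> \<subseteq> D'" if "\<beta> \<in> D'" for \<beta> using that \<D>D(2) unfolding D'_def by blast
          show "underS \<kappa> (d \<xi>) \<subseteq> D'" if "\<xi> \<in> D'" "\<xi> \<in> E1" for \<xi> using that \<D>D(3) unfolding D'_def by blast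
        qed
        have DD': "D \<subseteq> D'" unfolding \<gamma>(2) by (rule \<D>D(2)[OF D'\<D> \<gamma>D'])
        have "D \<subset> D'" using DD' \<gamma>D' \<kappa>.underS_irrefl unfolding \<gamma>(2) by blast
        obtain f1 where f1: "f1 \<in> rmod_hom R M ?LF" "\<And>x. x \<in> A D \<Longrightarrow> f1 x = f x"
          using layer_extend[OF M sub FN PD(2)[OF Pf]] by blast
        have "\<exists>f'. f' \<in> rmod_hom R M ?LF \<and> (\<forall>x\<in>A D. f' x = f x) \<and> (\<gamma> \<in> E1 \<longrightarrow> \<not> (\<exists>\<psi>. lift D' f' \<gamma> \<psi>))"
        proof (cases "\<gamma> \<in> E1 \<and> (\<exists>\<psi>. lift D' f1 \<gamma> \<psi>)")
          case False
          then show ?thesis using f1 by blast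
        next
          case True
          then obtain \<psi>1 where \<gamma>E: "\<gamma> \<in> E1" and \<psi>1: "lift D' f1 \<gamma> \<psi>1" by blast
          note b = bad1[OF \<gamma>E, unfolded bad_def]
          have \<Phi>: "\<Phi> \<gamma> \<in> rmod_hom R M ?LF" "\<And>x. x \<in> A D \<Longrightarrow> \<Phi> \<gamma> x = \<zero>\<^bsub>?L\<^esub>" using b unfolding \<gamma>(2) by blast+
          \<comment> \<open>Used when \<open>f1\<close> does have a lift \<open>\<psi>1\<close>
            compatible with the guess at \<open>\<gamma>\<close>. Adding
            \<open>\<Phi> \<gamma>\<close> changes nothing on \<open>D\<close>. A compatible lift of
            the sum would agree with \<open>\<psi>1\<close> below \<open>\<gamma>\<close>, and their
            difference would be a lift of \<open>\<Phi> \<gamma>\<close> vanishing there, which does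
            not exist.\<close>
          let ?f2 = "\<lambda>x. \<Phi> \<gamma> x \<oplus>\<^bsub>?LF\<^esub> f1 x"
          have f2: "?f2 \<in> rmod_hom R M ?LF" by (rule rmod_hom_add[OF M LF \<Phi>(1) f1(1)])
          have FL: "F N K \<subseteq> carrier ?L" using L.submoduleD(1)[OF FN(1)] .
          have mem: "\<Phi> \<gamma> x \<in> carrier ?L" "f1 x \<in> carrier ?L" if "x \<in> carrier M" for x
            using rmod_homD(1)[OF \<Phi>(1) that] rmod_homD(1)[OF f1(1) that] FL by auto
          have "?f2 x = f x" if x: "x \<in> A D" for x
            using \<Phi>(2)[OF x] f1(2)[OF x] mem(2)[OF M.submoduleD(5)[OF sub x]] by simp
          moreover have "\<not> lift D' ?f2 \<gamma> \<psi>2" for \<psi>2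
          proof
            assume \<psi>2: "lift D' ?f2 \<gamma> \<psi>2"
            let ?\<delta> = "underS \<kappa> (d \<gamma>)"
            have le: "?\<delta> \<subseteq> D'" by (rule \<D>D(3)[OF D'\<D> \<gamma>D' \<gamma>E])
            have l1: "lift ?\<delta> f1 \<gamma> \<psi>1" by (rule lift_mono[OF \<psi>1 le]) (rule refl)
            have l2: "lift ?\<delta> ?f2 \<gamma> \<psi>2" by (rule lift_mono[OF \<psi>2 le]) (rule refl)
            have h1: "\<psi>1 \<in> rmod_hom R (M\<lparr>carrier := A ?\<delta>\<rparr>) ?S" and h2: "\<psi>2 \<in> rmod_hom R (M\<lparr>carrier := A ?\<delta>\<rparr>) ?S"
              using l1 l2 unfolding lift_def by blast+
            let ?\<psi> = "\<lambda>x. \<psi>2 x \<ominus>\<^bsub>?S\<^esub> \<psi>1 x"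
            have \<psi>: "?\<psi> \<in> rmod_hom R (M\<lparr>carrier := A ?\<delta>\<rparr>) ?S" by (rule rmod_hom_minus[OF MA socle_seq_module h2 h1])
            have inS: "\<psi>1 x \<in> carrier ?S" "\<psi>2 x \<in> carrier ?S" if "x \<in> A ?\<delta>" for x
              using rmod_homD(1)[OF h1, of x] rmod_homD(1)[OF h2, of x] that by simp_all
            have D\<delta>: "underS \<kappa> \<gamma> \<subseteq> ?\<delta>" using b by blast
            have g\<delta>: "g ` underS \<kappa> \<gamma> \<subseteq> A ?\<delta>" using D\<delta> rspan_incl[of "g ` ?\<delta>" R M] unfolding A_image by blast
            have z: "\<psi>2 x = \<psi>1 x" if x: "x \<in> A (underS \<kappa> \<gamma>)" for x
            proof (rule rmod_hom_eq_on_rspan[OF MA socle_seq_module h2 h1])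
              show "g ` underS \<kappa> \<gamma> \<subseteq> carrier (M\<lparr>carrier := A ?\<delta>\<rparr>)" using g\<delta> by simp
              show "x \<in> rspan R (M\<lparr>carrier := A ?\<delta>\<rparr>) (g ` underS \<kappa> \<gamma>)"
                using x M.rspan_of_submodule[OF sub g\<delta>] unfolding A_image[of "underS \<kappa> \<gamma>"] by simp
              show "\<psi>2 y = \<psi>1 y" if "y \<in> g ` underS \<kappa> \<gamma>" for y
                using that l1 l2 unfolding lift_def by auto
            qed
            have "?\<psi> x = \<zero>" if x: "x \<in> A (underS \<kappa> \<gamma>)" for x
            proof -
              have x\<delta>: "x \<in> A ?\<delta>" using x Amono[OF D\<delta>] by blast
              have "?\<psi> x = \<zero>\<^bsub>?S\<^esub>"
                using S.minus_eq_zero_iff[OF inS(2)[OF x\<delta>] inS(1)[OF x\<delta>]] z[OF x] by blast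
              then show ?thesis by simp
            qed
            moreover have "\<Phi> \<gamma> x = socle_seq R N +> ?\<psi> x" if x: "x \<in> A ?\<delta>" for x
            proof -
              have xM: "x \<in> carrier M" using M.submoduleD(5)[OF sub x] .
              let ?c = "\<lambda>y. socle_seq R N +> y"
              have \<psi>S: "?\<psi> x \<in> carrier ?S" using rmod_homD(1)[OF \<psi>, of x] x by simp
              have cm: "?c (?\<psi> x) \<in> carrier ?L" using rmod_homD(1)[OF socle_layer(2) \<psi>S] .
              have "\<Phi> \<gamma> x \<oplus>\<^bsub>?L\<^esub> f1 x = ?c (\<psi>2 x)" using l2 x unfolding lift_def by simp
              also have "\<psi>2 x = ?\<psi> x \<oplus>\<^bsub>?S\<^esub> \<psi>1 x" using S.minus_add_cancel(1)[OF inS(2,1)[OF x]] by simp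
              also have "?c (?\<psi> x \<oplus>\<^bsub>?S\<^esub> \<psi>1 x) = ?c (?\<psi> x) \<oplus>\<^bsub>?L\<^esub> ?c (\<psi>1 x)"
                using rmod_homD(2)[OF socle_layer(2) \<psi>S inS(1)[OF x]] .
              also have "?c (\<psi>1 x) = f1 x" using l1 x unfolding lift_def by simp
              finally have eq: "\<Phi> \<gamma> x \<oplus>\<^bsub>?L\<^esub> f1 x = ?c (?\<psi> x) \<oplus>\<^bsub>?L\<^esub> f1 x" .
              have "\<Phi> \<gamma> x = (\<Phi> \<gamma> x \<oplus>\<^bsub>?L\<^esub> f1 x) \<ominus>\<^bsub>?L\<^esub> f1 x"
                by (rule L.minus_add_cancel(2)[OF mem(1)[OF xM] mem(2)[OF xM], symmetric])
              also have "\<dots> = ?c (?\<psi> x)"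
                unfolding eq by (rule L.minus_add_cancel(2)[OF cm mem(2)[OF xM]])
              finally show ?thesis .
            qed
            ultimately have "\<exists>\<psi>\<in>rmod_hom R (M\<lparr>carrier := A ?\<delta>\<rparr>) ?S.
                (\<forall>x\<in>A (underS \<kappa> \<gamma>). \<psi> x = \<zero>) \<and> (\<forall>x\<in>A ?\<delta>. \<Phi> \<gamma> x = socle_seq R N +> \<psi> x)"
              using \<psi> by (intro bexI[of _ ?\<psi>] conjI ballI)
            then show False using b by (elim conjE) (rule notE)
          qed
          ultimately show ?thesis using f2 by blast
        qed
        then obtain f' where f': "f' \<in> rmod_hom R M ?LF" "\<And>x. x \<in> A D \<Longrightarrow> f' x = f x"
          "\<gamma> \<in> E1 \<Longrightarrow> \<not> (\<exists>\<psi>. lift D' f' \<gamma> \<psi>)" by blast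
        have "P D' f'"
        proof (rule PI[OF D'\<D>])
          show "f' \<in> rmod_hom R (M\<lparr>carrier := A D'\<rparr>) ?LF"
            using rmod_hom_restrict[OF f'(1) M.submoduleD(1)[OF sub]] .
          fix \<xi> \<psi> assume \<xi>: "\<xi> \<in> D'" "\<xi> \<in> E1" "underS \<kappa> \<xi> \<in> \<D>" "lift D' f' \<xi> \<psi>"
          have \<xi>F: "\<xi> \<in> Field \<kappa>" using \<xi>(2) E1F by blast
          consider "\<xi> \<in> D" | "\<xi> = \<gamma>" | "\<gamma> \<in> underS \<kappa> \<xi>"
            using \<kappa>.underS_total[OF \<xi>F \<gamma>(1)] unfolding \<gamma>(2) by blast
          then show False
          proof cases
            case 1
            have "lift D f \<xi> \<psi>" by (rule lift_mono[OF \<xi>(4) DD']) (rule f'(2))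
            then show ?thesis using PD(3)[OF Pf 1 \<xi>(2,3)] by blast
          next
            case 2
            then show ?thesis using f'(3) \<xi>(2,4) by blast
          next
            \<comment> \<open>By minimality \<open>D'\<close> is contained in the admissible set
              \<open>underS \<kappa> \<xi>\<close>, so \<open>\<xi>\<close> cannot belong to it.
              This is why \<open>P\<close> asks for refutations only at points whose initial segment
              is admissible.\<close>
            case 3
            then show ?thesis using D'least[OF \<xi>(3)] \<xi>(1) \<kappa>.underS_irrefl by blast
          qed
        qed
        then show ?thesis using \<open>D \<subset> D'\<close> f'(2) by blast
      qed
    qed auto
    have AF: "A (Field \<kappa>) = carrier M" unfolding A_image using gen .
    have "\<phi> \<in> rmod_hom R M ?LF" using PD(2)[OF \<phi>] unfolding AF by (simp add: rmod_hom_def)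
    then obtain \<psi> where \<psi>: "\<psi> \<in> rmod_hom R M ?S" "\<And>x. x \<in> carrier M \<Longrightarrow> \<phi> x = socle_seq R N +> \<psi> x"
      using weakly_lift_into[OF M weak N(2) FN] by blast
    \<comment> \<open>At points closed under \<open>?H\<close> the initial segment is admissible.
      The values of \<open>\<psi>\<close> at the generators are guessed correctly at such a point of
      \<open>E1\<close>, where \<open>\<phi>\<close> was built so as to have no lift matching the
      guess.\<close>
    let ?H = "\<lambda>\<xi>. if \<xi> \<in> E1 then underS \<kappa> (d \<xi>) else {}"
    let ?C = "{\<gamma> \<in> Field \<kappa>. underS \<kappa> \<gamma> \<noteq> {} \<and> (\<forall>\<beta>\<in>underS \<kappa> \<gamma>. ?H \<beta> \<subseteq> underS \<kappa> \<gamma>)}"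
    have dF: "d \<xi> \<in> Field \<kappa>" if "\<xi> \<in> E1" for \<xi> using bad1[OF that] unfolding bad_def by blast
    have "club \<kappa> ?C"
    proof (rule \<kappa>.closure_club)
      show "?H \<beta> \<subseteq> Field \<kappa>" for \<beta> using \<kappa>.underS_FieldD by auto
      show "|?H \<beta>| <o \<kappa>" for \<beta> using \<kappa>.underS_less[OF dF] \<kappa>.countable_less[of "{}"] by auto
    qed
    moreover have "\<psi> (g \<beta>) \<in> carrier R" for \<beta>
      using rmod_homD(1)[OF \<psi>(1) g] socle_seq_subset[of "Suc N"] by auto
    ultimately obtain \<gamma> where \<gamma>: "\<gamma> \<in> E1" "\<gamma> \<in> ?C" "\<forall>\<beta>\<in>underS \<kappa> \<gamma>. c \<gamma> \<beta> = \<psi> (g \<beta>)"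
      using c[of "\<lambda>\<beta>. \<psi> (g \<beta>)" ?C] by blast
    have "underS \<kappa> \<gamma> \<in> \<D>"
    proof (rule \<D>I)
      show "underS \<kappa> \<gamma> \<subseteq> Field \<kappa>" using \<kappa>.underS_FieldD by blast
      show "underS \<kappa> \<beta> \<subseteq> underS \<kappa> \<gamma>" if "\<beta> \<in> underS \<kappa> \<gamma>" for \<beta> using \<kappa>.underS_trans[OF _ that] by blast
      show "underS \<kappa> (d \<xi>) \<subseteq> underS \<kappa> \<gamma>" if "\<xi> \<in> underS \<kappa> \<gamma>" "\<xi> \<in> E1" for \<xi>
      proof -
        have "?H \<xi> \<subseteq> underS \<kappa> \<gamma>" using \<gamma>(2) that(1) by blast
        then show ?thesis using that(2) by simp
      qed
    qed
    moreover have "lift (Field \<kappa>) \<phi> \<gamma> \<psi>"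
      unfolding lift_def AF using \<psi> \<gamma>(3) by (simp add: rmod_hom_def)
    ultimately show ?thesis using PD(3)[OF \<phi> _ \<gamma>(1)] \<gamma>(1) E1F by blast
  qed
qed

section \<open>Generating sets of singular cardinality\<close>

lemma (in right_module) finsum_closed_submodule:
  assumes A: "submodule A R M" and "finite B" "\<And>x. x \<in> B \<Longrightarrow> f x \<in> A"
  shows "finsum M f B \<in> A" "finsum (M\<lparr>carrier := A\<rparr>) f B = finsum M f B"
proof -
  interpret MA: right_module R "M\<lparr>carrier := A\<rparr>" using right_module_submodule[OF A] .
  note A' = submoduleD[OF A]
  have "finsum M f B \<in> A \<and> finsum (M\<lparr>carrier := A\<rparr>) f B = finsum M f B"
    using assms(2,3)
  proof (induction B)
    case empty
    then show ?case using A'(2) by simp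
  next
    case (insert b B)
    then have fA: "f \<in> B \<rightarrow> carrier (M\<lparr>carrier := A\<rparr>)" "f b \<in> carrier (M\<lparr>carrier := A\<rparr>)" by auto
    then have fM: "f \<in> B \<rightarrow> carrier M" "f b \<in> carrier M" using A'(5) by auto
    show ?case
      using insert M.finsum_insert[OF insert(1,2) fM] MA.M.finsum_insert[OF insert(1,2) fA] A'(3) by simp
  qed
  then show "finsum M f B \<in> A" "finsum (M\<lparr>carrier := A\<rparr>) f B = finsum M f B" by auto
qed

text \<open>The construction of the free module reads only the carrier of its argument, so this is
  the free module with basis \<open>U\<close>. Its elements are functions on the whole type;
  enlarging \<open>U\<close> therefore enlarges the carrier without changing the operations.\<close>

abbreviation free_on :: "('r, 'a) ring_scheme \<Rightarrow> ('r, 'm, 'b) module_scheme \<Rightarrow> 'm set \<Rightarrow> ('r, 'm \<Rightarrow> 'r) module"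
  where "free_on R M U \<equiv> free_module R (M\<lparr>carrier := U\<rparr>)"

lemma free_onD:
  assumes "u \<in> carrier (free_on R M U)"
  shows "finite {x. u x \<noteq> \<zero>\<^bsub>R\<^esub>}" "u x \<in> carrier R" "u x \<noteq> \<zero>\<^bsub>R\<^esub> \<Longrightarrow> x \<in> U"
  using assms by (auto simp: free_module_def)

lemma free_on_mono: "U \<subseteq> V \<Longrightarrow> carrier (free_on R M U) \<subseteq> carrier (free_on R M V)"
  by (auto simp: free_module_def)

lemma free_on_ops: "u \<oplus>\<^bsub>free_on R M U\<^esub> v = u \<oplus>\<^bsub>free_on R M V\<^esub> v" "r \<odot>\<^bsub>free_on R M U\<^esub> u = r \<odot>\<^bsub>free_on R M V\<^esub> u"
  by (simp_all add: free_module_def)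

context right_module
begin

lemma free_map_submodule:
  assumes U: "U \<subseteq> carrier M" and u: "u \<in> carrier (free_on R M U)" and A: "submodule A R M" "U \<subseteq> A"
  shows "free_map R (M\<lparr>carrier := A\<rparr>) (\<lambda>x. x) u = free_map R M (\<lambda>x. x) u"
proof -
  note u' = free_onD[OF u]
  have "u x \<odot>\<^bsub>M\<^esub> x \<in> A" if "x \<in> {x. u x \<noteq> \<zero>}" for x
    using submoduleD(4)[OF A(1) u'(2)] A(2) u'(3) that by blast
  then show ?thesis
    unfolding free_map_def using finsum_closed_submodule(2)[OF A(1) u'(1), of "\<lambda>x. u x \<odot>\<^bsub>M\<^esub> x"] by simp
qed

lemma free_cover:
  assumes U: "U \<subseteq> carrier M"
  shows "free_map R M (\<lambda>x. x) \<in> rmod_hom R (free_on R M U) (M\<lparr>carrier := rspan R M U\<rparr>)"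
    and "free_map R M (\<lambda>x. x) ` carrier (free_on R M U) = rspan R M U"
proof -
  let ?p = "free_map R M (\<lambda>x. x)" and ?F = "free_on R M U"
  have F: "right_module R ?F" using free_module_right_module R.ring_axioms .
  interpret F: right_module R ?F by (rule F)
  have p: "?p \<in> rmod_hom R ?F M" by (rule free_map_hom[OF right_module_axioms]) (use U in auto)
  have sub: "submodule (rspan R M U) R M" by (rule rspan_submodule[OF U])
  have le: "?p u \<in> rspan R M U" if u: "u \<in> carrier ?F" for u
  proof -
    note u' = free_onD[OF u]
    have "u x \<odot>\<^bsub>M\<^esub> x \<in> rspan R M U" if "x \<in> {x. u x \<noteq> \<zero>}" for x
      using submoduleD(4)[OF sub u'(2)] rspan_incl[of U R M] u'(3) that by blast
    then show ?thesis unfolding free_map_def by (intro finsum_closed_submodule(1)[OF sub u'(1)])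
  qed
  show "?p \<in> rmod_hom R ?F (M\<lparr>carrier := rspan R M U\<rparr>)"
    by (rule rmod_hom_codomain_restrict[OF p]) (use le in auto)
  have img: "submodule (?p ` carrier ?F) R M" by (rule submodule_image[OF F right_module_axioms p F.carrier_submodule])
  have "x \<in> ?p ` carrier ?F" if x: "x \<in> U" for x
  \<comment> \<open>In the zero ring the basis function at \<open>x\<close> has empty support, so
    this case is treated apart.\<close>
  proof (cases "\<one> = \<zero>")
    case True
    have xM: "x \<in> carrier M" using x U by blast
    have "x = \<zero>\<^bsub>M\<^esub>" using smult_one[OF xM] smult_zero_left[OF xM] True by simp
    then show ?thesis using submoduleD(2)[OF img] by simp
  next
    case False
    let ?u = "\<lambda>y. if y = x then \<one> else \<zero>"
    have supp: "{y. ?u y \<noteq> \<zero>} = {x}" using False by auto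
    have "?u \<in> carrier ?F" using x supp by (auto simp: free_module_def)
    moreover have "?p ?u = x" using x U unfolding free_map_def supp by auto
    ultimately show ?thesis by (metis image_eqI)
  qed
  then have "rspan R M U \<subseteq> ?p ` carrier ?F" by (intro rspan_minimal[OF img] subsetI)
  then show "?p ` carrier ?F = rspan R M U" using le by blast
qed

text \<open>Sections of free covers replace Kaplansky's decomposition of projective modules into countably
  generated summands: subsets of \<^term>\<open>U\<close> closed under the supports of a section \<^term>\<open>s\<close> yield
  submodules with projective quotients.\<close>

definition free_section :: "'m set \<Rightarrow> ('m \<Rightarrow> 'm \<Rightarrow> 'r) \<Rightarrow> bool"
  where "free_section U s \<longleftrightarrow> s \<in> rmod_hom R (M\<lparr>carrier := rspan R M U\<rparr>) (free_on R M U) \<and>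
    (\<forall>x\<in>rspan R M U. free_map R M (\<lambda>x. x) (s x) = x)"

lemma free_section_support:
  assumes "free_section U s" "y \<in> U"
  shows "finite {u. s y u \<noteq> \<zero>}" "{u. s y u \<noteq> \<zero>} \<subseteq> U"
proof -
  have s: "s \<in> rmod_hom R (M\<lparr>carrier := rspan R M U\<rparr>) (free_on R M U)"
    using assms(1) unfolding free_section_def by simp
  have "y \<in> carrier (M\<lparr>carrier := rspan R M U\<rparr>)" using assms(2) rspan_incl[of U R M] by auto
  note sy = free_onD[OF rmod_homD(1)[OF s this]]
  show "finite {u. s y u \<noteq> \<zero>}" by (rule sy(1))
  show "{u. s y u \<noteq> \<zero>} \<subseteq> U" using sy(3) by auto
qed

lemma free_section_exists:
  assumes U: "U \<subseteq> carrier M" and proj: "projective_module R (M\<lparr>carrier := rspan R M U\<rparr>)"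
  obtains s where "free_section U s"
proof -
  let ?B = "M\<lparr>carrier := rspan R M U\<rparr>"
  have MB: "right_module R ?B" by (rule right_module_submodule[OF rspan_submodule[OF U]])
  have F: "right_module R (free_on R M U)" using free_module_right_module R.ring_axioms .
  have "(\<lambda>x. x) \<in> rmod_hom R ?B ?B" by (rule rmod_hom_id)
  moreover have "free_map R M (\<lambda>x. x) ` carrier (free_on R M U) = carrier ?B" using free_cover(2)[OF U] by simp
  ultimately obtain s where "s \<in> rmod_hom R ?B (free_on R M U)" "\<forall>x\<in>carrier ?B. free_map R M (\<lambda>x. x) (s x) = x"
    using projective_module_lift[OF proj MB F MB free_cover(1)[OF U]] by blast
  then show ?thesis using that unfolding free_section_def by simp
qed

text \<open>A section is a lift of the identity along the free cover. The old section, read in the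
  larger free module, is such a lift on the smaller span, and the projective factor lets it be
  extended.\<close>

lemma free_section_extend:
  assumes U: "U \<subseteq> V" "V \<subseteq> carrier M" and s: "free_section U s"
    and rel: "rel_projective R M (rspan R M U) (rspan R M V)"
  obtains s' where "free_section V s'" "\<And>x. x \<in> rspan R M U \<Longrightarrow> s' x = s x"
proof -
  let ?B = "M\<lparr>carrier := rspan R M V\<rparr>"
  have UM: "U \<subseteq> carrier M" using U by blast
  have sub: "submodule (rspan R M V) R M" "submodule (rspan R M U) R M"
    using rspan_submodule U(2) UM by blast+
  have MB: "right_module R ?B" by (rule right_module_submodule[OF sub(1)])
  have F: "right_module R (free_on R M V)" using free_module_right_module R.ring_axioms .
  have s': "s \<in> rmod_hom R (M\<lparr>carrier := rspan R M U\<rparr>) (free_on R M U)"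
    "\<And>x. x \<in> rspan R M U \<Longrightarrow> free_map R M (\<lambda>x. x) (s x) = x" using s unfolding free_section_def by auto
  have h0: "s \<in> rmod_hom R (M\<lparr>carrier := rspan R M U\<rparr>) (free_on R M V)"
  proof (rule rmod_homI)
    show "s x \<in> carrier (free_on R M V)" if "x \<in> carrier (M\<lparr>carrier := rspan R M U\<rparr>)" for x
      using rmod_homD(1)[OF s'(1) that] free_on_mono[OF U(1)] by blast
  qed (use rmod_homD(2,3)[OF s'(1)] free_on_ops[where U = U and V = V] in simp_all)
  have surj: "free_map R M (\<lambda>x. x) ` carrier (free_on R M V) = carrier ?B" using free_cover(2)[OF U(2)] by simp
  have idB: "(\<lambda>x. x) \<in> rmod_hom R ?B ?B" by (rule rmod_hom_id)
  obtain s'' where s'': "s'' \<in> rmod_hom R ?B (free_on R M V)" "\<And>x. x \<in> rspan R M U \<Longrightarrow> s'' x = s x"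
    "\<And>x. x \<in> rspan R M V \<Longrightarrow> free_map R M (\<lambda>x. x) (s'' x) = (\<lambda>x. x) x"
    by (rule rel_projective_extend[OF right_module_axioms sub rspan_mono[OF U(1)] rel F MB
          free_cover(1)[OF U(2)] surj idB h0]) (simp_all add: s'(2))
  then have "free_section V s''" unfolding free_section_def by simp
  then show ?thesis using s''(2) by (rule that)
qed

end

text \<open>To lift a map \<open>f\<close> out of the quotient, preimages of \<open>f (q u)\<close>
  are chosen for the basis elements \<open>u\<close>, namely zero for those in \<open>Y\<close>.
  Composition with the section gives a lift on the span of \<open>U\<close>. It vanishes on
  \<open>Y\<close>, because the supports of \<open>s y\<close> remain in \<open>Y\<close>, and so it
  factors through the quotient.\<close>

lemma closed_rel_projective:
  fixes M :: "('r, 'm) module"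
  assumes M: "right_module R M" and U: "U \<subseteq> carrier M" and s: "right_module.free_section R M U s"
    and Y: "Y \<subseteq> U" "\<And>y u. y \<in> Y \<Longrightarrow> s y u \<noteq> \<zero>\<^bsub>R\<^esub> \<Longrightarrow> u \<in> Y"
  shows "rel_projective R M (rspan R M Y) (rspan R M U)"
proof -
  interpret M: right_module R M by fact
  let ?B = "M\<lparr>carrier := rspan R M U\<rparr>" and ?F = "free_on R M U"
  have sub: "submodule (rspan R M U) R M" by (rule M.rspan_submodule[OF U])
  have YM: "Y \<subseteq> carrier M" using Y(1) U by blast
  have MB: "right_module R ?B" by (rule M.right_module_submodule[OF sub])
  interpret MB: right_module R ?B by (rule MB)
  have YB: "Y \<subseteq> rspan R M U" using Y(1) rspan_incl[of U R M] by blast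
  have subY: "submodule (rspan R M Y) R ?B"
    using M.submodule_of_submodule_iff[OF sub] M.rspan_submodule[OF YM] rspan_mono[OF Y(1)] by blast
  have s': "s \<in> rmod_hom R ?B ?F" "\<And>x. x \<in> rspan R M U \<Longrightarrow> free_map R M (\<lambda>x. x) (s x) = x"
    using s unfolding M.free_section_def by auto
  obtain Q :: "('r, 'm) module" and q where Q: "right_module R Q" "q \<in> rmod_hom R ?B Q"
    "q ` carrier ?B = carrier Q" "\<And>x. x \<in> carrier ?B \<Longrightarrow> q x = \<zero>\<^bsub>Q\<^esub> \<longleftrightarrow> x \<in> rspan R M Y"
    using MB.quotient_exists[OF subY] by blast
  have "projective_module R Q"
    unfolding projective_module_def
  proof (intro allI impI, elim conjE)
    fix N :: "('r, 'm \<Rightarrow> 'r) module" and L :: "('r, 'm) module" and g f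
    assume N: "right_module R N" and L: "right_module R L"
      and g: "g \<in> rmod_hom R N L" "g ` carrier N = carrier L" and f: "f \<in> rmod_hom R Q L"
    interpret N: right_module R N by fact
    interpret L: right_module R L by fact
    have fq: "(\<lambda>x. f (q x)) \<in> rmod_hom R ?B L" by (rule rmod_hom_comp[OF Q(2) f])
    have pre: "\<exists>n. n \<in> carrier N \<and> g n = f (q u)" if u: "u \<in> U" for u
    proof -
      have "u \<in> carrier ?B" using u rspan_incl[of U R M] by auto
      then have "f (q u) \<in> g ` carrier N" unfolding g(2) using rmod_homD(1)[OF fq] by blast
      then show ?thesis by (metis imageE)
    qed
    define t where "t u = (if u \<in> Y then \<zero>\<^bsub>N\<^esub> else SOME n. n \<in> carrier N \<and> g n = f (q u))" for u
    have t: "t u \<in> carrier N" "g (t u) = f (q u)" if u: "u \<in> U" for u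
    proof -
      have "t u \<in> carrier N \<and> g (t u) = f (q u)"
      proof (cases "u \<in> Y")
        case True
        have "q u = \<zero>\<^bsub>Q\<^esub>" using Q(4)[of u] True YB rspan_incl[of Y R M] by auto
        then show ?thesis using True rmod_hom_zero[OF Q(1) L f] rmod_hom_zero[OF N L g(1)] by (simp add: t_def)
      next
        case False
        then show ?thesis using someI_ex[OF pre[OF u]] by (simp add: t_def)
      qed
      then show "t u \<in> carrier N" "g (t u) = f (q u)" by auto
    qed
    have tN: "t ` carrier (M\<lparr>carrier := U\<rparr>) \<subseteq> carrier N" using t(1) by auto
    have h0: "free_map R N t \<in> rmod_hom R ?F N" by (rule free_map_hom[OF N tN])
    let ?h = "\<lambda>x. free_map R N t (s x)"
    have h: "?h \<in> rmod_hom R ?B N" by (rule rmod_hom_comp[OF s'(1) h0])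
    have gh: "g (?h x) = f (q x)" if x: "x \<in> carrier ?B" for x
    proof -
      have sx: "s x \<in> carrier ?F" using rmod_homD(1)[OF s'(1) x] .
      note sx' = free_onD[OF sx]
      have UB: "(\<lambda>x. x) ` carrier (M\<lparr>carrier := U\<rparr>) \<subseteq> carrier ?B" using rspan_incl[of U R M] by auto
      have fqL: "f (q u) \<in> carrier L" if "u \<in> U" for u
        using rmod_homD(1)[OF fq, of u] that rspan_incl[of U R M] by auto
      have "g (?h x) = free_map R L (\<lambda>u. g (t u)) (s x)" by (rule hom_free_map[OF N L g(1) tN sx])
      also have "\<dots> = free_map R L (\<lambda>u. f (q u)) (s x)"
        unfolding free_map_def
        by (rule L.M.finsum_cong') (use sx' t(2) fqL in auto)
      also have "\<dots> = f (q (free_map R ?B (\<lambda>x. x) (s x)))"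
        using hom_free_map[OF MB L fq UB sx] by simp
      also have "free_map R ?B (\<lambda>x. x) (s x) = x"
        using M.free_map_submodule[OF U sx sub rspan_incl] s'(2)[of x] x by simp
      finally show ?thesis .
    qed
    have h_zero: "?h y = \<zero>\<^bsub>N\<^esub>" if y: "y \<in> Y" for y
    proof -
      have yB: "y \<in> carrier ?B" using y YB by auto
      note sy = free_onD[OF rmod_homD(1)[OF s'(1) yB]]
      have "(\<Oplus>\<^bsub>N\<^esub>u\<in>{u. s y u \<noteq> \<zero>\<^bsub>R\<^esub>}. s y u \<odot>\<^bsub>N\<^esub> t u) = (\<Oplus>\<^bsub>N\<^esub>u\<in>{u. s y u \<noteq> \<zero>\<^bsub>R\<^esub>}. \<zero>\<^bsub>N\<^esub>)"
        by (rule N.M.finsum_cong') (use Y(2)[OF y] sy(2) in \<open>auto simp: t_def\<close>)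
      then show ?thesis unfolding free_map_def by simp
    qed
    have "?h x = \<zero>\<^bsub>N\<^esub>" if x: "x \<in> carrier ?B" "q x = \<zero>\<^bsub>Q\<^esub>" for x
    proof (rule rmod_hom_eq_on_rspan[OF MB N h, of "\<lambda>_. \<zero>\<^bsub>N\<^esub>" Y])
      show "(\<lambda>_. \<zero>\<^bsub>N\<^esub>) \<in> rmod_hom R ?B N" by (rule rmod_homI) auto
      show "Y \<subseteq> carrier ?B" using YB by simp
      show "x \<in> rspan R ?B Y" using x Q(4) M.rspan_of_submodule[OF sub YB] by simp
    qed (rule h_zero)
    then obtain k where k: "k \<in> rmod_hom R Q N" "\<And>x. x \<in> carrier ?B \<Longrightarrow> k (q x) = ?h x"
      using rmod_hom_factor[OF MB Q(1) N Q(2,3) h] by blast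
    have "g (k y) = f y" if y: "y \<in> carrier Q" for y
    proof -
      obtain x where x: "x \<in> carrier ?B" "y = q x" using y Q(3) by blast
      then show ?thesis using k(2)[OF x(1)] gh[OF x(1)] by simp
    qed
    then show "\<exists>h\<in>rmod_hom R Q N. \<forall>x\<in>carrier Q. g (h x) = f x" using k(1) by blast
  qed
  then show ?thesis unfolding rel_projective_def using Q by (intro exI[of _ Q] exI[of _ q]) simp
qed

section \<open>Strong generating sets\<close>

lemma card_of_ordLeq_iff_less_cardSuc: "|B| \<le>o |L| \<longleftrightarrow> |B| <o cardSuc |L|"
  using cardSuc_ordLeq_ordLess[OF card_of_Card_order card_of_Card_order] by blast

context small_regular_ring
begin

text \<open>The smaller factor embeds into the projective module \<open>Q\<close>. As a submodule it
  is weakly R-projective, and having few generators it is projective by the induction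
  hypothesis.\<close>

lemma rel_projective_intermediate:
  fixes M :: "('a, 'm) module"
  assumes IH: "smaller_projective TYPE('m) \<kappa>" and M: "right_module R M"
    and rel: "rel_projective R M A B" and B: "submodule B R M"
    and Y: "Y \<subseteq> carrier M" "|Y| <o \<kappa>" "rspan R M Y \<subseteq> B"
  shows "rel_projective R M A (rspan R M Y)"
proof -
  interpret M: right_module R M by fact
  obtain Q :: "('a, 'm) module" and q where Q: "right_module R Q" "projective_module R Q"
    "q \<in> rmod_hom R (M\<lparr>carrier := B\<rparr>) Q" "q ` B = carrier Q" "\<And>x. x \<in> B \<Longrightarrow> q x = \<zero>\<^bsub>Q\<^esub> \<longleftrightarrow> x \<in> A"
    using rel unfolding rel_projective_def by blast
  let ?C = "M\<lparr>carrier := rspan R M Y\<rparr>" and ?Q = "Q\<lparr>carrier := q ` rspan R M Y\<rparr>"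
  interpret Q: right_module R Q by (rule Q(1))
  have MC: "right_module R ?C" by (rule M.right_module_submodule[OF M.rspan_submodule[OF Y(1)]])
  have qC: "q \<in> rmod_hom R ?C Q" by (rule rmod_hom_restrict2[OF Q(3) Y(3)])
  have img: "submodule (q ` rspan R M Y) R Q"
    using submodule_image[OF MC Q(1) qC right_module.carrier_submodule[OF MC]] by simp
  have weak: "weakly_R_projective R ?Q"
    using weakly_submodule[OF Q(1) projective_weakly[OF Q(1,2)] img] .
  show ?thesis
  proof (rule rel_projectiveI[OF IH M Y(1,2) Q.right_module_submodule[OF img] _ _ _ weak])
    show "q \<in> rmod_hom R ?C ?Q" by (rule rmod_hom_codomain_restrict[OF qC]) simp
    show "q x = \<zero>\<^bsub>?Q\<^esub> \<longleftrightarrow> x \<in> A" if "x \<in> rspan R M Y" for x using Q(5)[of x] that Y(3) by auto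
  qed simp
qed

text \<open>\<open>L\<close> enters through its cardinality only. The condition is what is needed to
  extend a section from \<open>Z\<close> to any larger set of size at most that of
  \<open>L\<close>.\<close>

definition strong_set :: "('a, 'm) module \<Rightarrow> 'l set \<Rightarrow> 'm set \<Rightarrow> bool"
  where "strong_set M L Z \<longleftrightarrow> Z \<subseteq> carrier M \<and> |Z| \<le>o |L| \<and>
    (\<forall>Z'. Z \<subseteq> Z' \<and> Z' \<subseteq> carrier M \<and> |Z'| \<le>o |L| \<longrightarrow> rel_projective R M (rspan R M Z) (rspan R M Z'))"

text \<open>Otherwise an increasing chain of length the successor of \<^term>\<open>|L|\<close> with non-projective
  factors would have a projective union, and a closed subset of the union in the chain.\<close>

lemma strong_set_exists:
  fixes M :: "('a, 'm) module" and L :: "'l set"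
  assumes IH: "smaller_projective TYPE('m) \<kappa>'" and M: "right_module R M" and weak: "weakly_R_projective R M"
    and L: "infinite L" "cardSuc |L| <o \<kappa>'" and X0: "X0 \<subseteq> carrier M" "|X0| \<le>o |L|"
  obtains Z where "X0 \<subseteq> Z" "strong_set M L Z"
proof (rule ccontr)
  assume "\<not> thesis"
  then have none: "\<not> strong_set M L Z" if "X0 \<subseteq> Z" for Z using that \<open>\<And>Z. X0 \<subseteq> Z \<Longrightarrow> strong_set M L Z \<Longrightarrow> thesis\<close> by blast
  interpret M: right_module R M by fact
  \<comment> \<open>A successor, hence regular, and its proper initial segments are no larger than
    \<open>L\<close>. The union of a chain of this length has size at most \<open>\<kappa>\<close>,
    still below \<open>\<kappa>'\<close>, so the induction hypothesis makes its span
    projective.\<close>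
  define \<kappa> where "\<kappa> = cardSuc |L|"
  have card\<kappa>: "Card_order \<kappa>" unfolding \<kappa>_def by (intro cardSuc_Card_order card_of_Card_order)
  have inf\<kappa>: "\<not> finite (Field \<kappa>)"
    unfolding \<kappa>_def using cardSuc_finite[OF card_of_Card_order, of L] L(1) by (simp add: Field_card_of)
  have \<kappa>_alt: "cardSuc |L| = \<kappa>" unfolding \<kappa>_def ..
  note Lless = card_of_ordLeq_iff_less_cardSuc[of _ L, unfolded \<kappa>_alt]
  have "natLeq \<le>o |L|" using L(1) infinite_iff_natLeq_ordLeq by blast
  then have "natLeq <o \<kappa>"
    unfolding \<kappa>_def using cardSuc_ordLeq_ordLess[OF card_of_Card_order natLeq_Card_order] by blast
  moreover have "regularCard \<kappa>"
    unfolding \<kappa>_def using infinite_cardSuc_regularCard[OF _ card_of_Card_order, of L] L(1) by (simp add: Field_card_of)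
  ultimately interpret \<kappa>: regular_cardinal \<kappa> using card\<kappa> inf\<kappa> by unfold_locales
  define ok where "ok Z \<longleftrightarrow> X0 \<subseteq> Z \<and> Z \<subseteq> carrier M \<and> |Z| \<le>o |L|" for Z
  have "\<exists>Z'. ok Z \<longrightarrow> Z \<subseteq> Z' \<and> ok Z' \<and> \<not> rel_projective R M (rspan R M Z) (rspan R M Z')" for Z
  proof (cases "ok Z")
    case True
    then have "\<not> strong_set M L Z" using none unfolding ok_def by blast
    then have "\<not> (\<forall>Z'. Z \<subseteq> Z' \<and> Z' \<subseteq> carrier M \<and> |Z'| \<le>o |L| \<longrightarrow> rel_projective R M (rspan R M Z) (rspan R M Z'))"
      using True unfolding strong_set_def ok_def by simp
    then obtain Z' where "Z \<subseteq> Z'" "Z' \<subseteq> carrier M" "|Z'| \<le>o |L|"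
      "\<not> rel_projective R M (rspan R M Z) (rspan R M Z')" by auto
    then show ?thesis using True unfolding ok_def by (intro exI[of _ Z']) auto
  qed simp
  then obtain G where G: "\<And>Z. ok Z \<Longrightarrow> Z \<subseteq> G Z" "\<And>Z. ok Z \<Longrightarrow> ok (G Z)"
    "\<And>Z. ok Z \<Longrightarrow> \<not> rel_projective R M (rspan R M Z) (rspan R M (G Z))" by metis
  \<comment> \<open>Each stage collects the bad enlargements \<open>G\<close> of all earlier stages,
    so that a later stage contains \<open>G\<close> of every earlier one.\<close>
  define H where "H h \<nu> = X0 \<union> (\<Union>\<xi>\<in>underS \<kappa> \<nu>. G (h \<xi>))" for h :: "'l set \<Rightarrow> 'm set" and \<nu>
  define X where "X = wo_rel.worec \<kappa> H"
  have "wo_rel.adm_wo \<kappa> H" unfolding wo_rel.adm_wo_def[OF \<kappa>.well(2)] H_def by simp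
  then have "X = H X" unfolding X_def by (rule wo_rel.worec_fixpoint[OF \<kappa>.well(2)])
  then have X: "X \<nu> = X0 \<union> (\<Union>\<xi>\<in>underS \<kappa> \<nu>. G (X \<xi>))" for \<nu> unfolding H_def by (rule fun_cong)
  have okX: "\<nu> \<in> Field \<kappa> \<longrightarrow> ok (X \<nu>)" for \<nu>
  proof (rule wo_rel.well_order_induct[OF \<kappa>.well(2)], intro impI)
    fix \<nu> assume "\<forall>\<mu>. \<mu> \<noteq> \<nu> \<and> (\<mu>, \<nu>) \<in> \<kappa> \<longrightarrow> \<mu> \<in> Field \<kappa> \<longrightarrow> ok (X \<mu>)" and \<nu>: "\<nu> \<in> Field \<kappa>"
    then have IH\<nu>: "ok (G (X \<xi>))" if "\<xi> \<in> underS \<kappa> \<nu>" for \<xi>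
      using that \<kappa>.underS_FieldD[OF that] G(2) unfolding underS_def by blast
    have "|underS \<kappa> \<nu>| \<le>o |L|" using \<kappa>.underS_less[OF \<nu>] Lless by blast
    moreover have "\<forall>\<xi>\<in>underS \<kappa> \<nu>. |G (X \<xi>)| \<le>o |L|" using IH\<nu> unfolding ok_def by blast
    ultimately have un: "|\<Union>\<xi>\<in>underS \<kappa> \<nu>. G (X \<xi>)| \<le>o |L|" by (rule card_of_UNION_ordLeq_infinite[OF L(1)])
    have "\<not> finite (Field |L| )" using L(1) by (simp add: Field_card_of)
    then have "|X \<nu>| \<le>o |L|"
      unfolding X[of \<nu>] by (rule card_of_Un_ordLeq_infinite_Field[OF _ X0(2) un card_of_Card_order])
    moreover have "X0 \<subseteq> X \<nu>" unfolding X[of \<nu>] by blast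
    moreover have "X \<nu> \<subseteq> carrier M" unfolding X[of \<nu>] using IH\<nu> X0(1) unfolding ok_def by blast
    ultimately show "ok (X \<nu>)" unfolding ok_def by blast
  qed
  have GX: "G (X \<xi>) \<subseteq> X \<nu>" if "\<xi> \<in> underS \<kappa> \<nu>" for \<xi> \<nu> unfolding X[of \<nu>] using that by blast
  have Xmono: "X \<xi> \<subseteq> X \<nu>" if \<xi>: "\<xi> \<in> underS \<kappa> \<nu>" for \<xi> \<nu>
    using GX[OF \<xi>] G(1)[of "X \<xi>"] okX \<kappa>.underS_FieldD[OF \<xi>] by blast
  define U where "U = (\<Union>\<nu>\<in>Field \<kappa>. X \<nu>)"
  have UM: "U \<subseteq> carrier M" using okX unfolding U_def ok_def by blast
  have "|U| \<le>o \<kappa>"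
    unfolding U_def
  proof (rule card_of_UNION_ordLeq_infinite_Field[OF inf\<kappa> card\<kappa>])
    show "|Field \<kappa>| \<le>o \<kappa>" using card_of_Field_ordIso[OF card\<kappa>] ordIso_imp_ordLeq by blast
    show "\<forall>\<nu>\<in>Field \<kappa>. |X \<nu>| \<le>o \<kappa>" using okX Lless ordLess_imp_ordLeq unfolding ok_def by blast
  qed
  then have Uless: "|U| <o \<kappa>'" using L(2) ordLeq_ordLess_trans unfolding \<kappa>_def by blast
  let ?B = "M\<lparr>carrier := rspan R M U\<rparr>"
  have subU: "submodule (rspan R M U) R M" by (rule M.rspan_submodule[OF UM])
  have "projective_module R ?B"
  proof (rule smaller_projectiveD[OF IH M.right_module_submodule[OF subU] _ _ Uless])
    show "U \<subseteq> carrier ?B" using rspan_incl[of U R M] by simp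
    show "rspan R ?B U = carrier ?B" using M.rspan_of_submodule[OF subU rspan_incl] by simp
    show "weakly_R_projective R ?B" by (rule weakly_submodule[OF M weak subU])
  qed
  then obtain s where s: "M.free_section U s" using M.free_section_exists[OF UM] by blast
  note s' = M.free_section_support[OF s]
  have "\<forall>u. \<exists>\<nu>. u \<in> U \<longrightarrow> \<nu> \<in> Field \<kappa> \<and> u \<in> X \<nu>" unfolding U_def by blast
  then obtain idx where idx: "\<And>u. u \<in> U \<Longrightarrow> idx u \<in> Field \<kappa> \<and> u \<in> X (idx u)" by metis
  have "\<forall>\<beta>. \<exists>\<gamma>. \<beta> \<in> Field \<kappa> \<longrightarrow> \<gamma> \<in> Field \<kappa> \<and> \<beta> \<in> underS \<kappa> \<gamma>" using \<kappa>.underS_limit by blast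
  then obtain sc where sc: "\<And>\<beta>. \<beta> \<in> Field \<kappa> \<Longrightarrow> sc \<beta> \<in> Field \<kappa> \<and> \<beta> \<in> underS \<kappa> (sc \<beta>)" by metis
  \<comment> \<open>The index \<open>sc \<nu>\<close> makes a closed stage a limit, so that each of
    its elements occurs at an earlier stage; the other indices keep the supports of the section
    \<open>s\<close> inside it.\<close>
  let ?K = "\<lambda>\<nu>. insert (sc \<nu>) (\<Union>y\<in>X \<nu>. idx ` {u. s y u \<noteq> \<zero>})"
  have XU: "X \<nu> \<subseteq> U" if "\<nu> \<in> Field \<kappa>" for \<nu> unfolding U_def using that by blast
  have K: "?K \<nu> \<subseteq> Field \<kappa> \<and> |?K \<nu>| <o \<kappa>" if \<nu>: "\<nu> \<in> Field \<kappa>" for \<nu>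
  proof
    show "?K \<nu> \<subseteq> Field \<kappa>" using sc[OF \<nu>] idx s'(2) XU[OF \<nu>] by blast
    have "|\<Union>y\<in>X \<nu>. idx ` {u. s y u \<noteq> \<zero>}| <o \<kappa>"
    proof (rule \<kappa>.UNION_less)
      show "|X \<nu>| <o \<kappa>" using okX \<nu> Lless unfolding ok_def by blast
      show "|idx ` {u. s y u \<noteq> \<zero>}| <o \<kappa>" if "y \<in> X \<nu>" for y
        using s'(1)[of y] XU[OF \<nu>] that by (intro \<kappa>.countable_less countable_finite finite_imageI) blast
    qed
    then have "|{sc \<nu>} \<union> (\<Union>y\<in>X \<nu>. idx ` {u. s y u \<noteq> \<zero>})| <o \<kappa>"
      using card_of_Un_ordLess_infinite_Field[OF inf\<kappa> card\<kappa> \<kappa>.countable_less[of "{sc \<nu>}"]] by simp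
    then show "|?K \<nu>| <o \<kappa>" by simp
  qed
  let ?C = "{\<gamma> \<in> Field \<kappa>. underS \<kappa> \<gamma> \<noteq> {} \<and> (\<forall>\<beta>\<in>underS \<kappa> \<gamma>. ?K \<beta> \<subseteq> underS \<kappa> \<gamma>)}"
  have "club \<kappa> ?C" by (rule \<kappa>.closure_club) (use K in blast)+
  then have "Field \<kappa> \<inter> ?C \<noteq> {}" using \<kappa>.stationary_Field unfolding stationary_def by blast
  then obtain \<gamma> where "\<gamma> \<in> ?C" by blast
  then have \<gamma>: "\<gamma> \<in> Field \<kappa>" "underS \<kappa> \<gamma> \<noteq> {}" "\<And>\<beta>. \<beta> \<in> underS \<kappa> \<gamma> \<Longrightarrow> ?K \<beta> \<subseteq> underS \<kappa> \<gamma>" by blast+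
  have closed: "u \<in> X \<gamma>" if y: "y \<in> X \<gamma>" and u: "s y u \<noteq> \<zero>" for y u
  proof -
    have "\<exists>\<beta>\<in>underS \<kappa> \<gamma>. y \<in> X \<beta>"
    proof (cases "y \<in> X0")
      case True
      then show ?thesis using \<gamma>(2) X by blast
    next
      case False
      then obtain \<xi> where \<xi>: "\<xi> \<in> underS \<kappa> \<gamma>" "y \<in> G (X \<xi>)" using y X[of \<gamma>] by blast
      have "\<xi> \<in> underS \<kappa> (sc \<xi>)" using sc \<kappa>.underS_FieldD[OF \<xi>(1)] by blast
      then have "y \<in> X (sc \<xi>)" using GX \<xi>(2) by blast
      moreover have "sc \<xi> \<in> underS \<kappa> \<gamma>" using \<gamma>(3)[OF \<xi>(1)] by blast
      ultimately show ?thesis by blast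
    qed
    then obtain \<beta> where \<beta>: "\<beta> \<in> underS \<kappa> \<gamma>" "y \<in> X \<beta>" by blast
    have "y \<in> U" using XU[of \<beta>] \<beta> \<kappa>.underS_FieldD[OF \<beta>(1)] by blast
    then have "u \<in> U" using s'(2) u by blast
    moreover have "idx u \<in> underS \<kappa> \<gamma>" using \<gamma>(3)[OF \<beta>(1)] \<beta>(2) u by blast
    ultimately show ?thesis using Xmono idx by blast
  qed
  have rel: "rel_projective R M (rspan R M (X \<gamma>)) (rspan R M U)"
    by (rule closed_rel_projective[OF M UM s XU[OF \<gamma>(1)] closed])
  have ok\<gamma>: "ok (X \<gamma>)" "ok (G (X \<gamma>))" using okX \<gamma>(1) G(2) by blast+
  \<comment> \<open>Now \<open>G (X \<gamma>)\<close> lies between \<open>X \<gamma>\<close> and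
    \<open>U\<close>, and the factor of \<open>U\<close> by \<open>X \<gamma>\<close> is projective.
    Hence so is the factor of \<open>G (X \<gamma>)\<close>, contrary to the choice of
    \<open>G\<close>.\<close>
  have "G (X \<gamma>) \<subseteq> U" using GX[of \<gamma> "sc \<gamma>"] sc[OF \<gamma>(1)] XU[of "sc \<gamma>"] by blast
  then have le: "rspan R M (G (X \<gamma>)) \<subseteq> rspan R M U" by (rule rspan_mono)
  have "|G (X \<gamma>)| <o \<kappa>'"
    using ok\<gamma>(2) Lless L(2) ordLess_transitive unfolding ok_def \<kappa>_def by blast
  then have "rel_projective R M (rspan R M (X \<gamma>)) (rspan R M (G (X \<gamma>)))"
    using rel_projective_intermediate[OF IH M rel subU _ _ le] ok\<gamma>(2) unfolding ok_def by blast
  then show False using G(3) ok\<gamma>(1) by blast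
qed

text \<open>The module is filtered by the spans of sets \<^term>\<open>V i\<close>, \<^term>\<open>i\<close> running through a cofinal
  set \<^term>\<open>K\<close> of small size. Each \<^term>\<open>V i\<close> is the union of a chain of strong sets, interleaved
  so that it is closed under the supports of a section on \<^term>\<open>V j\<close> for all larger \<^term>\<open>j\<close>.\<close>

lemma singular_projective:
  fixes M :: "('a, 'm) module" and X :: "'m set"
  assumes IH: "smaller_projective TYPE('m) |X|" and M: "right_module R M" and weak: "weakly_R_projective R M"
    and X: "X \<subseteq> carrier M" "rspan R M X = carrier M" "infinite X" and sing: "\<not> regularCard |X|"
  shows "projective_module R M"
proof -
  interpret M: right_module R M by fact
  have FX: "Field |X| = X" by (rule Field_card_of)
  have infF: "\<not> finite (Field |X| )" using X(3) FX by simp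
  interpret \<kappa>: infinite_cardinal "|X|"
    by unfold_locales (use card_of_Card_order infF in auto)
  \<comment> \<open>A cofinal set of smaller size, witnessing singularity; its members index the
    filtration.\<close>
  obtain K where K: "K \<subseteq> X" "cofinal K |X|" "\<not> |K| =o |X|" using sing unfolding regularCard_def FX by blast
  have "|K| \<le>o |X|" using K(1) by (rule card_of_mono1)
  then have Kless: "|K| <o |X|" using K(3) ordLeq_iff_ordLess_or_ordIso by blast
  obtain w :: "nat \<Rightarrow> 'm" where w: "inj w" "range w \<subseteq> X" using infinite_countable_subset[OF X(3)] by blast
  have "natLeq \<le>o |X|" using X(3) infinite_iff_natLeq_ordLeq by blast
  moreover have "\<not> natLeq =o |X|"
    using regularCard_ordIso[OF _ natLeq_Cinfinite regularCard_natLeq] sing by blast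
  ultimately have "natLeq <o |X|" using ordLeq_iff_ordLess_or_ordIso by blast
  moreover have "|range w| \<le>o natLeq"
    using card_of_image[of w UNIV] card_of_nat ordLeq_ordIso_trans by blast
  ultimately have wless: "|range w| <o |X|" using ordLeq_ordLess_trans by blast
  \<comment> \<open>The initial segment lets the sizes increase with \<open>i\<close> and exhaust
    the generators. \<open>K\<close> is included so that unions over \<open>K\<close> stay within
    the size of \<open>L i\<close>, and the copy of the natural numbers makes \<open>L i\<close>
    infinite.\<close>
  define L where "L i = underS |X| i \<union> (K \<union> range w)" for i
  have infL: "infinite (L i)" for i unfolding L_def using w(1) range_inj_infinite by auto
  have L: "|L i| <o |X|" "cardSuc |L i| <o |X|" if i: "i \<in> K" for i
  proof -
    have iF: "i \<in> Field |X|" using i K(1) FX by blast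
    show Li: "|L i| <o |X|"
      unfolding L_def
      by (intro card_of_Un_ordLess_infinite_Field[OF infF card_of_Card_order] \<kappa>.underS_less[OF iF] Kless wless)
    have "cardSuc |L i| \<le>o |X|" using cardSuc_least[OF card_of_Card_order card_of_Card_order Li] .
    \<comment> \<open>Infinite successor cardinals are regular and so differ from the singular
      \<open>|X|\<close>. The strict inequality is the room that \<open>strong_set_exists\<close>
      demands.\<close>
    moreover have "\<not> cardSuc |L i| =o |X|"
    proof -
      have inf: "\<not> finite (Field |L i| )" using infL by (simp add: Field_card_of)
      have "Cinfinite (cardSuc |L i| )"
        unfolding cinfinite_def using inf cardSuc_finite[OF card_of_Card_order, of "L i"]
          cardSuc_Card_order[OF card_of_Card_order, of "L i"] by auto
      then show ?thesis
        using regularCard_ordIso[OF _ _ infinite_cardSuc_regularCard[OF inf card_of_Card_order]] sing by blast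
    qed
    ultimately show "cardSuc |L i| <o |X|" using ordLeq_iff_ordLess_or_ordIso by blast
  qed
  have Lmono: "|L j| \<le>o |L i|" if "j \<in> underS |X| i" for i j
    using \<kappa>.underS_trans[OF _ that] unfolding L_def by (intro card_of_mono1) blast
  have strong: "\<exists>Z. Y \<subseteq> Z \<and> strong_set M (L i) Z" if "i \<in> K" "Y \<subseteq> carrier M" "|Y| \<le>o |L i|" for i Y
    using strong_set_exists[OF IH M weak infL L(2)[OF that(1)] that(2,3)] by blast
  have section_ex: "\<exists>s. M.free_section Z s" if "i \<in> K" "strong_set M (L i) Z" for i Z
  proof -
    have Z: "Z \<subseteq> carrier M" "|Z| \<le>o |L i|" using that(2) unfolding strong_set_def by auto
    have sub: "submodule (rspan R M Z) R M" by (rule M.rspan_submodule[OF Z(1)])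
    have "projective_module R (M\<lparr>carrier := rspan R M Z\<rparr>)"
    proof (rule smaller_projectiveD[OF IH M.right_module_submodule[OF sub]])
      show "Z \<subseteq> carrier (M\<lparr>carrier := rspan R M Z\<rparr>)" using rspan_incl[of Z R M] by simp
      show "rspan R (M\<lparr>carrier := rspan R M Z\<rparr>) Z = carrier (M\<lparr>carrier := rspan R M Z\<rparr>)"
        using M.rspan_of_submodule[OF sub rspan_incl] by simp
      show "|Z| <o |X|" using Z(2) L(1)[OF that(1)] ordLeq_ordLess_trans by blast
      show "weakly_R_projective R (M\<lparr>carrier := rspan R M Z\<rparr>)" by (rule weakly_submodule[OF M weak sub])
    qed
    then show ?thesis using M.free_section_exists[OF Z(1)] by blast
  qed
  note section_supp = M.free_section_support
  \<comment> \<open>A stage consists of strong sets with sections for all members of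
    \<open>K\<close> at once, because the closure conditions relate each index to smaller and to
    larger ones.\<close>
  define good where "good p \<longleftrightarrow> (\<forall>i\<in>K. strong_set M (L i) (fst p i) \<and> M.free_section (fst p i) (snd p i) \<and>
    underS |X| i \<subseteq> fst p i)" for p :: "('m \<Rightarrow> 'm set) \<times> ('m \<Rightarrow> 'm \<Rightarrow> 'm \<Rightarrow> 'a)"
  \<comment> \<open>Supports of the section for a larger \<open>j\<close> are absorbed only at
    elements common to both sets. They are finite and \<open>K\<close> is no larger than
    \<open>L i\<close>, so the enlargement keeps within the size of \<open>L i\<close>. Strongness
    of the old set allows its section to be extended.\<close>
  define nxt where "nxt p p' \<longleftrightarrow> (\<forall>i\<in>K. fst p i \<subseteq> fst p' i \<and> (\<forall>x\<in>rspan R M (fst p i). snd p' i x = snd p i x) \<and>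
    (\<forall>j\<in>K. j \<in> underS |X| i \<longrightarrow> fst p j \<subseteq> fst p' i) \<and>
    (\<forall>j\<in>K. i \<in> underS |X| j \<longrightarrow> (\<forall>y\<in>fst p i \<inter> fst p j. {u. snd p j y u \<noteq> \<zero>} \<subseteq> fst p' i)))"
    for p p' :: "('m \<Rightarrow> 'm set) \<times> ('m \<Rightarrow> 'm \<Rightarrow> 'm \<Rightarrow> 'a)"
  have "\<exists>p. good p"
  proof -
    have "\<exists>q. strong_set M (L i) (fst q) \<and> M.free_section (fst q) (snd q) \<and> underS |X| i \<subseteq> fst q" if i: "i \<in> K" for i
    proof -
      have "underS |X| i \<subseteq> carrier M" using \<kappa>.underS_FieldD FX X(1) by blast
      moreover have "|underS |X| i| \<le>o |L i|" unfolding L_def by (rule card_of_mono1) blast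
      ultimately obtain Z where Z: "underS |X| i \<subseteq> Z" "strong_set M (L i) Z" using strong[OF i] by blast
      obtain s where "M.free_section Z s" using section_ex[OF i Z(2)] by blast
      then show ?thesis using Z by (intro exI[of _ "(Z, s)"]) simp
    qed
    then have "\<exists>q. \<forall>i\<in>K. strong_set M (L i) (fst (q i)) \<and> M.free_section (fst (q i)) (snd (q i)) \<and>
      underS |X| i \<subseteq> fst (q i)" by (intro bchoice ballI)
    then obtain q where "\<forall>i\<in>K. strong_set M (L i) (fst (q i)) \<and> M.free_section (fst (q i)) (snd (q i)) \<and>
      underS |X| i \<subseteq> fst (q i)" by (rule exE)
    then show ?thesis unfolding good_def by (intro exI[of _ "(\<lambda>i. fst (q i), \<lambda>i. snd (q i))"]) simp
  qed
  moreover have "\<exists>p'. good p' \<and> nxt p p'" if p: "good p" for p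
  proof -
    have pK: "strong_set M (L i) (fst p i)" "M.free_section (fst p i) (snd p i)" "underS |X| i \<subseteq> fst p i"
      if "i \<in> K" for i using bspec[OF p[unfolded good_def] that] by auto
    have pM: "fst p i \<subseteq> carrier M" "|fst p i| \<le>o |L i|" if "i \<in> K" for i
      using pK(1)[OF that] unfolding strong_set_def by auto
    define Y where "Y i = fst p i \<union> ((\<Union>j\<in>K \<inter> underS |X| i. fst p j) \<union>
      (\<Union>j\<in>K. \<Union>y\<in>fst p i \<inter> fst p j. {u. snd p j y u \<noteq> \<zero>}))" for i
    have "\<exists>q. strong_set M (L i) (fst q) \<and> M.free_section (fst q) (snd q) \<and> Y i \<subseteq> fst q \<and>
      (\<forall>x\<in>rspan R M (fst p i). snd q x = snd p i x)" if i: "i \<in> K" for i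
    proof -
      have KL: "|K| \<le>o |L i|" unfolding L_def by (rule card_of_mono1) blast
      have inf: "\<not> finite (Field |L i| )" using infL by (simp add: Field_card_of)
      have Yi: "Y i \<subseteq> carrier M"
        unfolding Y_def using pM(1) i section_supp(2)[OF pK(2)] by blast
      have "|\<Union>j\<in>K \<inter> underS |X| i. fst p j| \<le>o |L i|"
      proof (rule card_of_UNION_ordLeq_infinite[OF infL])
        have "|K \<inter> underS |X| i| \<le>o |K|" by (rule card_of_mono1) blast
        then show "|K \<inter> underS |X| i| \<le>o |L i|" using KL ordLeq_transitive by blast
        show "\<forall>j\<in>K \<inter> underS |X| i. |fst p j| \<le>o |L i|" using pM(2) Lmono ordLeq_transitive by blast
      qed
      moreover have "|\<Union>j\<in>K. \<Union>y\<in>fst p i \<inter> fst p j. {u. snd p j y u \<noteq> \<zero>}| \<le>o |L i|"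
      proof (intro card_of_UNION_ordLeq_infinite[OF infL] KL ballI)
        fix j y assume j: "j \<in> K"
        have "|fst p i \<inter> fst p j| \<le>o |fst p i|" by (rule card_of_mono1) blast
        then show "|fst p i \<inter> fst p j| \<le>o |L i|" using pM(2)[OF i] ordLeq_transitive by blast
        assume "y \<in> fst p i \<inter> fst p j"
        then have "finite {u. snd p j y u \<noteq> \<zero>}" using section_supp(1)[OF pK(2)[OF j]] by blast
        then have "|{u. snd p j y u \<noteq> \<zero>}| <o natLeq" using finite_iff_ordLess_natLeq by blast
        moreover have "natLeq \<le>o |L i|" using infL infinite_iff_natLeq_ordLeq by blast
        ultimately show "|{u. snd p j y u \<noteq> \<zero>}| \<le>o |L i|" using ordLess_ordLeq_trans ordLess_imp_ordLeq by blast
      qed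
      ultimately have "|Y i| \<le>o |L i|"
        unfolding Y_def by (intro card_of_Un_ordLeq_infinite_Field[OF inf] pM(2)[OF i] card_of_Card_order)
      then obtain Z where Z: "Y i \<subseteq> Z" "strong_set M (L i) Z" using strong[OF i Yi] by blast
      have Z': "Z \<subseteq> carrier M" "|Z| \<le>o |L i|" using Z(2) unfolding strong_set_def by auto
      have le: "fst p i \<subseteq> Z" using Z(1) unfolding Y_def by blast
      have "rel_projective R M (rspan R M (fst p i)) (rspan R M Z)"
        using pK(1)[OF i] le Z' unfolding strong_set_def by simp
      then obtain s where "M.free_section Z s" "\<And>x. x \<in> rspan R M (fst p i) \<Longrightarrow> s x = snd p i x"
        using M.free_section_extend[OF le Z'(1) pK(2)[OF i]] by blast
      then show ?thesis using Z by (intro exI[of _ "(Z, s)"]) simp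
    qed
    then have "\<exists>q. \<forall>i\<in>K. strong_set M (L i) (fst (q i)) \<and> M.free_section (fst (q i)) (snd (q i)) \<and>
      Y i \<subseteq> fst (q i) \<and> (\<forall>x\<in>rspan R M (fst p i). snd (q i) x = snd p i x)" by (intro bchoice ballI)
    then obtain q where q: "\<forall>i\<in>K. strong_set M (L i) (fst (q i)) \<and> M.free_section (fst (q i)) (snd (q i)) \<and>
      Y i \<subseteq> fst (q i) \<and> (\<forall>x\<in>rspan R M (fst p i). snd (q i) x = snd p i x)" by (rule exE)
    let ?p' = "(\<lambda>i. fst (q i), \<lambda>i. snd (q i))"
    have Yq: "Y i \<subseteq> fst (q i)" if "i \<in> K" for i using q that by blast
    have "underS |X| i \<subseteq> fst (q i)" if "i \<in> K" for i using Yq[OF that] pK(3)[OF that] unfolding Y_def by blast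
    then have "good ?p'" unfolding good_def using q by simp
    moreover have "nxt p ?p'"
      unfolding nxt_def
    proof (intro ballI conjI impI)
      fix i assume i: "i \<in> K"
      show "fst p i \<subseteq> fst ?p' i" using Yq[OF i] unfolding Y_def by simp
      show "snd ?p' i x = snd p i x" if "x \<in> rspan R M (fst p i)" for x using q i that by simp
      show "fst p j \<subseteq> fst ?p' i" if "j \<in> K" "j \<in> underS |X| i" for j using Yq[OF i] that unfolding Y_def by auto
      show "{u. snd p j y u \<noteq> \<zero>} \<subseteq> fst ?p' i" if "j \<in> K" "y \<in> fst p i \<inter> fst p j" for j y
      proof -
        have "{u. snd p j y u \<noteq> \<zero>} \<subseteq> Y i" unfolding Y_def using that by blast
        then show ?thesis using Yq[OF i] by simp
      qed
    qed
    ultimately show ?thesis by blast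
  qed
  ultimately have "\<exists>f. \<forall>n::nat. good (f n) \<and> nxt (f n) (f (Suc n))"
    by (rule dependent_nat_choice[of "\<lambda>_ p. good p" "\<lambda>_ p p'. nxt p p'"])
  then obtain f where f: "\<And>n. good (f n)" "\<And>n. nxt (f n) (f (Suc n))" by blast
  define T where "T n i = fst (f n) i" for n i
  define s where "s n i = snd (f n) i" for n i
  have T: "strong_set M (L i) (T n i)" "M.free_section (T n i) (s n i)" "underS |X| i \<subseteq> T n i" "T n i \<subseteq> carrier M"
    if "i \<in> K" for i n
    using bspec[OF f(1)[unfolded good_def] that] unfolding T_def s_def strong_set_def by auto
  have nx: "T n i \<subseteq> T (Suc n) i" "\<And>x. x \<in> rspan R M (T n i) \<Longrightarrow> s (Suc n) i x = s n i x"
    "\<And>j. j \<in> K \<Longrightarrow> j \<in> underS |X| i \<Longrightarrow> T n j \<subseteq> T (Suc n) i"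
    "\<And>j y u. j \<in> K \<Longrightarrow> i \<in> underS |X| j \<Longrightarrow> y \<in> T n i \<Longrightarrow> y \<in> T n j \<Longrightarrow> s n j y u \<noteq> \<zero> \<Longrightarrow> u \<in> T (Suc n) i"
    if "i \<in> K" for i n
  proof -
    note b = bspec[OF f(2)[of n, unfolded nxt_def] that]
    show "T n i \<subseteq> T (Suc n) i" "\<And>x. x \<in> rspan R M (T n i) \<Longrightarrow> s (Suc n) i x = s n i x"
      "\<And>j. j \<in> K \<Longrightarrow> j \<in> underS |X| i \<Longrightarrow> T n j \<subseteq> T (Suc n) i"
      using b unfolding T_def s_def by auto
    show "u \<in> T (Suc n) i" if "j \<in> K" "i \<in> underS |X| j" "y \<in> T n i" "y \<in> T n j" "s n j y u \<noteq> \<zero>" for j y u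
      using b that unfolding T_def s_def by blast
  qed
  have Tmono: "T m i \<subseteq> T n i" if "m \<le> n" "i \<in> K" for m n i
    using lift_Suc_mono_le[of "\<lambda>n. T n i", OF nx(1)[OF that(2)] that(1)] .
  have smono: "s n i x = s m i x" if "m \<le> n" "i \<in> K" "x \<in> rspan R M (T m i)" for m n i x
    using that(1)
  proof (induction n rule: dec_induct)
    case (step n)
    have "x \<in> rspan R M (T n i)" using rspan_mono[OF Tmono[OF step(1) that(2)]] that(3) by blast
    then show ?case using nx(2)[OF that(2)] step(3) by simp
  qed simp
  define V where "V i = (\<Union>n. T n i)" for i
  have VM: "V i \<subseteq> carrier M" if "i \<in> K" for i using T(4)[OF that] unfolding V_def by blast
  have Vmono: "V j \<subseteq> V i" if "j \<in> K" "i \<in> K" "j \<in> underS |X| i" for i j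
    using nx(3)[OF that(2,1,3)] unfolding V_def by blast
  have Vspan: "rspan R M (V i) = (\<Union>n. rspan R M (T n i))" if i: "i \<in> K" for i
  proof -
    have "rspan R M (\<Union>(range (\<lambda>n. T n i))) = (\<Union>Z\<in>range (\<lambda>n. T n i). rspan R M Z)"
    proof (rule M.rspan_Union_chain)
      fix Y Z assume "Y \<in> range (\<lambda>n. T n i)" "Z \<in> range (\<lambda>n. T n i)"
      then obtain m n where "Y = T m i" "Z = T n i" by blast
      then show "Y \<subseteq> Z \<or> Z \<subseteq> Y" using Tmono[OF _ i] linear[of m n] by blast
    qed (use T(4)[OF i] in auto)
    then show ?thesis unfolding V_def by simp
  qed
  \<comment> \<open>The union of the sections; by \<open>smono\<close> every stage that reaches
    \<open>x\<close> gives the same value.\<close>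
  define S where "S i x = s (LEAST n. x \<in> rspan R M (T n i)) i x" for i x
  have S: "S i x = s n i x" if "i \<in> K" "x \<in> rspan R M (T n i)" for i x n
  proof -
    have "(LEAST n. x \<in> rspan R M (T n i)) \<le> n" using that(2) by (rule Least_le)
    moreover have "x \<in> rspan R M (T (LEAST n. x \<in> rspan R M (T n i)) i)"
      using that(2) by (rule LeastI)
    ultimately show ?thesis unfolding S_def using smono[OF _ that(1)] by simp
  qed
  have Ssec: "M.free_section (V i) (S i)" if i: "i \<in> K" for i
    unfolding M.free_section_def
  proof
    have "S i \<in> rmod_hom R (M\<lparr>carrier := \<Union>(range (\<lambda>n. rspan R M (T n i)))\<rparr>) (free_on R M (V i))"
    proof (rule rmod_hom_Union_chain[OF M])
      fix A assume "A \<in> range (\<lambda>n. rspan R M (T n i))"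
      then obtain n where n: "A = rspan R M (T n i)" by blast
      have MA: "right_module R (M\<lparr>carrier := A\<rparr>)"
        unfolding n by (rule M.right_module_submodule[OF M.rspan_submodule[OF T(4)[OF i]]])
      have sn: "s n i \<in> rmod_hom R (M\<lparr>carrier := A\<rparr>) (free_on R M (T n i))"
        using T(2)[OF i, of n] unfolding n M.free_section_def by blast
      have TV: "T n i \<subseteq> V i" unfolding V_def by blast
      have "s n i \<in> rmod_hom R (M\<lparr>carrier := A\<rparr>) (free_on R M (V i))"
      proof (rule rmod_homI)
        show "s n i x \<in> carrier (free_on R M (V i))" if "x \<in> carrier (M\<lparr>carrier := A\<rparr>)" for x
          using rmod_homD(1)[OF sn that] free_on_mono[OF TV] by blast
      qed (use rmod_homD(2,3)[OF sn] free_on_ops[where U = "T n i" and V = "V i"] in simp_all)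
      then show "S i \<in> rmod_hom R (M\<lparr>carrier := A\<rparr>) (free_on R M (V i))"
        by (rule rmod_hom_cong[OF MA]) (use S[OF i] n in auto)
    next
      fix A B assume "A \<in> range (\<lambda>n. rspan R M (T n i))" "B \<in> range (\<lambda>n. rspan R M (T n i))"
      then obtain m n where mn: "A = rspan R M (T m i)" "B = rspan R M (T n i)" by blast
      show "A \<subseteq> B \<or> B \<subseteq> A"
        using linear[of m n] rspan_mono[OF Tmono[OF _ i]] unfolding mn by blast
    qed
    then show "S i \<in> rmod_hom R (M\<lparr>carrier := rspan R M (V i)\<rparr>) (free_on R M (V i))" using Vspan[OF i] by simp
    show "\<forall>x\<in>rspan R M (V i). free_map R M (\<lambda>x. x) (S i x) = x"
    proof
      fix x assume "x \<in> rspan R M (V i)"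
      then obtain n where n: "x \<in> rspan R M (T n i)" unfolding Vspan[OF i] by blast
      then show "free_map R M (\<lambda>x. x) (S i x) = x"
        using S[OF i n] T(2)[OF i, of n] unfolding M.free_section_def by simp
    qed
  qed
  \<comment> \<open>An element of the set for \<open>j\<close> enters the set for \<open>i\<close>
    one round later, and its support enters the set for \<open>j\<close> after one more round. This
    delay is why the sets are built as unions of countably many rounds.\<close>
  have closed: "u \<in> V j" if ij: "j \<in> K" "i \<in> K" "j \<in> underS |X| i" and y: "y \<in> V j" "S i y u \<noteq> \<zero>" for i j y u
  proof -
    obtain m where m: "y \<in> T m j" using y(1) unfolding V_def by blast
    have "y \<in> T (Suc m) i" using nx(3)[OF ij(2,1,3)] m by blast
    moreover have "y \<in> T (Suc m) j" using nx(1)[OF ij(1)] m by blast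
    moreover have "S i y = s (Suc m) i y"
      using S[OF ij(2)] calculation(1) rspan_incl[of "T (Suc m) i" R M] by blast
    ultimately have "u \<in> T (Suc (Suc m)) j" using nx(4)[OF ij(1,2,3)] y(2) by simp
    then show ?thesis unfolding V_def by blast
  qed
  \<comment> \<open>Indices outside \<open>K\<close> contribute nothing, so the filtration can run
    through the initial segments of \<open>X\<close>.\<close>
  let ?V = "\<lambda>i. if i \<in> K then V i else {}"
  show ?thesis
  proof (rule filtration_projective[where X = ?V and T = X and \<D> = "{D. D \<subseteq> X \<and> (\<forall>\<beta>\<in>D. underS |X| \<beta> \<subseteq> D)}"])
    have "X \<subseteq> (\<Union>i\<in>X. ?V i)"
    proof
      fix x assume x: "x \<in> X"
      then obtain i where i: "i \<in> K" "x \<in> underS |X| i"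
        using K(2) unfolding cofinal_def underS_def FX by blast
      then have "x \<in> V i" using T(3)[OF i(1)] unfolding V_def by blast
      then show "x \<in> (\<Union>i\<in>X. ?V i)" using i(1) K(1) by auto
    qed
    then have "rspan R M X \<subseteq> rspan R M (\<Union>i\<in>X. ?V i)" by (rule rspan_mono)
    moreover have "rspan R M (\<Union>i\<in>X. ?V i) \<subseteq> carrier M" by (rule M.rspan_subset) (use VM in auto)
    ultimately show "rspan R M (\<Union>i\<in>X. ?V i) = carrier M" using X(2) by blast
    fix D assume D: "D \<in> {D. D \<subseteq> X \<and> (\<forall>\<beta>\<in>D. underS |X| \<beta> \<subseteq> D)}" "D \<noteq> X"
    then obtain \<gamma> where \<gamma>: "\<gamma> \<in> X" "D = underS |X| \<gamma>" using \<kappa>.downset_cases[of D] unfolding FX by blast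
    obtain k where k: "k \<in> K" "k \<notin> D"
    proof -
      obtain k where "k \<in> K" "\<gamma> \<in> underS |X| k"
        using K(2) \<gamma>(1) unfolding cofinal_def underS_def FX by blast
      then show ?thesis using that \<kappa>.underS_trans \<kappa>.underS_irrefl unfolding \<gamma>(2) by blast
    qed
    \<comment> \<open>The next relevant index is the least member of \<open>K\<close> outside
      \<open>D\<close>. All smaller members of \<open>K\<close> are in \<open>D\<close>, so the span
      at \<open>D\<close> is that of the union of the \<open>V j\<close> with \<open>j\<close> in
      \<open>K\<close> before it.\<close>
    have "\<exists>i. i \<in> K - D \<and> (\<forall>j. j \<noteq> i \<and> (j, i) \<in> |X| \<longrightarrow> j \<notin> K - D)"
    proof (rule ccontr)
      assume no: "\<not> ?thesis"
      have "k \<notin> K - D" for k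
        by (rule wo_rel.well_order_induct[OF \<kappa>.well(2), of "\<lambda>k. k \<notin> K - D"]) (use no in blast)
      then show False using k by blast
    qed
    then obtain i where i: "i \<in> K" "i \<notin> D" "\<And>j. j \<in> underS |X| i \<Longrightarrow> j \<in> K \<Longrightarrow> j \<in> D"
      unfolding underS_def by blast
    have iX: "i \<in> X" using i(1) K(1) by blast
    have before: "j \<in> underS |X| i" if j: "j \<in> D" for j
    proof -
      have jX: "j \<in> X" using j D(1) by blast
      have "i \<notin> underS |X| j" using i(2) D(1) j by blast
      moreover have "j \<noteq> i" using j i(2) by blast
      ultimately show ?thesis using \<kappa>.underS_total[of j i] jX iX unfolding FX by blast
    qed
    let ?D' = "insert i (underS |X| i)"
    have eqD: "(\<Union>j\<in>D. ?V j) = (\<Union>j\<in>K \<inter> underS |X| i. V j)" using before i(3) by auto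
    have eqD': "(\<Union>j\<in>?D'. ?V j) = V i" using i(1) Vmono[OF _ i(1)] by auto
    have "rel_projective R M (rspan R M (\<Union>j\<in>K \<inter> underS |X| i. V j)) (rspan R M (V i))"
    proof (rule closed_rel_projective[OF M VM[OF i(1)] Ssec[OF i(1)]])
      show "(\<Union>j\<in>K \<inter> underS |X| i. V j) \<subseteq> V i" using Vmono[OF _ i(1)] by blast
      show "u \<in> (\<Union>j\<in>K \<inter> underS |X| i. V j)"
        if "y \<in> (\<Union>j\<in>K \<inter> underS |X| i. V j)" "S i y u \<noteq> \<zero>" for y u using that closed[OF _ i(1)] by blast
    qed
    moreover have "?D' \<in> {D. D \<subseteq> X \<and> (\<forall>\<beta>\<in>D. underS |X| \<beta> \<subseteq> D)}"
      using iX \<kappa>.underS_FieldD \<kappa>.underS_trans unfolding FX by blast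
    moreover have "D \<subset> ?D'" using before i(2) by blast
    ultimately show "\<exists>D'\<in>{D. D \<subseteq> X \<and> (\<forall>\<beta>\<in>D. underS |X| \<beta> \<subseteq> D)}. D \<subset> D' \<and>
        rel_projective R M (rspan R M (\<Union>i\<in>D. ?V i)) (rspan R M (\<Union>i\<in>D'. ?V i))"
      unfolding eqD by (intro bexI[of _ ?D'] conjI) (simp_all only: eqD')
  next
    show "\<Union>\<C> \<in> {D. D \<subseteq> X \<and> (\<forall>\<beta>\<in>D. underS |X| \<beta> \<subseteq> D)}"
      if "\<C> \<subseteq> {D. D \<subseteq> X \<and> (\<forall>\<beta>\<in>D. underS |X| \<beta> \<subseteq> D)}" for \<C> using that by blast
  qed (use M VM in auto)
qed

section \<open>The Dual Baer Criterion\<close>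

text \<open>Well-founded induction on the cardinality of a generating set \<open>X\<close>, for all
  modules on the type simultaneously. Countable, singular and uncountable regular sizes are settled
  by the three preceding arguments.\<close>

lemma weakly_projective:
  fixes M :: "('a, 'm) module"
  assumes diamond: "diamond TYPE(('a + 'm) set)" and M: "right_module R M" and weak: "weakly_R_projective R M"
  shows "projective_module R M"
proof -
  have "\<forall>M :: ('a, 'm) module. right_module R M \<and> X \<subseteq> carrier M \<and> rspan R M X = carrier M \<and>
      weakly_R_projective R M \<longrightarrow> projective_module R M" for X :: "'m set"
  proof (induction X rule: wf_induct_rule[OF wf_inv_image[OF wf_ordLess, of card_of]])
    case (1 X)
    have IH: "smaller_projective TYPE('m) |X|"
      unfolding smaller_projective_def
    proof (intro allI impI, elim conjE)
      fix N :: "('a, 'm) module" and Y :: "'m set"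
      assume N: "right_module R N" "Y \<subseteq> carrier N" "rspan R N Y = carrier N" "|Y| <o |X|"
        "weakly_R_projective R N"
      have "(Y, X) \<in> inv_image ordLess card_of" using N(4) by simp
      from 1[OF this] show "projective_module R N" using N by blast
    qed
    show ?case
    proof (intro allI impI, elim conjE)
      fix M :: "('a, 'm) module"
      assume M: "right_module R M" "X \<subseteq> carrier M" "rspan R M X = carrier M" "weakly_R_projective R M"
      show "projective_module R M"
      proof (cases "countable X")
        case True
        then show ?thesis using weakly_countable_projective[OF M(1,4) finite_loewy _ M(2,3)] by blast
      next
        case False
        have inf: "infinite X" using False countable_finite by blast
        show ?thesis
        proof (cases "regularCard |X|")
          case False
          then show ?thesis using singular_projective[OF IH M(1,4,2,3) inf] by blast
        next
          case True
          interpret M: right_module R M by fact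
          \<comment> \<open>The generating set is copied into the type for which the diamond is
            assumed; being regular and uncountable passes to the copy.\<close>
          let ?e = "\<lambda>x :: 'm. {Inr x :: 'a + 'm}"
          let ?\<kappa> = "|?e ` X|"
          have inj: "inj_on ?e X" by (rule inj_onI) simp
          have iso: "|X| =o ?\<kappa>" using inj unfolding card_of_ordIso[symmetric] by (intro exI[of _ ?e]) (simp add: bij_betw_def)
          have "\<not> |X| \<le>o natLeq"
          proof
            assume "|X| \<le>o natLeq"
            then have "|X| \<le>o |UNIV :: nat set|" using card_of_nat ordIso_symmetric ordLeq_ordIso_trans by blast
            then show False using \<open>\<not> countable X\<close> unfolding countable_def card_of_ordLeq[symmetric] by blast
          qed
          then have "natLeq <o |X|"
            using not_ordLeq_iff_ordLess[OF natLeq_Well_order card_of_Well_order] by blast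
          then have unc: "natLeq <o ?\<kappa>" using iso ordLess_ordIso_trans by blast
          have "Cinfinite |X|" unfolding cinfinite_def using inf by (simp add: Field_card_of card_of_card_order_on)
          then have reg: "regularCard ?\<kappa>" using regularCard_ordIso[OF iso _ True] by blast
          have F: "Field ?\<kappa> = ?e ` X" by (rule Field_card_of)
          have infF: "\<not> finite (Field ?\<kappa>)" unfolding F using finite_imageD[OF _ inj] inf by blast
          have \<kappa>: "regular_cardinal ?\<kappa>"
            by unfold_locales (use card_of_Card_order infF unc reg in auto)
          have dia: "diamond_at ?\<kappa> E" if "stationary ?\<kappa> E" for E
            using diamond that card_of_Card_order unc reg unfolding diamond_def by blast
          have IH': "smaller_projective TYPE('m) ?\<kappa>"
            using IH ordLess_ordIso_trans[OF _ ordIso_symmetric[OF iso]] unfolding smaller_projective_def by blast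
          \<comment> \<open>Decodes the copy into generators. The default value zero lets
            \<open>g\<close> take every index into the carrier.\<close>
          define g where "g t = (if t \<in> ?e ` X then inv_into X ?e t else \<zero>\<^bsub>M\<^esub>)" for t
          have ge: "g (?e x) = x" if "x \<in> X" for x using inv_into_f_f[OF inj that] that unfolding g_def by simp
          have gM: "g t \<in> carrier M" for t
            using inv_into_into[of t ?e X] M(2) unfolding g_def by auto
          have "g ` Field ?\<kappa> = X" unfolding F image_image using ge by simp
          then show ?thesis using regular_projective[OF \<kappa> dia IH' M(1,4), of g] gM M(3) by simp
        qed
      qed
    qed
  qed
  moreover interpret M: right_module R M by fact
  have "rspan R M (carrier M) = carrier M" by (rule M.rspan_submodule_eq[OF M.carrier_submodule])
  ultimately show ?thesis using M weak by blast
qed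

end

section \<open>Module records with further fields\<close>

lemma (in right_module) truncate_right_module: "right_module R (module.truncate M)"
proof (rule right_moduleI)
  show "ring R" ..
  show "abelian_group (module.truncate M)"
    by (rule abelian_groupI) (auto simp: module.truncate_def M.a_ac intro: M.l_neg bexI[of _ "\<ominus>\<^bsub>M\<^esub> _"])
qed (auto simp: module.truncate_def smult_l_distr smult_r_distr smult_assoc)

lemma rmod_hom_truncate: "rmod_hom R (module.truncate M) N = rmod_hom R M N"
  by (simp add: rmod_hom_def module.truncate_def)

lemma projective_truncate: "projective_module R (module.truncate M) = projective_module R M"
  unfolding projective_module_def rmod_hom_truncate by (simp add: module.truncate_def)

lemma weakly_R_projective_truncate: "weakly_R_projective R (module.truncate M) = weakly_R_projective R M"
  unfolding weakly_R_projective_def rmod_hom_truncate by (simp add: module.truncate_def)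

theorem theorem4p4:
  fixes R :: "('r, 'a) ring_scheme" and M :: "('r, 'm, 'b) module_scheme"
  assumes "diamond TYPE(('r + 'm) set)"
    and "ring R"
    and "von_neumann_regular R"
    and "semiartinian R"
    and "primitive_factors_artinian R"
    and "\<not> completely_reducible R"
    and "small_ring R"
    and "right_module R M"
  shows "(weakly_R_projective R M \<longleftrightarrow> R_projective R M) \<and>
         (R_projective R M \<longleftrightarrow> projective_module R M) \<and>
         (\<forall>N :: ('r, 'm) module. right_module R N \<longrightarrow>
            (projective_module R N \<longleftrightarrow> R_projective R N))"
proof -
  interpret small_regular_ring R
    using assms(2,3,5,7)
    by (intro small_regular_ring.intro primitive_artinian_regular.intro
        primitive_artinian_regular_axioms.intro small_regular_ring_axioms.intro)
  have "projective_module R M" if "weakly_R_projective R M"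
    using weakly_projective[OF assms(1) right_module.truncate_right_module[OF assms(8)]] that
    unfolding projective_truncate weakly_R_projective_truncate by simp
  then have "weakly_R_projective R M \<longleftrightarrow> R_projective R M" "R_projective R M \<longleftrightarrow> projective_module R M"
    using R_projective_weakly[OF assms(8)] projective_R_projective[OF assms(8)] by blast+
  moreover have "projective_module R N \<longleftrightarrow> R_projective R N" if "right_module R N" for N :: "('r, 'm) module"
    using weakly_projective[OF assms(1) that] R_projective_weakly[OF that] projective_R_projective[OF that] by blast
  ultimately show ?thesis by blast
qed

end
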